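(* Let $M\subset\mathbb R^n$ be a smooth closed submanifold of dimension $m$. If $m$ is odd, then $E_M(-2m)=E_{I(M)}(-2m)$ for any Möbius transformation $I$ such that $I(M)$ remains compact.
   Context: A closed submanifold is a compact submanifold of $\mathbb R^n$ without boundary; $dx,dy$ denote the Riemannian volume element of $M$; $|\cdot|$ is the Euclidean norm; $\Delta_t=\{(x,y)\in\mathbb R^n\times\mathbb R^n: |x-y|\le t\}$. Möbius transformations are those of $\mathbb R^n\cup\{\infty\}$; "$I(M)$ remains compact" means that $I(M)$ is a compact subset of $\mathbb R^n$. Put $\psi_M(t)=\int_{(M\times M)\cap\Delta_t}dx\,dy$ for $t\ge 0$; it is smooth on some interval $[0,d]$, $d>0$ (including at $t=0$). For $z\in\mathbb C$ the regularized $z$-energy of $M$ is Hadamard's finite part $E_M(z)=\mathrm{Pf.}\int_{M\times M}|x-y|^z\,dxdy$, defined explicitly as follows: choosing an integer $k\ge 0$ with $\mathrm{Re}\,z>-k-1$, $$E_M(z)=\lim_{\varepsilon\to0^+}\left[\int_{(M\times M)\setminus\Delta_\varepsilon}|x-y|^z\,dxdy+\sum_{j=1}^{k}\frac{\psi_M^{(j)}(0)}{(j-1)!}\,\frac{\varepsilon^{z+j}}{z+j}\right],$$ where, if $z=-j$ for some $j$, the expression $\varepsilon^{0}/0$ is replaced by $\log\varepsilon$. *)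

theory Defs
  imports "HOL-Analysis.Analysis"
begin

text \<open>Smooth maps on open subsets of Euclidean spaces: all iterated directional derivatives exist
  and are continuous.\<close>

primrec higher_differentiable_on ::
    "nat \<Rightarrow> 'b::euclidean_space set \<Rightarrow> ('b \<Rightarrow> 'a::euclidean_space) \<Rightarrow> bool" where
  "higher_differentiable_on 0 W f \<longleftrightarrow> continuous_on W f"
| "higher_differentiable_on (Suc k) W f \<longleftrightarrow>
     (\<forall>x\<in>W. f differentiable (at x)) \<and>
     (\<forall>v. higher_differentiable_on k W (\<lambda>x. frechet_derivative f (at x) v))"

definition smooth_on :: "'b::euclidean_space set \<Rightarrow> ('b \<Rightarrow> 'a::euclidean_space) \<Rightarrow> bool" where
  "smooth_on W f \<longleftrightarrow> (\<forall>k. higher_differentiable_on k W f)"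

text \<open>The dimension of a submanifold is the cardinality of the index type \<open>'m\<close> of the parameter
  space \<open>real ^ 'm\<close>, so it is at least 1.\<close>

definition local_parametrization ::
    "'a::euclidean_space set \<Rightarrow> (real ^ 'm::finite) set \<Rightarrow> (real ^ 'm \<Rightarrow> 'a) \<Rightarrow> bool" where
  "local_parametrization M W f \<longleftrightarrow>
     open W \<and> smooth_on W f \<and> (\<forall>x\<in>W. inj (frechet_derivative f (at x))) \<and>
     openin (top_of_set M) (f ` W) \<and> (\<exists>g. homeomorphism W (f ` W) f g)"

definition closed_submanifold :: "'m::finite itself \<Rightarrow> 'a::euclidean_space set \<Rightarrow> bool" where
  "closed_submanifold (_ :: 'm itself) M \<longleftrightarrow>
     compact M \<and>
     (\<forall>p\<in>M. \<exists>W (f :: real ^ 'm \<Rightarrow> 'a). local_parametrization M W f \<and> p \<in> f ` W)"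

text \<open>The density of the volume element in local coordinates: the square root of the determinant of
  the first fundamental form.\<close>

definition volume_density :: "(real ^ 'm::finite \<Rightarrow> 'a::euclidean_space) \<Rightarrow> real ^ 'm \<Rightarrow> real" where
  "volume_density f x =
     sqrt (det (\<chi> i j. frechet_derivative f (at x) (axis i 1) \<bullet>
                       frechet_derivative f (at x) (axis j 1) :: real ^ 'm ^ 'm))"

text \<open>The Riemannian volume of \<open>M\<close>, as a Borel measure on the ambient space that is concentrated
  on \<open>M\<close>. Its values on the images of the local parametrizations determine it.\<close>

definition is_riemannian_volume ::
    "'m::finite itself \<Rightarrow> 'a::euclidean_space set \<Rightarrow> 'a measure \<Rightarrow> bool" where
  "is_riemannian_volume (_ :: 'm itself) M \<mu> \<longleftrightarrow>
     sets \<mu> = sets borel \<and> emeasure \<mu> (- M) = 0 \<and>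
     (\<forall>W (f :: real ^ 'm \<Rightarrow> 'a). local_parametrization M W f \<longrightarrow>
        (\<forall>A\<in>sets borel. A \<subseteq> W \<longrightarrow>
           emeasure \<mu> (f ` A) = (\<integral>\<^sup>+x\<in>A. ennreal (volume_density f x) \<partial>lborel)))"

definition riemannian_volume :: "'m::finite itself \<Rightarrow> 'a::euclidean_space set \<Rightarrow> 'a measure" where
  "riemannian_volume m M = (THE \<mu>. is_riemannian_volume m M \<mu>)"

definition near_diagonal :: "real \<Rightarrow> ('a::euclidean_space \<times> 'a) set" where
  "near_diagonal t = {(x, y). norm (x - y) \<le> t}"

definition psi :: "'m::finite itself \<Rightarrow> 'a::euclidean_space set \<Rightarrow> real \<Rightarrow> real" where
  "psi m M t =
     measure (riemannian_volume m M \<Otimes>\<^sub>M riemannian_volume m M) ((M \<times> M) \<inter> near_diagonal t)"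

text \<open>Derivatives at the left end point of \<open>{0..}\<close> are one-sided. Elsewhere on \<open>{0..}\<close> they are
  the ordinary ones.\<close>

definition deriv_nonneg :: "(real \<Rightarrow> real) \<Rightarrow> real \<Rightarrow> real" where
  "deriv_nonneg f t = vector_derivative f (at t within {0..})"

text \<open>The expression whose limit for \<open>\<epsilon> \<rightarrow> 0+\<close> is the finite part; \<open>k\<close> is the number of
  correction terms.\<close>

definition truncated_energy ::
    "'m::finite itself \<Rightarrow> nat \<Rightarrow> 'a::euclidean_space set \<Rightarrow> complex \<Rightarrow> real \<Rightarrow> complex" where
  "truncated_energy m k M z \<epsilon> =
     (LINT p : (M \<times> M) - near_diagonal \<epsilon> | riemannian_volume m M \<Otimes>\<^sub>M riemannian_volume m M.
        complex_of_real (norm (fst p - snd p)) powr z) +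
     (\<Sum>j=1..k. complex_of_real ((deriv_nonneg ^^ j) (psi m M) 0 / fact (j - 1)) *
        (if z = - of_nat j then complex_of_real (ln \<epsilon>)
         else complex_of_real \<epsilon> powr (z + of_nat j) / (z + of_nat j)))"

text \<open>The limit does not depend on the admissible \<open>k\<close>: two admissible choices differ by multiples
  of \<open>\<epsilon> powr (z + j)\<close> with \<open>Re z + j > 0\<close>.\<close>

definition regularized_energy ::
    "'m::finite itself \<Rightarrow> 'a::euclidean_space set \<Rightarrow> complex \<Rightarrow> complex" where
  "regularized_energy m M z =
     (THE e. \<forall>k::nat. Re z > - real k - 1 \<longrightarrow> (truncated_energy m k M z \<longlongrightarrow> e) (at_right 0))"

text \<open>Moebius transformations of the one-point compactification, with \<open>None\<close> as the point at
  infinity (as in \<open>Alexandroff_compactification\<close>), are the finite compositions of inversions in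
  spheres and reflections in hyperplanes.\<close>

definition sphere_inversion ::
    "'a::euclidean_space \<Rightarrow> real \<Rightarrow> 'a option \<Rightarrow> 'a option" where
  "sphere_inversion c r p = (case p of
       None \<Rightarrow> Some c
     | Some x \<Rightarrow> if x = c then None else Some (c + (r\<^sup>2 / (norm (x - c))\<^sup>2) *\<^sub>R (x - c)))"

definition hyperplane_reflection ::
    "'a::euclidean_space \<Rightarrow> real \<Rightarrow> 'a option \<Rightarrow> 'a option" where
  "hyperplane_reflection a b = map_option (\<lambda>x. x - (2 * (a \<bullet> x - b) / (a \<bullet> a)) *\<^sub>R a)"

inductive moebius_transformation :: "('a::euclidean_space option \<Rightarrow> 'a option) \<Rightarrow> bool" where
  identity: "moebius_transformation id"
| inversion: "r > 0 \<Longrightarrow> moebius_transformation T \<Longrightarrow> moebius_transformation (sphere_inversion c r \<circ> T)"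
| reflection: "a \<noteq> 0 \<Longrightarrow> moebius_transformation T \<Longrightarrow>
    moebius_transformation (hyperplane_reflection a b \<circ> T)"

end

theory Submission
  imports Defs
begin

text \<open>Write \<open>F(t)\<close> for the integral of \<open>|x - y| powr (-2m)\<close> over the pairs of points of \<open>M\<close> at distance more
  than \<open>t\<close>. Parametrizing the pairs near the diagonal by a point, a direction and the distance
  \<open>t\<close>, and averaging over a direction and its opposite, shows that \<open>psi(t) = t^m h(t)\<close> with \<open>h\<close> smooth
  and even. For odd \<open>m\<close> the coefficient of \<open>t^(2m)\<close> in \<open>psi\<close> therefore vanishes, so the regularized energy
  at \<open>-2m\<close> contains no logarithm and is the constant term of \<open>F\<close>, that is, its limit after removal of
  negative powers of \<open>t\<close>; this constant term is invariant under rescaling of \<open>t\<close>.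

  A Moebius transformation restricted to \<open>M\<close> is a map \<open>\<tau>\<close> with
  \<open>|\<tau> x - \<tau> y| = \<rho> x \<rho> y |x - y|\<close>, as one sees from its linear lift to the light cone, so it
  multiplies the volume element by \<open>\<rho>^(2m)\<close> and leaves \<open>|x - y| powr (-2m) dx dy\<close> invariant. Hence the
  functions \<open>F\<close> of \<open>M\<close> and of its image differ, up to rescaling, by the integral over a shell
  \<open>c0\<^sup>2 |x - y| \<le> t < \<rho> x \<rho> y |x - y|\<close>. By the same symmetrization this integral equals
  \<open>t^(-m) h(t)\<close> with \<open>h\<close> smooth and even, and has constant term 0 for odd \<open>m\<close>.\<close>

text \<open>Evenness presupposes that the expansions extend to negative \<open>t\<close>, so the
  auxiliary functions live on symmetric intervals: in a chart a pair is \<open>(u, u + r v)\<close>,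
  and reversing both \<open>v\<close> and \<open>r\<close> names the same pair. A chord divided by
  its signed parameter is smooth across the diagonal and does not vanish there; inverting the
  resulting function gives \<open>r = t \<sigma>(u, v, t)\<close> with \<open>\<sigma>\<close>
  smooth near \<open>t = 0\<close>, and compactness makes one interval serve for all
  \<open>u\<close> and \<open>v\<close>. Only the base point is localized, the other point runs
  through all of \<open>M\<close>; the reversal fixes the base point, so disjoint Borel pieces do
  the work of a partition of unity. The parity count rests on one number: the coefficient of
  \<open>t^(2m)\<close> in \<open>t^m h(t)\<close> and the constant term of
  \<open>t^(-m) h(t)\<close> are both the Taylor coefficient of \<open>h\<close> of order
  \<open>m\<close>. The link from \<open>psi\<close> to \<open>F\<close> is
  \<open>F' = - t^(-2m) psi'\<close>, obtained from two-sided bounds for the energy between two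
  distances. The constant \<open>c0\<close> is a positive lower bound of \<open>\<rho>\<close> on
  \<open>M\<close>; it nests the two regions compared, so the shell enters with one sign.\<close>

section \<open>Functions that are smooth uniformly in a compact parameter\<close>

text \<open>Continuity is demanded jointly in the parameter and \<open>t\<close>, derivatives only
  in \<open>t\<close>. Thus the parameter set may be a compact set, a product with
  \<open>annulus\<close>, or \<open>{0}\<close> for a single function. The derivative is an
  existential witness instead of an operator, so closure properties follow by induction on
  \<open>k\<close> from the rules of differentiation. The interval is symmetric because
  \<open>t\<close> will be replaced by \<open>-t\<close>.\<close>

primrec family_C :: "nat \<Rightarrow> 'x::topological_space set \<Rightarrow> real \<Rightarrow>
    ('x \<Rightarrow> real \<Rightarrow> 'b::real_normed_vector) \<Rightarrow> bool" where
  "family_C 0 X d F \<longleftrightarrow> continuous_on (X \<times> {-d<..<d}) (\<lambda>p. F (fst p) (snd p))"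
| "family_C (Suc k) X d F \<longleftrightarrow> continuous_on (X \<times> {-d<..<d}) (\<lambda>p. F (fst p) (snd p)) \<and>
     (\<exists>F'. (\<forall>x\<in>X. \<forall>t\<in>{-d<..<d}. (F x has_vector_derivative F' x t) (at t)) \<and> family_C k X d F')"

lemma family_C_cont: "family_C k X d F \<Longrightarrow> continuous_on (X \<times> {-d<..<d}) (\<lambda>p. F (fst p) (snd p))"
  by (cases k) auto

lemma family_C_SucI:
  assumes "continuous_on (X \<times> {-d<..<d}) (\<lambda>p. F (fst p) (snd p))"
    and "\<And>x t. x \<in> X \<Longrightarrow> t \<in> {-d<..<d} \<Longrightarrow> (F x has_vector_derivative F' x t) (at t)"
    and "family_C k X d F'"
  shows "family_C (Suc k) X d F"
  unfolding family_C.simps using assms by blast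

lemma family_C_SucE:
  assumes "family_C (Suc k) X d F"
  obtains F' where "\<And>x t. x \<in> X \<Longrightarrow> t \<in> {-d<..<d} \<Longrightarrow> (F x has_vector_derivative F' x t) (at t)"
    "family_C k X d F'"
  using assms unfolding family_C.simps by blast

lemma family_C_Suc_D: "family_C (Suc k) X d F \<Longrightarrow> family_C k X d F"
proof (induction k arbitrary: F)
  case (Suc k)
  obtain F' where F': "\<And>x t. x \<in> X \<Longrightarrow> t \<in> {-d<..<d} \<Longrightarrow> (F x has_vector_derivative F' x t) (at t)"
    "family_C (Suc k) X d F'"
    using family_C_SucE[OF Suc.prems] by blast
  show ?case
    by (rule family_C_SucI[OF family_C_cont[OF Suc.prems] F'(1) Suc.IH[OF F'(2)]])
qed simp

lemma family_C_cong:
  assumes "family_C k X d F" "\<And>x t. x \<in> X \<Longrightarrow> t \<in> {-d<..<d} \<Longrightarrow> F x t = G x t"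
  shows "family_C k X d G"
proof -
  have c: "continuous_on (X \<times> {-d<..<d}) (\<lambda>p. G (fst p) (snd p))"
    by (rule continuous_on_eq[OF family_C_cont[OF assms(1)]]) (use assms(2) in auto)
  show ?thesis
  proof (cases k)
    case (Suc j)
    obtain F' where F': "\<And>x t. x \<in> X \<Longrightarrow> t \<in> {-d<..<d} \<Longrightarrow> (F x has_vector_derivative F' x t) (at t)"
      "family_C j X d F'"
      using family_C_SucE assms(1) Suc by blast
    have "(G x has_vector_derivative F' x t) (at t)" if "x \<in> X" "t \<in> {-d<..<d}" for x t
      by (rule has_vector_derivative_transform_within_open[OF F'(1)[OF that], of "{-d<..<d}"])
        (use assms(2) that in auto)
    then show ?thesis unfolding Suc by (intro family_C_SucI[OF c _ F'(2)])
  qed (simp add: c)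
qed

lemma family_C_reparam:
  assumes "family_C k X d F" "continuous_on Y \<phi>" "\<phi> ` Y \<subseteq> X" "e \<le> d"
  shows "family_C k Y e (\<lambda>y. F (\<phi> y))"
  using assms(1)
proof (induction k arbitrary: F)
  have *: "continuous_on (Y \<times> {-e<..<e}) (\<lambda>p. F (\<phi> (fst p)) (snd p))"
    if "continuous_on (X \<times> {-d<..<d}) (\<lambda>p. F (fst p) (snd p))" for F :: "'a \<Rightarrow> real \<Rightarrow> 'b"
  proof -
    have "continuous_on (Y \<times> {-e<..<e}) (\<lambda>p. (\<phi> (fst p), snd p))"
      by (intro continuous_intros continuous_on_compose2[OF assms(2)]) auto
    moreover have "(\<lambda>p. (\<phi> (fst p), snd p)) ` (Y \<times> {-e<..<e}) \<subseteq> X \<times> {-d<..<d}"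
      using assms(3,4) by auto
    ultimately show ?thesis
      using continuous_on_compose2[OF that] by fastforce
  qed
  { case 0 then show ?case using *[of F] by simp }
  { case (Suc k)
    obtain F' where F': "\<And>x t. x \<in> X \<Longrightarrow> t \<in> {-d<..<d} \<Longrightarrow> (F x has_vector_derivative F' x t) (at t)"
      "family_C k X d F'"
      using family_C_SucE[OF Suc.prems] by blast
    show ?case
      by (rule family_C_SucI[OF *[OF family_C_cont[OF Suc.prems]] _ Suc.IH[OF F'(2)]])
        (rule F'(1); use assms(3,4) in auto) }
qed

lemma family_C_const:
  assumes "continuous_on X g"
  shows "family_C k X d (\<lambda>x t. g x)"
proof -
  have c: "continuous_on (X \<times> {-d<..<d}) (\<lambda>p. g (fst p))" if "continuous_on X g" for g :: "'a \<Rightarrow> 'b"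
    by (rule continuous_on_compose2[OF that]) (auto intro: continuous_on_fst continuous_on_id)
  have z: "family_C k X d (\<lambda>x t. 0::'b)" for k
  proof (induction k)
    case (Suc k)
    show ?case
      by (rule family_C_SucI[OF _ _ Suc]) auto
  qed simp
  show ?thesis
  proof (cases k)
    case (Suc j)
    show ?thesis unfolding Suc
      by (rule family_C_SucI[OF c[OF assms] _ z]) simp
  qed (simp add: c assms)
qed

lemma family_C_id: "family_C k X d (\<lambda>x t. t)"
proof (cases k)
  case (Suc j)
  have "family_C j X d (\<lambda>x t. 1::real)"
    by (rule family_C_const) (rule continuous_on_const)
  then show ?thesis unfolding Suc
    by (rule family_C_SucI[rotated 2]) (auto intro: continuous_on_snd continuous_on_id)
qed (auto intro: continuous_on_snd continuous_on_id)

lemma family_C_add: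
  assumes "family_C k X d F" "family_C k X d G"
  shows "family_C k X d (\<lambda>x t. F x t + G x t)"
  using assms
proof (induction k arbitrary: F G)
  case 0
  then show ?case by (simp add: continuous_on_add)
next
  case (Suc k)
  obtain F' where F': "\<And>x t. x \<in> X \<Longrightarrow> t \<in> {-d<..<d} \<Longrightarrow> (F x has_vector_derivative F' x t) (at t)"
    "family_C k X d F'"
    using family_C_SucE[OF Suc.prems(1)] by blast
  obtain G' where G': "\<And>x t. x \<in> X \<Longrightarrow> t \<in> {-d<..<d} \<Longrightarrow> (G x has_vector_derivative G' x t) (at t)"
    "family_C k X d G'"
    using family_C_SucE[OF Suc.prems(2)] by blast
  show ?case
    by (rule family_C_SucI[OF continuous_on_add[OF family_C_cont[OF Suc.prems(1)] family_C_cont[OF Suc.prems(2)]]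
          has_vector_derivative_add[OF F'(1) G'(1)] Suc.IH[OF F'(2) G'(2)]])
qed

lemma family_C_bilinear:
  assumes b: "bounded_bilinear b" and "family_C k X d F" "family_C k X d G"
  shows "family_C k X d (\<lambda>x t. b (F x t) (G x t))"
  using assms(2,3)
proof (induction k arbitrary: F G)
  case 0
  then show ?case
    by (simp add: bounded_bilinear.continuous_on[OF b])
next
  case (Suc k)
  obtain F' where F': "\<And>x t. x \<in> X \<Longrightarrow> t \<in> {-d<..<d} \<Longrightarrow> (F x has_vector_derivative F' x t) (at t)"
    "family_C k X d F'"
    using family_C_SucE[OF Suc.prems(1)] by blast
  obtain G' where G': "\<And>x t. x \<in> X \<Longrightarrow> t \<in> {-d<..<d} \<Longrightarrow> (G x has_vector_derivative G' x t) (at t)"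
    "family_C k X d G'"
    using family_C_SucE[OF Suc.prems(2)] by blast
  have *: "family_C k X d (\<lambda>x t. b (F x t) (G' x t) + b (F' x t) (G x t))"
    by (intro family_C_add Suc.IH F'(2) G'(2) family_C_Suc_D[OF Suc.prems(1)] family_C_Suc_D[OF Suc.prems(2)])
  show ?case
    by (rule family_C_SucI[OF bounded_bilinear.continuous_on[OF b family_C_cont[OF Suc.prems(1)] family_C_cont[OF Suc.prems(2)]]
          bounded_bilinear.has_vector_derivative[OF b F'(1) G'(1)] *])
qed

lemma family_C_linear:
  assumes b: "bounded_linear b" and "family_C k X d F"
  shows "family_C k X d (\<lambda>x t. b (F x t))"
  using assms(2)
proof (induction k arbitrary: F)
  case 0
  then show ?case
    by (simp add: bounded_linear.continuous_on[OF b])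
next
  case (Suc k)
  obtain F' where F': "\<And>x t. x \<in> X \<Longrightarrow> t \<in> {-d<..<d} \<Longrightarrow> (F x has_vector_derivative F' x t) (at t)"
    "family_C k X d F'"
    using family_C_SucE[OF Suc.prems(1)] by blast
  show ?case
    by (rule family_C_SucI[OF bounded_linear.continuous_on[OF b family_C_cont[OF Suc.prems(1)]]
          bounded_linear.has_vector_derivative[OF b F'(1)] Suc.IH[OF F'(2)]])
qed

lemmas family_C_mult = family_C_bilinear[OF bounded_bilinear_mult]
lemmas family_C_scaleR = family_C_bilinear[OF bounded_bilinear_scaleR]
lemmas family_C_inner = family_C_bilinear[OF bounded_bilinear_inner]

lemma family_C_minus: "family_C k X d F \<Longrightarrow> family_C k X d (\<lambda>x t. - F x t)"
  by (rule family_C_linear[OF bounded_linear_minus[OF bounded_linear_ident]])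

lemma family_C_diff:
  assumes "family_C k X d F" "family_C k X d G"
  shows "family_C k X d (\<lambda>x t. F x t - G x t)"
  using family_C_add[OF assms(1) family_C_minus[OF assms(2)]] by simp

lemma family_C_sum:
  "finite I \<Longrightarrow> (\<And>i. i \<in> I \<Longrightarrow> family_C k X d (F i)) \<Longrightarrow> family_C k X d (\<lambda>x t. \<Sum>i\<in>I. F i x t)"
  by (induction I rule: finite_induct) (auto intro: family_C_add family_C_const)

lemma family_C_prod:
  fixes F :: "'i \<Rightarrow> 'x::topological_space \<Rightarrow> real \<Rightarrow> real"
  shows "finite I \<Longrightarrow> (\<And>i. i \<in> I \<Longrightarrow> family_C k X d (F i)) \<Longrightarrow> family_C k X d (\<lambda>x t. \<Prod>i\<in>I. F i x t)"
  by (induction I rule: finite_induct) (auto intro: family_C_mult family_C_const)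

lemma family_C_power:
  fixes F :: "'x::topological_space \<Rightarrow> real \<Rightarrow> real"
  shows "family_C k X d F \<Longrightarrow> family_C k X d (\<lambda>x t. F x t ^ n)"
  by (induction n) (auto intro: family_C_mult family_C_const)

lemma family_C_inverse:
  fixes F :: "'x::topological_space \<Rightarrow> real \<Rightarrow> real"
  assumes "family_C k X d F" and nz: "\<And>x t. x \<in> X \<Longrightarrow> t \<in> {-d<..<d} \<Longrightarrow> F x t \<noteq> 0"
  shows "family_C k X d (\<lambda>x t. inverse (F x t))"
  using assms(1)
proof (induction k)
  have c: "continuous_on (X \<times> {-d<..<d}) (\<lambda>p. inverse (F (fst p) (snd p)))"
    using nz by (intro continuous_on_inverse family_C_cont[OF assms(1)]) auto
  { case 0 then show ?case using c by simp }
  { case (Suc k)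
    obtain F' where F': "\<And>x t. x \<in> X \<Longrightarrow> t \<in> {-d<..<d} \<Longrightarrow> (F x has_vector_derivative F' x t) (at t)"
      "family_C k X d F'"
      using family_C_SucE[OF Suc.prems(1)] by blast
    have IH: "family_C k X d (\<lambda>x t. inverse (F x t))"
      by (rule Suc.IH[OF family_C_Suc_D[OF Suc.prems]])
    have *: "family_C k X d (\<lambda>x t. - (inverse (F x t) * F' x t * inverse (F x t)))"
      by (intro family_C_minus family_C_mult IH F'(2))
    show ?case
      by (rule family_C_SucI[OF c _ *])
        (use F'(1) nz in \<open>auto simp: has_real_derivative_iff_has_vector_derivative[symmetric] intro!: DERIV_inverse'\<close>) }
qed

lemma family_C_sqrt:
  fixes F :: "'x::topological_space \<Rightarrow> real \<Rightarrow> real"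
  assumes "family_C k X d F" and nz: "\<And>x t. x \<in> X \<Longrightarrow> t \<in> {-d<..<d} \<Longrightarrow> F x t > 0"
  shows "family_C k X d (\<lambda>x t. sqrt (F x t))"
  using assms(1)
proof (induction k)
  have c: "continuous_on (X \<times> {-d<..<d}) (\<lambda>p. sqrt (F (fst p) (snd p)))"
    by (intro continuous_on_real_sqrt family_C_cont[OF assms(1)])
  { case 0 then show ?case using c by simp }
  { case (Suc k)
    obtain F' where F': "\<And>x t. x \<in> X \<Longrightarrow> t \<in> {-d<..<d} \<Longrightarrow> (F x has_vector_derivative F' x t) (at t)"
      "family_C k X d F'"
      using family_C_SucE[OF Suc.prems(1)] by blast
    have IH: "family_C k X d (\<lambda>x t. sqrt (F x t))"
      by (rule Suc.IH[OF family_C_Suc_D[OF Suc.prems]])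
    have nz': "sqrt (F x t) \<noteq> 0" if "x \<in> X" "t \<in> {-d<..<d}" for x t
      using nz[OF that] by simp
    have "family_C k X d (\<lambda>x t. F' x t * (inverse (sqrt (F x t)) * (1/2)))"
      by (rule family_C_mult[OF F'(2) family_C_mult[OF family_C_inverse[OF IH nz'] family_C_const]])
        (auto intro: continuous_on_const)
    moreover have "((\<lambda>t. sqrt (F x t)) has_vector_derivative F' x t * (inverse (sqrt (F x t)) * (1/2))) (at t)"
      if "x \<in> X" "t \<in> {-d<..<d}" for x t
      unfolding has_real_derivative_iff_has_vector_derivative[symmetric]
      using DERIV_chain2[where f = sqrt and g = "F x", OF DERIV_real_sqrt[OF nz[OF that]]]
        F'(1)[OF that] by (simp add: has_real_derivative_iff_has_vector_derivative[symmetric] mult.commute)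
    ultimately show ?case
      by (intro family_C_SucI[OF c]) }
qed

text \<open>The chain rule for a fixed parameter. In the inductive step \<open>H\<close> is needed
  only to order \<open>k\<close> inside \<open>F'\<close>, which \<open>family_C_Suc_D\<close>
  supplies.\<close>

lemma family_C_compose:
  assumes F: "family_C k X d F" and H: "family_C k X e H"
    and sub: "\<And>x t. x \<in> X \<Longrightarrow> t \<in> {-e<..<e} \<Longrightarrow> H x t \<in> {-d<..<d}"
  shows "family_C k X e (\<lambda>x t. F x (H x t))"
  using assms(1,2)
proof (induction k arbitrary: F)
  have *: "continuous_on (X \<times> {-e<..<e}) (\<lambda>p. F (fst p) (H (fst p) (snd p)))"
    if F: "continuous_on (X \<times> {-d<..<d}) (\<lambda>p. F (fst p) (snd p))"
    for F :: "'a \<Rightarrow> real \<Rightarrow> 'b"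
  proof -
    have "continuous_on (X \<times> {-e<..<e}) (\<lambda>p. (fst p, H (fst p) (snd p)))"
      by (intro continuous_on_Pair continuous_on_fst continuous_on_id family_C_cont[OF H])
    moreover have "(\<lambda>p. (fst p, H (fst p) (snd p))) ` (X \<times> {-e<..<e}) \<subseteq> X \<times> {-d<..<d}"
      using sub by auto
    ultimately show ?thesis
      using continuous_on_compose2[OF F] by fastforce
  qed
  { case 0 then show ?case using *[of F] by simp }
  { case (Suc k)
    obtain F' where F': "\<And>x t. x \<in> X \<Longrightarrow> t \<in> {-d<..<d} \<Longrightarrow> (F x has_vector_derivative F' x t) (at t)"
      "family_C k X d F'"
      using family_C_SucE[OF Suc.prems(1)] by blast
    obtain H' where H': "\<And>x t. x \<in> X \<Longrightarrow> t \<in> {-e<..<e} \<Longrightarrow> (H x has_vector_derivative H' x t) (at t)"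
      "family_C k X e H'"
      using family_C_SucE[OF Suc.prems(2)] by blast
    have "family_C k X e (\<lambda>x t. H' x t *\<^sub>R F' x (H x t))"
      by (rule family_C_scaleR[OF H'(2) Suc.IH[OF F'(2) family_C_Suc_D[OF Suc.prems(2)]]])
    moreover have "((\<lambda>t. F x (H x t)) has_vector_derivative H' x t *\<^sub>R F' x (H x t)) (at t)"
      if "x \<in> X" "t \<in> {-e<..<e}" for x t
      using vector_diff_chain_at[OF H'(1)[OF that] F'(1)[OF that(1) sub[OF that]]]
      by (simp add: o_def)
    ultimately show ?case
      by (intro family_C_SucI[OF *[OF family_C_cont[OF Suc.prems(1)]]]) }
qed

definition family_smooth :: "'x::topological_space set \<Rightarrow> real \<Rightarrow> ('x \<Rightarrow> real \<Rightarrow> 'b::real_normed_vector) \<Rightarrow> bool" where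
  "family_smooth X d F \<longleftrightarrow> (\<forall>k. family_C k X d F)"

lemma family_smooth_cont: "family_smooth X d F \<Longrightarrow> continuous_on (X \<times> {-d<..<d}) (\<lambda>p. F (fst p) (snd p))"
  unfolding family_smooth_def using family_C_cont by blast

lemma family_smooth_deriv:
  assumes "family_smooth X d F"
  obtains F' where "\<And>x t. x \<in> X \<Longrightarrow> t \<in> {-d<..<d} \<Longrightarrow> (F x has_vector_derivative F' x t) (at t)"
    "family_smooth X d F'"
proof -
  \<comment> \<open>The witnesses in \<open>family_C\<close> may depend on \<open>k\<close>;
    \<open>vector_derivative\<close> is one choice for all orders.\<close>
  let ?F' = "\<lambda>x t. vector_derivative (F x) (at t)"
  have *: "(F x has_vector_derivative ?F' x t) (at t)" if "x \<in> X" "t \<in> {-d<..<d}" for x t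
  proof -
    have "family_C (Suc 0) X d F" using assms unfolding family_smooth_def by blast
    then show ?thesis
      using that by (metis family_C_SucE vector_derivative_at)
  qed
  have "family_C k X d ?F'" for k
  proof -
    have "family_C (Suc k) X d F" using assms unfolding family_smooth_def by blast
    then obtain F' where F': "\<And>x t. x \<in> X \<Longrightarrow> t \<in> {-d<..<d} \<Longrightarrow> (F x has_vector_derivative F' x t) (at t)"
      "family_C k X d F'"
      using family_C_SucE by blast
    show ?thesis
      by (rule family_C_cong[OF F'(2)]) (use F'(1) in \<open>auto intro: vector_derivative_at[symmetric]\<close>)
  qed
  then have "family_smooth X d ?F'" by (simp add: family_smooth_def)
  with * show ?thesis by (rule that)
qed

lemma family_smooth_has_deriv:
  assumes "family_smooth X d F"
    and "\<And>x t. x \<in> X \<Longrightarrow> t \<in> {-d<..<d} \<Longrightarrow> (F x has_vector_derivative F' x t) (at t)"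
  shows "family_smooth X d F'"
proof -
  obtain G where G: "\<And>x t. x \<in> X \<Longrightarrow> t \<in> {-d<..<d} \<Longrightarrow> (F x has_vector_derivative G x t) (at t)"
    "family_smooth X d G"
    using family_smooth_deriv[OF assms(1)] by blast
  have "family_C k X d F'" for k
  proof (rule family_C_cong[of k X d G])
    show "family_C k X d G" using G(2) by (simp add: family_smooth_def)
    show "G x t = F' x t" if "x \<in> X" "t \<in> {-d<..<d}" for x t
      by (rule vector_derivative_unique_at[OF G(1)[OF that] assms(2)[OF that]])
  qed
  then show ?thesis by (simp add: family_smooth_def)
qed

lemma family_smooth_cong:
  assumes "family_smooth X d F" "\<And>x t. x \<in> X \<Longrightarrow> t \<in> {-d<..<d} \<Longrightarrow> F x t = G x t"
  shows "family_smooth X d G"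
  using family_C_cong[of _ X d F G] assms unfolding family_smooth_def by blast

section \<open>Integrals over compact parameter sets, division by \<open>t\<close>, inverse
  functions\<close>

lemma compact_continuous_norm_bound:
  fixes f :: "'a::topological_space \<Rightarrow> 'b::real_normed_vector"
  assumes "compact S" "continuous_on S f"
  obtains B where "\<And>x. x \<in> S \<Longrightarrow> norm (f x) \<le> B"
proof -
  have "bounded (f ` S)"
    using compact_continuous_image[OF assms(2,1)] by (rule compact_imp_bounded)
  then obtain B where "\<forall>y\<in>f ` S. norm y \<le> B" unfolding bounded_iff by blast
  then show ?thesis using that by blast
qed

lemma vector_differentiable_bound:
  fixes f :: "real \<Rightarrow> 'b::real_normed_vector"
  assumes "convex S" "\<And>x. x \<in> S \<Longrightarrow> (f has_vector_derivative f' x) (at x within S)"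
    and "\<And>x. x \<in> S \<Longrightarrow> norm (f' x) \<le> B" "x \<in> S" "y \<in> S"
  shows "norm (f x - f y) \<le> B * norm (x - y)"
proof (rule differentiable_bound[OF assms(1) _ _ assms(4,5)])
  show "(f has_derivative (\<lambda>h. h *\<^sub>R f' x)) (at x within S)" if "x \<in> S" for x
    using assms(2)[OF that] by (simp add: has_vector_derivative_def)
  show "onorm (\<lambda>h. h *\<^sub>R f' x) \<le> B" if "x \<in> S" for x
    using assms(3)[OF that] by (simp add: onorm_scaleR_left onorm_id)
qed

text \<open>The quotient form of the derivative can be tested along sequences, which is what
  dominated convergence requires.\<close>

lemma has_vector_derivative_iff_quotient:
  "(f has_vector_derivative D) (at t) \<longleftrightarrow> ((\<lambda>s. (1 / (s - t)) *\<^sub>R (f s - f t)) \<longlongrightarrow> D) (at t)"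
proof -
  have "((\<lambda>s. (1 / (s - t)) *\<^sub>R (f s - f t)) \<longlongrightarrow> D) (at t) \<longleftrightarrow>
      ((\<lambda>s. norm ((1 / (s - t)) *\<^sub>R (f s - f t) - D)) \<longlongrightarrow> 0) (at t)"
    by (simp add: tendsto_norm_zero_iff LIM_zero_iff)
  also have "\<dots> \<longleftrightarrow> ((\<lambda>s. norm (f s - f t - (s - t) *\<^sub>R D) / norm (s - t)) \<longlongrightarrow> 0) (at t)"
  proof (intro filterlim_cong refl)
    show "\<forall>\<^sub>F s in at t. norm ((1 / (s - t)) *\<^sub>R (f s - f t) - D) = norm (f s - f t - (s - t) *\<^sub>R D) / norm (s - t)"
      unfolding eventually_at_filter
    proof (rule always_eventually, intro allI impI)
      fix s assume "s \<noteq> t"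
      then have "(1 / (s - t)) *\<^sub>R (f s - f t) - D = (1 / (s - t)) *\<^sub>R (f s - f t - (s - t) *\<^sub>R D)"
        by (simp add: scaleR_right_diff_distrib)
      then show "norm ((1 / (s - t)) *\<^sub>R (f s - f t) - D) = norm (f s - f t - (s - t) *\<^sub>R D) / norm (s - t)"
        by simp
    qed
  qed
  finally show ?thesis
    by (simp add: has_vector_derivative_def has_derivative_iff_norm bounded_linear_scaleR_left)
qed

text \<open>Differentiation under the integral sign. On a compact \<open>Y\<close> of finite measure
  continuous integrands are bounded and constants are integrable, so constants dominate both the
  integrands and their difference quotients; the induction replaces \<open>F\<close> by its
  derivative in \<open>t\<close>.\<close>

lemma family_C_integral:
  fixes F :: "'x::heine_borel \<times> 'y::euclidean_space \<Rightarrow> real \<Rightarrow> 'b::euclidean_space"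
  assumes Y: "compact Y" and \<nu>: "sets \<nu> = sets borel" "emeasure \<nu> Y < \<infinity>"
    and F: "family_C k (X \<times> Y) d F"
  shows "family_C k X d (\<lambda>x t. LINT y:Y|\<nu>. F (x, y) t)"
proof -
  have Ym: "Y \<in> sets \<nu>"
    using \<nu>(1) Y by (simp add: borel_compact)
  have bnd: "integrable \<nu> (\<lambda>y. B * indicator Y y :: real)" for B
    using \<nu>(2) Ym by auto
  have meas: "(\<lambda>y. indicator Y y *\<^sub>R f y) \<in> borel_measurable \<nu>" if "continuous_on Y f" for f :: "'y \<Rightarrow> 'b"
    using borel_measurable_continuous_on_indicator[OF _ that] Y \<nu>(1)
    by (simp add: borel_compact cong: measurable_cong_sets)
  have cY: "continuous_on Y (\<lambda>y. F (x, y) t)"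
    if "continuous_on ((X \<times> Y) \<times> {-d<..<d}) (\<lambda>p. F (fst p) (snd p))" "x \<in> X" "t \<in> {-d<..<d}"
    for F :: "'x \<times> 'y \<Rightarrow> real \<Rightarrow> 'b" and x t
  proof -
    have "continuous_on Y (\<lambda>y. ((x, y), t))" by (intro continuous_intros)
    moreover have "(\<lambda>y. ((x, y), t)) ` Y \<subseteq> (X \<times> Y) \<times> {-d<..<d}" using that by auto
    ultimately show ?thesis using continuous_on_compose2[OF that(1)] by fastforce
  qed
  have cont: "continuous_on (X \<times> {-d<..<d}) (\<lambda>p. LINT y:Y|\<nu>. F (fst p, y) (snd p))"
    if F: "continuous_on ((X \<times> Y) \<times> {-d<..<d}) (\<lambda>p. F (fst p) (snd p))" for F :: "'x \<times> 'y \<Rightarrow> real \<Rightarrow> 'b"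
    unfolding continuous_on_sequentially
  proof (intro allI ballI impI)
    fix p and a :: "'x \<times> real" assume "a \<in> X \<times> {-d<..<d}"
      and p: "(\<forall>n. p n \<in> X \<times> {-d<..<d}) \<and> p \<longlonglongrightarrow> a"
    \<comment> \<open>A convergent sequence together with its limit is compact, so one constant
      bounds the integrand on \<open>C \<times> Y\<close>, even if \<open>X\<close> is not
      compact.\<close>
    define C where "C = insert a (range p)"
    have "compact C" unfolding C_def using compact_sequence_with_limit[of p a] p by simp
    have Csub: "C \<subseteq> X \<times> {-d<..<d}" using conjunct1[OF p] \<open>a \<in> _\<close> unfolding C_def by (simp add: image_subset_iff)
    let ?g = "\<lambda>z. ((fst (fst z), snd z), snd (fst z))"
    have "continuous_on (C \<times> Y) ?g" by (intro continuous_intros)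
    moreover have "?g ` (C \<times> Y) \<subseteq> (X \<times> Y) \<times> {-d<..<d}" using Csub by fastforce
    ultimately have c: "continuous_on (C \<times> Y) (\<lambda>z. F (fst (fst z), snd z) (snd (fst z)))"
      using continuous_on_compose2[OF F] by fastforce
    obtain B where "\<And>z. z \<in> C \<times> Y \<Longrightarrow> norm (F (fst (fst z), snd z) (snd (fst z))) \<le> B"
      using compact_continuous_norm_bound[OF compact_Times[OF \<open>compact C\<close> Y] c] by blast
    from this[of "(c, y)" for c y] have B: "norm (F (fst c, y) (snd c)) \<le> B" if "c \<in> C" "y \<in> Y" for c y
      using that by simp
    show "((\<lambda>p. LINT y:Y|\<nu>. F (fst p, y) (snd p)) \<circ> p) \<longlonglongrightarrow> (LINT y:Y|\<nu>. F (fst a, y) (snd a))"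
      unfolding o_def set_lebesgue_integral_def
    proof (rule integral_dominated_convergence[OF _ _ bnd[of B]])
      show "(\<lambda>y. indicator Y y *\<^sub>R F (fst a, y) (snd a)) \<in> borel_measurable \<nu>"
        by (intro meas cY[OF F]) (use \<open>a \<in> _\<close> in auto)
      show "(\<lambda>y. indicator Y y *\<^sub>R F (fst (p i), y) (snd (p i))) \<in> borel_measurable \<nu>" for i
        by (intro meas cY[OF F]) (use p in \<open>auto simp: mem_Times_iff\<close>)
      show "AE y in \<nu>. (\<lambda>i. indicator Y y *\<^sub>R F (fst (p i), y) (snd (p i))) \<longlonglongrightarrow> indicator Y y *\<^sub>R F (fst a, y) (snd a)"
      proof (rule AE_I2)
        fix y
        show "(\<lambda>i. indicator Y y *\<^sub>R F (fst (p i), y) (snd (p i))) \<longlonglongrightarrow> indicator Y y *\<^sub>R F (fst a, y) (snd a)"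
        proof (cases "y \<in> Y")
          case True
          have "(\<lambda>i. ((fst (p i), y), snd (p i))) \<longlonglongrightarrow> ((fst a, y), snd a)"
            using p by (intro tendsto_intros) auto
          then have "(\<lambda>i. F (fst (p i), y) (snd (p i))) \<longlonglongrightarrow> F (fst a, y) (snd a)"
            using F[unfolded continuous_on_sequentially, rule_format, of "((fst a, y), snd a)" "\<lambda>i. ((fst (p i), y), snd (p i))"]
              p \<open>a \<in> _\<close> True by (auto simp: o_def mem_Times_iff)
          then show ?thesis using True by simp
        qed simp
      qed
      show "AE y in \<nu>. norm (indicator Y y *\<^sub>R F (fst (p i), y) (snd (p i))) \<le> B * indicator Y y" for i
        by (rule AE_I2) (use B[of "p i"] in \<open>auto simp: C_def indicator_def\<close>)
    qed
  qed
  show ?thesis using F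
  proof (induction k arbitrary: F)
    case 0
    then show ?case using cont by simp
  next
    case (Suc k)
    obtain F' where F': "\<And>x t. x \<in> X \<times> Y \<Longrightarrow> t \<in> {-d<..<d} \<Longrightarrow> (F x has_vector_derivative F' x t) (at t)"
      "family_C k (X \<times> Y) d F'"
      using family_C_SucE[OF Suc.prems(1)] by blast
    note cF = family_C_cont[OF Suc.prems] and cF' = family_C_cont[OF F'(2)]
    have "((\<lambda>t. LINT y:Y|\<nu>. F (x, y) t) has_vector_derivative (LINT y:Y|\<nu>. F' (x, y) t)) (at t)"
      if x: "x \<in> X" and t: "t \<in> {-d<..<d}" for x t
    proof -
      obtain e where e: "e > 0" "cball t e \<subseteq> {-d<..<d}"
        using t open_contains_cball open_greaterThanLessThan by blast
      let ?g = "\<lambda>z. ((x, snd z), fst z)"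
      have "continuous_on (cball t e \<times> Y) ?g" by (intro continuous_intros)
      moreover have "?g ` (cball t e \<times> Y) \<subseteq> (X \<times> Y) \<times> {-d<..<d}" using e x by auto
      ultimately have c: "continuous_on (cball t e \<times> Y) (\<lambda>z. F' (x, snd z) (fst z))"
        using continuous_on_compose2[OF cF'] by fastforce
      obtain B where "\<And>z. z \<in> cball t e \<times> Y \<Longrightarrow> norm (F' (x, snd z) (fst z)) \<le> B"
        using compact_continuous_norm_bound[OF compact_Times[OF compact_cball Y] c] by blast
      from this[of "(s, y)" for s y] have B: "norm (F' (x, y) s) \<le> B" if "s \<in> cball t e" "y \<in> Y" for s y
        using that by simp
      \<comment> \<open>The mean value bound from the derivative dominates all difference quotients
        near \<open>t\<close>.\<close>
      have lip: "norm (F (x, y) s - F (x, y) t) \<le> B * norm (s - t)" if "s \<in> cball t e" "y \<in> Y" for s y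
      proof (rule vector_differentiable_bound[of "cball t e" "F (x, y)" "F' (x, y)"])
        show "(F (x, y) has_vector_derivative F' (x, y) u) (at u within cball t e)" if "u \<in> cball t e" for u
          using F'(1)[of "(x, y)" u] \<open>y \<in> Y\<close> x subsetD[OF e(2) that]
          by (simp add: has_vector_derivative_at_within)
        show "norm (F' (x, y) u) \<le> B" if "u \<in> cball t e" for u
          by (rule B[OF that \<open>y \<in> Y\<close>])
        show "t \<in> cball t e" using e(1) by simp
      qed (fact convex_cball that(1))+
      have int: "integrable \<nu> (\<lambda>y. indicator Y y *\<^sub>R F (x, y) s)" if s: "s \<in> {-d<..<d}" for s
      proof -
        have c: "continuous_on Y (\<lambda>y. F (x, y) s)" by (rule cY[OF cF x s])
        obtain B' where "\<And>y. y \<in> Y \<Longrightarrow> norm (F (x, y) s) \<le> B'"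
          using compact_continuous_norm_bound[OF Y c] by blast
        then show ?thesis
          by (intro Bochner_Integration.integrable_bound[OF bnd[of B']] meas c AE_I2)
            (auto simp: indicator_def intro: order_trans[OF _ abs_ge_self])
      qed
      have "((\<lambda>s. (1 / (s - t)) *\<^sub>R ((LINT y:Y|\<nu>. F (x, y) s) - (LINT y:Y|\<nu>. F (x, y) t))) \<longlongrightarrow> (LINT y:Y|\<nu>. F' (x, y) t)) (at t)"
        unfolding tendsto_at_iff_sequentially
      proof (intro allI impI)
        fix s assume s: "\<forall>i. s i \<in> UNIV - {t}" "s \<longlonglongrightarrow> t"
        then have "\<forall>\<^sub>F i in sequentially. s i \<in> cball t e"
          using eventually_mono[OF topological_tendstoD[OF s(2) open_ball[of t e]]] e(1) ball_subset_cball by fastforce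
        then obtain N where N: "\<And>i. i \<ge> N \<Longrightarrow> s i \<in> cball t e"
          by (auto simp: eventually_sequentially)
        \<comment> \<open>Dropping finitely many terms keeps the whole sequence in the ball on which
          the bound \<open>B\<close> holds.\<close>
        define r where "r i = s (i + N)" for i
        have r: "r i \<in> cball t e" "r i \<noteq> t" "r \<longlonglongrightarrow> t" for i
          using N s LIMSEQ_ignore_initial_segment[OF s(2)] by (auto simp: r_def[abs_def])
        have rd: "r i \<in> {-d<..<d}" for i by (rule subsetD[OF e(2) r(1)])
        have "(\<lambda>i. LINT y|\<nu>. (1 / (r i - t)) *\<^sub>R (indicator Y y *\<^sub>R F (x, y) (r i) - indicator Y y *\<^sub>R F (x, y) t))
           \<longlonglongrightarrow> (LINT y|\<nu>. indicator Y y *\<^sub>R F' (x, y) t)"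
        proof (rule integral_dominated_convergence[OF _ _ bnd[of B]])
          show "(\<lambda>y. indicator Y y *\<^sub>R F' (x, y) t) \<in> borel_measurable \<nu>"
            by (intro meas cY[OF cF' x t])
          show "(\<lambda>y. (1 / (r i - t)) *\<^sub>R (indicator Y y *\<^sub>R F (x, y) (r i) - indicator Y y *\<^sub>R F (x, y) t)) \<in> borel_measurable \<nu>" for i
            by (intro borel_measurable_scaleR borel_measurable_diff meas cY[OF cF x t] cY[OF cF x rd]) auto
          show "AE y in \<nu>. (\<lambda>i. (1 / (r i - t)) *\<^sub>R (indicator Y y *\<^sub>R F (x, y) (r i) - indicator Y y *\<^sub>R F (x, y) t))
              \<longlonglongrightarrow> indicator Y y *\<^sub>R F' (x, y) t"
          proof (rule AE_I2)
            fix y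
            show "(\<lambda>i. (1 / (r i - t)) *\<^sub>R (indicator Y y *\<^sub>R F (x, y) (r i) - indicator Y y *\<^sub>R F (x, y) t))
              \<longlonglongrightarrow> indicator Y y *\<^sub>R F' (x, y) t"
            proof (cases "y \<in> Y")
              case True
              then have "((\<lambda>s. (1 / (s - t)) *\<^sub>R (F (x, y) s - F (x, y) t)) \<longlongrightarrow> F' (x, y) t) (at t)"
                using F'(1)[of "(x, y)" t] x t by (simp add: has_vector_derivative_iff_quotient)
              then show ?thesis
                unfolding tendsto_at_iff_sequentially using r True by (auto simp: o_def)
            qed simp
          qed
          show "AE y in \<nu>. norm ((1 / (r i - t)) *\<^sub>R (indicator Y y *\<^sub>R F (x, y) (r i) - indicator Y y *\<^sub>R F (x, y) t)) \<le> B * indicator Y y" for i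
          proof (rule AE_I2)
            fix y
            show "norm ((1 / (r i - t)) *\<^sub>R (indicator Y y *\<^sub>R F (x, y) (r i) - indicator Y y *\<^sub>R F (x, y) t)) \<le> B * indicator Y y"
            proof (cases "y \<in> Y")
              case True
              then show ?thesis
                using lip[OF r(1)[of i] True] r(2)[of i] by (simp add: divide_simps)
            qed simp
          qed
        qed
        then have "(\<lambda>i. (1 / (r i - t)) *\<^sub>R ((LINT y:Y|\<nu>. F (x, y) (r i)) - (LINT y:Y|\<nu>. F (x, y) t)))
           \<longlonglongrightarrow> (LINT y:Y|\<nu>. F' (x, y) t)"
          unfolding set_lebesgue_integral_def
          by (simp add: Bochner_Integration.integral_diff[OF int[OF rd] int[OF t]])
        then show "((\<lambda>s. (1 / (s - t)) *\<^sub>R ((LINT y:Y|\<nu>. F (x, y) s) - (LINT y:Y|\<nu>. F (x, y) t))) \<circ> s) \<longlonglongrightarrow> (LINT y:Y|\<nu>. F' (x, y) t)"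
          unfolding r_def o_def by (rule LIMSEQ_offset)
      qed
      then show ?thesis
        by (simp add: has_vector_derivative_iff_quotient)
    qed
    then show ?case
      by (intro family_C_SucI[OF cont[OF cF] _ Suc.IH[OF F'(2)]])
  qed
qed

text \<open>Hadamard's division lemma: the quotient is the integral of \<open>F'(x, a t)\<close>
  over \<open>a\<close> in \<open>[0, 1]\<close>, which is smooth across \<open>t = 0\<close> by
  differentiation under the integral sign.\<close>

lemma family_smooth_divide:
  fixes F :: "'x::heine_borel \<Rightarrow> real \<Rightarrow> 'b::euclidean_space"
  assumes F: "family_smooth X d F" and F0: "\<And>x. x \<in> X \<Longrightarrow> F x 0 = 0"
  obtains G where "family_smooth X d G"
    "\<And>x t. x \<in> X \<Longrightarrow> t \<in> {-d<..<d} \<Longrightarrow> F x t = t *\<^sub>R G x t"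
proof -
  obtain F' where F': "\<And>x t. x \<in> X \<Longrightarrow> t \<in> {-d<..<d} \<Longrightarrow> (F x has_vector_derivative F' x t) (at t)"
    "family_smooth X d F'"
    using family_smooth_deriv[OF F] by blast
  define G where "G x t = (LINT a:{0..1}|lborel. F' x (a * t))" for x t
  have in_d: "a * t \<in> {-d<..<d}" if "a \<in> {0..1}" "t \<in> {-d<..<d}" for a t :: real
  proof -
    have "\<bar>a * t\<bar> \<le> \<bar>t\<bar>" using that by (simp add: abs_mult mult_left_le_one_le)
    then show ?thesis using that by auto
  qed
  have "family_C k X d G" for k
  proof -
    have "family_C k (X \<times> {0..1}) d (\<lambda>z. F' (fst z))"
      by (rule family_C_reparam[of k X d]) (use F'(2) in \<open>auto simp: family_smooth_def intro!: continuous_intros\<close>)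
    moreover have "family_C k (X \<times> {0..1}) d (\<lambda>z t. snd z * t)"
      by (intro family_C_mult family_C_const family_C_id continuous_intros)
    ultimately have "family_C k (X \<times> {0..1}) d (\<lambda>z t. F' (fst z) (snd z * t))"
      by (rule family_C_compose) (use in_d in auto)
    then show ?thesis unfolding G_def
      by (rule family_C_integral[of "{0..1::real}" lborel k X d "\<lambda>z t. F' (fst z) (snd z * t)", simplified, rotated 1])
  qed
  moreover have "F x t = t *\<^sub>R G x t" if x: "x \<in> X" and t: "t \<in> {-d<..<d}" for x t
  proof -
    have "(LBINT a. indicator {0..1} a *\<^sub>R (t *\<^sub>R F' x (a * t))) = F x (1 * t) - F x (0 * t)"
    proof (rule integral_FTC_Icc)
      show "((\<lambda>a. F x (a * t)) has_vector_derivative t *\<^sub>R F' x (a * t)) (at a within {0..1})" if "0 \<le> a" "a \<le> 1" for a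
      proof (rule has_vector_derivative_at_within)
        have "((\<lambda>a. a * t) has_vector_derivative t) (at a)"
          by (auto intro!: derivative_eq_intros simp: has_real_derivative_iff_has_vector_derivative[symmetric])
        from vector_diff_chain_at[OF this F'(1)[OF x in_d[of a t]]]
        show "((\<lambda>a. F x (a * t)) has_vector_derivative t *\<^sub>R F' x (a * t)) (at a)"
          using that t by (auto simp: o_def)
      qed
      have "continuous_on {0..1} (\<lambda>a. (x, a * t))" by (intro continuous_intros)
      moreover have "(\<lambda>a. (x, a * t)) ` {0..1} \<subseteq> X \<times> {-d<..<d}" using in_d t x by auto
      ultimately have "continuous_on {0..1} (\<lambda>a. F' x (a * t))"
        using continuous_on_compose2[OF family_smooth_cont[OF F'(2)]] by fastforce
      then show "continuous_on {0..1} (\<lambda>a. t *\<^sub>R F' x (a * t))" by (intro continuous_intros)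
    qed simp
    moreover have "indicator {0..1} a *\<^sub>R (t *\<^sub>R F' x (a * t)) = t *\<^sub>R (indicator {0..1} a *\<^sub>R F' x (a * t))" for a :: real
      by (rule scaleR_left_commute)
    ultimately show ?thesis
      using F0[OF x] by (simp only: integral_scaleR_right) (simp add: G_def set_lebesgue_integral_def)
  qed
  ultimately show ?thesis using that unfolding family_smooth_def by blast
qed

lemma compact_continuous_lower_bound:
  fixes f :: "'a::topological_space \<Rightarrow> real"
  assumes "compact S" "continuous_on S f" "\<And>x. x \<in> S \<Longrightarrow> f x > 0"
  obtains c where "c > 0" "\<And>x. x \<in> S \<Longrightarrow> f x \<ge> c"
proof (cases "S = {}")
  case True
  then show ?thesis using that[of 1] by simp
next
  case False
  then obtain z where "z \<in> S" "\<forall>x\<in>S. f z \<le> f x"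
    using continuous_attains_inf[OF assms(1) _ assms(2)] by blast
  then show ?thesis using that[of "f z"] assms(3) by auto
qed

text \<open>A parametrized inverse function theorem adapted to radii: the solution \<open>s\<close>
  of \<open>s q(x, s) = t\<close> vanishes at \<open>t = 0\<close>, hence has the form
  \<open>t \<sigma>(x, t)\<close> with \<open>\<sigma>\<close> smooth and positive. Compactness of
  \<open>X\<close> gives one interval of \<open>t\<close> for all parameters. The inequality in the
  conclusion describes regions of integration, the equation serves to derive symmetries of
  \<open>\<sigma>\<close>.\<close>

lemma family_smooth_inverse:
  fixes X :: "'x::heine_borel set" and q :: "'x \<Rightarrow> real \<Rightarrow> real"
  assumes X: "compact X" and s1: "0 < s1" "s1 < s0" and q: "family_smooth X s0 q"
    and q0: "\<And>x s. x \<in> X \<Longrightarrow> s \<in> {-s0<..<s0} \<Longrightarrow> q x s > 0"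
    and p': "\<And>x s. x \<in> X \<Longrightarrow> s \<in> {-s0<..<s0} \<Longrightarrow> ((\<lambda>s. s * q x s) has_real_derivative p' x s) (at s)"
    and p'0: "\<And>x s. x \<in> X \<Longrightarrow> s \<in> {-s0<..<s0} \<Longrightarrow> p' x s > 0"
  obtains d \<sigma> where "d > 0" "family_smooth X d \<sigma>"
    "\<And>x t. x \<in> X \<Longrightarrow> t \<in> {-d<..<d} \<Longrightarrow> \<sigma> x t > 0"
    "\<And>x t. x \<in> X \<Longrightarrow> t \<in> {-d<..<d} \<Longrightarrow> t * \<sigma> x t \<in> {-s1<..<s1}"
    "\<And>x t s. x \<in> X \<Longrightarrow> t \<in> {-d<..<d} \<Longrightarrow> s \<in> {-s1<..<s1} \<Longrightarrow> s * q x s \<le> t \<longleftrightarrow> s \<le> t * \<sigma> x t"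
    "\<And>x t s. x \<in> X \<Longrightarrow> t \<in> {-d<..<d} \<Longrightarrow> s \<in> {-s1<..<s1} \<Longrightarrow> s * q x s = t \<longleftrightarrow> s = t * \<sigma> x t"
proof -
  define p where "p x s = s * q x s" for x s
  have p: "family_smooth X s0 p"
    unfolding p_def family_smooth_def using q
    by (auto intro!: family_C_mult family_C_id simp: family_smooth_def)
  have sub: "{-s1..s1} \<subseteq> {-s0<..<s0}" using s1 by auto
  have dp: "(p x has_real_derivative p' x s) (at s)" if "x \<in> X" "s \<in> {-s0<..<s0}" for x s
    using p'[OF that] by (simp add: p_def[abs_def])
  have mono: "p x a < p x b" if "x \<in> X" "a \<in> {-s0<..<s0}" "b \<in> {-s0<..<s0}" "a < b" for x a b
  proof (rule DERIV_pos_imp_increasing[OF that(4)])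
    fix s assume "a \<le> s" "s \<le> b"
    then show "\<exists>y. DERIV (p x) s :> y \<and> 0 < y"
      using dp[of x s] p'0[of x s] that by (intro exI[of _ "p' x s"]) auto
  qed
  have inj: "a = b" if "x \<in> X" "a \<in> {-s0<..<s0}" "b \<in> {-s0<..<s0}" "p x a = p x b" for x a b
    using mono[of x a b] mono[of x b a] that by (cases a b rule: linorder_cases) auto
  have contq: "continuous_on (X \<times> {-s1..s1}) (\<lambda>z. q (fst z) (snd z))"
    by (rule continuous_on_subset[OF family_smooth_cont[OF q]]) (use sub in auto)
  have contp: "continuous_on (X \<times> {-s1..s1}) (\<lambda>z. p (fst z) (snd z))"
    by (rule continuous_on_subset[OF family_smooth_cont[OF p]]) (use sub in auto)
  have "compact (X \<times> {-s1..s1})" using X by (intro compact_Times) auto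
  then obtain c where c: "c > 0" "\<And>z. z \<in> X \<times> {-s1..s1} \<Longrightarrow> q (fst z) (snd z) \<ge> c"
    using compact_continuous_lower_bound[OF _ contq] q0 sub by (metis mem_Times_iff subsetD)
  \<comment> \<open>\<open>c\<close> bounds \<open>q\<close> below, so \<open>s q\<close> has
    modulus at least \<open>c s1\<close> at \<open>s = s1\<close> and at \<open>s = -s1\<close>, and
    the intermediate value theorem reaches every \<open>t\<close> in between.\<close>
  define d where "d = c * s1"
  have "d > 0" using c(1) s1 by (simp add: d_def)
  have big: "p x s1 \<ge> d" "p x (-s1) \<le> -d" if "x \<in> X" for x
  proof -
    have "q x s1 \<ge> c" "q x (-s1) \<ge> c" using c(2)[of "(x, s1)"] c(2)[of "(x, -s1)"] that s1 by auto
    then show "p x s1 \<ge> d" "p x (-s1) \<le> -d" using s1 by (auto simp: p_def d_def mult.commute)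
  qed
  have ex: "\<exists>s\<in>{-s1<..<s1}. p x s = t" if x: "x \<in> X" and t: "t \<in> {-d<..<d}" for x t
  proof -
    have "continuous_on {-s1..s1} (p x)"
      using dp[OF x] sub by (intro continuous_at_imp_continuous_on ballI) (meson DERIV_isCont subsetD)
    then obtain s where "s \<in> {-s1..s1}" "p x s = t"
      using IVT'[of "p x" "-s1" t s1] big[OF x] t s1 by auto
    moreover have "s \<noteq> s1" "s \<noteq> -s1" using big[OF x] t \<open>p x s = t\<close> by auto
    ultimately show ?thesis by (intro bexI[of _ s]) auto
  qed
  define S where "S x t = (SOME s. s \<in> {-s1<..<s1} \<and> p x s = t)" for x t
  have S: "S x t \<in> {-s1<..<s1}" "p x (S x t) = t" if "x \<in> X" "t \<in> {-d<..<d}" for x t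
    using someI_ex[of "\<lambda>s. s \<in> {-s1<..<s1} \<and> p x s = t"] ex[OF that] unfolding S_def by blast+
  have S_eq: "S x t = s" if "x \<in> X" "t \<in> {-d<..<d}" "s \<in> {-s0<..<s0}" "p x s = t" for x t s
    using inj[of x "S x t" s] S[OF that(1,2)] that s1 by auto
  \<comment> \<open>The map taking \<open>(x, s)\<close> to \<open>(x, p x s)\<close> is continuous
    and injective on a compact set, so its inverse is continuous; \<open>S\<close> is the second
    component of that inverse.\<close>
  have contS: "continuous_on (X \<times> {-d<..<d}) (\<lambda>z. S (fst z) (snd z))"
  proof -
    let ?K = "X \<times> {-s1..s1}" and ?\<Phi> = "\<lambda>z. (fst z, p (fst z) (snd z))"
    have c\<Phi>: "continuous_on ?K ?\<Phi>"
      by (intro continuous_on_Pair continuous_on_fst continuous_on_id contp)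
    have "inj_on ?\<Phi> ?K"
    proof (rule inj_onI)
      fix z w assume z: "z \<in> ?K" and w: "w \<in> ?K" and eq: "?\<Phi> z = ?\<Phi> w"
      have "snd z = snd w"
        by (rule inj[of "fst z"]) (use z w eq s1 in auto)
      then show "z = w" using eq by (simp add: prod_eq_iff)
    qed
    then have ci: "continuous_on (?\<Phi> ` ?K) (inv_into ?K ?\<Phi>)"
      by (intro continuous_on_inv[OF c\<Phi> \<open>compact ?K\<close>] ballI inv_into_f_f)
    have sub\<Phi>: "X \<times> {-d<..<d} \<subseteq> ?\<Phi> ` ?K"
    proof
      fix z assume "z \<in> X \<times> {-d<..<d}"
      then have "?\<Phi> (fst z, S (fst z) (snd z)) = z" "(fst z, S (fst z) (snd z)) \<in> ?K"
        using S[of "fst z" "snd z"] by (auto simp: mem_Times_iff)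
      then show "z \<in> ?\<Phi> ` ?K" by (intro image_eqI[of z ?\<Phi> "(fst z, S (fst z) (snd z))"]) simp_all
    qed
    have "continuous_on (X \<times> {-d<..<d}) (\<lambda>z. snd (inv_into ?K ?\<Phi> z))"
      by (rule continuous_on_snd[OF continuous_on_subset[OF ci sub\<Phi>]])
    moreover have "snd (inv_into ?K ?\<Phi> z) = S (fst z) (snd z)" if "z \<in> X \<times> {-d<..<d}" for z
    proof -
      have "?\<Phi> (fst z, S (fst z) (snd z)) = z" "(fst z, S (fst z) (snd z)) \<in> ?K"
        using S[of "fst z" "snd z"] that by (auto simp: mem_Times_iff)
      then have "inv_into ?K ?\<Phi> z = (fst z, S (fst z) (snd z))"
        using inv_into_f_f[OF \<open>inj_on ?\<Phi> ?K\<close>, of "(fst z, S (fst z) (snd z))"] by simp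
      then show ?thesis by simp
    qed
    ultimately show ?thesis by (simp cong: continuous_on_cong)
  qed
  have smp': "family_smooth X s0 p'"
    by (rule family_smooth_has_deriv[OF p]) (use dp in \<open>simp add: has_real_derivative_iff_has_vector_derivative\<close>)
  have dS: "(S x has_real_derivative inverse (p' x (S x t))) (at t)" if x: "x \<in> X" and t: "t \<in> {-d<..<d}" for x t
  proof (rule DERIV_inverse_function[where f = "p x" and a = "-d" and b = d])
    show "DERIV (p x) (S x t) :> p' x (S x t)" "p' x (S x t) \<noteq> 0"
      using dp[OF x] p'0[OF x, of "S x t"] S[OF x t] s1 by auto
    show "p x (S x y) = y" if "- d < y" "y < d" for y using S[OF x] that by simp
    have "continuous_on {-d<..<d} (\<lambda>t. (x, t))" by (intro continuous_intros)
    then have "continuous_on {-d<..<d} (S x)"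
      using continuous_on_compose2[OF contS, of "{-d<..<d}" "\<lambda>t. (x, t)"] x by auto
    then show "isCont (S x) t" using t by (metis continuous_on_eq_continuous_at open_greaterThanLessThan)
  qed (use t in auto)
  \<comment> \<open>Bootstrapping: the derivative of \<open>S\<close> is
    \<open>1 / p'(x, S)\<close>, so order \<open>k\<close> for \<open>S\<close> gives order
    \<open>k\<close> for its derivative.\<close>
  have SC: "family_C k X d S" for k
  proof (induction k)
    case (Suc k)
    have "family_C k X d (\<lambda>x t. p' x (S x t))"
      proof (rule family_C_compose[OF _ Suc, of s0 p'])
      show "S x t \<in> {-s0<..<s0}" if "x \<in> X" "t \<in> {-d<..<d}" for x t
        using S(1)[OF that] s1 by auto
    qed (use smp' in \<open>simp add: family_smooth_def\<close>)
    then have "family_C k X d (\<lambda>x t. inverse (p' x (S x t)))"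
    proof (rule family_C_inverse)
      show "p' x (S x t) \<noteq> 0" if "x \<in> X" "t \<in> {-d<..<d}" for x t
        using p'0[OF that(1), of "S x t"] S[OF that] s1 by auto
    qed
    then show ?case
      by (rule family_C_SucI[OF contS, rotated])
        (use dS in \<open>simp add: has_real_derivative_iff_has_vector_derivative\<close>)
  qed (simp add: contS)
  then have "family_smooth X d S" by (simp add: family_smooth_def)
  moreover have S0: "S x 0 = 0" if "x \<in> X" for x
    by (rule S_eq) (use that s1 \<open>d > 0\<close> in \<open>auto simp: p_def\<close>)
  ultimately obtain \<sigma> where \<sigma>: "family_smooth X d \<sigma>" "\<And>x t. x \<in> X \<Longrightarrow> t \<in> {-d<..<d} \<Longrightarrow> S x t = t * \<sigma> x t"
    by (rule family_smooth_divide) auto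
  have le: "s * q x s \<le> t \<longleftrightarrow> s \<le> S x t" if "x \<in> X" "t \<in> {-d<..<d}" "s \<in> {-s1<..<s1}" for x t s
  proof -
    have "S x t \<in> {-s0<..<s0}" "s \<in> {-s0<..<s0}" using S(1)[OF that(1,2)] that s1 by auto
    note m = mono[OF that(1) this] mono[OF that(1) this(2,1)]
    show ?thesis
      using m S(2)[OF that(1,2)] unfolding p_def[symmetric]
      by (cases s "S x t" rule: linorder_cases) simp_all
  qed
  have eq: "s * q x s = t \<longleftrightarrow> s = S x t" if "x \<in> X" "t \<in> {-d<..<d}" "s \<in> {-s1<..<s1}" for x t s
  proof -
    have "s \<in> {-s0<..<s0}" using that s1 by auto
    then show ?thesis
      using S_eq[OF that(1,2)] S(2)[OF that(1,2)] unfolding p_def[symmetric] by metis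
  qed
  have pos: "\<sigma> x t > 0" if x: "x \<in> X" and t: "t \<in> {-d<..<d}" for x t
  proof (cases "t = 0")
    case False
    have "p x (S x t) = t" "q x (S x t) > 0" using S[OF x t] q0[OF x, of "S x t"] s1 by auto
    then have "t * (\<sigma> x t * q x (S x t)) = t * 1" using \<sigma>(2)[OF x t] by (simp add: p_def mult.assoc)
    then have "\<sigma> x t * q x (S x t) = 1" using False by (metis mult_cancel_left)
    then show ?thesis using \<open>q x (S x t) > 0\<close> by (metis zero_less_mult_pos2 zero_less_one)
  next
    case True
    \<comment> \<open>At \<open>t = 0\<close> the factor \<open>\<sigma>\<close> equals the
      derivative of \<open>S\<close>, that is, \<open>1 / p' x 0\<close>.\<close>
    obtain \<sigma>' where "\<And>x t. x \<in> X \<Longrightarrow> t \<in> {-d<..<d} \<Longrightarrow> (\<sigma> x has_vector_derivative \<sigma>' x t) (at t)"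
      using family_smooth_deriv[OF \<sigma>(1)] by metis
    then have "(\<sigma> x has_real_derivative \<sigma>' x 0) (at 0)"
      using x \<open>d > 0\<close> by (auto simp: has_real_derivative_iff_has_vector_derivative)
    then have "((\<lambda>t. t * \<sigma> x t) has_real_derivative \<sigma> x 0) (at 0)"
      by (auto intro!: derivative_eq_intros)
    then have "(S x has_real_derivative \<sigma> x 0) (at 0)"
      by (rule has_field_derivative_transform_within_open[of _ _ _ "{-d<..<d}"]) (use \<sigma>(2)[OF x] \<open>d > 0\<close> in auto)
    then have "\<sigma> x 0 = inverse (p' x (S x 0))" using dS[OF x, of 0] \<open>d > 0\<close> by (auto intro: DERIV_unique)
    then show ?thesis using True p'0[OF x, of 0] S0[OF x] s1 by simp
  qed
  show ?thesis
  proof (rule that[OF \<open>d > 0\<close> \<sigma>(1) pos])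
    fix x t assume xt: "x \<in> X" "t \<in> {-d<..<d}"
    show "t * \<sigma> x t \<in> {-s1<..<s1}" using S(1)[OF xt] \<sigma>(2)[OF xt] by simp
    fix s assume s: "s \<in> {-s1<..<s1}"
    show "s * q x s \<le> t \<longleftrightarrow> s \<le> t * \<sigma> x t" using le[OF xt s] \<sigma>(2)[OF xt] by simp
    show "s * q x s = t \<longleftrightarrow> s = t * \<sigma> x t" using eq[OF xt s] \<sigma>(2)[OF xt] by simp
  qed
qed

section \<open>Smooth maps\<close>

lemma higher_differentiable_on_continuous:
  "higher_differentiable_on k W f \<Longrightarrow> continuous_on W f"
  by (cases k)
    (auto intro!: continuous_at_imp_continuous_on simp: differentiable_imp_continuous_within)

lemma higher_differentiable_on_has_derivative:
  "higher_differentiable_on (Suc k) W f \<Longrightarrow> x \<in> W \<Longrightarrow> (f has_derivative frechet_derivative f (at x)) (at x)"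
  by (simp add: frechet_derivative_works[symmetric])

lemma higher_differentiable_on_Suc_D:
  "higher_differentiable_on (Suc k) W f \<Longrightarrow> higher_differentiable_on k W f"
proof (induction k arbitrary: f)
  case 0
  then show ?case using higher_differentiable_on_continuous[OF 0] by simp
next
  case (Suc k)
  have "higher_differentiable_on k W (\<lambda>x. frechet_derivative f (at x) v)" for v
    by (rule Suc.IH) (use Suc.prems in simp)
  then show ?case using Suc.prems by simp
qed

lemma higher_differentiable_on_cong:
  assumes "higher_differentiable_on k W f" "open W" "\<And>x. x \<in> W \<Longrightarrow> f x = g x"
  shows "higher_differentiable_on k W g"
  using assms(1,3)
proof (induction k arbitrary: f g)
  case 0
  then show ?case by (simp cong: continuous_on_cong)
next
  case (Suc k)
  have d: "(g has_derivative frechet_derivative f (at x)) (at x)" if "x \<in> W" for x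
    by (rule has_derivative_transform_within_open[OF higher_differentiable_on_has_derivative[OF Suc.prems(1) that] assms(2) that])
      (rule Suc.prems(2))
  have "higher_differentiable_on k W (\<lambda>x. frechet_derivative g (at x) v)" for v
  proof (rule Suc.IH)
    show "higher_differentiable_on k W (\<lambda>x. frechet_derivative f (at x) v)" using Suc.prems by simp
    show "frechet_derivative f (at x) v = frechet_derivative g (at x) v" if "x \<in> W" for x
      using frechet_derivative_at[OF d[OF that]] by simp
  qed
  then show ?case using d by (auto simp: differentiable_def)
qed

text \<open>Frees the inductions from \<open>frechet_derivative\<close>: any derivative may be
  exhibited, since on an open set derivatives are unique.\<close>

lemma higher_differentiable_on_SucI:
  assumes "open W" and d: "\<And>x. x \<in> W \<Longrightarrow> (f has_derivative f' x) (at x)"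
    and "\<And>v. higher_differentiable_on k W (\<lambda>x. f' x v)"
  shows "higher_differentiable_on (Suc k) W f"
proof -
  have "higher_differentiable_on k W (\<lambda>x. frechet_derivative f (at x) v)" for v
    by (rule higher_differentiable_on_cong[OF assms(3)[of v] assms(1)])
      (simp add: frechet_derivative_at[OF d, symmetric])
  then show ?thesis using d by (auto simp: differentiable_def)
qed

lemma higher_differentiable_on_const:
  assumes "open W"
  shows "higher_differentiable_on k W (\<lambda>x. c)"
proof (induction k arbitrary: c)
  case (Suc k)
  show ?case
    by (rule higher_differentiable_on_SucI[OF assms has_derivative_const Suc])
qed (simp add: continuous_on_const)

lemma higher_differentiable_on_linear:
  assumes W: "open W" and L: "bounded_linear L" and f: "higher_differentiable_on k W f"
  shows "higher_differentiable_on k W (\<lambda>x. L (f x))"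
  using f
proof (induction k arbitrary: f)
  case 0
  then show ?case by (simp add: bounded_linear.continuous_on[OF L])
next
  case (Suc k)
  show ?case
  proof (rule higher_differentiable_on_SucI[OF W])
    show "((\<lambda>x. L (f x)) has_derivative (\<lambda>v. L (frechet_derivative f (at x) v))) (at x)" if "x \<in> W" for x
      by (rule bounded_linear.has_derivative[OF L higher_differentiable_on_has_derivative[OF Suc.prems that]])
    show "higher_differentiable_on k W (\<lambda>x. L (frechet_derivative f (at x) v))" for v
      by (rule Suc.IH) (use Suc.prems in simp)
  qed
qed

lemma higher_differentiable_on_add:
  assumes W: "open W" and "higher_differentiable_on k W f" "higher_differentiable_on k W g"
  shows "higher_differentiable_on k W (\<lambda>x. f x + g x)"
  using assms(2,3)
proof (induction k arbitrary: f g)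
  case 0
  then show ?case by (simp add: continuous_on_add)
next
  case (Suc k)
  show ?case
  proof (rule higher_differentiable_on_SucI[OF W])
    show "((\<lambda>x. f x + g x) has_derivative (\<lambda>v. frechet_derivative f (at x) v + frechet_derivative g (at x) v)) (at x)"
      if "x \<in> W" for x
      by (intro has_derivative_add higher_differentiable_on_has_derivative[OF Suc.prems(1) that]
          higher_differentiable_on_has_derivative[OF Suc.prems(2) that])
    show "higher_differentiable_on k W (\<lambda>x. frechet_derivative f (at x) v + frechet_derivative g (at x) v)" for v
      by (rule Suc.IH) (use Suc.prems in simp_all)
  qed
qed

lemma higher_differentiable_on_bilinear:
  assumes W: "open W" and b: "bounded_bilinear b"
    and "higher_differentiable_on k W f" "higher_differentiable_on k W g"
  shows "higher_differentiable_on k W (\<lambda>x. b (f x) (g x))"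
  using assms(3,4)
proof (induction k arbitrary: f g)
  case 0
  then show ?case by (simp add: bounded_bilinear.continuous_on[OF b])
next
  case (Suc k)
  show ?case
  proof (rule higher_differentiable_on_SucI[OF W])
    show "((\<lambda>x. b (f x) (g x)) has_derivative
        (\<lambda>v. b (f x) (frechet_derivative g (at x) v) + b (frechet_derivative f (at x) v) (g x))) (at x)"
      if "x \<in> W" for x
      by (intro bounded_bilinear.FDERIV[OF b] higher_differentiable_on_has_derivative[OF Suc.prems(1) that]
          higher_differentiable_on_has_derivative[OF Suc.prems(2) that])
    show "higher_differentiable_on k W
        (\<lambda>x. b (f x) (frechet_derivative g (at x) v) + b (frechet_derivative f (at x) v) (g x))" for v
      by (intro higher_differentiable_on_add[OF W] Suc.IH higher_differentiable_on_Suc_D[OF Suc.prems(1)]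
          higher_differentiable_on_Suc_D[OF Suc.prems(2)]) (use Suc.prems in simp_all)
  qed
qed

lemma higher_differentiable_on_inverse:
  fixes f :: "'a::euclidean_space \<Rightarrow> real"
  assumes W: "open W" and "higher_differentiable_on k W f" and nz: "\<And>x. x \<in> W \<Longrightarrow> f x \<noteq> 0"
  shows "higher_differentiable_on k W (\<lambda>x. inverse (f x))"
  using assms(2)
proof (induction k)
  case 0
  then show ?case using nz by (simp add: continuous_on_inverse)
next
  case (Suc k)
  have IH: "higher_differentiable_on k W (\<lambda>x. inverse (f x))"
    by (rule Suc.IH[OF higher_differentiable_on_Suc_D[OF Suc.prems]])
  show ?case
  proof (rule higher_differentiable_on_SucI[OF W])
    show "((\<lambda>x. inverse (f x)) has_derivative
        (\<lambda>v. - (inverse (f x) * frechet_derivative f (at x) v * inverse (f x)))) (at x)"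
      if "x \<in> W" for x
      by (rule Deriv.has_derivative_inverse[OF nz[OF that] higher_differentiable_on_has_derivative[OF Suc.prems that]])
    show "higher_differentiable_on k W (\<lambda>x. - (inverse (f x) * frechet_derivative f (at x) v * inverse (f x)))" for v
      by (intro higher_differentiable_on_linear[OF W bounded_linear_minus[OF bounded_linear_ident]]
          higher_differentiable_on_bilinear[OF W bounded_bilinear_mult] IH) (use Suc.prems in simp)
  qed
qed

lemma higher_differentiable_on_sqrt:
  fixes f :: "'a::euclidean_space \<Rightarrow> real"
  assumes W: "open W" and "higher_differentiable_on k W f" and nz: "\<And>x. x \<in> W \<Longrightarrow> f x > 0"
  shows "higher_differentiable_on k W (\<lambda>x. sqrt (f x))"
  using assms(2)
proof (induction k)
  case 0
  then show ?case by (simp add: continuous_on_real_sqrt)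
next
  case (Suc k)
  have IH: "higher_differentiable_on k W (\<lambda>x. sqrt (f x))"
    by (rule Suc.IH[OF higher_differentiable_on_Suc_D[OF Suc.prems]])
  show ?case
  proof (rule higher_differentiable_on_SucI[OF W])
    show "((\<lambda>x. sqrt (f x)) has_derivative
        (\<lambda>v. frechet_derivative f (at x) v * (inverse (sqrt (f x)) * (1 / 2)))) (at x)"
      if "x \<in> W" for x
    proof -
      have "(sqrt has_derivative (*) (inverse (sqrt (f x)) / 2)) (at (f x))"
        using DERIV_real_sqrt[OF nz[OF that]] by (simp add: has_field_derivative_def)
      from has_derivative_compose[OF higher_differentiable_on_has_derivative[OF Suc.prems that] this]
      show ?thesis by (simp add: mult.commute)
    qed
    have "higher_differentiable_on k W (\<lambda>x. inverse (sqrt (f x)))"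
      by (rule higher_differentiable_on_inverse[OF W IH]) (use nz in force)
    then show "higher_differentiable_on k W (\<lambda>x. frechet_derivative f (at x) v * (inverse (sqrt (f x)) * (1 / 2)))" for v
      by (intro higher_differentiable_on_bilinear[OF W bounded_bilinear_mult] higher_differentiable_on_const[OF W])
        (use Suc.prems in simp_all)
  qed
qed

lemma smooth_on_has_derivative:
  "smooth_on W f \<Longrightarrow> x \<in> W \<Longrightarrow> (f has_derivative frechet_derivative f (at x)) (at x)"
  unfolding smooth_on_def using higher_differentiable_on_has_derivative by blast

lemma smooth_on_continuous: "smooth_on W f \<Longrightarrow> continuous_on W f"
  unfolding smooth_on_def using higher_differentiable_on_continuous by blast

lemma smooth_on_frechet:
  assumes "smooth_on W f"
  shows "smooth_on W (\<lambda>x. frechet_derivative f (at x) v)"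
  unfolding smooth_on_def
proof
  fix k
  have "higher_differentiable_on (Suc k) W f" using assms by (simp only: smooth_on_def)
  then show "higher_differentiable_on k W (\<lambda>x. frechet_derivative f (at x) v)" by simp
qed

text \<open>Turns smoothness on an open set into smoothness along lines.
  \<open>higher_differentiable_on\<close> recurses on derivatives in fixed directions, so the
  derivative in the varying direction \<open>b x\<close> is expanded over \<open>Basis\<close>, with
  coefficients that do not depend on \<open>t\<close>.\<close>

lemma family_C_line:
  fixes f :: "'e::euclidean_space \<Rightarrow> 'b::euclidean_space" and a b :: "'x::topological_space \<Rightarrow> 'e"
  assumes "higher_differentiable_on k W f" and a: "continuous_on X a" and b: "continuous_on X b"
    and sub: "\<And>x t. x \<in> X \<Longrightarrow> t \<in> {-d<..<d} \<Longrightarrow> a x + t *\<^sub>R b x \<in> W"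
  shows "family_C k X d (\<lambda>x t. f (a x + t *\<^sub>R b x))"
  using assms(1)
proof (induction k arbitrary: f)
  have cont: "continuous_on (X \<times> {-d<..<d}) (\<lambda>p. f (a (fst p) + snd p *\<^sub>R b (fst p)))"
    if f: "continuous_on W f" for f :: "'e \<Rightarrow> 'b"
  proof -
    have "continuous_on (X \<times> {-d<..<d}) (\<lambda>p. a (fst p))" "continuous_on (X \<times> {-d<..<d}) (\<lambda>p. b (fst p))"
      by (rule continuous_on_compose2[OF a] continuous_on_compose2[OF b]; auto intro: continuous_on_fst continuous_on_id)+
    then have "continuous_on (X \<times> {-d<..<d}) (\<lambda>p. a (fst p) + snd p *\<^sub>R b (fst p))"
      by (intro continuous_on_add continuous_on_scaleR continuous_on_snd continuous_on_id)
    then show ?thesis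
      by (rule continuous_on_compose2[OF f]) (use sub in auto)
  qed
  { case 0 then show ?case using cont[of f] by simp }
  { case (Suc k)
    let ?D = "\<lambda>x. frechet_derivative f (at x)"
    have "family_C k X d (\<lambda>x t. \<Sum>e\<in>Basis. (b x \<bullet> e) *\<^sub>R ?D (a x + t *\<^sub>R b x) e)"
    proof (intro family_C_sum finite_Basis family_C_scaleR Suc.IH)
      show "family_C k X d (\<lambda>x t. b x \<bullet> e)" for e
        by (intro family_C_const continuous_on_inner b continuous_on_const)
    qed (use Suc.prems in simp)
    moreover have "((\<lambda>t. f (a x + t *\<^sub>R b x)) has_vector_derivative (\<Sum>e\<in>Basis. (b x \<bullet> e) *\<^sub>R ?D (a x + t *\<^sub>R b x) e)) (at t)"
      if "x \<in> X" "t \<in> {-d<..<d}" for x t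
    proof -
      let ?z = "a x + t *\<^sub>R b x"
      have D: "(f has_derivative ?D ?z) (at ?z)"
        by (rule higher_differentiable_on_has_derivative[OF Suc.prems sub[OF that]])
      then have lin: "linear (?D ?z)" by (rule has_derivative_linear)
      have "((\<lambda>t. a x + t *\<^sub>R b x) has_derivative (\<lambda>h. h *\<^sub>R b x)) (at t)"
        by (auto intro!: derivative_eq_intros)
      from has_derivative_compose[OF this D]
      have "((\<lambda>t. f (a x + t *\<^sub>R b x)) has_vector_derivative ?D ?z (b x)) (at t)"
        by (simp add: has_vector_derivative_def linear_scale[OF lin])
      moreover have "?D ?z (b x) = (\<Sum>e\<in>Basis. (b x \<bullet> e) *\<^sub>R ?D ?z e)"
        by (subst (1) euclidean_representation[of "b x", symmetric])
          (simp only: linear_sum[OF lin] linear_scale[OF lin])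
      ultimately show ?thesis by simp
    qed
    ultimately show ?case
      by (intro family_C_SucI[OF cont[OF higher_differentiable_on_continuous[OF Suc.prems]]]) }
qed

section \<open>Change of variables\<close>

text \<open>\<open>has_absolute_integral_change_of_variables\<close> concerns spaces
  \<open>real ^ 'm\<close> whose index type is well-ordered. An initial segment of the natural
  numbers of size \<open>CARD('m)\<close> provides such a type for every finite \<open>'m\<close>,
  and the result is carried back along a bijection of coordinates.\<close>

typedef ('m::finite) ordinal_index = "{..<CARD('m)}"
  by (rule exI[of _ 0]) simp

instantiation ordinal_index :: (finite) linorder
begin
definition "a < b \<longleftrightarrow> Rep_ordinal_index a < Rep_ordinal_index b"
definition "a \<le> b \<longleftrightarrow> Rep_ordinal_index a \<le> Rep_ordinal_index b"
instance
  by intro_classes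
    (auto simp: less_eq_ordinal_index_def less_ordinal_index_def Rep_ordinal_index_inject)
end

instance ordinal_index :: (finite) finite
proof
  show "finite (UNIV :: 'a ordinal_index set)"
    using type_definition.univ[OF type_definition_ordinal_index] by (metis finite_imageI finite_lessThan)
qed

instance ordinal_index :: (finite) wellorder
proof -
  have "wf {(x :: 'a ordinal_index, y). x < y}"
    by (rule wf_subset[OF wf_measure[of Rep_ordinal_index]]) (auto simp: less_ordinal_index_def)
  then show "OFCLASS('a ordinal_index, wellorder_class)"
    by (rule wf_wellorderI) intro_classes
qed

lemma card_ordinal_index: "CARD('m::finite ordinal_index) = CARD('m)"
  using type_definition.card[OF type_definition_ordinal_index] by simp

text \<open>Conjugation by \<open>e\<close> takes the transposition of \<open>a\<close> and
  \<open>b\<close> to that of \<open>e a\<close> and \<open>e b\<close>, so the number of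
  transpositions is kept.\<close>

lemma swapidseq_conjugate:
  assumes "bij e" "swapidseq n p"
  shows "swapidseq n (e \<circ> p \<circ> inv e)"
  using assms(2)
proof (induction rule: swapidseq.induct)
  case id
  have "e \<circ> id \<circ> inv e = id" using assms(1) by (auto simp: fun_eq_iff bij_is_surj surj_f_inv_f)
  then show ?case by (metis swapidseq.id)
next
  case (comp_Suc n p a b)
  have "e \<circ> (Transposition.transpose a b \<circ> p) \<circ> inv e = Transposition.transpose (e a) (e b) \<circ> (e \<circ> p \<circ> inv e)"
    using assms(1) by (auto simp: fun_eq_iff Transposition.transpose_def bij_is_inj inj_eq)
  moreover have "e a \<noteq> e b" using comp_Suc assms(1) by (simp add: bij_is_inj inj_eq)
  then have "swapidseq (Suc n) (Transposition.transpose (e a) (e b) \<circ> (e \<circ> p \<circ> inv e))"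
    by (rule swapidseq.comp_Suc[OF comp_Suc.IH])
  ultimately show ?case by (simp only:)
qed

lemma sign_conjugate:
  assumes "bij e" "permutation p"
  shows "sign (e \<circ> p \<circ> inv e) = sign p"
proof -
  obtain n where n: "swapidseq n p" using assms(2) by (auto simp: permutation_def)
  have "evenperm (e \<circ> p \<circ> inv e) = even n" "evenperm p = even n"
    using evenperm_unique[OF swapidseq_conjugate[OF assms(1) n]] evenperm_unique[OF n] by auto
  then show ?thesis by (simp add: sign_def)
qed

text \<open>Conjugating permutations by \<open>e\<close> matches the terms of the two Leibniz sums;
  the signs agree by \<open>sign_conjugate\<close>.\<close>

lemma det_reindex:
  fixes A :: "real ^ 'm ^ 'm" and e :: "'m::finite \<Rightarrow> 'k::finite"
  assumes e: "bij e"
  shows "det (\<chi> i j. A $ inv e i $ inv e j :: real ^ 'k ^ 'k) = det A"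
proof -
  have ie: "inv e (e i) = i" "e (inv e k) = k" for i k
    using e by (simp_all add: bij_is_inj bij_is_surj surj_f_inv_f)
  have perm: "permutation p" if "p permutes (UNIV :: 'm set)" for p
    using that finite permutation_permutes by blast
  have "(\<Sum>q | q permutes (UNIV :: 'k set). of_int (sign q) * (\<Prod>i\<in>UNIV. A $ inv e i $ inv e (q i))) =
        (\<Sum>p | p permutes (UNIV :: 'm set). of_int (sign p) * (\<Prod>i\<in>UNIV. A $ i $ p i))"
  proof (rule sum.reindex_bij_witness[of _ "\<lambda>p. e \<circ> p \<circ> inv e" "\<lambda>q. inv e \<circ> q \<circ> e"])
    fix q assume "q \<in> {q. q permutes (UNIV :: 'k set)}"
    then have q: "bij q" by (simp add: bij_imp_permutes permutes_bij)
    show "e \<circ> (inv e \<circ> q \<circ> e) \<circ> inv e = q" by (auto simp: ie fun_eq_iff)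
    have b: "bij (inv e \<circ> q \<circ> e)" using q e by (intro bij_comp) (auto simp: bij_imp_bij_inv)
    then have b': "inv e \<circ> q \<circ> e permutes UNIV" by (rule bij_imp_permutes) simp
    then show "inv e \<circ> q \<circ> e \<in> {p. p permutes UNIV}" by simp
    have "sign q = sign (inv e \<circ> q \<circ> e)"
      using sign_conjugate[OF e, of "inv e \<circ> q \<circ> e"] perm[OF b']
      by (simp only: \<open>e \<circ> (inv e \<circ> q \<circ> e) \<circ> inv e = q\<close>)
    moreover have "(\<Prod>i\<in>UNIV. A $ inv e i $ inv e (q i)) = (\<Prod>i\<in>UNIV. A $ i $ (inv e \<circ> q \<circ> e) i)"
      by (rule prod.reindex_bij_witness[of _ e "inv e"]) (auto simp: ie)
    ultimately show "of_int (sign (inv e \<circ> q \<circ> e)) * (\<Prod>i\<in>UNIV. A $ i $ (inv e \<circ> q \<circ> e) i) =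
        of_int (sign q) * (\<Prod>i\<in>UNIV. A $ inv e i $ inv e (q i))" by simp
  next
    fix p assume "p \<in> {p. p permutes (UNIV :: 'm set)}"
    then have p: "bij p" by (simp add: permutes_bij)
    show "inv e \<circ> (e \<circ> p \<circ> inv e) \<circ> e = p" by (auto simp: ie fun_eq_iff)
    show "e \<circ> p \<circ> inv e \<in> {q. q permutes UNIV}"
      using p e by (auto intro!: bij_comp bij_imp_permutes simp: bij_imp_bij_inv)
  qed
  then show ?thesis by (simp add: det_def)
qed

text \<open>A renaming of coordinates takes boxes to boxes with the same side lengths, and boxes
  determine \<open>lborel\<close>.\<close>

lemma distr_lborel_reindex:
  fixes e :: "'m::finite \<Rightarrow> 'k::finite"
  assumes e: "bij e"
  shows "distr lborel borel (\<lambda>y::real^'k. (\<chi> i. y $ e i) :: real ^ 'm) = lborel"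
proof (rule lborel_eqI[symmetric])
  have ie: "inv e (e i) = i" "e (inv e k) = k" for i k
    using e by (simp_all add: bij_is_inj bij_is_surj surj_f_inv_f)
  let ?R = "\<lambda>y::real^'k. (\<chi> i. y $ e i) :: real ^ 'm"
  have prodB: "(\<Prod>b\<in>Basis. x \<bullet> b) = (\<Prod>i\<in>UNIV. x $ i)" for x :: "real ^ 'x::finite"
    by (simp add: Basis_vec_def cart_eq_inner_axis axis_eq_axis prod.UNION_disjoint)
  have meas: "?R \<in> borel_measurable borel"
    by (intro borel_measurable_continuous_onI continuous_intros)
  fix l u :: "real ^ 'm" assume le: "\<And>b. b \<in> Basis \<Longrightarrow> l \<bullet> b \<le> u \<bullet> b"
  have le': "l $ i \<le> u $ i" for i
    using le[of "axis i 1"] by (simp add: cart_eq_inner_axis axis_in_Basis_iff)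
  let ?l = "(\<chi> k. l $ inv e k) :: real ^ 'k" and ?u = "(\<chi> k. u $ inv e k) :: real ^ 'k"
  have "?R -` box l u = box ?l ?u"
    by (auto simp: mem_box_cart ie) (metis ie)+
  then have "emeasure (distr lborel borel ?R) (box l u) = emeasure lborel (box ?l ?u)"
    using meas by (simp add: emeasure_distr)
  also have "\<dots> = (\<Prod>b\<in>Basis. (?u - ?l) \<bullet> b)"
  proof (rule emeasure_lborel_box)
    fix b :: "real ^ 'k" assume "b \<in> Basis"
    then obtain k where "b = axis k 1" by (auto simp: Basis_vec_def)
    then show "?l \<bullet> b \<le> ?u \<bullet> b" using le' by (simp add: cart_eq_inner_axis[symmetric])
  qed
  also have "(\<Prod>b\<in>Basis. (?u - ?l) \<bullet> b) = (\<Prod>b\<in>Basis. (u - l) \<bullet> b)"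
    unfolding prodB by (rule prod.reindex_bij_witness[of _ e "inv e"]) (auto simp: ie)
  finally show "emeasure (distr lborel borel ?R) (box l u) = (\<Prod>b\<in>Basis. (u - l) \<bullet> b)" .
qed simp

text \<open>Finiteness of the integral over \<open>A\<close> makes \<open>g\<close> absolutely
  integrable there, which brings the statement within reach of the change of variables for signed
  integrands.\<close>

lemma nn_integral_change_of_variables_wellorder:
  fixes \<phi> :: "real ^ 'm::{finite,wellorder} \<Rightarrow> real ^ 'm::_"
  assumes A: "A \<in> sets borel" and d: "\<And>x. x \<in> A \<Longrightarrow> (\<phi> has_derivative \<phi>' x) (at x)" and inj: "inj_on \<phi> A"
    and g: "g \<in> borel_measurable borel" "\<And>x. x \<in> A \<Longrightarrow> 0 \<le> g x"
    and f: "\<And>y. y \<in> \<phi> ` A \<Longrightarrow> 0 \<le> f y"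
    and fg: "\<And>x. x \<in> A \<Longrightarrow> g x = \<bar>det (matrix (\<phi>' x))\<bar> * f (\<phi> x)"
    and fin: "(\<integral>\<^sup>+x\<in>A. ennreal (g x) \<partial>lborel) < \<infinity>"
  shows "(\<integral>\<^sup>+x\<in>A. ennreal (g x) \<partial>lborel) = (\<integral>\<^sup>+y\<in>\<phi> ` A. ennreal (f y) \<partial>lborel)"
proof -
  have AL: "A \<in> sets lebesgue" using A by simp
  have "integrable lborel (\<lambda>x. indicator A x *\<^sub>R g x)"
  proof (rule integrableI_bounded)
    show "(\<lambda>x. indicator A x *\<^sub>R g x) \<in> borel_measurable lborel" using A g(1) by simp
    have "(\<integral>\<^sup>+ x. ennreal (norm (indicator A x *\<^sub>R g x)) \<partial>lborel) = (\<integral>\<^sup>+x\<in>A. ennreal (g x) \<partial>lborel)"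
      by (rule nn_integral_cong) (auto simp: indicator_def g(2))
    then show "(\<integral>\<^sup>+ x. ennreal (norm (indicator A x *\<^sub>R g x)) \<partial>lborel) < \<infinity>" using fin by simp
  qed
  then have "integrable lebesgue (\<lambda>x. indicator A x *\<^sub>R g x)"
    by (subst integrable_completion) (use A g(1) in auto)
  then have ai: "g absolutely_integrable_on A" by (simp add: set_integrable_def)
  define b where "b = integral A g"
  \<comment> \<open>The theorem is about vector-valued integrands; a real integrand is read as one
    with values in \<open>real ^ 1\<close>.\<close>
  have cov: "(\<lambda>x. \<bar>det (matrix (\<phi>' x))\<bar> *\<^sub>R (vec (f (\<phi> x)) :: real ^ 1)) absolutely_integrable_on A \<and>
      integral A (\<lambda>x. \<bar>det (matrix (\<phi>' x))\<bar> *\<^sub>R vec (f (\<phi> x))) = (vec b :: real ^ 1) \<longleftrightarrow>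
      (\<lambda>x. vec (f x) :: real ^ 1) absolutely_integrable_on \<phi> ` A \<and> integral (\<phi> ` A) (\<lambda>x. vec (f x)) = (vec b :: real ^ 1)"
    by (rule has_absolute_integral_change_of_variables[OF AL has_derivative_at_withinI[OF d] inj])
  have "(\<lambda>x. \<bar>det (matrix (\<phi>' x))\<bar> * f (\<phi> x)) absolutely_integrable_on A"
    using ai fg by (simp cong: set_integrable_cong)
  moreover have "integral A (\<lambda>x. \<bar>det (matrix (\<phi>' x))\<bar> * f (\<phi> x)) = b"
    unfolding b_def by (rule integral_cong) (simp add: fg)
  ultimately have f': "f absolutely_integrable_on \<phi> ` A" "integral (\<phi> ` A) f = b"
    using cov by (simp_all add: absolutely_integrable_on_1_iff integral_on_1_eq)
  have "(g has_integral b) A" unfolding b_def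
    using ai by (simp add: absolutely_integrable_on_def integrable_integral)
  moreover have "(f has_integral b) (\<phi> ` A)"
    using f' by (auto simp: absolutely_integrable_on_def)
  ultimately show ?thesis
    using nn_integral_has_integral_lebesgue'[of A g b] nn_integral_has_integral_lebesgue'[of "\<phi> ` A" f b] f g(2)
    by simp
qed

lemma nn_integral_change_of_variables:
  fixes \<phi> :: "real ^ 'm::finite \<Rightarrow> real ^ 'm::_"
  assumes A: "A \<in> sets borel" and \<phi>A: "\<phi> ` A \<in> sets borel"
    and d: "\<And>x. x \<in> A \<Longrightarrow> (\<phi> has_derivative \<phi>' x) (at x)" and inj: "inj_on \<phi> A"
    and g: "g \<in> borel_measurable borel" "\<And>x. x \<in> A \<Longrightarrow> 0 \<le> g x"
    and f: "f \<in> borel_measurable borel" "\<And>y. y \<in> \<phi> ` A \<Longrightarrow> 0 \<le> f y"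
    and fg: "\<And>x. x \<in> A \<Longrightarrow> g x = \<bar>det (matrix (\<phi>' x))\<bar> * f (\<phi> x)"
    and fin: "(\<integral>\<^sup>+x\<in>A. ennreal (g x) \<partial>lborel) < \<infinity>"
  shows "(\<integral>\<^sup>+x\<in>A. ennreal (g x) \<partial>lborel) = (\<integral>\<^sup>+y\<in>\<phi> ` A. ennreal (f y) \<partial>lborel)"
proof -
  have "card (UNIV :: 'm set) = card (UNIV :: 'm ordinal_index set)" by (simp add: card_ordinal_index)
  then obtain e :: "'m \<Rightarrow> 'm ordinal_index" where e: "bij e"
    using finite_same_card_bij[of "UNIV :: 'm set" "UNIV :: 'm ordinal_index set"] by auto
  have ie: "inv e (e i) = i" "e (inv e k) = k" for i k
    using e by (simp_all add: bij_is_inj bij_is_surj surj_f_inv_f)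
  define R :: "real ^ 'm ordinal_index \<Rightarrow> real ^ 'm" where "R y = (\<chi> i. y $ e i)" for y
  define Q :: "real ^ 'm \<Rightarrow> real ^ 'm ordinal_index" where "Q x = (\<chi> k. x $ inv e k)" for x
  have RQ: "R (Q x) = x" "Q (R y) = y" for x y by (simp_all add: R_def Q_def ie)
  have linR: "linear R" and linQ: "linear Q"
    by (auto simp: linear_iff R_def Q_def vec_eq_iff)
  have dR: "distr lborel borel R = lborel"
    using distr_lborel_reindex[OF e] by (simp add: R_def[abs_def])
  have mR[measurable]: "R \<in> borel_measurable borel"
    by (intro borel_measurable_continuous_onI linear_continuous_on linear_conv_bounded_linear[THEN iffD1, OF linR])
  have tr: "(\<integral>\<^sup>+y\<in>Q ` B. ennreal (h (R y)) \<partial>lborel) = (\<integral>\<^sup>+x\<in>B. ennreal (h x) \<partial>lborel)"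
    if "B \<in> sets borel" "h \<in> borel_measurable borel" for B and h :: "real ^ 'm \<Rightarrow> real"
  proof -
    have "(\<integral>\<^sup>+x\<in>B. ennreal (h x) \<partial>lborel) = (\<integral>\<^sup>+x\<in>B. ennreal (h x) \<partial>distr lborel borel R)"
      by (simp add: dR)
    also have "\<dots> = (\<integral>\<^sup>+y. ennreal (h (R y)) * indicator B (R y) \<partial>lborel)"
      by (rule nn_integral_distr) (use that in auto)
    also have "\<dots> = (\<integral>\<^sup>+y\<in>Q ` B. ennreal (h (R y)) \<partial>lborel)"
    proof (rule nn_integral_cong)
      fix y
      have "R y \<in> B \<longleftrightarrow> y \<in> Q ` B" using RQ by (metis image_iff)
      then show "ennreal (h (R y)) * indicator B (R y) = ennreal (h (R y)) * indicator (Q ` B) y"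
        by (simp add: indicator_def)
    qed
    finally show ?thesis by simp
  qed
  define \<psi> where "\<psi> y = Q (\<phi> (R y))" for y
  define \<psi>' where "\<psi>' y = Q \<circ> \<phi>' (R y) \<circ> R" for y
  have QB: "Q ` B \<in> sets borel" if "B \<in> sets borel" for B
  proof -
    have "Q ` B = R -` B \<inter> space borel" using RQ by (auto simp: image_iff) metis
    then show ?thesis using measurable_sets[OF mR that] by simp
  qed
  have \<psi>A: "\<psi> ` Q ` A = Q ` \<phi> ` A" by (auto simp: \<psi>_def RQ image_iff)
  have "(\<integral>\<^sup>+y\<in>Q ` A. ennreal (g (R y)) \<partial>lborel) = (\<integral>\<^sup>+y\<in>\<psi> ` Q ` A. ennreal (f (R y)) \<partial>lborel)"
  proof (rule nn_integral_change_of_variables_wellorder[where \<phi>' = \<psi>'])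
    show "Q ` A \<in> sets borel" by (rule QB[OF A])
    show "inj_on \<psi> (Q ` A)"
    proof (rule inj_onI)
      fix x y assume "x \<in> Q ` A" "y \<in> Q ` A" "\<psi> x = \<psi> y"
      then obtain a b where "x = Q a" "y = Q b" "a \<in> A" "b \<in> A" "\<phi> a = \<phi> b"
        unfolding \<psi>_def by (metis RQ imageE)
      then show "x = y" using inj by (auto simp: inj_on_def)
    qed
    show "(\<lambda>y. g (R y)) \<in> borel_measurable borel" using g(1) by measurable
    show "(\<integral>\<^sup>+y\<in>Q ` A. ennreal (g (R y)) \<partial>lborel) < \<infinity>" using tr[OF A g(1)] fin by simp
    fix y assume y: "y \<in> Q ` A"
    then have Ry: "R y \<in> A" using RQ by auto
    show "(\<psi> has_derivative \<psi>' y) (at y)"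
    proof -
      have "(R has_derivative R) (at y)" using linR by (simp add: linear_imp_has_derivative)
      from has_derivative_compose[OF this d[OF Ry]]
      have "((\<lambda>y. \<phi> (R y)) has_derivative (\<lambda>v. \<phi>' (R y) (R v))) (at y)" .
      from has_derivative_compose[OF this linear_imp_has_derivative[OF linQ]]
      show ?thesis by (simp add: \<psi>_def[abs_def] \<psi>'_def o_def)
    qed
    show "0 \<le> g (R y)" using g(2)[OF Ry] .
    have "matrix (\<psi>' y) = (\<chi> i j. matrix (\<phi>' (R y)) $ inv e i $ inv e j)"
    proof -
      have "R (axis j 1) = axis (inv e j) 1" for j
        using ie by (auto simp: R_def vec_eq_iff axis_def)
      then show ?thesis by (simp add: matrix_def \<psi>'_def Q_def)
    qed
    then have "det (matrix (\<psi>' y)) = det (matrix (\<phi>' (R y)))"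
      by (simp add: det_reindex[OF e])
    then show "g (R y) = \<bar>det (matrix (\<psi>' y))\<bar> * f (R (\<psi> y))"
      using fg[OF Ry] by (simp add: \<psi>_def RQ)
  next
    fix y assume "y \<in> \<psi> ` Q ` A"
    then show "0 \<le> f (R y)" using f(2) unfolding \<psi>A by (auto simp: RQ)
  qed
  then show ?thesis using tr[OF A g(1)] tr[OF \<phi>A f(1)] unfolding \<psi>A by simp
qed

section \<open>Local parametrizations\<close>

text \<open>The first fundamental form as a function of the derivative alone, so that linear algebra
  applies without reference to a chart.\<close>

definition gram :: "(real ^ 'm::finite \<Rightarrow> 'a::euclidean_space) \<Rightarrow> real ^ 'm ^ 'm" where
  "gram L = (\<chi> i j. L (axis i 1) \<bullet> L (axis j 1))"

lemma volume_density_gram: "volume_density f x = sqrt (det (gram (frechet_derivative f (at x))))"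
  by (simp add: volume_density_def gram_def)

lemma linear_vec_expansion:
  fixes L :: "real ^ 'm::finite \<Rightarrow> 'a::real_vector"
  assumes "linear L"
  shows "L v = (\<Sum>i\<in>UNIV. v $ i *\<^sub>R L (axis i 1))"
proof -
  have "v = (\<Sum>i\<in>UNIV. v $ i *\<^sub>R axis i 1)"
    using basis_expansion[of v] by (simp add: scalar_mult_eq_scaleR)
  then have "L v = L (\<Sum>i\<in>UNIV. v $ i *\<^sub>R axis i 1)" by simp
  then show ?thesis by (simp only: linear_sum[OF assms] linear_scale[OF assms])
qed

lemma gram_quadratic_form:
  fixes L :: "real ^ 'm::finite \<Rightarrow> 'a::euclidean_space"
  assumes "linear L"
  shows "v \<bullet> (gram L *v w) = L v \<bullet> L w"
proof -
  have "L v \<bullet> L w = (\<Sum>i\<in>UNIV. v $ i * (L (axis i 1) \<bullet> L w))"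
    by (subst linear_vec_expansion[OF assms, of v]) (simp add: inner_sum_left)
  moreover have "x \<bullet> L w = (\<Sum>j\<in>UNIV. w $ j * (x \<bullet> L (axis j 1)))" for x
    by (subst linear_vec_expansion[OF assms, of w]) (simp add: inner_sum_right)
  ultimately have "L v \<bullet> L w = (\<Sum>i\<in>UNIV. v $ i * (\<Sum>j\<in>UNIV. w $ j * (L (axis i 1) \<bullet> L (axis j 1))))"
    by simp
  then show ?thesis
    by (simp add: inner_vec_def matrix_vector_mult_def gram_def sum_distrib_left mult_ac)
qed

text \<open>The segment from the identity matrix to the Gram matrix consists of positive definite,
  hence nonsingular, matrices.\<close>

lemma det_gram_pos:
  fixes L :: "real ^ 'm::finite \<Rightarrow> 'a::euclidean_space"
  assumes L: "linear L" "inj L"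
  shows "det (gram L) > 0"
proof (rule ccontr)
  assume neg: "\<not> det (gram L) > 0"
  define A where "A t = (\<chi> i j. t * gram L $ i $ j + (1 - t) * mat 1 $ i $ j :: real ^ 'm ^ 'm)" for t :: real
  have "continuous_on {0..1} (\<lambda>t. det (A t))"
    unfolding det_def A_def by (simp, intro continuous_intros)
  moreover have "A 1 = gram L" "A 0 = mat 1" by (simp_all add: A_def vec_eq_iff)
  ultimately obtain t where t: "0 \<le> t" "t \<le> 1" "det (A t) = 0"
    using IVT2'[of "\<lambda>t. det (A t)" 1 0 0] neg by (auto simp: det_I)
  then obtain v where v: "v \<noteq> 0" "A t *v v = 0"
    using invertible_det_nz[of "A t"] matrix_left_invertible_ker[of "A t"] invertible_left_inverse[of "A t"]
    by blast
  have "A t *v v = t *\<^sub>R (gram L *v v) + (1 - t) *\<^sub>R v"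
  proof -
    have "A t = t *\<^sub>R gram L + (1 - t) *\<^sub>R mat 1" by (simp add: A_def vec_eq_iff)
    then show ?thesis
      by (simp add: matrix_vector_mult_add_rdistrib scaleR_matrix_vector_assoc[symmetric])
  qed
  then have "0 = v \<bullet> (t *\<^sub>R (gram L *v v) + (1 - t) *\<^sub>R v)" using v by simp
  also have "\<dots> = t * (norm (L v))\<^sup>2 + (1 - t) * (norm v)\<^sup>2"
    by (simp add: inner_add_right gram_quadratic_form[OF L(1)] power2_norm_eq_inner)
  finally have 0: "t * (norm (L v))\<^sup>2 + (1 - t) * (norm v)\<^sup>2 = 0" by simp
  have "norm (L v) > 0" using v L by (metis linear_injective_0 zero_less_norm_iff)
  then have "t * (norm (L v))\<^sup>2 + (1 - t) * (norm v)\<^sup>2 > 0"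
    using t(1,2) v(1) by (cases "t = 0") (auto intro!: add_pos_nonneg)
  with 0 show False by simp
qed

text \<open>The Gram matrix of \<open>L \<circ> P\<close> is the transpose of
  \<open>matrix P\<close> times the Gram matrix of \<open>L\<close> times \<open>matrix P\<close>.
  This is the transformation law of the volume density under a change of chart.\<close>

lemma det_gram_compose:
  fixes L :: "real ^ 'm::finite \<Rightarrow> 'a::euclidean_space" and P :: "real ^ 'm \<Rightarrow> real ^ 'm"
  assumes L: "linear L" and P: "linear P"
  shows "det (gram (L \<circ> P)) = (det (matrix P))\<^sup>2 * det (gram L)"
proof -
  have "gram (L \<circ> P) = transpose (matrix P) ** (gram L ** matrix P)"
  proof -
    have "gram (L \<circ> P) $ i $ j = (transpose (matrix P) ** (gram L ** matrix P)) $ i $ j" for i j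
    proof -
      have "gram (L \<circ> P) $ i $ j = P (axis i 1) \<bullet> (gram L *v P (axis j 1))"
        using gram_quadratic_form[OF L] by (simp add: gram_def)
      also have "\<dots> = (transpose (matrix P) ** (gram L ** matrix P)) $ i $ j"
        by (simp add: inner_vec_def matrix_matrix_mult_def transpose_def matrix_vector_mult_def matrix_def)
      finally show ?thesis .
    qed
    then show ?thesis by (simp add: vec_eq_iff)
  qed
  then show ?thesis by (simp add: det_mul det_transpose power2_eq_square mult_ac)
qed

text \<open>Polarization recovers the inner products from the norms.\<close>

lemma gram_scale:
  fixes L L' :: "real ^ 'm::finite \<Rightarrow> 'a::euclidean_space"
  assumes L: "linear L" "linear L'" and norms: "\<And>v. norm (L' v) = c * norm (L v)"
  shows "gram L' = c\<^sup>2 *\<^sub>R gram L"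
proof -
  have "L' v \<bullet> L' w = c\<^sup>2 * (L v \<bullet> L w)" for v w
  proof -
    have "L' v \<bullet> L' w = ((norm (L' (v + w)))\<^sup>2 - (norm (L' v))\<^sup>2 - (norm (L' w))\<^sup>2) / 2"
      by (simp add: linear_add[OF L(2)] dot_norm)
    also have "\<dots> = c\<^sup>2 * (((norm (L (v + w)))\<^sup>2 - (norm (L v))\<^sup>2 - (norm (L w))\<^sup>2) / 2)"
      by (simp add: norms power_mult_distrib field_simps)
    also have "\<dots> = c\<^sup>2 * (L v \<bullet> L w)"
      by (simp add: linear_add[OF L(1)] dot_norm)
    finally show ?thesis .
  qed
  then show ?thesis by (simp add: gram_def vec_eq_iff)
qed

lemma det_scaleR:
  fixes A :: "real ^ 'm::finite ^ 'm"
  shows "det (c *\<^sub>R A) = c ^ CARD('m) * det A"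
  by (simp add: det_def prod.distrib sum_distrib_left mult_ac)

lemma local_parametrizationD:
  assumes "local_parametrization M W f"
  shows "open W" "smooth_on W f" "\<And>x. x \<in> W \<Longrightarrow> inj (frechet_derivative f (at x))"
    "openin (top_of_set M) (f ` W)" "inj_on f W" "continuous_on W f" "f ` W \<subseteq> M"
    "\<And>x. x \<in> W \<Longrightarrow> (f has_derivative frechet_derivative f (at x)) (at x)"
    "\<And>x. x \<in> W \<Longrightarrow> linear (frechet_derivative f (at x))"
    "continuous_on (f ` W) (inv_into W f)"
proof -
  obtain g where g: "homeomorphism W (f ` W) f g"
    using assms by (auto simp: local_parametrization_def)
  show "open W" "smooth_on W f" "\<And>x. x \<in> W \<Longrightarrow> inj (frechet_derivative f (at x))"
    "openin (top_of_set M) (f ` W)"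
    using assms by (auto simp: local_parametrization_def)
  then show "f ` W \<subseteq> M" using openin_imp_subset by blast
  show d: "\<And>x. x \<in> W \<Longrightarrow> (f has_derivative frechet_derivative f (at x)) (at x)"
    using smooth_on_has_derivative[OF \<open>smooth_on W f\<close>] .
  show "linear (frechet_derivative f (at x))" if "x \<in> W" for x
    using d[OF that] by (rule has_derivative_linear)
  show inj: "inj_on f W" using g by (auto simp: homeomorphism_def intro: inj_on_inverseI)
  show "continuous_on W f" using g by (simp add: homeomorphism_def)
  have "inv_into W f y = g y" if "y \<in> f ` W" for y
    using that g inv_into_f_f[OF inj] by (auto simp: homeomorphism_def)
  moreover have "continuous_on (f ` W) g" using g by (simp add: homeomorphism_def)
  ultimately show "continuous_on (f ` W) (inv_into W f)" by (simp cong: continuous_on_cong)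
qed

lemma volume_density_pos:
  assumes "local_parametrization M W f" "x \<in> W"
  shows "volume_density f x > 0"
  using det_gram_pos[OF local_parametrizationD(9,3)[OF assms]]
  by (simp add: volume_density_gram)

lemma continuous_on_volume_density:
  assumes "local_parametrization M W f"
  shows "continuous_on W (volume_density f)"
proof -
  have "continuous_on W (\<lambda>x. frechet_derivative f (at x) v)" for v
    by (rule smooth_on_continuous[OF smooth_on_frechet[OF local_parametrizationD(2)[OF assms]]])
  then show ?thesis
    unfolding volume_density_gram gram_def det_def by (simp, intro continuous_intros) auto
qed

lemma volume_density_measurable:
  assumes "local_parametrization M W f" "A \<in> sets borel" "A \<subseteq> W"
  shows "(\<lambda>x. indicator A x * volume_density f x) \<in> borel_measurable borel"
  using borel_measurable_continuous_on_indicator[OF assms(2) continuous_on_subset[OF continuous_on_volume_density[OF assms(1)] assms(3)]]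
  by simp

lemma local_parametrization_measurable:
  assumes "local_parametrization M W f" "A \<in> sets borel" "A \<subseteq> W"
  shows "(\<lambda>x. indicator A x *\<^sub>R f x) \<in> borel_measurable borel"
  using borel_measurable_continuous_on_indicator[OF assms(2) continuous_on_subset[OF local_parametrizationD(6)[OF assms(1)] assms(3)]]
  by simp

text \<open>The image of \<open>A\<close> is its preimage under the inverse of \<open>f\<close>,
  which is continuous on the image of \<open>W\<close>; that image is relatively open in
  \<open>M\<close>, hence Borel.\<close>

lemma borel_image_local_parametrization:
  assumes M: "compact M" and f: "local_parametrization M W f" and A: "A \<in> sets borel" "A \<subseteq> W"
  shows "f ` A \<in> sets borel"
proof -
  obtain U where U: "open U" "f ` W = M \<inter> U"
    using local_parametrizationD(4)[OF f] by (auto simp: openin_open)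
  then have fW: "f ` W \<in> sets borel" using M by (auto simp: borel_compact)
  have "inv_into W f \<in> borel_measurable (restrict_space borel (f ` W))"
    by (rule borel_measurable_continuous_on_restrict[OF local_parametrizationD(10)[OF f]])
  from measurable_sets[OF this A(1)]
  have "inv_into W f -` A \<inter> f ` W \<in> sets (restrict_space borel (f ` W))"
    by (simp add: space_restrict_space)
  then have "inv_into W f -` A \<inter> f ` W \<in> sets borel"
    using fW by (simp add: sets_restrict_space_iff)
  moreover have "inv_into W f -` A \<inter> f ` W = f ` A"
    using A(2) inv_into_f_f[OF local_parametrizationD(5)[OF f]] by (auto simp: image_iff)
  ultimately show ?thesis by simp
qed

lemma borel_preimage_local_parametrization:
  assumes f: "local_parametrization M W f" and A: "A \<in> sets borel" "A \<subseteq> W" and E: "E \<in> sets borel"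
  shows "A \<inter> f -` E \<in> sets borel"
proof -
  have "A \<inter> f -` E = A \<inter> ((\<lambda>x. indicator A x *\<^sub>R f x) -` E \<inter> space borel)"
    by (auto simp: indicator_def)
  then show ?thesis
    using measurable_sets[OF local_parametrization_measurable[OF f A] E] A(1) by simp
qed

text \<open>Differentiability of a transition map \<open>\<phi>\<close> known only through
  \<open>g (\<phi> z) = f z\<close> and continuity. A linear left inverse \<open>P\<close> of the
  injective \<open>g'\<close> proposes the derivative \<open>P \<circ> f'\<close>; continuity first
  yields a Lipschitz bound for \<open>\<phi>\<close> at \<open>x\<close>, and this bound makes the
  error terms small.\<close>

lemma transition_has_derivative:
  fixes f g :: "real ^ 'm::finite \<Rightarrow> 'a::euclidean_space"
  assumes W: "open W" "x \<in> W" and f: "(f has_derivative f') (at x)"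
    and g: "(g has_derivative g') (at (\<phi> x))" "inj g'"
    and \<phi>: "isCont \<phi> x" and eq: "\<And>z. z \<in> W \<Longrightarrow> g (\<phi> z) = f z"
  obtains L where "(\<phi> has_derivative L) (at x)" "f' = g' \<circ> L"
proof -
  have lg: "linear g'" and lf: "linear f'"
    using g(1) f has_derivative_linear by blast+
  obtain P where P: "linear P" "P \<circ> g' = id"
    using linear_injective_left_inverse[OF lg g(2)] by blast
  obtain K where K: "K > 0" "\<And>v. norm (P v) \<le> K * norm v"
    using linear_bounded_pos[OF P(1)] by blast
  obtain C0 where C0: "C0 > 0" "\<And>v. norm (f' v) \<le> C0 * norm v"
    using linear_bounded_pos[OF lf] by blast
  define C where "C = C0 + 1"
  let ?L = "P \<circ> f'"
  have linL: "linear ?L" by (rule linear_compose[OF lf P(1)])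
  have "(\<phi> has_derivative ?L) (at x)"
    unfolding has_derivative_at_alt
  proof (intro conjI allI impI)
    show "bounded_linear ?L" using linL by (simp add: linear_conv_bounded_linear)
    fix e :: real assume e: "e > 0"
    \<comment> \<open>The first bound lets the error \<open>K \<eta> |u|\<close> be absorbed into
      \<open>|u|\<close>, leaving \<open>|u| \<le> 2 |P w|\<close>. The second makes the same error
      at most \<open>e / 2\<close> times \<open>|h|\<close> once \<open>|u| \<le> 2 K C |h|\<close>
      is known.\<close>
    define \<eta> where "\<eta> = min (1 / (2 * K)) (e / (4 * K * K * C))"
    have "C > 0" using C0(1) by (simp add: C_def)
    have \<eta>: "\<eta> > 0" "K * \<eta> \<le> 1 / 2" "K * \<eta> * (2 * K * C) \<le> e / 2"
    proof -
      show "\<eta> > 0" using K(1) e \<open>C > 0\<close> by (simp add: \<eta>_def)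
      have "K * \<eta> \<le> K * (1 / (2 * K))" using K(1) by (intro mult_left_mono) (auto simp: \<eta>_def)
      then show "K * \<eta> \<le> 1 / 2" using K(1) by simp
      have "K * \<eta> * (2 * K * C) \<le> K * (e / (4 * K * K * C)) * (2 * K * C)"
        using K(1) \<open>C > 0\<close> by (intro mult_right_mono mult_left_mono) (auto simp: \<eta>_def)
      also have "\<dots> = e / 2" using K(1) \<open>C > 0\<close> by (simp add: field_simps)
      finally show "K * \<eta> * (2 * K * C) \<le> e / 2" .
    qed
    obtain d1 where d1: "d1 > 0" "\<And>z. norm (z - \<phi> x) < d1 \<Longrightarrow> norm (g z - g (\<phi> x) - g' (z - \<phi> x)) \<le> \<eta> * norm (z - \<phi> x)"
      using g(1) \<eta>(1) unfolding has_derivative_at_alt by blast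
    obtain d2 where d2: "d2 > 0" "\<And>z. norm (z - x) < d2 \<Longrightarrow> norm (\<phi> z - \<phi> x) < d1"
      using \<phi> d1(1) unfolding continuous_at_eps_delta dist_norm by blast
    define \<eta>' where "\<eta>' = min 1 (e / (2 * K))"
    have \<eta>': "\<eta>' > 0" "\<eta>' \<le> 1" "K * \<eta>' \<le> e / 2"
    proof -
      show "\<eta>' > 0" "\<eta>' \<le> 1" using K(1) e by (simp_all add: \<eta>'_def)
      have "K * \<eta>' \<le> K * (e / (2 * K))" using K(1) by (intro mult_left_mono) (auto simp: \<eta>'_def)
      then show "K * \<eta>' \<le> e / 2" using K(1) by simp
    qed
    obtain d3 where d3: "d3 > 0" "\<And>z. norm (z - x) < d3 \<Longrightarrow> norm (f z - f x - f' (z - x)) \<le> \<eta>' * norm (z - x)"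
      using f \<eta>'(1) unfolding has_derivative_at_alt by blast
    obtain d4 where d4: "d4 > 0" "ball x d4 \<subseteq> W" using W open_contains_ball by blast
    show "\<exists>d>0. \<forall>z. norm (z - x) < d \<longrightarrow> norm (\<phi> z - \<phi> x - ?L (z - x)) \<le> e * norm (z - x)"
    proof (intro exI[of _ "min d2 (min d3 d4)"] conjI allI impI)
      fix z assume z: "norm (z - x) < min d2 (min d3 d4)"
      define u w h where "u = \<phi> z - \<phi> x" and "w = f z - f x" and "h = z - x"
      have "z \<in> W" using z d4(2) by (auto simp: dist_norm norm_minus_commute subset_iff)
      then have w: "w = g (\<phi> z) - g (\<phi> x)" using eq W(2) by (simp add: w_def)
      have "norm (w - g' u) \<le> \<eta> * norm u"
        using d1(2)[OF d2(2)] z by (simp add: w u_def)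
      moreover have "u - P w = - P (w - g' u)"
        using P(2) by (simp add: linear_diff[OF P(1)] fun_eq_iff)
      ultimately have 1: "norm (u - P w) \<le> K * (\<eta> * norm u)"
        using K(2)[of "w - g' u"] mult_left_mono[of "norm (w - g' u)" "\<eta> * norm u" K] K(1)
        by (metis less_eq_real_def norm_minus_cancel order_trans)
      have fz: "norm (w - f' h) \<le> \<eta>' * norm h" using d3(2)[of z] z by (simp add: w_def h_def)
      have "\<eta>' * norm h \<le> norm h" using \<eta>'(1,2) mult_right_mono[of \<eta>' 1 "norm h"] by simp
      then have nw: "norm w \<le> C * norm h"
        using fz C0(2)[of h] norm_triangle_sub[of w "f' h"] by (simp add: C_def algebra_simps)
      have "K * (\<eta> * norm u) \<le> 1 / 2 * norm u"
        using mult_right_mono[OF \<eta>(2), of "norm u"] by (simp add: mult.assoc)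
      then have "norm u \<le> 2 * norm (P w)"
        using 1 norm_triangle_sub[of u "P w"] by linarith
      also have "\<dots> \<le> 2 * (K * (C * norm h))"
        using K(2)[of w] mult_left_mono[OF nw, of K] K(1) by linarith
      finally have nu: "norm u \<le> 2 * (K * (C * norm h))" .
      have "K * \<eta> * norm u \<le> K * \<eta> * (2 * (K * (C * norm h)))"
        using nu K(1) \<eta>(1) by (intro mult_left_mono) auto
      also have "\<dots> = (K * \<eta> * (2 * K * C)) * norm h" by (simp add: mult_ac)
      also have "\<dots> \<le> e / 2 * norm h" by (intro mult_right_mono \<eta>(3)) simp
      finally have a: "norm (u - P w) \<le> e / 2 * norm h" using 1 by (simp add: mult.assoc)
      have "norm (P (w - f' h)) \<le> K * (\<eta>' * norm h)"
        using K(2)[of "w - f' h"] mult_left_mono[OF fz, of K] K(1) by linarith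
      also have "\<dots> \<le> e / 2 * norm h" using mult_right_mono[OF \<eta>'(3), of "norm h"] by (simp add: mult.assoc)
      finally have b: "norm (P w - P (f' h)) \<le> e / 2 * norm h" by (simp add: linear_diff[OF P(1)])
      have "norm (u - P (f' h)) \<le> norm (u - P w) + norm (P w - P (f' h))"
        using norm_triangle_ineq[of "u - P w" "P w - P (f' h)"] by simp
      then show "norm (\<phi> z - \<phi> x - ?L (z - x)) \<le> e * norm (z - x)"
        using a b by (simp add: u_def h_def)
    qed (use d2 d3 d4 in auto)
  qed
  note d\<phi> = this
  have "((\<lambda>z. g (\<phi> z)) has_derivative (\<lambda>v. g' (?L v))) (at x)"
    by (rule has_derivative_compose[OF d\<phi> g(1)])
  then have "(f has_derivative (\<lambda>v. g' (?L v))) (at x)"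
    by (rule has_derivative_transform_within_open[OF _ W]) (rule eq)
  from has_derivative_unique[OF f this] have "f' = g' \<circ> ?L" unfolding o_def .
  with d\<phi> show ?thesis by (rule that)
qed

section \<open>The Riemannian volume\<close>

text \<open>The transition map is differentiable by \<open>transition_has_derivative\<close>, and
  the modulus of its determinant is the quotient of the two densities by
  \<open>det_gram_compose\<close>.\<close>

lemma transition_volume:
  fixes f g :: "real ^ 'm::finite \<Rightarrow> 'a::euclidean_space"
  assumes f: "local_parametrization M W f" and g: "local_parametrization M V g"
    and A: "A \<in> sets borel" "A \<subseteq> W" and B: "B \<in> sets borel" "B \<subseteq> V" and eq: "f ` A = g ` B"
    and fin: "(\<integral>\<^sup>+x\<in>A. ennreal (volume_density f x) \<partial>lborel) < \<infinity>"
  shows "(\<integral>\<^sup>+x\<in>A. ennreal (volume_density f x) \<partial>lborel) = (\<integral>\<^sup>+y\<in>B. ennreal (volume_density g y) \<partial>lborel)"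
proof -
  obtain U where U: "open U" "g ` V = M \<inter> U"
    using local_parametrizationD(4)[OF g] by (auto simp: openin_open)
  \<comment> \<open>The part of \<open>W\<close> that is mapped into the other chart image is open,
    so \<open>\<phi>\<close> is differentiable at every point of \<open>A\<close>, although
    \<open>A\<close> is merely Borel.\<close>
  define W' where "W' = W \<inter> f -` U"
  have W': "open W'"
    unfolding W'_def using continuous_openin_preimage_gen local_parametrizationD(1,6)[OF f] U(1)
    by (metis continuous_open_preimage)
  have fW': "f x \<in> g ` V" if "x \<in> W'" for x
    using that U(2) local_parametrizationD(7)[OF f] by (auto simp: W'_def)
  define \<phi> where "\<phi> x = inv_into V g (f x)" for x
  have \<phi>: "\<phi> x \<in> V" "g (\<phi> x) = f x" if "x \<in> W'" for x
    using fW'[OF that] by (auto simp: \<phi>_def inv_into_into f_inv_into_f)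
  have contf: "continuous_on W' f"
    by (rule continuous_on_subset[OF local_parametrizationD(6)[OF f]]) (simp add: W'_def)
  have "continuous_on W' \<phi>" unfolding \<phi>_def
    by (rule continuous_on_compose2[OF local_parametrizationD(10)[OF g] contf]) (use fW' in auto)
  then have cont\<phi>: "isCont \<phi> x" if "x \<in> W'" for x
    using W' that by (simp add: continuous_on_eq_continuous_at)
  have AW': "A \<subseteq> W'"
  proof
    fix x assume "x \<in> A"
    then have "f x \<in> g ` V" using eq B(2) by (metis image_eqI image_mono subsetD)
    then show "x \<in> W'" using \<open>x \<in> A\<close> A(2) U(2) by (auto simp: W'_def)
  qed
  have "\<exists>L. (\<phi> has_derivative L) (at x) \<and> frechet_derivative f (at x) = frechet_derivative g (at (\<phi> x)) \<circ> L"
    if x: "x \<in> W'" for x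
  proof -
    have "x \<in> W" using x by (simp add: W'_def)
    obtain L where "(\<phi> has_derivative L) (at x)" "frechet_derivative f (at x) = frechet_derivative g (at (\<phi> x)) \<circ> L"
      by (rule transition_has_derivative[OF W' x local_parametrizationD(8)[OF f \<open>x \<in> W\<close>]
            local_parametrizationD(8)[OF g \<phi>(1)[OF x]] local_parametrizationD(3)[OF g \<phi>(1)[OF x]] cont\<phi>[OF x] \<phi>(2)])
    then show ?thesis by blast
  qed
  then obtain L where L: "\<And>x. x \<in> W' \<Longrightarrow> (\<phi> has_derivative L x) (at x)"
    "\<And>x. x \<in> W' \<Longrightarrow> frechet_derivative f (at x) = frechet_derivative g (at (\<phi> x)) \<circ> L x"
    by metis
  have \<phi>A: "\<phi> ` A = B"
  proof (intro subset_antisym subsetI)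
    fix y assume "y \<in> \<phi> ` A"
    then obtain x where x: "x \<in> A" "y = \<phi> x" by blast
    then have "g y = f x" using \<phi>(2) AW' by blast
    then have "g y \<in> g ` B" using x(1) eq by blast
    moreover have "y \<in> V" using x \<phi>(1) AW' by auto
    ultimately show "y \<in> B" using local_parametrizationD(5)[OF g] B(2) by (auto dest: inj_onD)
  next
    fix y assume y: "y \<in> B"
    then have "g y \<in> f ` A" using eq by blast
    then obtain x where x: "x \<in> A" "g y = f x" by blast
    then have "\<phi> x = y"
      using inv_into_f_f[OF local_parametrizationD(5)[OF g]] y B(2) by (metis \<phi>_def subsetD)
    then show "y \<in> \<phi> ` A" using x by blast
  qed
  have inj: "inj_on \<phi> A"
  proof (rule inj_onI)
    fix x y assume "x \<in> A" "y \<in> A" "\<phi> x = \<phi> y"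
    then have "f x = f y" using \<phi>(2) AW' by (metis subsetD)
    then show "x = y" using \<open>x \<in> A\<close> \<open>y \<in> A\<close> A(2) local_parametrizationD(5)[OF f] by (auto dest: inj_onD)
  qed
  have dens: "volume_density f x = \<bar>det (matrix (L x))\<bar> * volume_density g (\<phi> x)" if "x \<in> A" for x
  proof -
    have x: "x \<in> W'" using that AW' by blast
    have "det (gram (frechet_derivative f (at x))) =
        (det (matrix (L x)))\<^sup>2 * det (gram (frechet_derivative g (at (\<phi> x))))"
      unfolding L(2)[OF x]
      by (rule det_gram_compose[OF local_parametrizationD(9)[OF g \<phi>(1)[OF x]] has_derivative_linear[OF L(1)[OF x]]])
    then show ?thesis by (simp add: volume_density_gram real_sqrt_mult)
  qed
  \<comment> \<open>Off the chart domains the densities are arbitrary; extension by zero makes them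
    Borel functions on the whole space.\<close>
  let ?F = "\<lambda>x. indicator A x * volume_density f x" and ?G = "\<lambda>x. indicator B x * volume_density g x"
  have eqA: "(\<integral>\<^sup>+x\<in>A. ennreal (?F x) \<partial>lborel) = (\<integral>\<^sup>+x\<in>A. ennreal (volume_density f x) \<partial>lborel)"
    by (rule nn_integral_cong) (auto simp: indicator_def)
  have eqB: "(\<integral>\<^sup>+x\<in>B. ennreal (?G x) \<partial>lborel) = (\<integral>\<^sup>+x\<in>B. ennreal (volume_density g x) \<partial>lborel)"
    by (rule nn_integral_cong) (auto simp: indicator_def)
  have "(\<integral>\<^sup>+x\<in>A. ennreal (?F x) \<partial>lborel) = (\<integral>\<^sup>+y\<in>\<phi> ` A. ennreal (?G y) \<partial>lborel)"
  proof (rule nn_integral_change_of_variables[where \<phi>' = L])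
    show "?F \<in> borel_measurable borel" "?G \<in> borel_measurable borel"
      by (rule volume_density_measurable[OF f A] volume_density_measurable[OF g B])+
    show "0 \<le> ?F x" if "x \<in> A" for x
      using volume_density_pos[OF f] that A(2) by (simp add: subset_iff less_imp_le)
    show "0 \<le> ?G y" if "y \<in> \<phi> ` A" for y
      using volume_density_pos[OF g] that B(2) \<phi>A by (simp add: subset_iff less_imp_le)
    show "?F x = \<bar>det (matrix (L x))\<bar> * ?G (\<phi> x)" if "x \<in> A" for x
      using dens[OF that] that \<phi>A by auto
    show "(\<phi> has_derivative L x) (at x)" if "x \<in> A" for x using L(1) that AW' by blast
    show "(\<integral>\<^sup>+x\<in>A. ennreal (?F x) \<partial>lborel) < \<infinity>" using fin eqA by simp
  qed (use A inj \<phi>A B in auto)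
  then show ?thesis using eqA eqB \<phi>A by simp
qed

section \<open>Finite Borel atlases, existence and uniqueness of the volume\<close>

text \<open>The Borel pieces \<open>B i\<close> have disjoint images and carry the integration, the
  compact sets \<open>K i\<close> provide uniform constants, and the open sets \<open>W i\<close>
  leave room for a second point near the first. Sharp pieces are enough because only the base point
  of a pair is localized.\<close>

definition atlas_partition ::
    "'a::euclidean_space set \<Rightarrow> nat \<Rightarrow> (nat \<Rightarrow> (real ^ 'm::finite) set) \<Rightarrow> (nat \<Rightarrow> real ^ 'm \<Rightarrow> 'a) \<Rightarrow>
     (nat \<Rightarrow> (real ^ 'm) set) \<Rightarrow> (nat \<Rightarrow> (real ^ 'm) set) \<Rightarrow> bool" where
  "atlas_partition M N W f K B \<longleftrightarrow>
     (\<forall>i<N. local_parametrization M (W i) (f i) \<and> compact (K i) \<and> K i \<subseteq> W i \<and> B i \<subseteq> K i \<and> B i \<in> sets borel) \<and>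
     disjoint_family_on (\<lambda>i. f i ` B i) {..<N} \<and> M = (\<Union>i<N. f i ` B i)"

lemma openin_image_local_parametrization:
  assumes f: "local_parametrization M W f" and U: "open U" "U \<subseteq> W"
  shows "openin (top_of_set M) (f ` U)"
proof -
  obtain g where g: "homeomorphism W (f ` W) f g"
    using f by (auto simp: local_parametrization_def)
  have "openin (top_of_set W) U" using U by (simp add: open_openin_trans local_parametrizationD(1)[OF f] openin_open_eq)
  then have "openin (top_of_set (f ` W)) (f ` U)"
    using homeomorphism_imp_open_map[OF g] by blast
  then show ?thesis using local_parametrizationD(4)[OF f] openin_trans by blast
qed

text \<open>The images of the interiors of finitely many compact sets cover \<open>M\<close>; from
  the image of each compact set the images of the earlier ones are removed.\<close>

lemma exists_atlas_partition:
  assumes "closed_submanifold TYPE('m::finite) (M :: 'a::euclidean_space set)"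
  obtains N W f K B where "atlas_partition M N W (f :: nat \<Rightarrow> real ^ 'm \<Rightarrow> 'a) K B"
proof -
  have M: "compact M" using assms by (simp add: closed_submanifold_def)
  have "\<exists>W (f :: real ^ 'm \<Rightarrow> 'a) K. local_parametrization M W f \<and> compact K \<and> K \<subseteq> W \<and> p \<in> f ` interior K"
    if p: "p \<in> M" for p
  proof -
    obtain W and f :: "real ^ 'm \<Rightarrow> 'a" where f: "local_parametrization M W f" "p \<in> f ` W"
      using assms p unfolding closed_submanifold_def by blast
    then obtain u where u: "u \<in> W" "p = f u" by blast
    obtain e where e: "e > 0" "cball u e \<subseteq> W"
      using u local_parametrizationD(1)[OF f(1)] open_contains_cball by blast
    then show ?thesis
      using f u by (intro exI[of _ W] exI[of _ f] exI[of _ "cball u e"]) auto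
  qed
  then obtain W and f :: "'a \<Rightarrow> real ^ 'm \<Rightarrow> 'a" and K where
    c: "\<And>p. p \<in> M \<Longrightarrow> local_parametrization M (W p) (f p) \<and> compact (K p) \<and> K p \<subseteq> W p \<and> p \<in> f p ` interior (K p)"
    by metis
  have "\<exists>U. open U \<and> f p ` interior (K p) = M \<inter> U" if "p \<in> M" for p
  proof -
    have "interior (K p) \<subseteq> W p" using c[OF that] interior_subset by blast
    then have "openin (top_of_set M) (f p ` interior (K p))"
      using c[OF that] by (intro openin_image_local_parametrization) auto
    then show ?thesis by (auto simp: openin_open)
  qed
  then obtain U where U: "\<And>p. p \<in> M \<Longrightarrow> open (U p) \<and> f p ` interior (K p) = M \<inter> U p"
    by metis
  have "M \<subseteq> (\<Union>p\<in>M. U p)" using c U by blast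
  then obtain D where D: "D \<subseteq> M" "finite D" "M \<subseteq> (\<Union>p\<in>D. U p)"
    using compactE_image[OF M, of M U] U by metis
  obtain N and q :: "nat \<Rightarrow> 'a" where q: "D = q ` {..<N}"
    using D(2) by (metis finite_imp_nat_seg_image_inj_on lessThan_def)
  have cq: "local_parametrization M (W (q i)) (f (q i))" "compact (K (q i))" "K (q i) \<subseteq> W (q i)" if "i < N" for i
    using c[of "q i"] D(1) q that by auto
  define P where "P i = f (q i) ` K (q i) - (\<Union>j<i. f (q j) ` K (q j))" for i
  define B where "B i = K (q i) \<inter> f (q i) -` P i" for i
  have fB: "f (q i) ` B i = P i" for i by (auto simp: B_def P_def)
  have Kcl: "f (q i) ` K (q i) \<in> sets borel" if "i < N" for i
    using that cq[OF that] by (intro borel_compact compact_continuous_image)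
      (auto intro: continuous_on_subset[OF local_parametrizationD(6)])
  have PB: "P i \<in> sets borel" if "i < N" for i
    unfolding P_def using that Kcl by (intro sets.Diff sets.finite_UN) auto
  have BB: "B i \<in> sets borel" if "i < N" for i
    unfolding B_def using cq[OF that] PB[OF that]
    by (intro borel_preimage_local_parametrization[OF cq(1)[OF that]]) (auto simp: borel_compact)
  have "M = (\<Union>i<N. P i)"
  proof (intro subset_antisym subsetI)
    fix x assume "x \<in> M"
    then obtain p where "p \<in> D" "x \<in> U p" using D(3) by blast
    then have "x \<in> f p ` K p" using U[of p] D(1) \<open>x \<in> M\<close> interior_subset by blast
    then have ex: "\<exists>i. i < N \<and> x \<in> f (q i) ` K (q i)" using \<open>p \<in> D\<close> q by blast
    define i where "i = (LEAST i. i < N \<and> x \<in> f (q i) ` K (q i))"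
    have "i < N \<and> x \<in> f (q i) ` K (q i)" unfolding i_def by (rule LeastI_ex[OF ex])
    moreover have "x \<notin> f (q j) ` K (q j)" if "j < i" for j
      using not_less_Least[of j "\<lambda>i. i < N \<and> x \<in> f (q i) ` K (q i)"] that calculation by (auto simp: i_def)
    ultimately show "x \<in> (\<Union>i<N. P i)" by (auto simp: P_def)
  next
    fix x assume "x \<in> (\<Union>i<N. P i)"
    then obtain i where "i < N" "x \<in> f (q i) ` K (q i)" by (auto simp: P_def)
    then show "x \<in> M" using cq(3) local_parametrizationD(7)[OF cq(1)] by blast
  qed
  moreover have "disjoint_family_on P {..<N}"
  proof (unfold disjoint_family_on_def, intro ballI impI)
    fix i j assume "i \<in> {..<N}" "j \<in> {..<N}" "i \<noteq> j"
    then show "P i \<inter> P j = {}"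
      by (cases i j rule: linorder_cases) (auto simp: P_def)
  qed
  ultimately have "atlas_partition M N (\<lambda>i. W (q i)) (\<lambda>i. f (q i)) (\<lambda>i. K (q i)) B"
    unfolding atlas_partition_def fB using cq BB by (auto simp: B_def)
  then show ?thesis by (rule that)
qed

lemma atlas_partitionD:
  assumes "atlas_partition M N W f K B" "i < N"
  shows "local_parametrization M (W i) (f i)" "compact (K i)" "K i \<subseteq> W i" "B i \<subseteq> K i" "B i \<subseteq> W i"
    "B i \<in> sets borel"
  using assms unfolding atlas_partition_def by blast+

lemma atlas_partition_volume_finite:
  fixes f :: "nat \<Rightarrow> real ^ 'm::finite \<Rightarrow> 'a::euclidean_space"
  assumes a: "atlas_partition M N W f K B" and i: "i < N" and A: "A \<subseteq> B i"
  shows "(\<integral>\<^sup>+x\<in>A. ennreal (volume_density (f i) x) \<partial>lborel) < \<infinity>"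
proof -
  note D = atlas_partitionD[OF a i]
  have "continuous_on (K i) (volume_density (f i))"
    by (rule continuous_on_subset[OF continuous_on_volume_density[OF D(1)] D(3)])
  then obtain C where C: "\<And>x. x \<in> K i \<Longrightarrow> norm (volume_density (f i) x) \<le> C"
    using compact_continuous_norm_bound[OF D(2)] by blast
  have "(\<integral>\<^sup>+x\<in>A. ennreal (volume_density (f i) x) \<partial>lborel) \<le> (\<integral>\<^sup>+x. ennreal C * indicator (K i) x \<partial>lborel)"
  proof (rule nn_integral_mono)
    fix x
    have "volume_density (f i) x \<le> C" if "x \<in> A" using C[of x] A D(4) that by auto
    then show "ennreal (volume_density (f i) x) * indicator A x \<le> ennreal C * indicator (K i) x"
      using A D(4) by (auto simp: indicator_def intro!: ennreal_leI)
  qed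
  also have "\<dots> = ennreal C * emeasure lborel (K i)"
    by (rule nn_integral_cmult_indicator) (use D(2) in \<open>simp add: borel_compact\<close>)
  also have "\<dots> < \<infinity>"
    using emeasure_bounded_finite[OF compact_imp_bounded[OF D(2)]] by (simp add: ennreal_mult_less_top)
  finally show ?thesis .
qed

text \<open>The values on images of charts determine the measure of every Borel set. This gives
  uniqueness and, with \<open>atlas_partition_volume_finite\<close>, finiteness of the
  volume.\<close>

lemma emeasure_atlas_partition:
  fixes f :: "nat \<Rightarrow> real ^ 'm::finite \<Rightarrow> 'a::euclidean_space"
  assumes M: "compact M" and a: "atlas_partition M N W f K B"
    and \<mu>: "is_riemannian_volume TYPE('m) M \<mu>" and E: "E \<in> sets borel"
  shows "emeasure \<mu> E = (\<Sum>i<N. \<integral>\<^sup>+x\<in>B i \<inter> f i -` E. ennreal (volume_density (f i) x) \<partial>lborel)"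
proof -
  have s: "sets \<mu> = sets borel" and n: "emeasure \<mu> (- M) = 0"
    and c: "\<And>W (f :: real ^ 'm \<Rightarrow> 'a) A. local_parametrization M W f \<Longrightarrow> A \<in> sets borel \<Longrightarrow> A \<subseteq> W \<Longrightarrow>
      emeasure \<mu> (f ` A) = (\<integral>\<^sup>+x\<in>A. ennreal (volume_density f x) \<partial>lborel)"
    using \<mu> by (auto simp: is_riemannian_volume_def)
  have MB: "M \<in> sets borel" using M by (rule borel_compact)
  have Ai: "B i \<inter> f i -` E \<in> sets borel" if "i < N" for i
    by (rule borel_preimage_local_parametrization[OF atlas_partitionD(1,6,5)[OF a that] E])
  have fA: "f i ` (B i \<inter> f i -` E) \<in> sets \<mu>" if "i < N" for i
    unfolding s using Ai[OF that] atlas_partitionD(5)[OF a that]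
    by (intro borel_image_local_parametrization[OF M atlas_partitionD(1)[OF a that]]) auto
  have "emeasure \<mu> E = emeasure \<mu> (E \<inter> M)"
  proof (rule emeasure_eq_AE)
    have "- M \<in> null_sets \<mu>" using n MB s by (intro null_setsI) auto
    then have "AE x in \<mu>. x \<notin> - M" by (rule AE_not_in)
    then show "AE x in \<mu>. (x \<in> E) = (x \<in> E \<inter> M)" by eventually_elim simp
  qed (use E MB s in auto)
  also have "E \<inter> M = (\<Union>i<N. f i ` (B i \<inter> f i -` E))"
    using a unfolding atlas_partition_def by blast
  also have "emeasure \<mu> \<dots> = (\<Sum>i<N. emeasure \<mu> (f i ` (B i \<inter> f i -` E)))"
  proof (rule sum_emeasure[symmetric])
    show "(\<lambda>i. f i ` (B i \<inter> f i -` E)) ` {..<N} \<subseteq> sets \<mu>" using fA by blast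
    have "disjoint_family_on (\<lambda>i. f i ` B i) {..<N}" using a by (simp add: atlas_partition_def)
    then show "disjoint_family_on (\<lambda>i. f i ` (B i \<inter> f i -` E)) {..<N}"
      unfolding disjoint_family_on_def by blast
  qed simp
  also have "\<dots> = (\<Sum>i<N. \<integral>\<^sup>+x\<in>B i \<inter> f i -` E. ennreal (volume_density (f i) x) \<partial>lborel)"
  proof (rule sum.cong[OF refl])
    fix i assume "i \<in> {..<N}"
    then have i: "i < N" by simp
    show "emeasure \<mu> (f i ` (B i \<inter> f i -` E)) = (\<integral>\<^sup>+x\<in>B i \<inter> f i -` E. ennreal (volume_density (f i) x) \<partial>lborel)"
      by (rule c[OF atlas_partitionD(1)[OF a i] Ai[OF i]]) (use atlas_partitionD(5)[OF a i] in blast)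
  qed
  finally show ?thesis .
qed

lemma riemannian_volume_unique:
  fixes M :: "'a::euclidean_space set"
  assumes "closed_submanifold TYPE('m::finite) M"
    and "is_riemannian_volume TYPE('m) M \<mu>" "is_riemannian_volume TYPE('m) M \<nu>"
  shows "\<mu> = \<nu>"
proof -
  obtain N W K B and f :: "nat \<Rightarrow> real ^ 'm \<Rightarrow> 'a" where a: "atlas_partition M N W f K B"
    using exists_atlas_partition[OF assms(1)] by blast
  have M: "compact M" using assms by (simp add: closed_submanifold_def)
  show ?thesis
  proof (rule measure_eqI)
    show "sets \<mu> = sets \<nu>" using assms(2,3) by (simp add: is_riemannian_volume_def)
    fix E assume "E \<in> sets \<mu>"
    then have "E \<in> sets borel" using assms(2) by (simp add: is_riemannian_volume_def)
    then show "emeasure \<mu> E = emeasure \<nu> E"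
      using emeasure_atlas_partition[OF M a assms(2)] emeasure_atlas_partition[OF M a assms(3)] by simp
  qed
qed

text \<open>The measure is assembled from the pieces of one atlas partition. That it has the right
  values in every other chart is the invariance of the density under transition maps.\<close>

lemma riemannian_volume_exists:
  fixes M :: "'a::euclidean_space set"
  assumes cl: "closed_submanifold TYPE('m::finite) M"
  shows "\<exists>\<mu>. is_riemannian_volume TYPE('m) M \<mu>"
proof -
  obtain N W K B and f :: "nat \<Rightarrow> real ^ 'm \<Rightarrow> 'a" where a: "atlas_partition M N W f K B"
    using exists_atlas_partition[OF cl] by blast
  have M: "compact M" using cl by (simp add: closed_submanifold_def)
  note D = atlas_partitionD[OF a]
  \<comment> \<open>The density vanishes outside \<open>B i\<close>, so the value \<open>0\<close>
    that the extended parametrization takes there receives no mass.\<close>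
  define \<nu> where "\<nu> i = distr (density lborel (\<lambda>u. ennreal (indicator (B i) u * volume_density (f i) u))) borel
      (\<lambda>u. indicator (B i) u *\<^sub>R f i u)" for i
  have m1[measurable]: "(\<lambda>u. indicator (B i) u * volume_density (f i) u) \<in> borel_measurable borel" if "i < N" for i
    by (rule volume_density_measurable[OF D(1,6,5)[OF that]])
  have m2[measurable]: "(\<lambda>u. indicator (B i) u *\<^sub>R f i u) \<in> borel_measurable borel" if "i < N" for i
    by (rule local_parametrization_measurable[OF D(1,6,5)[OF that]])
  have sets\<nu>: "sets (\<nu> i) = sets borel" for i by (simp add: \<nu>_def)
  have em\<nu>: "emeasure (\<nu> i) E = (\<integral>\<^sup>+x\<in>B i \<inter> f i -` E. ennreal (volume_density (f i) x) \<partial>lborel)"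
    if i: "i < N" and E: "E \<in> sets borel" for i E
  proof -
    have "emeasure (\<nu> i) E = emeasure (density lborel (\<lambda>u. ennreal (indicator (B i) u * volume_density (f i) u)))
        ((\<lambda>u. indicator (B i) u *\<^sub>R f i u) -` E)"
      unfolding \<nu>_def using m2[OF i] E by (simp add: emeasure_distr)
    also have "\<dots> = (\<integral>\<^sup>+u. ennreal (indicator (B i) u * volume_density (f i) u) *
        indicator ((\<lambda>u. indicator (B i) u *\<^sub>R f i u) -` E) u \<partial>lborel)"
      using m1[OF i] measurable_sets[OF m2[OF i] E] by (intro emeasure_density) auto
    also have "\<dots> = (\<integral>\<^sup>+x\<in>B i \<inter> f i -` E. ennreal (volume_density (f i) x) \<partial>lborel)"
      by (rule nn_integral_cong) (auto simp: indicator_def)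
    finally show ?thesis .
  qed
  define \<mu> where "\<mu> = measure_of UNIV (sets borel) (\<lambda>E. \<Sum>i<N. emeasure (\<nu> i) E)"
  have sets\<mu>: "sets \<mu> = sets borel"
    unfolding \<mu>_def using sets.sigma_sets_eq[of borel] by (simp add: sets_measure_of)
  have em\<mu>: "emeasure \<mu> E = (\<Sum>i<N. emeasure (\<nu> i) E)" if "E \<in> sets borel" for E
  proof (rule emeasure_measure_of[OF \<mu>_def])
    show "positive (sets \<mu>) (\<lambda>E. \<Sum>i<N. emeasure (\<nu> i) E)" by (simp add: positive_def)
    show "countably_additive (sets \<mu>) (\<lambda>E. \<Sum>i<N. emeasure (\<nu> i) E)"
    proof (rule countably_additiveI)
      fix A :: "nat \<Rightarrow> 'a set" assume A: "range A \<subseteq> sets \<mu>" "disjoint_family A"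
      have "(\<Sum>n. \<Sum>i<N. emeasure (\<nu> i) (A n)) = (\<Sum>i<N. \<Sum>n. emeasure (\<nu> i) (A n))"
        by (rule suminf_sum) simp
      also have "\<dots> = (\<Sum>i<N. emeasure (\<nu> i) (\<Union> (range A)))"
        by (intro sum.cong refl suminf_emeasure) (use A sets\<mu> sets\<nu> in auto)
      finally show "(\<Sum>n. \<Sum>i<N. emeasure (\<nu> i) (A n)) = (\<Sum>i<N. emeasure (\<nu> i) (\<Union> (range A)))" .
    qed
  qed (use that sets\<mu> in auto)
  have "is_riemannian_volume TYPE('m) M \<mu>"
    unfolding is_riemannian_volume_def
  proof (intro conjI allI impI ballI)
    show "sets \<mu> = sets borel" by (rule sets\<mu>)
    have "- M \<in> sets borel" using M by (intro borel_comp borel_compact)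
    moreover have "B i \<inter> f i -` (- M) = {}" if "i < N" for i
      using D(5)[OF that] local_parametrizationD(7)[OF D(1)[OF that]] by blast
    ultimately show "emeasure \<mu> (- M) = 0" by (simp add: em\<mu> em\<nu>)
    fix V and g :: "real ^ 'm \<Rightarrow> 'a" and A
    assume g: "local_parametrization M V g" and A: "A \<in> sets borel" "A \<subseteq> V"
    have gA: "g ` A \<in> sets borel" by (rule borel_image_local_parametrization[OF M g A])
    \<comment> \<open>The part of \<open>A\<close> that \<open>g\<close> maps into the
      \<open>i\<close>-th piece. These parts partition \<open>A\<close>, so the sum over
      \<open>i\<close> becomes a single integral.\<close>
    define A' where "A' i = A \<inter> g -` (f i ` B i)" for i
    have A': "A' i \<in> sets borel" if i: "i < N" for i
      unfolding A'_def
      by (rule borel_preimage_local_parametrization[OF g A borel_image_local_parametrization[OF M D(1,6,5)[OF i]]])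
    have "emeasure \<mu> (g ` A) = (\<Sum>i<N. \<integral>\<^sup>+x\<in>B i \<inter> f i -` (g ` A). ennreal (volume_density (f i) x) \<partial>lborel)"
      using gA by (simp add: em\<mu> em\<nu>)
    also have "\<dots> = (\<Sum>i<N. \<integral>\<^sup>+x\<in>A' i. ennreal (volume_density g x) \<partial>lborel)"
    proof (rule sum.cong[OF refl])
      fix i assume "i \<in> {..<N}"
      then have i: "i < N" by simp
      show "(\<integral>\<^sup>+x\<in>B i \<inter> f i -` (g ` A). ennreal (volume_density (f i) x) \<partial>lborel) =
          (\<integral>\<^sup>+x\<in>A' i. ennreal (volume_density g x) \<partial>lborel)"
      proof (rule transition_volume[OF D(1)[OF i] g])
        show "B i \<inter> f i -` (g ` A) \<in> sets borel"
          by (rule borel_preimage_local_parametrization[OF D(1,6,5)[OF i] gA])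
        have im: "h ` (X \<inter> h -` Y) = h ` X \<inter> Y" for h :: "real ^ 'm \<Rightarrow> 'a" and X Y by blast
        show "f i ` (B i \<inter> f i -` (g ` A)) = g ` A' i"
          unfolding A'_def im by (rule Int_commute)
        show "(\<integral>\<^sup>+x\<in>B i \<inter> f i -` (g ` A). ennreal (volume_density (f i) x) \<partial>lborel) < \<infinity>"
          by (rule atlas_partition_volume_finite[OF a i]) blast
      qed (use D(5)[OF i] A A'[OF i] in \<open>auto simp: A'_def\<close>)
    qed
    also have "\<dots> = (\<integral>\<^sup>+x. (\<Sum>i<N. ennreal (indicator A x * volume_density g x) * indicator (A' i) x) \<partial>lborel)"
    proof (subst nn_integral_sum)
      show "(\<Sum>i<N. \<integral>\<^sup>+x\<in>A' i. ennreal (volume_density g x) \<partial>lborel) =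
          (\<Sum>i<N. \<integral>\<^sup>+x. ennreal (indicator A x * volume_density g x) * indicator (A' i) x \<partial>lborel)"
        by (intro sum.cong refl nn_integral_cong) (auto simp: A'_def indicator_def)
    qed (use volume_density_measurable[OF g A] A' in auto)
    also have "\<dots> = (\<integral>\<^sup>+x\<in>A. ennreal (volume_density g x) \<partial>lborel)"
    proof (rule nn_integral_cong)
      fix x
      show "(\<Sum>i<N. ennreal (indicator A x * volume_density g x) * indicator (A' i) x) =
          ennreal (volume_density g x) * indicator A x"
      proof (cases "x \<in> A")
        case True
        then have "g x \<in> M" using A(2) local_parametrizationD(7)[OF g] by blast
        then obtain i where i: "i < N" "g x \<in> f i ` B i" using a unfolding atlas_partition_def by blast
        have "x \<in> A' j \<longleftrightarrow> j = i" if "j < N" for j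
          using a i that True unfolding atlas_partition_def disjoint_family_on_def A'_def by blast
        then have "(\<Sum>j<N. ennreal (indicator A x * volume_density g x) * indicator (A' j) x) =
            (\<Sum>j<N. if j = i then ennreal (volume_density g x) else 0)"
          using True by (intro sum.cong refl) (auto simp: indicator_def)
        also have "\<dots> = ennreal (volume_density g x)" using i(1) by simp
        finally show ?thesis using True by simp
      qed simp
    qed
    finally show "emeasure \<mu> (g ` A) = (\<integral>\<^sup>+x\<in>A. ennreal (volume_density g x) \<partial>lborel)" .
  qed
  then show ?thesis by blast
qed

lemma is_riemannian_volume_riemannian_volume:
  fixes M :: "'a::euclidean_space set"
  assumes "closed_submanifold TYPE('m::finite) M"
  shows "is_riemannian_volume TYPE('m) M (riemannian_volume TYPE('m) M)"
proof -
  have "\<exists>!\<mu>. is_riemannian_volume TYPE('m) M \<mu>"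
    using riemannian_volume_exists[OF assms] riemannian_volume_unique[OF assms] by blast
  then show ?thesis unfolding riemannian_volume_def by (rule theI')
qed

lemma riemannian_volume_finite:
  fixes M :: "'a::euclidean_space set"
  assumes cl: "closed_submanifold TYPE('m::finite) M"
  shows "finite_measure (riemannian_volume TYPE('m) M)"
proof
  obtain N W K B and f :: "nat \<Rightarrow> real ^ 'm \<Rightarrow> 'a" where a: "atlas_partition M N W f K B"
    using exists_atlas_partition[OF cl] by blast
  have M: "compact M" using cl by (simp add: closed_submanifold_def)
  note v = is_riemannian_volume_riemannian_volume[OF cl]
  have "space (riemannian_volume TYPE('m) M) = UNIV"
    using v sets_eq_imp_space_eq[of "riemannian_volume TYPE('m) M" borel] by (simp add: is_riemannian_volume_def)
  then have "emeasure (riemannian_volume TYPE('m) M) (space (riemannian_volume TYPE('m) M)) =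
      (\<Sum>i<N. \<integral>\<^sup>+x\<in>B i \<inter> f i -` UNIV. ennreal (volume_density (f i) x) \<partial>lborel)"
    using emeasure_atlas_partition[OF M a v, of UNIV] by simp
  also have "\<dots> < \<infinity>"
    using atlas_partition_volume_finite[OF a] by (simp add: less_top)
  finally show "emeasure (riemannian_volume TYPE('m) M) (space (riemannian_volume TYPE('m) M)) \<noteq> \<infinity>" by simp
qed

text \<open>The volume restricted to the image of \<open>A\<close> is the pushforward of a density
  on the parameter domain, so the formula for measures of sets passes to integrals.\<close>

lemma nn_integral_local_parametrization:
  fixes f :: "real ^ 'm::finite \<Rightarrow> 'a::euclidean_space"
  assumes M: "compact M" and \<mu>: "is_riemannian_volume TYPE('m) M \<mu>" and f: "local_parametrization M W f"
    and A: "A \<in> sets borel" "A \<subseteq> W" and h: "h \<in> borel_measurable borel"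
  shows "(\<integral>\<^sup>+y\<in>f ` A. h y \<partial>\<mu>) = (\<integral>\<^sup>+x\<in>A. h (f x) * ennreal (volume_density f x) \<partial>lborel)"
proof -
  have s: "sets \<mu> = sets borel"
    and c: "\<And>A. A \<in> sets borel \<Longrightarrow> A \<subseteq> W \<Longrightarrow>
      emeasure \<mu> (f ` A) = (\<integral>\<^sup>+x\<in>A. ennreal (volume_density f x) \<partial>lborel)"
    using \<mu> f by (auto simp: is_riemannian_volume_def)
  have fA: "f ` A \<in> sets borel" by (rule borel_image_local_parametrization[OF M f A])
  note m1 = volume_density_measurable[OF f A] and m2 = local_parametrization_measurable[OF f A]
  have hm: "h \<in> borel_measurable \<mu>" using h s by (simp cong: measurable_cong_sets)
  define N where "N = distr (density lborel (\<lambda>u. ennreal (indicator A u * volume_density f u))) borel (\<lambda>u. indicator A u *\<^sub>R f u)"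
  have eq: "density \<mu> (indicator (f ` A)) = N"
  proof (rule measure_eqI)
    show "sets (density \<mu> (indicator (f ` A))) = sets N" by (simp add: N_def s)
    fix E assume "E \<in> sets (density \<mu> (indicator (f ` A)))"
    then have E: "E \<in> sets borel" using s by simp
    have "emeasure (density \<mu> (indicator (f ` A))) E = (\<integral>\<^sup>+x. indicator (f ` A) x * indicator E x \<partial>\<mu>)"
      using fA E s by (intro emeasure_density) auto
    also have "\<dots> = (\<integral>\<^sup>+x. indicator (f ` (A \<inter> f -` E)) x \<partial>\<mu>)"
      by (rule nn_integral_cong) (auto simp: indicator_def)
    also have "\<dots> = emeasure \<mu> (f ` (A \<inter> f -` E))"
    proof (rule nn_integral_indicator)
      have "f ` (A \<inter> f -` E) = f ` A \<inter> E" by blast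
      then show "f ` (A \<inter> f -` E) \<in> sets \<mu>" using fA E s by simp
    qed
    also have "\<dots> = (\<integral>\<^sup>+x\<in>A \<inter> f -` E. ennreal (volume_density f x) \<partial>lborel)"
      by (rule c[OF borel_preimage_local_parametrization[OF f A E]]) (use A in blast)
    also have "\<dots> = (\<integral>\<^sup>+u. ennreal (indicator A u * volume_density f u) *
        indicator ((\<lambda>u. indicator A u *\<^sub>R f u) -` E) u \<partial>lborel)"
      by (rule nn_integral_cong) (auto simp: indicator_def)
    also have "\<dots> = emeasure (density lborel (\<lambda>u. ennreal (indicator A u * volume_density f u)))
        ((\<lambda>u. indicator A u *\<^sub>R f u) -` E)"
      using m1 measurable_sets[OF m2 E] by (intro emeasure_density[symmetric]) auto
    also have "\<dots> = emeasure N E"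
      unfolding N_def using m2 E by (simp add: emeasure_distr)
    finally show "emeasure (density \<mu> (indicator (f ` A))) E = emeasure N E" .
  qed
  have "(\<integral>\<^sup>+y\<in>f ` A. h y \<partial>\<mu>) = (\<integral>\<^sup>+y. h y \<partial>density \<mu> (indicator (f ` A)))"
    using fA s hm by (subst nn_integral_density) (auto simp: mult.commute)
  also have "\<dots> = (\<integral>\<^sup>+u. h (indicator A u *\<^sub>R f u) \<partial>density lborel (\<lambda>u. ennreal (indicator A u * volume_density f u)))"
    unfolding eq N_def using m2 h by (subst nn_integral_distr) auto
  also have "\<dots> = (\<integral>\<^sup>+u. ennreal (indicator A u * volume_density f u) * h (indicator A u *\<^sub>R f u) \<partial>lborel)"
  proof (rule nn_integral_density)
    show "(\<lambda>u. h (indicator A u *\<^sub>R f u)) \<in> borel_measurable lborel"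
      using measurable_compose[OF m2 h] by simp
  qed (use m1 in simp)
  also have "\<dots> = (\<integral>\<^sup>+x\<in>A. h (f x) * ennreal (volume_density f x) \<partial>lborel)"
    by (rule nn_integral_cong) (auto simp: indicator_def mult.commute)
  finally show ?thesis .
qed

section \<open>Integration near the diagonal\<close>

text \<open>A set of directions with positive Lebesgue measure, so averages over directions are
  plain Lebesgue integrals. It is compact, avoids \<open>0\<close> and is invariant under
  \<open>v\<close> to \<open>-v\<close>.\<close>

definition annulus :: "'a::euclidean_space set" where
  "annulus = {v. 1 \<le> norm v \<and> norm v \<le> 2}"

lemma annulus_uminus: "- v \<in> annulus \<longleftrightarrow> v \<in> annulus"
  by (simp add: annulus_def)

lemma compact_annulus: "compact (annulus :: 'a::euclidean_space set)"
proof -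
  have "annulus = cball 0 2 - ball (0 :: 'a) 1" by (auto simp: annulus_def)
  then show ?thesis using compact_diff[OF compact_cball open_ball] by metis
qed

lemma annulus_measurable[measurable]: "annulus \<in> sets borel"
  by (rule borel_compact[OF compact_annulus])

lemma measurable_fst_borel[measurable]:
  "fst \<in> borel_measurable (borel :: ('a::topological_space \<times> 'b::topological_space) measure)"
  by (intro borel_measurable_continuous_onI continuous_on_fst continuous_on_id)

lemma measurable_snd_borel[measurable]:
  "snd \<in> borel_measurable (borel :: ('a::topological_space \<times> 'b::topological_space) measure)"
  by (intro borel_measurable_continuous_onI continuous_on_snd continuous_on_id)

lemma nn_integral_lborel_scale:
  fixes f :: "'a::euclidean_space \<Rightarrow> ennreal"
  assumes [measurable]: "f \<in> borel_measurable borel" and c: "c \<noteq> 0"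
  shows "(\<integral>\<^sup>+x. f x \<partial>lborel) = ennreal (\<bar>c\<bar> ^ DIM('a)) * (\<integral>\<^sup>+x. f (t + c *\<^sub>R x) \<partial>lborel)"
  by (subst lborel_affine[OF c, of t])
    (simp add: nn_integral_density nn_integral_distr nn_integral_cmult)

text \<open>Polar coordinates in which the directions range over an annulus instead of the unit sphere.
  The constant \<open>ln 2\<close> is the integral of \<open>1 / s\<close> over the scales \<open>s\<close> that bring a given vector into the annulus.\<close>

lemma nn_integral_polar_annulus:
  fixes g :: "'a::euclidean_space \<Rightarrow> ennreal"
  assumes [measurable]: "g \<in> borel_measurable borel"
  shows "(\<integral>\<^sup>+v\<in>annulus. (\<integral>\<^sup>+s\<in>{0<..}. ennreal (s ^ (DIM('a) - 1)) * g (s *\<^sub>R v) \<partial>lborel) \<partial>lborel) =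
    ennreal (ln 2) * (\<integral>\<^sup>+w. g w \<partial>lborel)"
proof -
  have m1[measurable]: "(\<lambda>p::'a \<times> real. snd p *\<^sub>R fst p) \<in> borel_measurable borel"
    by (intro borel_measurable_continuous_onI continuous_intros)
  have [measurable]: "(\<lambda>p::'a \<times> real. g (snd p *\<^sub>R fst p)) \<in> borel_measurable borel"
    by (rule measurable_compose[OF m1]) measurable
  have m2: "(\<lambda>p::'a \<times> real. inverse (snd p) *\<^sub>R fst p) \<in> borel_measurable borel"
    by measurable
  have [measurable]: "(\<lambda>p::'a \<times> real. indicator annulus (inverse (snd p) *\<^sub>R fst p) :: ennreal) \<in> borel_measurable borel"
    by (rule measurable_compose[OF m2]) measurable
  have eqm: "borel_measurable (lborel \<Otimes>\<^sub>M lborel) = (borel_measurable borel :: ('a \<times> real \<Rightarrow> ennreal) set)"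
    unfolding lborel_prod by simp
  let ?n = "DIM('a)"
  have "(\<integral>\<^sup>+v\<in>annulus. (\<integral>\<^sup>+s\<in>{0<..}. ennreal (s ^ (?n - 1)) * g (s *\<^sub>R v) \<partial>lborel) \<partial>lborel) =
      (\<integral>\<^sup>+v. (\<integral>\<^sup>+s. indicator annulus v * (ennreal (s ^ (?n - 1)) * g (s *\<^sub>R v) * indicator {0<..} s) \<partial>lborel) \<partial>lborel)"
  proof (rule nn_integral_cong)
    fix v :: 'a
    have "(\<lambda>s. ennreal (s ^ (?n - 1)) * g (s *\<^sub>R v) * indicator {0<..} s) \<in> borel_measurable lborel"
      by measurable
    then show "(\<integral>\<^sup>+s\<in>{0<..}. ennreal (s ^ (?n - 1)) * g (s *\<^sub>R v) \<partial>lborel) * indicator annulus v =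
        (\<integral>\<^sup>+s. indicator annulus v * (ennreal (s ^ (?n - 1)) * g (s *\<^sub>R v) * indicator {0<..} s) \<partial>lborel)"
      by (simp add: nn_integral_cmult mult.commute)
  qed
  also have "\<dots> = (\<integral>\<^sup>+s. (\<integral>\<^sup>+v. indicator annulus v * (ennreal (s ^ (?n - 1)) * g (s *\<^sub>R v) * indicator {0<..} s) \<partial>lborel) \<partial>lborel)"
  proof (rule lborel_pair.Fubini'[symmetric])
    have "(\<lambda>p::'a \<times> real. indicator annulus (fst p) * (ennreal (snd p ^ (?n - 1)) * g (snd p *\<^sub>R fst p) * indicator {0<..} (snd p)))
        \<in> borel_measurable borel"
      by measurable
    then show "(\<lambda>(v, s). indicator annulus v * (ennreal (s ^ (?n - 1)) * g (s *\<^sub>R v) * indicator {0<..} s))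
        \<in> borel_measurable (lborel \<Otimes>\<^sub>M lborel)"
      unfolding eqm by (simp add: case_prod_unfold)
  qed
  \<comment> \<open>For fixed \<open>s\<close> the substitution \<open>w = s v\<close> contributes
    \<open>s^(-n)\<close> with \<open>n\<close> the dimension, which leaves the weight
    \<open>1 / s\<close>.\<close>
  also have "\<dots> = (\<integral>\<^sup>+s. (\<integral>\<^sup>+w. ennreal (inverse s) * indicator {0<..} s * indicator annulus (inverse s *\<^sub>R w) * g w \<partial>lborel) \<partial>lborel)"
  proof (rule nn_integral_cong)
    fix s :: real
    show "(\<integral>\<^sup>+v. indicator annulus v * (ennreal (s ^ (?n - 1)) * g (s *\<^sub>R v) * indicator {0<..} s) \<partial>lborel) =
        (\<integral>\<^sup>+w. ennreal (inverse s) * indicator {0<..} s * indicator annulus (inverse s *\<^sub>R w) * g w \<partial>lborel)"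
    proof (cases "s > 0")
      case True
      have m3: "(\<lambda>w::'a. indicator annulus (inverse s *\<^sub>R w) :: ennreal) \<in> borel_measurable borel"
        by (rule measurable_compose[of _ borel borel]) measurable
      have "(\<integral>\<^sup>+w. ennreal (inverse s) * indicator {0<..} s * indicator annulus (inverse s *\<^sub>R w) * g w \<partial>lborel) =
          ennreal (\<bar>s\<bar> ^ ?n) * (\<integral>\<^sup>+v. ennreal (inverse s) * indicator {0<..} s * indicator annulus (inverse s *\<^sub>R (0 + s *\<^sub>R v)) * g (0 + s *\<^sub>R v) \<partial>lborel)"
        by (rule nn_integral_lborel_scale) (use True m3 in auto)
      also have "\<dots> = ennreal (\<bar>s\<bar> ^ ?n) * (\<integral>\<^sup>+v. ennreal (inverse s) * (indicator annulus v * g (s *\<^sub>R v)) \<partial>lborel)"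
        using True by (simp add: mult.assoc)
      also have "\<dots> = (\<integral>\<^sup>+v. ennreal (\<bar>s\<bar> ^ ?n) * (ennreal (inverse s) * (indicator annulus v * g (s *\<^sub>R v))) \<partial>lborel)"
        by (rule nn_integral_cmult[symmetric]) measurable
      also have "\<dots> = (\<integral>\<^sup>+v. indicator annulus v * (ennreal (s ^ (?n - 1)) * g (s *\<^sub>R v) * indicator {0<..} s) \<partial>lborel)"
      proof (rule nn_integral_cong)
        fix v :: 'a
        have "\<bar>s\<bar> ^ ?n * inverse s = s ^ (?n - 1)"
          using True DIM_positive[where 'a='a] by (cases "?n") (auto simp: field_simps)
        then have "ennreal (\<bar>s\<bar> ^ ?n) * ennreal (inverse s) = ennreal (s ^ (?n - 1))"
          using True by (simp flip: ennreal_mult')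
        then have "ennreal (\<bar>s\<bar> ^ ?n) * (ennreal (inverse s) * (indicator annulus v * g (s *\<^sub>R v))) =
            ennreal (s ^ (?n - 1)) * (indicator annulus v * g (s *\<^sub>R v))"
          by (simp only: mult.assoc[symmetric])
        then show "ennreal (\<bar>s\<bar> ^ ?n) * (ennreal (inverse s) * (indicator annulus v * g (s *\<^sub>R v))) =
            indicator annulus v * (ennreal (s ^ (?n - 1)) * g (s *\<^sub>R v) * indicator {0<..} s)"
          using True by (simp only: indicator_simps mult_1_right greaterThan_iff mult.left_commute)
      qed
      finally show ?thesis ..
    qed simp
  qed
  also have "\<dots> = (\<integral>\<^sup>+w. (\<integral>\<^sup>+s. ennreal (inverse s) * indicator {0<..} s * indicator annulus (inverse s *\<^sub>R w) * g w \<partial>lborel) \<partial>lborel)"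
  proof (rule lborel_pair.Fubini')
    have "(\<lambda>p::'a \<times> real. ennreal (inverse (snd p)) * indicator {0<..} (snd p) * indicator annulus (inverse (snd p) *\<^sub>R fst p) * g (fst p))
        \<in> borel_measurable borel"
      by measurable
    then show "(\<lambda>(w, s). ennreal (inverse s) * indicator {0<..} s * indicator annulus (inverse s *\<^sub>R w) * g w)
        \<in> borel_measurable (lborel \<Otimes>\<^sub>M lborel)"
      unfolding eqm by (simp add: case_prod_unfold)
  qed
  also have "\<dots> = (\<integral>\<^sup>+w. ennreal (ln 2) * g w \<partial>lborel)"
  proof (rule nn_integral_cong_AE)
    have "AE w :: 'a in lborel. w \<noteq> 0" by (rule AE_lborel_singleton)
    then show "AE w in lborel. (\<integral>\<^sup>+s. ennreal (inverse s) * indicator {0<..} s * indicator annulus (inverse s *\<^sub>R w) * g w \<partial>lborel) = ennreal (ln 2) * g w"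
    proof eventually_elim
      case (elim w)
      \<comment> \<open>The scales \<open>s\<close> with \<open>w / s\<close> in the annulus form
        the interval from \<open>|w| / 2\<close> to \<open>|w|\<close>, of logarithmic length
        \<open>ln 2\<close>.\<close>
      then have w: "norm w > 0" by simp
      have "(\<integral>\<^sup>+s. ennreal (inverse s) * indicator {0<..} s * indicator annulus (inverse s *\<^sub>R w) * g w \<partial>lborel) =
          (\<integral>\<^sup>+s. ennreal (inverse s) * indicator {norm w / 2..norm w} s * g w \<partial>lborel)"
      proof (rule nn_integral_cong)
        fix s :: real
        have "s > 0 \<and> inverse s *\<^sub>R w \<in> annulus \<longleftrightarrow> s \<in> {norm w / 2..norm w}"
        proof (cases "s > 0")
          case False
          then have "s < norm w / 2" using w by linarith
          then show ?thesis using False by simp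
        qed (auto simp: annulus_def field_simps)
        then show "ennreal (inverse s) * indicator {0<..} s * indicator annulus (inverse s *\<^sub>R w) * g w =
            ennreal (inverse s) * indicator {norm w / 2..norm w} s * g w"
          by (auto simp: indicator_def)
      qed
      also have "\<dots> = (\<integral>\<^sup>+s. ennreal (inverse s) * indicator {norm w / 2..norm w} s \<partial>lborel) * g w"
        by (rule nn_integral_multc) measurable
      also have "(\<integral>\<^sup>+s. ennreal (inverse s) * indicator {norm w / 2..norm w} s \<partial>lborel) = ennreal (ln (norm w) - ln (norm w / 2))"
      proof (rule nn_integral_FTC_Icc)
        fix s assume "s \<in> {norm w / 2..norm w}"
        then have "norm w / 2 \<le> s" by simp
        then have s: "s > 0" using w by linarith
        then show "(ln has_real_derivative inverse s) (at s)" by (rule DERIV_ln)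
        show "0 \<le> inverse s" using s by simp
      qed simp_all
      also have "ln (norm w) - ln (norm w / 2) = ln 2" using w by (simp add: ln_div)
      finally show ?case .
    qed
  qed
  also have "\<dots> = ennreal (ln 2) * (\<integral>\<^sup>+w. g w \<partial>lborel)" by (rule nn_integral_cmult) measurable
  finally show ?thesis .
qed

text \<open>Two uniform distances are combined: \<open>d0\<close> separates the image of
  \<open>K\<close> from the part of \<open>M\<close> outside the image of \<open>V\<close>, and
  \<open>d1\<close> comes from uniform continuity of the inverse parametrization on the image of the
  compact set \<open>K2\<close>.\<close>

lemma near_points_in_chart:
  fixes f :: "real ^ 'm::finite \<Rightarrow> 'a::euclidean_space"
  assumes M: "compact M" and f: "local_parametrization M W f" and K: "compact K" "K \<subseteq> W"
    and s: "s > 0" "\<And>u w. u \<in> K \<Longrightarrow> norm w \<le> s \<Longrightarrow> u + w \<in> W"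
  obtains d where "d > 0"
    "\<And>u y. u \<in> K \<Longrightarrow> y \<in> M \<Longrightarrow> norm (f u - y) \<le> d \<Longrightarrow> \<exists>w. norm w < s \<and> y = f (u + w)"
proof -
  note F = local_parametrizationD[OF f]
  define V where "V = (\<Union>u\<in>K. ball u s)"
  define K2 where "K2 = (\<lambda>p. fst p + snd p) ` (K \<times> cball 0 s)"
  have K2: "compact K2" unfolding K2_def
    by (intro compact_continuous_image compact_Times K compact_cball continuous_intros)
  have K2W: "K2 \<subseteq> W" using s(2) by (auto simp: K2_def)
  have VK2: "V \<subseteq> K2"
  proof
    fix z assume "z \<in> V"
    then obtain u where "u \<in> K" "dist u z < s" by (auto simp: V_def)
    then show "z \<in> K2" unfolding K2_def
      by (intro image_eqI[of _ _ "(u, z - u)"]) (auto simp: dist_norm norm_minus_commute)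
  qed
  have KV: "K \<subseteq> V" using s(1) by (auto simp: V_def)
  have "openin (top_of_set M) (f ` V)"
    by (rule openin_image_local_parametrization[OF f]) (use VK2 K2W in \<open>auto simp: V_def\<close>)
  then obtain U where U: "open U" "f ` V = M \<inter> U" by (auto simp: openin_open)
  have "compact (f ` K)"
    by (intro compact_continuous_image continuous_on_subset[OF F(6)] K)
  moreover have "closed (M - U)" using M U(1) by (simp add: closed_Diff compact_imp_closed)
  moreover have "f ` K \<inter> (M - U) = {}" using KV U(2) by blast
  ultimately obtain d0 where d0: "d0 > 0" "\<And>x y. x \<in> f ` K \<Longrightarrow> y \<in> M - U \<Longrightarrow> d0 \<le> dist x y"
    using separate_compact_closed by metis
  have "compact (f ` K2)"
    by (intro compact_continuous_image continuous_on_subset[OF F(6)] K2 K2W)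
  moreover have "continuous_on (f ` K2) (inv_into W f)"
    by (rule continuous_on_subset[OF F(10)]) (use K2W in blast)
  ultimately have "uniformly_continuous_on (f ` K2) (inv_into W f)" by (rule compact_uniformly_continuous[rotated])
  then obtain d1 where d1: "d1 > 0" "\<And>x y. x \<in> f ` K2 \<Longrightarrow> y \<in> f ` K2 \<Longrightarrow> dist y x < d1 \<Longrightarrow>
      dist (inv_into W f y) (inv_into W f x) < s"
    unfolding uniformly_continuous_on_def using s(1) by metis
  show ?thesis
  proof (rule that[of "min d0 d1 / 2"])
    show "min d0 d1 / 2 > 0" using d0 d1 by simp
    fix u y assume u: "u \<in> K" and y: "y \<in> M" and d: "norm (f u - y) \<le> min d0 d1 / 2"
    have "y \<in> f ` V"
    proof (rule ccontr)
      assume "y \<notin> f ` V"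
      then have "d0 \<le> dist (f u) y" using d0(2)[of "f u" y] u y U(2) by blast
      then show False using d d0(1) by (simp add: dist_norm min_def split: if_splits)
    qed
    then obtain z where z: "z \<in> V" "y = f z" by blast
    then have "dist (inv_into W f (f z)) (inv_into W f (f u)) < s"
      using u KV VK2 d d1(1) d0(1) by (intro d1(2)) (auto simp: dist_norm norm_minus_commute min_def split: if_splits)
    then have "norm (z - u) < s"
      using inv_into_f_f[OF F(5)] z(1) u VK2 K2W K(2) by (simp add: dist_norm subset_iff)
    then show "\<exists>w. norm w < s \<and> y = f (u + w)" using z by (intro exI[of _ "z - u"]) simp
  qed
qed

text \<open>For kernels that vanish beyond a small distance the second point stays in the chart of
  the first, so the inner integral over \<open>M\<close> can be taken in coordinates centred at
  \<open>u\<close> and then in the polar form of \<open>nn_integral_polar_annulus\<close>, whose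
  constant \<open>ln 2\<close> reappears as a divisor. The margin is \<open>2 * s\<close> since
  directions have norm up to \<open>2\<close>.\<close>

lemma nn_integral_near_diagonal:
  fixes f :: "real ^ 'm::finite \<Rightarrow> 'a::euclidean_space"
  assumes cl: "closed_submanifold TYPE('m) M" and f: "local_parametrization M W f" and K: "compact K" "K \<subseteq> W"
    and s: "s > 0" "\<And>u w. u \<in> K \<Longrightarrow> norm w \<le> 2 * s \<Longrightarrow> u + w \<in> W"
  obtains d where "d > 0"
    "\<And>B k. B \<in> sets borel \<Longrightarrow> B \<subseteq> K \<Longrightarrow> (\<lambda>p. k (fst p) (snd p)) \<in> borel_measurable borel \<Longrightarrow>
      (\<And>x y. k x y \<noteq> 0 \<Longrightarrow> norm (x - y) \<le> d) \<Longrightarrow>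
      (\<integral>\<^sup>+x\<in>f ` B. (\<integral>\<^sup>+y\<in>M. k x y \<partial>riemannian_volume TYPE('m) M) \<partial>riemannian_volume TYPE('m) M) =
      (\<integral>\<^sup>+u\<in>B. (\<integral>\<^sup>+v\<in>annulus. (\<integral>\<^sup>+r\<in>{0<..<s}.
         ennreal (volume_density f u * volume_density f (u + r *\<^sub>R v) * r ^ (CARD('m) - 1) / ln 2) *
         k (f u) (f (u + r *\<^sub>R v)) \<partial>lborel) \<partial>lborel) \<partial>lborel)"
proof -
  have M: "compact M" using cl by (simp add: closed_submanifold_def)
  note F = local_parametrizationD[OF f]
  let ?\<mu> = "riemannian_volume TYPE('m) M"
  note v = is_riemannian_volume_riemannian_volume[OF cl]
  have sm: "sets ?\<mu> = sets borel" using v by (simp add: is_riemannian_volume_def)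
  interpret finite_measure ?\<mu> by (rule riemannian_volume_finite[OF cl])
  have sr: "u + w \<in> W" if "u \<in> K" "norm w \<le> s" for u w using s that by auto
  obtain d where d: "d > 0"
    "\<And>u y. u \<in> K \<Longrightarrow> y \<in> M \<Longrightarrow> norm (f u - y) \<le> d \<Longrightarrow> \<exists>w. norm w < s \<and> y = f (u + w)"
    using near_points_in_chart[OF M f K s(1) sr] by blast
  have WB: "W \<in> sets borel" using F(1) by simp
  have MB: "M \<in> sets borel" using M by (rule borel_compact)
  show ?thesis
  proof (rule that[OF d(1)])
    fix B and k :: "'a \<Rightarrow> 'a \<Rightarrow> ennreal"
    assume B: "B \<in> sets borel" "B \<subseteq> K" and km: "(\<lambda>p. k (fst p) (snd p)) \<in> borel_measurable borel"
      and ks: "\<And>x y. k x y \<noteq> 0 \<Longrightarrow> norm (x - y) \<le> d"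
    have ky[measurable]: "k x \<in> borel_measurable borel" for x
    proof -
      have "(\<lambda>y. (x, y)) \<in> borel_measurable borel"
        by (intro borel_measurable_continuous_onI continuous_intros)
      from measurable_compose[OF this km] show ?thesis by simp
    qed
    have inner: "(\<integral>\<^sup>+y\<in>M. k (f u) y \<partial>?\<mu>) * ennreal (volume_density f u) =
      (\<integral>\<^sup>+v\<in>annulus. (\<integral>\<^sup>+r\<in>{0<..<s}.
         ennreal (volume_density f u * volume_density f (u + r *\<^sub>R v) * r ^ (CARD('m) - 1) / ln 2) *
         k (f u) (f (u + r *\<^sub>R v)) \<partial>lborel) \<partial>lborel)" if u: "u \<in> B" for u
    proof -
      have uK: "u \<in> K" using u B(2) by blast
      define g where "g z = ennreal (indicator W z * volume_density f z) * k (f u) (indicator W z *\<^sub>R f z)" for z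
      have g[measurable]: "g \<in> borel_measurable borel"
        unfolding g_def[abs_def] using volume_density_measurable[OF f WB order_refl]
          measurable_compose[OF local_parametrization_measurable[OF f WB order_refl] ky] by simp
      have "(\<integral>\<^sup>+y\<in>M. k (f u) y \<partial>?\<mu>) = (\<integral>\<^sup>+y\<in>f ` W. k (f u) y \<partial>?\<mu>)"
      proof (rule nn_integral_cong)
        fix y
        have "y \<in> f ` W" if "y \<in> M" "k (f u) y \<noteq> 0"
          using d(2)[OF uK that(1) ks[OF that(2)]] sr[OF uK] by (metis image_eqI less_imp_le)
        then show "k (f u) y * indicator M y = k (f u) y * indicator (f ` W) y"
          using F(7) by (auto simp: indicator_def)
      qed
      also have "\<dots> = (\<integral>\<^sup>+z\<in>W. k (f u) (f z) * ennreal (volume_density f z) \<partial>lborel)"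
        by (rule nn_integral_local_parametrization[OF M v f WB order_refl ky])
      also have "\<dots> = (\<integral>\<^sup>+z. g z \<partial>lborel)"
        by (rule nn_integral_cong) (auto simp: g_def indicator_def mult.commute)
      also have "\<dots> = (\<integral>\<^sup>+w. g (u + w) \<partial>lborel)"
        using nn_integral_lborel_scale[of g 1 u] g by simp
      finally have 1: "(\<integral>\<^sup>+y\<in>M. k (f u) y \<partial>?\<mu>) = (\<integral>\<^sup>+w. g (u + w) \<partial>lborel)" .
      have gu: "(\<lambda>w. g (u + w)) \<in> borel_measurable borel" by measurable
      \<comment> \<open>The cut-off \<open>r < s\<close> loses nothing: a pair with nonzero kernel
        has a coordinate difference of norm below \<open>s\<close>, while
        \<open>|r v| \<ge> r\<close>.\<close>
      have g0: "g (u + r *\<^sub>R v) = 0" if "v \<in> annulus" "r \<ge> s" for v r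
      proof (rule ccontr)
        assume nz: "g (u + r *\<^sub>R v) \<noteq> 0"
        then have inW: "u + r *\<^sub>R v \<in> W" by (cases "u + r *\<^sub>R v \<in> W") (auto simp: g_def)
        then have "k (f u) (f (u + r *\<^sub>R v)) \<noteq> 0" using nz by (auto simp: g_def)
        then obtain w where w: "norm w < s" "f (u + r *\<^sub>R v) = f (u + w)"
          using d(2)[OF uK _ ks] F(7) inW by blast
        then have "u + r *\<^sub>R v = u + w"
          using F(5) inW sr[OF uK] by (auto dest!: inj_onD)
        then have "r * norm v < s" using w(1) s(1) that(2) by (metis abs_of_nonneg add_left_cancel less_le_trans less_imp_le norm_scaleR)
        moreover have "r * norm v \<ge> r * 1" using that s(1) by (intro mult_left_mono) (auto simp: annulus_def)
        ultimately show False using that by simp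
      qed
      have "ennreal (ln 2) * (\<integral>\<^sup>+w. g (u + w) \<partial>lborel) =
          (\<integral>\<^sup>+v\<in>annulus. (\<integral>\<^sup>+r\<in>{0<..}. ennreal (r ^ (CARD('m) - 1)) * g (u + r *\<^sub>R v) \<partial>lborel) \<partial>lborel)"
        using nn_integral_polar_annulus[OF gu] by simp
      then have "ennreal (volume_density f u / ln 2) * (ennreal (ln 2) * (\<integral>\<^sup>+w. g (u + w) \<partial>lborel)) =
          ennreal (volume_density f u / ln 2) * (\<integral>\<^sup>+v\<in>annulus. (\<integral>\<^sup>+r\<in>{0<..}. ennreal (r ^ (CARD('m) - 1)) * g (u + r *\<^sub>R v) \<partial>lborel) \<partial>lborel)"
        by simp
      moreover have ln2: "ennreal (volume_density f u / ln 2) * ennreal (ln 2) = ennreal (volume_density f u)"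
        by (subst ennreal_mult''[symmetric]) simp_all
      ultimately have "(\<integral>\<^sup>+w. g (u + w) \<partial>lborel) * ennreal (volume_density f u) =
          ennreal (volume_density f u / ln 2) * (\<integral>\<^sup>+v\<in>annulus. (\<integral>\<^sup>+r\<in>{0<..}. ennreal (r ^ (CARD('m) - 1)) * g (u + r *\<^sub>R v) \<partial>lborel) \<partial>lborel)"
        by (simp only: ln2[symmetric] mult_ac)
      also have "\<dots> = (\<integral>\<^sup>+v. ennreal (volume_density f u / ln 2) * ((\<integral>\<^sup>+r\<in>{0<..}. ennreal (r ^ (CARD('m) - 1)) * g (u + r *\<^sub>R v) \<partial>lborel) * indicator annulus v) \<partial>lborel)"
      proof (rule nn_integral_cmult[symmetric])
        have mm: "(\<lambda>p. u + snd p *\<^sub>R fst p :: real ^ 'm) \<in> borel_measurable borel"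
          by (intro borel_measurable_continuous_onI continuous_intros)
        have "(\<lambda>p::(real ^ 'm) \<times> real. ennreal (snd p ^ (CARD('m) - 1)) * g (u + snd p *\<^sub>R fst p) * indicator {0<..} (snd p)) \<in> borel_measurable borel"
          using measurable_compose[OF mm g] by measurable
        then have "(\<lambda>(v, r). ennreal (r ^ (CARD('m) - 1)) * g (u + r *\<^sub>R v) * indicator {0<..} r) \<in> borel_measurable (lborel \<Otimes>\<^sub>M lborel)"
          by (simp add: case_prod_unfold lborel_prod)
        then have "(\<lambda>v. \<integral>\<^sup>+r\<in>{0<..}. ennreal (r ^ (CARD('m) - 1)) * g (u + r *\<^sub>R v) \<partial>lborel) \<in> borel_measurable lborel"
          by (rule lborel.borel_measurable_nn_integral)
        then show "(\<lambda>v. (\<integral>\<^sup>+r\<in>{0<..}. ennreal (r ^ (CARD('m) - 1)) * g (u + r *\<^sub>R v) \<partial>lborel) * indicator annulus v) \<in> borel_measurable lborel"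
          by measurable
      qed
      also have "\<dots> = (\<integral>\<^sup>+v\<in>annulus. (\<integral>\<^sup>+r\<in>{0<..<s}.
         ennreal (volume_density f u * volume_density f (u + r *\<^sub>R v) * r ^ (CARD('m) - 1) / ln 2) *
         k (f u) (f (u + r *\<^sub>R v)) \<partial>lborel) \<partial>lborel)"
      proof (rule nn_integral_cong)
        fix v :: "real ^ 'm"
        show "ennreal (volume_density f u / ln 2) * ((\<integral>\<^sup>+r\<in>{0<..}. ennreal (r ^ (CARD('m) - 1)) * g (u + r *\<^sub>R v) \<partial>lborel) * indicator annulus v) =
          (\<integral>\<^sup>+r\<in>{0<..<s}. ennreal (volume_density f u * volume_density f (u + r *\<^sub>R v) * r ^ (CARD('m) - 1) / ln 2) *
             k (f u) (f (u + r *\<^sub>R v)) \<partial>lborel) * indicator annulus v"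
        proof (cases "v \<in> annulus")
          case True
          have mr: "(\<lambda>r. u + r *\<^sub>R v) \<in> borel_measurable borel"
            by (intro borel_measurable_continuous_onI continuous_intros)
          have "ennreal (volume_density f u / ln 2) * (\<integral>\<^sup>+r\<in>{0<..}. ennreal (r ^ (CARD('m) - 1)) * g (u + r *\<^sub>R v) \<partial>lborel) =
              (\<integral>\<^sup>+r. ennreal (volume_density f u / ln 2) * (ennreal (r ^ (CARD('m) - 1)) * g (u + r *\<^sub>R v) * indicator {0<..} r) \<partial>lborel)"
            by (rule nn_integral_cmult[symmetric]) (use measurable_compose[OF mr g] in measurable)
          also have "\<dots> = (\<integral>\<^sup>+r\<in>{0<..<s}. ennreal (volume_density f u * volume_density f (u + r *\<^sub>R v) * r ^ (CARD('m) - 1) / ln 2) *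
             k (f u) (f (u + r *\<^sub>R v)) \<partial>lborel)"
          proof (rule nn_integral_cong)
            fix r
            show "ennreal (volume_density f u / ln 2) * (ennreal (r ^ (CARD('m) - 1)) * g (u + r *\<^sub>R v) * indicator {0<..} r) =
                ennreal (volume_density f u * volume_density f (u + r *\<^sub>R v) * r ^ (CARD('m) - 1) / ln 2) *
                k (f u) (f (u + r *\<^sub>R v)) * indicator {0<..<s} r"
            proof (cases "r \<in> {0<..<s}")
              case True
              have "norm (r *\<^sub>R v) \<le> 2 * s"
                using True \<open>v \<in> annulus\<close> mult_mono[of r s "norm v" 2] by (simp add: annulus_def)
              then have inW: "u + r *\<^sub>R v \<in> W" by (rule s(2)[OF uK])
              have uW: "u \<in> W" using uK K(2) by blast
              have "ennreal (volume_density f u * volume_density f (u + r *\<^sub>R v) * r ^ (CARD('m) - 1) / ln 2) =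
                  ennreal (volume_density f u / ln 2 * (r ^ (CARD('m) - 1) * volume_density f (u + r *\<^sub>R v)))"
                by (simp add: mult_ac)
              also have "\<dots> = ennreal (volume_density f u / ln 2) * (ennreal (r ^ (CARD('m) - 1)) * ennreal (volume_density f (u + r *\<^sub>R v)))"
              proof -
                have nn: "0 \<le> volume_density f u / ln 2" "0 \<le> r ^ (CARD('m) - 1)" "0 \<le> volume_density f (u + r *\<^sub>R v)"
                  using True volume_density_pos[OF f inW] volume_density_pos[OF f uW] by simp_all
                show ?thesis
                  by (simp only: ennreal_mult[OF nn(1) mult_nonneg_nonneg[OF nn(2,3)]] ennreal_mult[OF nn(2,3)])
              qed
              finally show ?thesis using True inW by (simp add: g_def mult.assoc)
            next
              case False
              then show ?thesis using g0[OF \<open>v \<in> annulus\<close>, of r] by (cases "r > 0") auto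
            qed
          qed
          finally show ?thesis using True by simp
        qed simp
      qed
      finally show ?thesis unfolding 1 .
    qed
    have H: "(\<lambda>x. \<integral>\<^sup>+y\<in>M. k x y \<partial>?\<mu>) \<in> borel_measurable borel"
    proof -
      have s2: "sets ((borel :: 'a measure) \<Otimes>\<^sub>M ?\<mu>) = sets borel"
        using sets_pair_measure_cong[OF refl sm, of "borel :: 'a measure"] unfolding borel_prod .
      have "(\<lambda>p. k (fst p) (snd p) * indicator M (snd p)) \<in> borel_measurable borel"
        using km MB by measurable
      then have "(\<lambda>(x, y). k x y * indicator M y) \<in> borel_measurable (borel \<Otimes>\<^sub>M ?\<mu>)"
        by (simp add: case_prod_unfold cong: measurable_cong_sets[OF s2 refl])
      then show ?thesis by (rule borel_measurable_nn_integral)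
    qed
    have BW: "B \<subseteq> W" using B(2) K(2) by blast
    have "(\<integral>\<^sup>+x\<in>f ` B. (\<integral>\<^sup>+y\<in>M. k x y \<partial>?\<mu>) \<partial>?\<mu>) =
        (\<integral>\<^sup>+u\<in>B. (\<integral>\<^sup>+y\<in>M. k (f u) y \<partial>?\<mu>) * ennreal (volume_density f u) \<partial>lborel)"
      by (rule nn_integral_local_parametrization[OF M v f B(1) BW H])
    also have "\<dots> = (\<integral>\<^sup>+u\<in>B. (\<integral>\<^sup>+v\<in>annulus. (\<integral>\<^sup>+r\<in>{0<..<s}.
         ennreal (volume_density f u * volume_density f (u + r *\<^sub>R v) * r ^ (CARD('m) - 1) / ln 2) *
         k (f u) (f (u + r *\<^sub>R v)) \<partial>lborel) \<partial>lborel) \<partial>lborel)"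
    proof (rule nn_integral_cong)
      fix u
      show "(\<integral>\<^sup>+y\<in>M. k (f u) y \<partial>?\<mu>) * ennreal (volume_density f u) * indicator B u =
        (\<integral>\<^sup>+v\<in>annulus. (\<integral>\<^sup>+r\<in>{0<..<s}.
         ennreal (volume_density f u * volume_density f (u + r *\<^sub>R v) * r ^ (CARD('m) - 1) / ln 2) *
         k (f u) (f (u + r *\<^sub>R v)) \<partial>lborel) \<partial>lborel) * indicator B u"
        by (cases "u \<in> B") (simp_all only: inner indicator_simps mult_zero_right not_False_eq_True)
    qed
    finally show "(\<integral>\<^sup>+x\<in>f ` B. (\<integral>\<^sup>+y\<in>M. k x y \<partial>?\<mu>) \<partial>?\<mu>) = \<dots>" .
  qed
qed

section \<open>Radial integrals over shells and averages over directions\<close>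

lemma family_smoothI: "(\<And>k. family_C k X d F) \<Longrightarrow> family_smooth X d F"
  by (simp add: family_smooth_def)

lemma family_smoothD: "family_smooth X d F \<Longrightarrow> family_C k X d F"
  by (simp add: family_smooth_def)

lemma family_smooth_reparam:
  "family_smooth X d F \<Longrightarrow> continuous_on Y \<phi> \<Longrightarrow> \<phi> ` Y \<subseteq> X \<Longrightarrow> e \<le> d \<Longrightarrow> family_smooth Y e (\<lambda>y. F (\<phi> y))"
  unfolding family_smooth_def using family_C_reparam by blast

lemma family_smooth_restrict: "family_smooth X d F \<Longrightarrow> e \<le> d \<Longrightarrow> family_smooth X e F"
  using family_smooth_reparam[of X d F X "\<lambda>x. x" e] by simp

text \<open>An affine substitution onto \<open>[0, 1]\<close> moves end points that depend on
  \<open>t\<close> into the integrand, where smoothness in \<open>t\<close> can be seen.\<close>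

lemma nn_integral_shell:
  fixes \<gamma> :: "real \<Rightarrow> real"
  assumes S: "0 \<le> S1" "S1 \<le> S2" "S2 < s" and \<gamma>: "continuous_on {0<..<s} \<gamma>"
  shows "(\<integral>\<^sup>+r\<in>{0<..<s}. ennreal (\<gamma> r) * indicator {S1<..S2} r \<partial>lborel) =
    (\<integral>\<^sup>+a\<in>{0..1}. ennreal ((S2 - S1) * \<gamma> (S1 + (S2 - S1) * a)) \<partial>lborel)"
proof (cases "S1 = S2")
  case False
  define c where "c = S2 - S1"
  have c: "c > 0" using False S by (simp add: c_def)
  define g where "g r = ennreal (indicator {0<..<s} r *\<^sub>R \<gamma> r) * indicator {S1<..S2} r" for r
  have [measurable]: "(\<lambda>r. indicator {0<..<s} r *\<^sub>R \<gamma> r) \<in> borel_measurable borel"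
    by (rule borel_measurable_continuous_on_indicator[OF _ \<gamma>]) simp
  have g[measurable]: "g \<in> borel_measurable borel" unfolding g_def[abs_def] by measurable
  have "(\<integral>\<^sup>+r\<in>{0<..<s}. ennreal (\<gamma> r) * indicator {S1<..S2} r \<partial>lborel) = (\<integral>\<^sup>+r. g r \<partial>lborel)"
    by (rule nn_integral_cong) (auto simp: g_def indicator_def)
  also have "\<dots> = ennreal \<bar>c\<bar> * (\<integral>\<^sup>+a. g (S1 + c * a) \<partial>lborel)"
    by (rule nn_integral_real_affine) (use c in auto)
  also have "\<dots> = (\<integral>\<^sup>+a. ennreal \<bar>c\<bar> * g (S1 + c * a) \<partial>lborel)"
    by (rule nn_integral_cmult[symmetric]) measurable
  also have "\<dots> = (\<integral>\<^sup>+a\<in>{0..1}. ennreal (c * \<gamma> (S1 + c * a)) \<partial>lborel)"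
  proof (rule nn_integral_cong_AE)
    \<comment> \<open>The shell is open at its lower end, so the single point \<open>a = 0\<close>
      has to be left out.\<close>
    have "AE a :: real in lborel. a \<noteq> 0" by (rule AE_lborel_singleton)
    then show "AE a in lborel. ennreal \<bar>c\<bar> * g (S1 + c * a) = ennreal (c * \<gamma> (S1 + c * a)) * indicator {0..1} a"
    proof eventually_elim
      case (elim a)
      have in1: "S1 + c * a \<in> {S1<..S2} \<longleftrightarrow> a \<in> {0..1}"
      proof -
        have "S2 = S1 + c * 1" by (simp add: c_def)
        then have "S1 + c * a \<in> {S1<..S2} \<longleftrightarrow> 0 < c * a \<and> c * a \<le> c * 1" by auto
        then show ?thesis using c elim by (auto simp: zero_less_mult_iff)
      qed
      show ?case
      proof (cases "a \<in> {0..1}")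
        case True
        then have "S1 + c * a \<in> {S1<..S2}" using in1 by blast
        then have "S1 + c * a \<in> {0<..<s}" using S by auto
        then show ?thesis using True in1 c by (simp add: g_def ennreal_mult')
      next
        case False
        then have "S1 + c * a \<notin> {S1<..S2}" using in1 by blast
        then show ?thesis using False by (simp add: g_def)
      qed
    qed
  qed
  finally show ?thesis by (simp add: c_def)
qed simp

lemma nn_integral_lborel_prod:
  fixes F :: "('a::euclidean_space \<times> 'b::euclidean_space) \<times> 'c::euclidean_space \<Rightarrow> ennreal"
  assumes F: "F \<in> borel_measurable borel"
  shows "(\<integral>\<^sup>+z. F z \<partial>lborel) = (\<integral>\<^sup>+u. (\<integral>\<^sup>+v. (\<integral>\<^sup>+a. F ((u, v), a) \<partial>lborel) \<partial>lborel) \<partial>lborel)"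
    and "(\<lambda>v. \<integral>\<^sup>+a. F ((u, v), a) \<partial>lborel) \<in> borel_measurable borel"
proof -
  have F': "F \<in> borel_measurable (lborel \<Otimes>\<^sub>M lborel)" using F by (simp add: lborel_prod)
  have m: "(\<lambda>p. \<integral>\<^sup>+a. F (p, a) \<partial>lborel) \<in> borel_measurable lborel"
    by (rule lborel.borel_measurable_nn_integral_fst[OF F'])
  then have m': "(\<lambda>p. \<integral>\<^sup>+a. F (p, a) \<partial>lborel) \<in> borel_measurable (lborel \<Otimes>\<^sub>M lborel)" by (simp add: lborel_prod)
  have "(\<integral>\<^sup>+z. F z \<partial>lborel) = (\<integral>\<^sup>+p. (\<integral>\<^sup>+a. F (p, a) \<partial>lborel) \<partial>lborel)"
    using lborel.nn_integral_fst[OF F'] by (simp add: lborel_prod)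
  also have "\<dots> = (\<integral>\<^sup>+u. (\<integral>\<^sup>+v. (\<integral>\<^sup>+a. F ((u, v), a) \<partial>lborel) \<partial>lborel) \<partial>lborel)"
    using lborel.nn_integral_fst[OF m'] by (simp add: lborel_prod)
  finally show "(\<integral>\<^sup>+z. F z \<partial>lborel) = (\<integral>\<^sup>+u. (\<integral>\<^sup>+v. (\<integral>\<^sup>+a. F ((u, v), a) \<partial>lborel) \<partial>lborel) \<partial>lborel)" .
  have "(\<lambda>v::'b. (u, v)) \<in> borel_measurable borel"
    by (intro borel_measurable_continuous_onI continuous_intros)
  from measurable_compose[OF this] m
  show "(\<lambda>v. \<integral>\<^sup>+a. F ((u, v), a) \<partial>lborel) \<in> borel_measurable borel" by simp
qed

text \<open>Averages \<open>H\<close> over base point, direction and radial variable.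
  Differentiation under the integral makes the average smooth, and the measure-preserving change of
  \<open>v\<close> to \<open>-v\<close> turns the reversal symmetry of \<open>H\<close> into
  evenness. The factor \<open>C\<close> stays outside because in its uses it may be singular at
  \<open>t = 0\<close>. A family over \<open>{0::real}\<close> encodes a single smooth
  function.\<close>

lemma symmetric_average:
  fixes H :: "((real ^ 'm::finite) \<times> (real ^ 'm)) \<times> real \<Rightarrow> real \<Rightarrow> real"
  assumes K: "compact K" and B: "B \<in> sets borel" "B \<subseteq> K"
    and H: "family_smooth ((K \<times> annulus) \<times> {0..1}) d H"
    and pos: "\<And>z t. z \<in> (K \<times> annulus) \<times> {0..1} \<Longrightarrow> t \<in> {0<..<d} \<Longrightarrow> 0 \<le> H z t"
    and even: "\<And>u v a t. u \<in> K \<Longrightarrow> v \<in> annulus \<Longrightarrow> a \<in> {0..1} \<Longrightarrow> t \<in> {0<..<d} \<Longrightarrow>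
      H ((u, - v), a) (- t) = H ((u, v), a) t"
  obtains h where "family_smooth {0::real} d (\<lambda>_. h)" "\<And>t. t \<in> {-d<..<d} \<Longrightarrow> h (- t) = h t"
    "\<And>t. t \<in> {0<..<d} \<Longrightarrow> 0 \<le> h t"
    "\<And>t C. t \<in> {0<..<d} \<Longrightarrow> 0 \<le> C \<Longrightarrow>
      (\<integral>\<^sup>+u\<in>B. (\<integral>\<^sup>+v\<in>annulus. (\<integral>\<^sup>+a\<in>{0..1}. ennreal (C * H ((u, v), a) t) \<partial>lborel) \<partial>lborel) \<partial>lborel) =
      ennreal (C * h t)"
proof -
  define Y where "Y = (K \<times> (annulus :: (real ^ 'm) set)) \<times> {0..1::real}"
  define Z where "Z = (B \<times> (annulus :: (real ^ 'm) set)) \<times> {0..1::real}"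
  have Y: "compact Y" unfolding Y_def by (intro compact_Times K compact_annulus) simp
  have YB: "Y \<in> sets borel" by (rule borel_compact[OF Y])
  have ZB: "Z \<in> sets borel" unfolding Z_def by (intro borel_Times B annulus_measurable) simp
  have ZY: "Z \<subseteq> Y" using B(2) by (auto simp: Z_def Y_def)
  \<comment> \<open>\<open>B\<close> is merely Borel, whereas families are integrated over a compact
    set: the integral runs over \<open>Y\<close>, and the measure is restricted to
    \<open>Z\<close>.\<close>
  define \<nu> where "\<nu> = density lborel (indicator Z :: _ \<Rightarrow> ennreal)"
  have s\<nu>: "sets \<nu> = sets borel" by (simp add: \<nu>_def)
  have fin: "emeasure \<nu> Y < \<infinity>"
  proof -
    have "emeasure \<nu> Y = (\<integral>\<^sup>+z. indicator Z z * indicator Y z \<partial>lborel)"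
      unfolding \<nu>_def using ZB YB by (intro emeasure_density) auto
    also have "\<dots> \<le> (\<integral>\<^sup>+z. indicator Y z \<partial>lborel)"
      by (rule nn_integral_mono) (auto simp: indicator_def)
    also have "\<dots> = emeasure lborel Y" using YB by simp
    also have "\<dots> < \<infinity>" using emeasure_bounded_finite[OF compact_imp_bounded[OF Y]] by simp
    finally show ?thesis .
  qed
  define h where "h t = (LINT z:Y|\<nu>. H z t)" for t
  have smooth: "family_smooth {0::real} d (\<lambda>_. h)"
  proof (rule family_smoothI)
    fix k
    have "family_C k ({0::real} \<times> Y) d (\<lambda>p. H (snd p))"
      by (rule family_C_reparam[OF family_smoothD[OF H]]) (auto simp: Y_def intro: continuous_on_snd continuous_on_id)
    from family_C_integral[OF Y s\<nu> fin this]
    show "family_C k {0::real} d (\<lambda>_. h)" by (simp add: h_def[abs_def])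
  qed
  have contY: "continuous_on Y (\<lambda>z. H z t)" if "t \<in> {-d<..<d}" for t
  proof -
    have "continuous_on Y (\<lambda>z. (z, t))" by (intro continuous_intros)
    moreover have "(\<lambda>z. (z, t)) ` Y \<subseteq> Y \<times> {-d<..<d}" using that by auto
    ultimately show ?thesis
      using continuous_on_compose2[OF family_smooth_cont[OF H[folded Y_def]]] by fastforce
  qed
  define F where "F C t z = indicator Z z * ennreal (C * (indicator Y z * H z t))" for C t z
  have Hm: "(\<lambda>z. indicator Y z * H z t) \<in> borel_measurable borel" if "t \<in> {-d<..<d}" for t
    using borel_measurable_continuous_on_indicator[OF YB contY[OF that]] by simp
  have Fm: "F C t \<in> borel_measurable borel" if "t \<in> {-d<..<d}" for t C
    unfolding F_def[abs_def] using Hm[OF that] ZB by measurable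
  \<comment> \<open>For negative \<open>t\<close> the sign comes from the reversal symmetry; nothing
    is assumed at \<open>t = 0\<close>.\<close>
  have pos': "0 \<le> H z t" if "z \<in> Y" "t \<in> {-d<..<d}" "t \<noteq> 0" for z t
  proof (cases "t > 0")
    case True then show ?thesis using pos that by (simp add: Y_def)
  next
    case False
    obtain u v a where z: "z = ((u, v), a)" by (metis surj_pair)
    then have "H z t = H ((u, - v), a) (- t)"
      using even[of u "- v" a "- t"] that False by (simp add: Y_def annulus_uminus)
    then show ?thesis using pos[of "((u, - v), a)" "- t"] z that False by (simp add: Y_def annulus_uminus)
  qed
  have hF: "ennreal (C * h t) = (\<integral>\<^sup>+z. F C t z \<partial>lborel)" "0 \<le> h t" if t: "t \<in> {-d<..<d}" "t \<noteq> 0" and C: "0 \<le> C" for t C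
  proof -
    obtain b where b: "\<And>z. z \<in> Y \<Longrightarrow> norm (H z t) \<le> b"
      using compact_continuous_norm_bound[OF Y contY[OF t(1)]] by blast
    have Hm': "(\<lambda>z. indicator Y z * H z t) \<in> borel_measurable \<nu>"
      using Hm[OF t(1)] by (simp add: \<nu>_def)
    have "integrable \<nu> (\<lambda>z. indicator Y z * H z t)"
    proof (rule Bochner_Integration.integrable_bound)
      show "integrable \<nu> (\<lambda>z. b * indicator Y z :: real)" using fin YB s\<nu> by auto
      show "AE z in \<nu>. norm (indicator Y z * H z t) \<le> norm (b * indicator Y z)"
        using b by (intro AE_I2) (auto simp: indicator_def intro: order_trans[OF _ abs_ge_self])
    qed (rule Hm')
    then have int: "integrable \<nu> (\<lambda>z. C * (indicator Y z * H z t))" by simp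
    have nn: "0 \<le> indicator Y z * H z t" for z using pos'[OF _ t] by (cases "z \<in> Y") auto
    have "(\<integral>\<^sup>+z. ennreal (C * (indicator Y z * H z t)) \<partial>\<nu>) = ennreal (\<integral>z. C * (indicator Y z * H z t) \<partial>\<nu>)"
      by (rule nn_integral_eq_integral[OF int]) (use nn C in auto)
    also have "(\<integral>z. C * (indicator Y z * H z t) \<partial>\<nu>) = C * h t"
      by (simp add: h_def set_lebesgue_integral_def)
    also have "(\<integral>\<^sup>+z. ennreal (C * (indicator Y z * H z t)) \<partial>\<nu>) = (\<integral>\<^sup>+z. F C t z \<partial>lborel)"
      unfolding \<nu>_def F_def using ZB Hm[OF t(1)] by (subst nn_integral_density) auto
    finally show "ennreal (C * h t) = (\<integral>\<^sup>+z. F C t z \<partial>lborel)" ..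
    show "0 \<le> h t" unfolding h_def set_lebesgue_integral_def
      by (rule integral_nonneg_AE) (use nn in auto)
  qed
  have even_h: "h (- t) = h t" if t: "t \<in> {0<..<d}" for t
  proof -
    have td: "t \<in> {-d<..<d}" "- t \<in> {-d<..<d}" "t \<noteq> 0" "- t \<noteq> 0" using t by auto
    have Feq: "F 1 (- t) ((u, - v), a) = F 1 t ((u, v), a)" for u v a
      using even[of u v a t] t B(2) by (auto simp: F_def Z_def Y_def indicator_def annulus_uminus)
    have "(\<integral>\<^sup>+z. F 1 (- t) z \<partial>lborel) = (\<integral>\<^sup>+u. (\<integral>\<^sup>+v. (\<integral>\<^sup>+a. F 1 (- t) ((u, v), a) \<partial>lborel) \<partial>lborel) \<partial>lborel)"
      by (rule nn_integral_lborel_prod(1)[OF Fm[OF td(2)]])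
    also have "\<dots> = (\<integral>\<^sup>+u. (\<integral>\<^sup>+v. (\<integral>\<^sup>+a. F 1 t ((u, v), a) \<partial>lborel) \<partial>lborel) \<partial>lborel)"
    proof (rule nn_integral_cong)
      fix u
      have "(\<integral>\<^sup>+v. (\<integral>\<^sup>+a. F 1 (- t) ((u, v), a) \<partial>lborel) \<partial>lborel) =
          (\<integral>\<^sup>+v. (\<integral>\<^sup>+a. F 1 (- t) ((u, - v), a) \<partial>lborel) \<partial>lborel)"
        using nn_integral_lborel_scale[OF nn_integral_lborel_prod(2)[OF Fm[OF td(2)]], of "-1" 1 u 0] by simp
      then show "(\<integral>\<^sup>+v. (\<integral>\<^sup>+a. F 1 (- t) ((u, v), a) \<partial>lborel) \<partial>lborel) =
          (\<integral>\<^sup>+v. (\<integral>\<^sup>+a. F 1 t ((u, v), a) \<partial>lborel) \<partial>lborel)"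
        by (simp add: Feq)
    qed
    also have "\<dots> = (\<integral>\<^sup>+z. F 1 t z \<partial>lborel)"
      by (rule nn_integral_lborel_prod(1)[OF Fm[OF td(1)], symmetric])
    finally have "ennreal (1 * h (- t)) = ennreal (1 * h t)"
      using hF(1)[OF td(2,4), of 1] hF(1)[OF td(1,3), of 1] by simp
    then show ?thesis using hF(2)[OF td(2,4), of 1] hF(2)[OF td(1,3), of 1] by simp
  qed
  show ?thesis
  proof (rule that[OF smooth])
    show "h (- t) = h t" if "t \<in> {-d<..<d}" for t
      using even_h[of t] even_h[of "- t"] that by (cases t "0::real" rule: linorder_cases) auto
    fix t assume t: "t \<in> {0<..<d}"
    then have td: "t \<in> {-d<..<d}" "t \<noteq> 0" by auto
    show "0 \<le> h t" by (rule hF(2)[OF td, of 1]) simp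
    fix C :: real assume C: "0 \<le> C"
    have "ennreal (C * h t) = (\<integral>\<^sup>+u. (\<integral>\<^sup>+v. (\<integral>\<^sup>+a. F C t ((u, v), a) \<partial>lborel) \<partial>lborel) \<partial>lborel)"
      using hF(1)[OF td C] nn_integral_lborel_prod(1)[OF Fm[OF td(1)]] by simp
    also have "\<dots> = (\<integral>\<^sup>+u\<in>B. (\<integral>\<^sup>+v\<in>annulus. (\<integral>\<^sup>+a\<in>{0..1}. ennreal (C * H ((u, v), a) t) \<partial>lborel) \<partial>lborel) \<partial>lborel)"
    proof (rule nn_integral_cong)
      fix u
      show "(\<integral>\<^sup>+v. (\<integral>\<^sup>+a. F C t ((u, v), a) \<partial>lborel) \<partial>lborel) =
          (\<integral>\<^sup>+v\<in>annulus. (\<integral>\<^sup>+a\<in>{0..1}. ennreal (C * H ((u, v), a) t) \<partial>lborel) \<partial>lborel) * indicator B u"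
      proof (cases "u \<in> B")
        case True
        have "(\<integral>\<^sup>+v. (\<integral>\<^sup>+a. F C t ((u, v), a) \<partial>lborel) \<partial>lborel) =
            (\<integral>\<^sup>+v\<in>annulus. (\<integral>\<^sup>+a\<in>{0..1}. ennreal (C * H ((u, v), a) t) \<partial>lborel) \<partial>lborel)"
        proof (rule nn_integral_cong)
          fix v :: "real ^ 'm"
          show "(\<integral>\<^sup>+a. F C t ((u, v), a) \<partial>lborel) =
              (\<integral>\<^sup>+a\<in>{0..1}. ennreal (C * H ((u, v), a) t) \<partial>lborel) * indicator annulus v"
          proof (cases "v \<in> annulus")
            case v: True
            have "F C t ((u, v), a) = ennreal (C * H ((u, v), a) t) * indicator {0..1} a" for a
              using True v B(2) by (auto simp: F_def Z_def Y_def indicator_def)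
            then show ?thesis using v by simp
          next
            case False
            then have "F C t ((u, v), a) = 0" for a by (simp add: F_def Z_def)
            then show ?thesis using False by simp
          qed
        qed
        then show ?thesis using True by simp
      next
        case False
        then have "F C t ((u, v), a) = 0" for v a by (simp add: F_def Z_def)
        then show ?thesis using False by simp
      qed
    qed
    finally show "(\<integral>\<^sup>+u\<in>B. (\<integral>\<^sup>+v\<in>annulus. (\<integral>\<^sup>+a\<in>{0..1}. ennreal (C * H ((u, v), a) t) \<partial>lborel) \<partial>lborel) \<partial>lborel) =
        ennreal (C * h t)" ..
  qed
qed

section \<open>Expansions in powers of the distance\<close>

lemma family_smooth_line:
  assumes "smooth_on W f" "continuous_on X a" "continuous_on X b"
    and "\<And>x t. x \<in> X \<Longrightarrow> t \<in> {-d<..<d} \<Longrightarrow> a x + t *\<^sub>R b x \<in> W"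
  shows "family_smooth X d (\<lambda>x t. f (a x + t *\<^sub>R b x))"
  by (rule family_smoothI, rule family_C_line) (use assms in \<open>auto simp: smooth_on_def\<close>)

text \<open>The determinant is a polynomial in inner products of derivatives, and its positivity for
  injective derivatives makes the root smooth.\<close>

lemma family_smooth_volume_density:
  assumes f: "local_parametrization M W f" and a: "continuous_on X a" and b: "continuous_on X b"
    and sub: "\<And>x t. x \<in> X \<Longrightarrow> t \<in> {-d<..<d} \<Longrightarrow> a x + t *\<^sub>R b x \<in> W"
  shows "family_smooth X d (\<lambda>x t. volume_density f (a x + t *\<^sub>R b x))"
proof (rule family_smoothI)
  fix k
  have D: "family_C k X d (\<lambda>x t. frechet_derivative f (at (a x + t *\<^sub>R b x)) w)" for w
    using family_smooth_line[OF smooth_on_frechet[OF local_parametrizationD(2)[OF f]] a b sub]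
    by (simp add: family_smooth_def)
  have "family_C k X d (\<lambda>x t. det (gram (frechet_derivative f (at (a x + t *\<^sub>R b x)))))"
    unfolding det_def gram_def vec_lambda_beta
    by (intro family_C_sum family_C_mult family_C_prod family_C_inner D family_C_const continuous_on_const)
      (auto simp: finite_permutations)
  then show "family_C k X d (\<lambda>x t. volume_density f (a x + t *\<^sub>R b x))"
    unfolding volume_density_gram
    by (rule family_C_sqrt) (rule det_gram_pos[OF local_parametrizationD(9,3)[OF f]]; rule sub)
qed

text \<open>The chord \<open>f(u + s v) - f(u)\<close> vanishes at \<open>s = 0\<close>, so it is
  \<open>s r\<close> with \<open>r\<close> smooth. The vector \<open>r\<close> never vanishes: by
  injectivity of \<open>f\<close> for \<open>s \<noteq> 0\<close>, and because \<open>f\<close> is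
  an immersion for \<open>s = 0\<close>. Hence \<open>R = |r|\<close> is smooth. Reversing
  \<open>v\<close> and \<open>s\<close> together gives the same chord, hence the symmetry.\<close>

lemma chord_family:
  fixes f :: "real ^ 'm::finite \<Rightarrow> 'a::euclidean_space"
  assumes f: "local_parametrization M W f" and K: "compact K" and s0: "s0 > 0"
    and room: "\<And>u w. u \<in> K \<Longrightarrow> norm w \<le> 2 * s0 \<Longrightarrow> u + w \<in> W"
  obtains R where "family_smooth (K \<times> annulus) s0 R"
    "\<And>x s. x \<in> K \<times> annulus \<Longrightarrow> s \<in> {-s0<..<s0} \<Longrightarrow> 0 < R x s"
    "\<And>u v s. u \<in> K \<Longrightarrow> v \<in> annulus \<Longrightarrow> s \<in> {-s0<..<s0} \<Longrightarrow> norm (f (u + s *\<^sub>R v) - f u) = \<bar>s\<bar> * R (u, v) s"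
    "\<And>u v s. u \<in> K \<Longrightarrow> v \<in> annulus \<Longrightarrow> s \<in> {-s0<..<s0} \<Longrightarrow> s \<noteq> 0 \<Longrightarrow> R (u, - v) (- s) = R (u, v) s"
proof -
  note F = local_parametrizationD[OF f]
  let ?X = "K \<times> (annulus :: (real ^ 'm) set)"
  have inW: "fst x + s *\<^sub>R snd x \<in> W" if "x \<in> ?X" "s \<in> {-s0<..<s0}" for x s
  proof -
    have "norm (s *\<^sub>R snd x) \<le> s0 * 2"
      unfolding norm_scaleR using that by (intro mult_mono) (auto simp: annulus_def)
    then show ?thesis using room that by (auto simp: mult.commute)
  qed
  define D where "D x s = f (fst x + s *\<^sub>R snd x) - f (fst x)" for x s
  have cf: "continuous_on ?X fst" and cs: "continuous_on ?X snd"
    by (auto intro: continuous_on_fst continuous_on_snd continuous_on_id)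
  have "K \<subseteq> W" using room[of _ 0] s0 by auto
  have sm: "family_smooth ?X s0 D"
  proof (rule family_smoothI)
    fix k
    have "family_C k ?X s0 (\<lambda>x s. f (fst x + s *\<^sub>R snd x))"
      by (rule family_smoothD[OF family_smooth_line[OF F(2) cf cs inW]])
    moreover have "family_C k ?X s0 (\<lambda>x s. f (fst x))"
      by (intro family_C_const continuous_on_compose2[OF F(6) cf]) (use \<open>K \<subseteq> W\<close> in auto)
    ultimately show "family_C k ?X s0 D" unfolding D_def by (rule family_C_diff)
  qed
  moreover have "D x 0 = 0" for x by (simp add: D_def)
  ultimately obtain r where r: "family_smooth ?X s0 r"
    "\<And>x t. x \<in> ?X \<Longrightarrow> t \<in> {-s0<..<s0} \<Longrightarrow> D x t = t *\<^sub>R r x t"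
    using family_smooth_divide by blast
  have r0: "r x s \<noteq> 0" if x: "x \<in> ?X" and s: "s \<in> {-s0<..<s0}" for x s
  proof (cases "s = 0")
    case False
    have v: "snd x \<noteq> 0" using x by (auto simp: annulus_def)
    have "fst x \<in> W" using x \<open>K \<subseteq> W\<close> by auto
    then have "D x s \<noteq> 0"
      using F(5) inW[OF x s] v False by (auto simp: D_def dest: inj_onD)
    then show ?thesis using r(2)[OF x s] by auto
  next
    case True
    let ?L = "frechet_derivative f (at (fst x))"
    have fx: "fst x \<in> W" using x \<open>K \<subseteq> W\<close> by auto
    have "((\<lambda>t. fst x + t *\<^sub>R snd x) has_derivative (\<lambda>h. h *\<^sub>R snd x)) (at 0)"
      by (auto intro!: derivative_eq_intros)
    moreover have "(f has_derivative ?L) (at (fst x + 0 *\<^sub>R snd x))" using F(8)[OF fx] by simp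
    ultimately have "((\<lambda>t. f (fst x + t *\<^sub>R snd x)) has_derivative (\<lambda>h. ?L (h *\<^sub>R snd x))) (at 0)"
      by (rule has_derivative_compose)
    then have "((\<lambda>t. f (fst x + t *\<^sub>R snd x)) has_vector_derivative ?L (snd x)) (at 0)"
      by (simp add: has_vector_derivative_def linear_scale[OF F(9)[OF fx]])
    then have 1: "(D x has_vector_derivative ?L (snd x)) (at 0)"
      unfolding D_def[abs_def] by (auto intro!: derivative_eq_intros)
    obtain r' where "\<And>x t. x \<in> ?X \<Longrightarrow> t \<in> {-s0<..<s0} \<Longrightarrow> (r x has_vector_derivative r' x t) (at t)"
      using family_smooth_deriv[OF r(1)] by metis
    then have "(r x has_vector_derivative r' x 0) (at 0)" using x s0 by auto
    then have "((\<lambda>t. t *\<^sub>R r x t) has_vector_derivative r x 0) (at 0)"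
      by (auto intro!: derivative_eq_intros)
    then have "(D x has_vector_derivative r x 0) (at 0)"
      by (rule has_vector_derivative_transform_within_open[of _ _ _ "{-s0<..<s0}"]) (use r(2)[OF x] s0 in auto)
    then have "r x 0 = ?L (snd x)" using 1 by (rule vector_derivative_unique_at)
    moreover have "?L (snd x) \<noteq> 0"
    proof
      assume "?L (snd x) = 0"
      then have "snd x = 0" using F(3,9)[OF fx] by (metis linear_injective_0)
      then show False using x by (auto simp: annulus_def)
    qed
    ultimately show ?thesis using True by simp
  qed
  define R where "R x s = sqrt (r x s \<bullet> r x s)" for x s
  have Rsm: "family_smooth ?X s0 R" unfolding R_def
    by (intro family_smoothI family_C_sqrt family_C_inner family_smoothD[OF r(1)]) (use r0 in auto)
  have Rpos: "0 < R x s" if "x \<in> ?X" "s \<in> {-s0<..<s0}" for x s using r0[OF that] by (simp add: R_def)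
  have Rn: "norm (f (u + s *\<^sub>R v) - f u) = \<bar>s\<bar> * R (u, v) s" if "u \<in> K" "v \<in> annulus" "s \<in> {-s0<..<s0}" for u v s
    using r(2)[of "(u, v)" s] that by (simp add: D_def R_def norm_eq_sqrt_inner[symmetric])
  have Re: "R (u, - v) (- s) = R (u, v) s" if "u \<in> K" "v \<in> annulus" "s \<in> {-s0<..<s0}" "s \<noteq> 0" for u v s
    using Rn[of u v s] Rn[of u "- v" "- s"] that by (simp add: annulus_uminus)
  show ?thesis by (rule that[OF Rsm Rpos Rn Re])
qed

text \<open>The radius as a function of the distance, for distances weighted by
  \<open>\<eta>\<close> at both ends. The weight is \<open>1\<close> for balls, a constant for
  rescaled balls and \<open>\<rho> \<circ> f\<close> for distances in the conformal image. The
  conclusion holds for every smaller \<open>s'\<close>, so that two weights can share one range of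
  radii.\<close>

lemma chord_inverse:
  fixes f :: "real ^ 'm::finite \<Rightarrow> 'a::euclidean_space"
  assumes f: "local_parametrization M W f" and K: "compact K" and s0: "s0 > 0"
    and room: "\<And>u w. u \<in> K \<Longrightarrow> norm w \<le> 2 * s0 \<Longrightarrow> u + w \<in> W"
    and \<eta>: "smooth_on W \<eta>" "\<And>u. u \<in> W \<Longrightarrow> 0 < (\<eta> u :: real)"
  obtains s1 where "0 < s1" "s1 \<le> s0"
    "\<And>s'. 0 < s' \<Longrightarrow> s' < s1 \<Longrightarrow> \<exists>d>0. \<exists>\<sigma>. family_smooth (K \<times> annulus) d \<sigma> \<and>
      (\<forall>x\<in>K \<times> annulus. \<forall>t\<in>{-d<..<d}. 0 < \<sigma> x t \<and> t * \<sigma> x t \<in> {-s'<..<s'}) \<and>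
      (\<forall>u\<in>K. \<forall>v\<in>annulus. \<forall>t\<in>{0<..<d}. \<forall>s\<in>{0<..<s'}.
         norm (f (u + s *\<^sub>R v) - f u) * (\<eta> u * \<eta> (u + s *\<^sub>R v)) \<le> t \<longleftrightarrow> s \<le> t * \<sigma> (u, v) t) \<and>
      (\<forall>u\<in>K. \<forall>v\<in>annulus. \<forall>t\<in>{-d<..<d}. t \<noteq> 0 \<longrightarrow> \<sigma> (u, - v) (- t) = \<sigma> (u, v) t)"
proof -
  let ?X = "K \<times> (annulus :: (real ^ 'm) set)"
  have X: "compact ?X" by (intro compact_Times K compact_annulus)
  obtain R where R: "family_smooth ?X s0 R"
    "\<And>x s. x \<in> ?X \<Longrightarrow> s \<in> {-s0<..<s0} \<Longrightarrow> 0 < R x s"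
    "\<And>u v s. u \<in> K \<Longrightarrow> v \<in> annulus \<Longrightarrow> s \<in> {-s0<..<s0} \<Longrightarrow> norm (f (u + s *\<^sub>R v) - f u) = \<bar>s\<bar> * R (u, v) s"
    "\<And>u v s. u \<in> K \<Longrightarrow> v \<in> annulus \<Longrightarrow> s \<in> {-s0<..<s0} \<Longrightarrow> s \<noteq> 0 \<Longrightarrow> R (u, - v) (- s) = R (u, v) s"
    using chord_family[OF f K s0 room] by blast
  have inW: "fst x + s *\<^sub>R snd x \<in> W" if "x \<in> ?X" "s \<in> {-s0<..<s0}" for x s
  proof -
    have "norm (s *\<^sub>R snd x) \<le> s0 * 2"
      unfolding norm_scaleR using that by (intro mult_mono) (auto simp: annulus_def)
    then show ?thesis using room that by (auto simp: mult.commute)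
  qed
  have "K \<subseteq> W" using room[of _ 0] s0 by auto
  have cf: "continuous_on ?X fst" and cs: "continuous_on ?X snd"
    by (auto intro: continuous_on_fst continuous_on_snd continuous_on_id)
  define q where "q x s = R x s * (\<eta> (fst x) * \<eta> (fst x + s *\<^sub>R snd x))" for x s
  have "family_C k ?X s0 (\<lambda>x s. \<eta> (fst x))" for k
    by (intro family_C_const continuous_on_compose2[OF smooth_on_continuous[OF \<eta>(1)] cf]) (use \<open>K \<subseteq> W\<close> in auto)
  then have q: "family_smooth ?X s0 q" unfolding q_def
    by (intro family_smoothI family_C_mult family_smoothD[OF R(1)]
        family_smoothD[OF family_smooth_line[OF \<eta>(1) cf cs inW]])
  have q0: "0 < q x s" if "x \<in> ?X" "s \<in> {-s0<..<s0}" for x s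
    unfolding q_def using R(2)[OF that] \<eta>(2)[OF inW[OF that]] \<eta>(2)[of "fst x"] that \<open>K \<subseteq> W\<close> by auto
  obtain q' where q': "\<And>x t. x \<in> ?X \<Longrightarrow> t \<in> {-s0<..<s0} \<Longrightarrow> (q x has_vector_derivative q' x t) (at t)"
    "family_smooth ?X s0 q'"
    using family_smooth_deriv[OF q] by blast
  have sub: "?X \<times> {-s0/2..s0/2} \<subseteq> ?X \<times> {-s0<..<s0}" using s0 by auto
  have C: "compact (?X \<times> {-s0/2..s0/2})" by (intro compact_Times X) simp
  obtain c where c: "c > 0" "\<And>p. p \<in> ?X \<times> {-s0/2..s0/2} \<Longrightarrow> c \<le> q (fst p) (snd p)"
  proof (rule compact_continuous_lower_bound[OF C continuous_on_subset[OF family_smooth_cont[OF q] sub]])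
    show "0 < q (fst p) (snd p)" if "p \<in> ?X \<times> {-s0/2..s0/2}" for p
      by (rule q0) (use that s0 in auto)
  qed blast
  obtain b where b: "\<And>p. p \<in> ?X \<times> {-s0/2..s0/2} \<Longrightarrow> norm (q' (fst p) (snd p)) \<le> b"
    using compact_continuous_norm_bound[OF C continuous_on_subset[OF family_smooth_cont[OF q'(2)] sub]] by blast
  \<comment> \<open>With \<open>q \<ge> c\<close> and \<open>|q'| \<le> b\<close>, this size keeps
    \<open>q + s q'\<close>, the derivative of \<open>s q\<close>, positive.\<close>
  define s1 where "s1 = min (s0 / 2) (c / (\<bar>b\<bar> + 1))"
  have s1: "0 < s1" "s1 \<le> s0 / 2"
    unfolding s1_def using s0 c(1) by (simp_all only: min_less_iff_conj min.cobounded1) simp_all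
  have p': "((\<lambda>s. s * q x s) has_real_derivative q x s + s * q' x s) (at s)" if "x \<in> ?X" "s \<in> {-s1<..<s1}" for x s
    using q'(1)[OF that(1), of s] that s1 s0
    by (auto simp: has_real_derivative_iff_has_vector_derivative[symmetric] intro!: derivative_eq_intros)
  have p'0: "0 < q x s + s * q' x s" if "x \<in> ?X" "s \<in> {-s1<..<s1}" for x s
  proof -
    have m: "(x, s) \<in> ?X \<times> {-s0/2..s0/2}" using that s1 by auto
    have "\<bar>s * q' x s\<bar> \<le> \<bar>s\<bar> * \<bar>b\<bar>"
      using b[OF m] by (auto simp: abs_mult intro!: mult_left_mono)
    also have "\<dots> \<le> s1 * \<bar>b\<bar>" using that by (intro mult_right_mono) auto
    also have "\<dots> < s1 * (\<bar>b\<bar> + 1)" using s1 by simp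
    also have "\<dots> \<le> c / (\<bar>b\<bar> + 1) * (\<bar>b\<bar> + 1)" by (intro mult_right_mono) (auto simp: s1_def)
    also have "\<dots> = c" by (simp add: add_nonneg_eq_0_iff)
    also have "c \<le> q x s" using c(2)[OF m] by simp
    finally show ?thesis by linarith
  qed
  have qs1: "family_smooth ?X s1 q" by (rule family_smooth_restrict[OF q]) (use s1 s0 in auto)
  have q0s1: "0 < q x s" if "x \<in> ?X" "s \<in> {-s1<..<s1}" for x s
    by (rule q0[OF that(1)]) (use that s1 s0 in auto)
  show ?thesis
  proof (rule that[of s1])
    show "0 < s1" "s1 \<le> s0" using s1 s0 by auto
    fix s' :: real assume s': "0 < s'" "s' < s1"
    obtain d \<sigma> where d: "d > 0" "family_smooth ?X d \<sigma>"
      "\<And>x t. x \<in> ?X \<Longrightarrow> t \<in> {-d<..<d} \<Longrightarrow> \<sigma> x t > 0"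
      "\<And>x t. x \<in> ?X \<Longrightarrow> t \<in> {-d<..<d} \<Longrightarrow> t * \<sigma> x t \<in> {-s'<..<s'}"
      "\<And>x t s. x \<in> ?X \<Longrightarrow> t \<in> {-d<..<d} \<Longrightarrow> s \<in> {-s'<..<s'} \<Longrightarrow> s * q x s \<le> t \<longleftrightarrow> s \<le> t * \<sigma> x t"
      "\<And>x t s. x \<in> ?X \<Longrightarrow> t \<in> {-d<..<d} \<Longrightarrow> s \<in> {-s'<..<s'} \<Longrightarrow> s * q x s = t \<longleftrightarrow> s = t * \<sigma> x t"
      using family_smooth_inverse[OF X s' qs1 q0s1 p' p'0] by blast
    have le: "norm (f (u + s *\<^sub>R v) - f u) * (\<eta> u * \<eta> (u + s *\<^sub>R v)) \<le> t \<longleftrightarrow> s \<le> t * \<sigma> (u, v) t"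
      if "u \<in> K" "v \<in> annulus" "t \<in> {0<..<d}" "s \<in> {0<..<s'}" for u v t s
      using d(5)[of "(u, v)" t s] R(3)[of u v s] that s' s1 s0 by (simp add: q_def mult.assoc)
    \<comment> \<open>Reversing \<open>v\<close> and the radius leaves \<open>q\<close> unchanged,
      so \<open>-S\<close> solves the reversed equation; uniqueness of the solution transfers the
      symmetry to \<open>\<sigma>\<close>.\<close>
    have ev: "\<sigma> (u, - v) (- t) = \<sigma> (u, v) t" if uv: "u \<in> K" "v \<in> annulus" and t: "t \<in> {-d<..<d}" "t \<noteq> 0" for u v t
    proof -
      define S where "S = t * \<sigma> (u, v) t"
      have S: "S \<in> {-s'<..<s'}" "S \<noteq> 0" using d(3,4)[of "(u, v)" t] uv t by (auto simp: S_def)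
      then have "S * q (u, v) S = t" using d(6)[of "(u, v)" t S] uv t by (simp add: S_def)
      moreover have "q (u, - v) (- S) = q (u, v) S"
        using R(4)[of u v S] uv S s' s1 s0 by (simp add: q_def)
      ultimately have "(- S) * q (u, - v) (- S) = - t" by simp
      then have "- S = - t * \<sigma> (u, - v) (- t)"
        using d(6)[of "(u, - v)" "- t" "- S"] uv t S by (simp add: annulus_uminus)
      then show ?thesis using t by (simp add: S_def)
    qed
    show "\<exists>d>0. \<exists>\<sigma>. family_smooth ?X d \<sigma> \<and>
      (\<forall>x\<in>?X. \<forall>t\<in>{-d<..<d}. 0 < \<sigma> x t \<and> t * \<sigma> x t \<in> {-s'<..<s'}) \<and>
      (\<forall>u\<in>K. \<forall>v\<in>annulus. \<forall>t\<in>{0<..<d}. \<forall>s\<in>{0<..<s'}.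
         norm (f (u + s *\<^sub>R v) - f u) * (\<eta> u * \<eta> (u + s *\<^sub>R v)) \<le> t \<longleftrightarrow> s \<le> t * \<sigma> (u, v) t) \<and>
      (\<forall>u\<in>K. \<forall>v\<in>annulus. \<forall>t\<in>{-d<..<d}. t \<noteq> 0 \<longrightarrow> \<sigma> (u, - v) (- t) = \<sigma> (u, v) t)"
      by (intro exI[of _ d] exI[of _ \<sigma>] conjI ballI impI)
        (fact d(1) | fact d(2) | (rule d(3); assumption) | (rule d(4); assumption) | (rule le; assumption) | (rule ev; assumption))+
  qed
qed

text \<open>The common frame of both expansions: once the radial integral of a kernel is
  \<open>C t\<close> times the integral of a smooth family \<open>H\<close> with reversal symmetry,
  the integral over all pairs with base point in the piece is \<open>C t\<close> times an even
  smooth function.\<close>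

lemma piece_shell:
  fixes f :: "real ^ 'm::finite \<Rightarrow> 'a::euclidean_space"
    and H :: "((real ^ 'm) \<times> (real ^ 'm)) \<times> real \<Rightarrow> real \<Rightarrow> real"
  assumes cl: "closed_submanifold TYPE('m) M" and f: "local_parametrization M W f" and K: "compact K" "K \<subseteq> W"
    and B: "B \<in> sets borel" "B \<subseteq> K"
    and s: "s > 0" "\<And>u w. u \<in> K \<Longrightarrow> norm w \<le> 2 * s \<Longrightarrow> u + w \<in> W" and d0: "d0 > 0"
    and H: "family_smooth ((K \<times> annulus) \<times> {0..1}) d0 H"
    and pos: "\<And>z t. z \<in> (K \<times> annulus) \<times> {0..1} \<Longrightarrow> t \<in> {0<..<d0} \<Longrightarrow> 0 \<le> H z t"
    and even: "\<And>u v a t. u \<in> K \<Longrightarrow> v \<in> annulus \<Longrightarrow> a \<in> {0..1} \<Longrightarrow> t \<in> {0<..<d0} \<Longrightarrow>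
      H ((u, - v), a) (- t) = H ((u, v), a) t"
    and C: "\<And>t. t \<in> {0<..<d0} \<Longrightarrow> 0 \<le> C t"
    and km: "\<And>t. t \<in> {0<..<d0} \<Longrightarrow> (\<lambda>p. k t (fst p) (snd p)) \<in> borel_measurable borel"
    and c: "c > 0" "\<And>t x y. t \<in> {0<..<d0} \<Longrightarrow> k t x y \<noteq> 0 \<Longrightarrow> c * norm (x - y) \<le> t"
    and eq: "\<And>u v t. u \<in> K \<Longrightarrow> v \<in> annulus \<Longrightarrow> t \<in> {0<..<d0} \<Longrightarrow>
      (\<integral>\<^sup>+r\<in>{0<..<s}. ennreal (volume_density f u * volume_density f (u + r *\<^sub>R v) * r ^ (CARD('m) - 1) / ln 2) *
         k t (f u) (f (u + r *\<^sub>R v)) \<partial>lborel) =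
      (\<integral>\<^sup>+a\<in>{0..1}. ennreal (C t * H ((u, v), a) t) \<partial>lborel)"
  obtains d h where "d > 0" "d \<le> d0" "family_smooth {0::real} d (\<lambda>_. h)" "\<And>t. t \<in> {-d<..<d} \<Longrightarrow> h (- t) = h t"
    "\<And>t. t \<in> {0<..<d} \<Longrightarrow> 0 \<le> h t"
    "\<And>t. t \<in> {0<..<d} \<Longrightarrow>
      (\<integral>\<^sup>+x\<in>f ` B. (\<integral>\<^sup>+y\<in>M. k t x y \<partial>riemannian_volume TYPE('m) M) \<partial>riemannian_volume TYPE('m) M) = ennreal (C t * h t)"
proof -
  let ?\<mu> = "riemannian_volume TYPE('m) M"
  obtain d1 where d1: "d1 > 0"
    "\<And>B k. B \<in> sets borel \<Longrightarrow> B \<subseteq> K \<Longrightarrow> (\<lambda>p. k (fst p) (snd p)) \<in> borel_measurable borel \<Longrightarrow>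
      (\<And>x y. k x y \<noteq> 0 \<Longrightarrow> norm (x - y) \<le> d1) \<Longrightarrow>
      (\<integral>\<^sup>+x\<in>f ` B. (\<integral>\<^sup>+y\<in>M. k x y \<partial>?\<mu>) \<partial>?\<mu>) =
      (\<integral>\<^sup>+u\<in>B. (\<integral>\<^sup>+v\<in>annulus. (\<integral>\<^sup>+r\<in>{0<..<s}.
         ennreal (volume_density f u * volume_density f (u + r *\<^sub>R v) * r ^ (CARD('m) - 1) / ln 2) *
         k (f u) (f (u + r *\<^sub>R v)) \<partial>lborel) \<partial>lborel) \<partial>lborel)"
  proof (rule nn_integral_near_diagonal[OF cl f K s(1)], goal_cases)
    case (1 u w)
    then show ?case using s(2) by blast
  next
    case (2 d)
    show ?case by (rule that[OF 2(2) 2(3)])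
  qed
  obtain h where h: "family_smooth {0::real} d0 (\<lambda>_. h)" "\<And>t. t \<in> {-d0<..<d0} \<Longrightarrow> h (- t) = h t"
    "\<And>t. t \<in> {0<..<d0} \<Longrightarrow> 0 \<le> h t"
    "\<And>t C. t \<in> {0<..<d0} \<Longrightarrow> 0 \<le> C \<Longrightarrow>
      (\<integral>\<^sup>+u\<in>B. (\<integral>\<^sup>+v\<in>annulus. (\<integral>\<^sup>+a\<in>{0..1}. ennreal (C * H ((u, v), a) t) \<partial>lborel) \<partial>lborel) \<partial>lborel) =
      ennreal (C * h t)"
    by (rule symmetric_average[OF K(1) B H pos even]) ((rule that; assumption) | assumption)+
  \<comment> \<open>\<open>k t\<close> is supported where \<open>c |x - y| \<le> t\<close>, so
    \<open>t < c d1\<close> puts its support within distance \<open>d1\<close>.\<close>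
  define d where "d = min d0 (c * d1)"
  have d: "d > 0" "d \<le> d0" "d \<le> c * d1" using d0 d1(1) c(1) by (simp_all add: d_def)
  show ?thesis
  proof (rule that[OF d(1,2) family_smooth_restrict[OF h(1) d(2)]])
    show "h (- t) = h t" if "t \<in> {-d<..<d}" for t using h(2)[of t] that d by auto
    fix t assume t: "t \<in> {0<..<d}"
    then have t0: "t \<in> {0<..<d0}" using d by auto
    show "0 \<le> h t" by (rule h(3)[OF t0])
    have "(\<integral>\<^sup>+x\<in>f ` B. (\<integral>\<^sup>+y\<in>M. k t x y \<partial>?\<mu>) \<partial>?\<mu>) =
      (\<integral>\<^sup>+u\<in>B. (\<integral>\<^sup>+v\<in>annulus. (\<integral>\<^sup>+r\<in>{0<..<s}.
         ennreal (volume_density f u * volume_density f (u + r *\<^sub>R v) * r ^ (CARD('m) - 1) / ln 2) *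
         k t (f u) (f (u + r *\<^sub>R v)) \<partial>lborel) \<partial>lborel) \<partial>lborel)"
    proof (rule d1(2)[OF B km[OF t0]])
      fix x y assume "k t x y \<noteq> 0"
      from c(2)[OF t0 this] have "c * norm (x - y) \<le> c * d1" using t d(3) by auto
      then show "norm (x - y) \<le> d1" using c(1) by simp
    qed
    also have "\<dots> = (\<integral>\<^sup>+u\<in>B. (\<integral>\<^sup>+v\<in>annulus. (\<integral>\<^sup>+a\<in>{0..1}. ennreal (C t * H ((u, v), a) t) \<partial>lborel) \<partial>lborel) \<partial>lborel)"
    proof (rule nn_integral_cong)
      fix u
      show "(\<integral>\<^sup>+v\<in>annulus. (\<integral>\<^sup>+r\<in>{0<..<s}.
         ennreal (volume_density f u * volume_density f (u + r *\<^sub>R v) * r ^ (CARD('m) - 1) / ln 2) *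
         k t (f u) (f (u + r *\<^sub>R v)) \<partial>lborel) \<partial>lborel) * indicator B u =
         (\<integral>\<^sup>+v\<in>annulus. (\<integral>\<^sup>+a\<in>{0..1}. ennreal (C t * H ((u, v), a) t) \<partial>lborel) \<partial>lborel) * indicator B u"
      proof (cases "u \<in> B")
        case True
        then have uK: "u \<in> K" using B(2) by blast
        have "(\<integral>\<^sup>+v\<in>annulus. (\<integral>\<^sup>+r\<in>{0<..<s}.
           ennreal (volume_density f u * volume_density f (u + r *\<^sub>R v) * r ^ (CARD('m) - 1) / ln 2) *
           k t (f u) (f (u + r *\<^sub>R v)) \<partial>lborel) \<partial>lborel) =
           (\<integral>\<^sup>+v\<in>annulus. (\<integral>\<^sup>+a\<in>{0..1}. ennreal (C t * H ((u, v), a) t) \<partial>lborel) \<partial>lborel)"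
        proof (rule nn_integral_cong)
          fix v :: "real ^ 'm"
          show "(\<integral>\<^sup>+r\<in>{0<..<s}.
             ennreal (volume_density f u * volume_density f (u + r *\<^sub>R v) * r ^ (CARD('m) - 1) / ln 2) *
             k t (f u) (f (u + r *\<^sub>R v)) \<partial>lborel) * indicator annulus v =
             (\<integral>\<^sup>+a\<in>{0..1}. ennreal (C t * H ((u, v), a) t) \<partial>lborel) * indicator annulus v"
            using eq[OF uK _ t0, of v] by (cases "v \<in> annulus") (simp_all only: indicator_simps mult_zero_right not_False_eq_True)
        qed
        then show ?thesis by simp
      qed simp
    qed
    also have "\<dots> = ennreal (C t * h t)" by (rule h(4)[OF t0 C[OF t0]])
    finally show "(\<integral>\<^sup>+x\<in>f ` B. (\<integral>\<^sup>+y\<in>M. k t x y \<partial>?\<mu>) \<partial>?\<mu>) = ennreal (C t * h t)" .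
  qed
qed

text \<open>The factor \<open>2\<close> matches the largest norm in \<open>annulus\<close>.\<close>

lemma compact_in_open_room:
  fixes K W :: "'e::euclidean_space set"
  assumes "compact K" "open W" "K \<subseteq> W"
  obtains s where "s > 0" "\<And>u w. u \<in> K \<Longrightarrow> norm w \<le> 2 * s \<Longrightarrow> u + w \<in> W"
proof -
  obtain e where e: "e > 0" "(\<Union>x\<in>K. cball x e) \<subseteq> W"
    using compact_subset_open_imp_cball_epsilon_subset[OF assms] by blast
  show ?thesis
  proof (rule that[of "e / 2"])
    show "u + w \<in> W" if "u \<in> K" "norm w \<le> 2 * (e / 2)" for u w
    proof -
      have "u + w \<in> cball u e" using that by (simp add: dist_norm)
      then show ?thesis using e(2) that(1) by blast
    qed
  qed (use e in simp)
qed

lemma family_smooth_volume_density_shell: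
  fixes f :: "real ^ 'm::finite \<Rightarrow> 'a::euclidean_space" and \<rho> :: "((real ^ 'm) \<times> (real ^ 'm)) \<times> real \<Rightarrow> real \<Rightarrow> real"
  assumes f: "local_parametrization M W f" and K: "K \<subseteq> W"
    and s: "\<And>u w. u \<in> K \<Longrightarrow> norm w \<le> 2 * s \<Longrightarrow> u + w \<in> W"
    and \<rho>: "family_smooth ((K \<times> annulus) \<times> {0..1}) d \<rho>"
    and sub: "\<And>z t. z \<in> (K \<times> annulus) \<times> {0..1} \<Longrightarrow> t \<in> {-d<..<d} \<Longrightarrow> t * \<rho> z t \<in> {-s<..<s}"
  shows "family_smooth ((K \<times> annulus) \<times> {0..1}) d (\<lambda>z t. volume_density f (fst (fst z)) *
      volume_density f (fst (fst z) + (t * \<rho> z t) *\<^sub>R snd (fst z)))"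
proof (rule family_smoothI)
  fix k
  let ?X = "(K \<times> (annulus :: (real ^ 'm) set)) \<times> {0..1::real}"
  have c1: "continuous_on ?X (\<lambda>z. fst (fst z))" and c2: "continuous_on ?X (\<lambda>z. snd (fst z))"
    by (intro continuous_intros)+
  have inW: "fst (fst z) + r *\<^sub>R snd (fst z) \<in> W" if "z \<in> ?X" "r \<in> {-s<..<s}" for z r
  proof -
    have "norm (r *\<^sub>R snd (fst z)) \<le> s * 2"
      unfolding norm_scaleR using that by (intro mult_mono) (auto simp: annulus_def)
    then show ?thesis using s that by (auto simp: mult.commute)
  qed
  have 1: "family_C k ?X d (\<lambda>z t. volume_density f (fst (fst z)))"
    by (intro family_C_const continuous_on_compose2[OF continuous_on_volume_density[OF f] c1]) (use K in auto)
  have "family_C k ?X s (\<lambda>z r. volume_density f (fst (fst z) + r *\<^sub>R snd (fst z)))"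
    by (rule family_smoothD[OF family_smooth_volume_density[OF f c1 c2 inW]])
  moreover have "family_C k ?X d (\<lambda>z t. t * \<rho> z t)"
    by (intro family_C_mult family_C_id family_smoothD[OF \<rho>])
  ultimately have "family_C k ?X d (\<lambda>z t. volume_density f (fst (fst z) + (t * \<rho> z t) *\<^sub>R snd (fst z)))"
    by (rule family_C_compose) (rule sub)
  with 1 show "family_C k ?X d (\<lambda>z t. volume_density f (fst (fst z)) *
      volume_density f (fst (fst z) + (t * \<rho> z t) *\<^sub>R snd (fst z)))"
    by (rule family_C_mult)
qed

lemma continuous_on_volume_density_line:
  fixes f :: "real ^ 'm::finite \<Rightarrow> 'a::euclidean_space"
  assumes f: "local_parametrization M W f"
    and s: "\<And>w. norm w \<le> 2 * s \<Longrightarrow> u + w \<in> W" and v: "v \<in> annulus"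
  shows "continuous_on {0<..<s} (\<lambda>r. volume_density f (u + r *\<^sub>R v))"
proof (rule continuous_on_compose2[OF continuous_on_volume_density[OF f]])
  show "continuous_on {0<..<s} (\<lambda>r. u + r *\<^sub>R v)" by (intro continuous_intros)
  show "(\<lambda>r. u + r *\<^sub>R v) ` {0<..<s} \<subseteq> W"
  proof (intro image_subsetI)
    fix r assume r: "r \<in> {0<..<s}"
    have "norm (r *\<^sub>R v) \<le> s * 2"
      unfolding norm_scaleR using r v by (intro mult_mono) (auto simp: annulus_def)
    then show "u + r *\<^sub>R v \<in> W" using s by (simp add: mult.commute)
  qed
qed

text \<open>The ball condition reads \<open>r \<le> t \<sigma>\<close>. With
  \<open>r = t \<sigma> a\<close> the length of the interval contributes one factor \<open>t\<close>
  and \<open>r^(m-1)\<close> the others, so \<open>t^m\<close> can be taken out.\<close>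

lemma piece_ball_volume:
  fixes f :: "real ^ 'm::finite \<Rightarrow> 'a::euclidean_space"
  assumes cl: "closed_submanifold TYPE('m) M" and f: "local_parametrization M W f" and K: "compact K" "K \<subseteq> W"
    and B: "B \<in> sets borel" "B \<subseteq> K"
  obtains d h where "d > 0" "family_smooth {0::real} d (\<lambda>_. h)" "\<And>t. t \<in> {-d<..<d} \<Longrightarrow> h (- t) = h t"
    "\<And>t. t \<in> {0<..<d} \<Longrightarrow> 0 \<le> h t"
    "\<And>t. t \<in> {0<..<d} \<Longrightarrow>
      (\<integral>\<^sup>+x\<in>f ` B. (\<integral>\<^sup>+y\<in>M. indicator {..t} (norm (x - y)) \<partial>riemannian_volume TYPE('m) M) \<partial>riemannian_volume TYPE('m) M) =
      ennreal (t ^ CARD('m) * h t)"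
proof -
  note F = local_parametrizationD[OF f]
  let ?X = "K \<times> (annulus :: (real ^ 'm) set)"
  obtain s0 where s0: "s0 > 0" "\<And>u w. u \<in> K \<Longrightarrow> norm w \<le> 2 * s0 \<Longrightarrow> u + w \<in> W"
    using compact_in_open_room[OF K(1) F(1) K(2)] by blast
  have sm1: "smooth_on W (\<lambda>_. 1::real)"
    by (simp add: smooth_on_def higher_differentiable_on_const[OF F(1)])
  obtain s1 where s1: "0 < s1" "s1 \<le> s0"
    "\<And>s'. 0 < s' \<Longrightarrow> s' < s1 \<Longrightarrow> \<exists>d>0. \<exists>\<sigma>. family_smooth ?X d \<sigma> \<and>
      (\<forall>x\<in>?X. \<forall>t\<in>{-d<..<d}. 0 < \<sigma> x t \<and> t * \<sigma> x t \<in> {-s'<..<s'}) \<and>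
      (\<forall>u\<in>K. \<forall>v\<in>annulus. \<forall>t\<in>{0<..<d}. \<forall>s\<in>{0<..<s'}.
         norm (f (u + s *\<^sub>R v) - f u) * (1 * 1) \<le> t \<longleftrightarrow> s \<le> t * \<sigma> (u, v) t) \<and>
      (\<forall>u\<in>K. \<forall>v\<in>annulus. \<forall>t\<in>{-d<..<d}. t \<noteq> 0 \<longrightarrow> \<sigma> (u, - v) (- t) = \<sigma> (u, v) t)"
    by (rule chord_inverse[OF f K(1) s0 sm1]) auto
  define s where "s = s1 / 2"
  have s: "0 < s" "s < s1" using s1 by (auto simp: s_def)
  have room: "u + w \<in> W" if "u \<in> K" "norm w \<le> 2 * s" for u w using s0(2)[of u w] that s s1 by auto
  obtain d \<sigma> where d: "d > 0" and \<sigma>: "family_smooth ?X d \<sigma>"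
    "\<And>x t. x \<in> ?X \<Longrightarrow> t \<in> {-d<..<d} \<Longrightarrow> 0 < \<sigma> x t" "\<And>x t. x \<in> ?X \<Longrightarrow> t \<in> {-d<..<d} \<Longrightarrow> t * \<sigma> x t \<in> {-s<..<s}"
    "\<And>u v t r. u \<in> K \<Longrightarrow> v \<in> annulus \<Longrightarrow> t \<in> {0<..<d} \<Longrightarrow> r \<in> {0<..<s} \<Longrightarrow>
      norm (f (u + r *\<^sub>R v) - f u) \<le> t \<longleftrightarrow> r \<le> t * \<sigma> (u, v) t"
    "\<And>u v t. u \<in> K \<Longrightarrow> v \<in> annulus \<Longrightarrow> t \<in> {-d<..<d} \<Longrightarrow> t \<noteq> 0 \<Longrightarrow> \<sigma> (u, - v) (- t) = \<sigma> (u, v) t"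
    using s1(3)[OF s] by (simp only: mult_1_right) blast
  \<comment> \<open>Here \<open>\<rho>\<close> is the radius divided by \<open>t\<close>, not a
    conformal factor; the last component of \<open>z\<close> is the radial variable
    \<open>a\<close>.\<close>
  define \<rho> where "\<rho> z t = \<sigma> (fst z) t * snd z" for z :: "((real ^ 'm) \<times> (real ^ 'm)) \<times> real" and t
  define H where "H z t = \<sigma> (fst z) t * \<rho> z t ^ (CARD('m) - 1) * (volume_density f (fst (fst z)) *
      volume_density f (fst (fst z) + (t * \<rho> z t) *\<^sub>R snd (fst z))) * (1 / ln 2)" for z t
  have cfst: "continuous_on (?X \<times> {0..1::real}) fst" and csnd: "continuous_on (?X \<times> {0..1::real}) snd"
    by (intro continuous_intros)+
  have \<sigma>': "family_smooth (?X \<times> {0..1::real}) d (\<lambda>z. \<sigma> (fst z))"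
    by (rule family_smooth_reparam[OF \<sigma>(1) cfst]) auto
  have \<rho>: "family_smooth (?X \<times> {0..1}) d \<rho>" unfolding \<rho>_def
    by (intro family_smoothI family_C_mult family_smoothD[OF \<sigma>'] family_C_const csnd)
  have \<rho>s: "t * \<rho> z t \<in> {-s<..<s}" if "z \<in> ?X \<times> {0..1}" "t \<in> {-d<..<d}" for z t
  proof -
    have "\<bar>t * \<sigma> (fst z) t * snd z\<bar> \<le> \<bar>t * \<sigma> (fst z) t\<bar>"
      using that by (auto simp: abs_mult intro!: mult_left_le)
    moreover have "\<bar>t * \<sigma> (fst z) t\<bar> < s" using \<sigma>(3)[of "fst z" t] that by auto
    ultimately show ?thesis by (auto simp: \<rho>_def mult.assoc)
  qed
  have Hsm: "family_smooth (?X \<times> {0..1}) d H" unfolding H_def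
    by (intro family_smoothI family_C_mult family_C_power family_smoothD[OF \<sigma>'] family_smoothD[OF \<rho>]
        family_smoothD[OF family_smooth_volume_density_shell[OF f K(2) room \<rho> \<rho>s]] family_C_const continuous_on_const)
  have inW: "u + r *\<^sub>R v \<in> W" if "u \<in> K" "v \<in> annulus" "r \<in> {-s<..<s}" for u v r
  proof -
    have "norm (r *\<^sub>R v) \<le> s * 2"
      unfolding norm_scaleR using that by (intro mult_mono) (auto simp: annulus_def)
    then show ?thesis using room that by (auto simp: mult.commute)
  qed
  have vdp: "0 < volume_density f u" if "u \<in> W" for u by (rule volume_density_pos[OF f that])
  obtain d' h where "d' > 0" "d' \<le> d" "family_smooth {0::real} d' (\<lambda>_. h)" "\<And>t. t \<in> {-d'<..<d'} \<Longrightarrow> h (- t) = h t"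
    "\<And>t. t \<in> {0<..<d'} \<Longrightarrow> 0 \<le> h t"
    "\<And>t. t \<in> {0<..<d'} \<Longrightarrow>
      (\<integral>\<^sup>+x\<in>f ` B. (\<integral>\<^sup>+y\<in>M. indicator {..t} (norm (x - y)) \<partial>riemannian_volume TYPE('m) M) \<partial>riemannian_volume TYPE('m) M) =
      ennreal (t ^ CARD('m) * h t)"
  proof (rule piece_shell[OF cl f K B s(1) room d Hsm, where C = "\<lambda>t. t ^ CARD('m)" and
        k = "\<lambda>t x y. indicator {..t} (norm (x - y))" and c = 1])
    fix z :: "((real ^ 'm) \<times> (real ^ 'm)) \<times> real" and t assume z: "z \<in> ?X \<times> {0..1}" and t: "t \<in> {0<..<d}"
    then have td: "t \<in> {-d<..<d}" by auto
    have "0 \<le> \<rho> z t" using \<sigma>(2)[of "fst z" t] z td by (auto simp: \<rho>_def)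
    moreover have "0 < \<sigma> (fst z) t" using \<sigma>(2)[of "fst z" t] z td by auto
    moreover have "0 < volume_density f (fst (fst z))" using z K(2) by (intro vdp) auto
    moreover have "0 < volume_density f (fst (fst z) + (t * \<rho> z t) *\<^sub>R snd (fst z))"
      using z \<rho>s[OF z td] by (intro vdp inW) auto
    ultimately show "0 \<le> H z t" by (auto simp: H_def)
  next
    fix u v :: "real ^ 'm" and a t :: real assume "u \<in> K" "v \<in> annulus" "a \<in> {0..1::real}" "t \<in> {0<..<d}"
    then have "\<sigma> (u, - v) (- t) = \<sigma> (u, v) t" by (intro \<sigma>(5)) auto
    then show "H ((u, - v), a) (- t) = H ((u, v), a) t" by (simp add: H_def \<rho>_def)
  next
    fix t :: real assume "t \<in> {0<..<d}"
    then show "0 \<le> t ^ CARD('m)" by simp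
    show "(\<lambda>p. indicator {..t} (norm (fst p - snd p)) :: ennreal) \<in> borel_measurable (borel :: ('a \<times> 'a) measure)"
      by measurable
    show "1 * norm (x - y) \<le> t" if "indicator {..t} (norm (x - y)) \<noteq> (0::ennreal)" for x y :: 'a
      using that by (auto simp: indicator_def split: if_splits)
  next
    fix u v :: "real ^ 'm" and t :: real assume u: "u \<in> K" and v: "v \<in> annulus" and t: "t \<in> {0<..<d}"
    then have td: "t \<in> {-d<..<d}" by auto
    define \<gamma> where "\<gamma> r = volume_density f u * volume_density f (u + r *\<^sub>R v) * r ^ (CARD('m) - 1) / ln 2" for r
    have S: "0 < t * \<sigma> (u, v) t" "t * \<sigma> (u, v) t < s" using \<sigma>(2,3)[of "(u, v)" t] u v t td by auto
    have cont: "continuous_on {0<..<s} \<gamma>" unfolding \<gamma>_def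
      by (intro continuous_intros continuous_on_volume_density_line[OF f room[OF u] v]) auto
    have "(\<integral>\<^sup>+r\<in>{0<..<s}. ennreal (volume_density f u * volume_density f (u + r *\<^sub>R v) * r ^ (CARD('m) - 1) / ln 2) *
         indicator {..t} (norm (f u - f (u + r *\<^sub>R v))) \<partial>lborel) =
        (\<integral>\<^sup>+r\<in>{0<..<s}. ennreal (\<gamma> r) * indicator {0<..t * \<sigma> (u, v) t} r \<partial>lborel)"
    proof (rule nn_integral_cong)
      fix r
      show "ennreal (volume_density f u * volume_density f (u + r *\<^sub>R v) * r ^ (CARD('m) - 1) / ln 2) *
         indicator {..t} (norm (f u - f (u + r *\<^sub>R v))) * indicator {0<..<s} r =
         ennreal (\<gamma> r) * indicator {0<..t * \<sigma> (u, v) t} r * indicator {0<..<s} r"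
        using \<sigma>(4)[OF u v t, of r] by (cases "r \<in> {0<..<s}") (auto simp: \<gamma>_def indicator_def norm_minus_commute)
    qed
    also have "\<dots> = (\<integral>\<^sup>+a\<in>{0..1}. ennreal ((t * \<sigma> (u, v) t - 0) * \<gamma> (0 + (t * \<sigma> (u, v) t - 0) * a)) \<partial>lborel)"
      by (rule nn_integral_shell[OF _ _ _ cont]) (use S in auto)
    also have "\<dots> = (\<integral>\<^sup>+a\<in>{0..1}. ennreal (t ^ CARD('m) * H ((u, v), a) t) \<partial>lborel)"
    proof -
      have "(t * \<sigma> (u, v) t) * \<gamma> (t * \<sigma> (u, v) t * a) = t ^ CARD('m) * H ((u, v), a) t" for a
      proof -
        have "t ^ CARD('m) = t * t ^ (CARD('m) - 1)" by (simp flip: power_Suc)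
        then show ?thesis
          by (simp add: \<gamma>_def H_def \<rho>_def power_mult_distrib mult_ac)
      qed
      then show ?thesis by simp
    qed
    finally show "(\<integral>\<^sup>+r\<in>{0<..<s}. ennreal (volume_density f u * volume_density f (u + r *\<^sub>R v) * r ^ (CARD('m) - 1) / ln 2) *
         indicator {..t} (norm (f u - f (u + r *\<^sub>R v))) \<partial>lborel) =
        (\<integral>\<^sup>+a\<in>{0..1}. ennreal (t ^ CARD('m) * H ((u, v), a) t) \<partial>lborel)" .
  qed auto
  then show ?thesis using that by blast
qed

text \<open>With the weight \<open>c0\<close> the first condition reads
  \<open>r \<le> t \<sigma>1\<close>, with the weight \<open>\<rho>\<close> the second reads
  \<open>r > t \<sigma>2\<close>. The volume contributes \<open>t^m\<close> and the kernel
  \<open>t^(-2m)\<close>; the quotient of chord and radius enters the kernel through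
  \<open>R\<close>.\<close>

lemma piece_energy_shell:
  fixes f :: "real ^ 'm::finite \<Rightarrow> 'a::euclidean_space" and \<rho> :: "'a \<Rightarrow> real"
  assumes cl: "closed_submanifold TYPE('m) M" and f: "local_parametrization M W f" and K: "compact K" "K \<subseteq> W"
    and B: "B \<in> sets borel" "B \<subseteq> K"
    and \<rho>: "\<rho> \<in> borel_measurable borel" "smooth_on W (\<lambda>u. \<rho> (f u))" and c0: "0 < c0" "\<And>x. x \<in> M \<Longrightarrow> c0 \<le> \<rho> x"
  obtains d h where "d > 0" "family_smooth {0::real} d (\<lambda>_. h)" "\<And>t. t \<in> {-d<..<d} \<Longrightarrow> h (- t) = h t"
    "\<And>t. t \<in> {0<..<d} \<Longrightarrow> 0 \<le> h t"
    "\<And>t. t \<in> {0<..<d} \<Longrightarrow>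
      (\<integral>\<^sup>+x\<in>f ` B. (\<integral>\<^sup>+y\<in>M. (if c0 * c0 * norm (x - y) \<le> t \<and> t < \<rho> x * \<rho> y * norm (x - y)
         then ennreal (inverse (norm (x - y) ^ (2 * CARD('m)))) else 0)
         \<partial>riemannian_volume TYPE('m) M) \<partial>riemannian_volume TYPE('m) M) =
      ennreal (inverse (t ^ CARD('m)) * h t)"
proof -
  note F = local_parametrizationD[OF f]
  let ?X = "K \<times> (annulus :: (real ^ 'm) set)"
  let ?X' = "?X \<times> {0..1::real}"
  obtain s0 where s0: "s0 > 0" "\<And>u w. u \<in> K \<Longrightarrow> norm w \<le> 2 * s0 \<Longrightarrow> u + w \<in> W"
    using compact_in_open_room[OF K(1) F(1) K(2)] by blast
  obtain R where R: "family_smooth ?X s0 R"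
    "\<And>x s. x \<in> ?X \<Longrightarrow> s \<in> {-s0<..<s0} \<Longrightarrow> 0 < R x s"
    "\<And>u v s. u \<in> K \<Longrightarrow> v \<in> annulus \<Longrightarrow> s \<in> {-s0<..<s0} \<Longrightarrow> norm (f (u + s *\<^sub>R v) - f u) = \<bar>s\<bar> * R (u, v) s"
    "\<And>u v s. u \<in> K \<Longrightarrow> v \<in> annulus \<Longrightarrow> s \<in> {-s0<..<s0} \<Longrightarrow> s \<noteq> 0 \<Longrightarrow> R (u, - v) (- s) = R (u, v) s"
    using chord_family[OF f K(1) s0] by blast
  have smc: "smooth_on W (\<lambda>_. c0)"
    by (simp add: smooth_on_def higher_differentiable_on_const[OF F(1)])
  obtain s1 where s1: "0 < s1" "s1 \<le> s0"
    "\<And>s'. 0 < s' \<Longrightarrow> s' < s1 \<Longrightarrow> \<exists>d>0. \<exists>\<sigma>. family_smooth ?X d \<sigma> \<and>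
      (\<forall>x\<in>?X. \<forall>t\<in>{-d<..<d}. 0 < \<sigma> x t \<and> t * \<sigma> x t \<in> {-s'<..<s'}) \<and>
      (\<forall>u\<in>K. \<forall>v\<in>annulus. \<forall>t\<in>{0<..<d}. \<forall>s\<in>{0<..<s'}.
         norm (f (u + s *\<^sub>R v) - f u) * (c0 * c0) \<le> t \<longleftrightarrow> s \<le> t * \<sigma> (u, v) t) \<and>
      (\<forall>u\<in>K. \<forall>v\<in>annulus. \<forall>t\<in>{-d<..<d}. t \<noteq> 0 \<longrightarrow> \<sigma> (u, - v) (- t) = \<sigma> (u, v) t)"
    by (rule chord_inverse[OF f K(1) s0 smc]) (use c0(1) in auto)
  have \<rho>W: "c0 \<le> \<rho> (f u)" if "u \<in> W" for u using c0(2) F(7) that by blast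
  have \<rho>W': "0 < \<rho> (f u)" if "u \<in> W" for u using \<rho>W[OF that] c0(1) by linarith
  obtain s2 where s2: "0 < s2" "s2 \<le> s0"
    "\<And>s'. 0 < s' \<Longrightarrow> s' < s2 \<Longrightarrow> \<exists>d>0. \<exists>\<sigma>. family_smooth ?X d \<sigma> \<and>
      (\<forall>x\<in>?X. \<forall>t\<in>{-d<..<d}. 0 < \<sigma> x t \<and> t * \<sigma> x t \<in> {-s'<..<s'}) \<and>
      (\<forall>u\<in>K. \<forall>v\<in>annulus. \<forall>t\<in>{0<..<d}. \<forall>s\<in>{0<..<s'}.
         norm (f (u + s *\<^sub>R v) - f u) * (\<rho> (f u) * \<rho> (f (u + s *\<^sub>R v))) \<le> t \<longleftrightarrow> s \<le> t * \<sigma> (u, v) t) \<and>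
      (\<forall>u\<in>K. \<forall>v\<in>annulus. \<forall>t\<in>{-d<..<d}. t \<noteq> 0 \<longrightarrow> \<sigma> (u, - v) (- t) = \<sigma> (u, v) t)"
    by (rule chord_inverse[OF f K(1) s0 \<rho>(2) \<rho>W']) blast+
  \<comment> \<open>One range of radii for both weights, possible because
    \<open>chord_inverse\<close> holds for all smaller bounds.\<close>
  define s where "s = min s1 s2 / 2"
  have s: "0 < s" "s < s1" "s < s2" "s < s0" using s1(1,2) s2(1) by (auto simp: s_def)
  have room: "u + w \<in> W" if "u \<in> K" "norm w \<le> 2 * s" for u w using s0(2)[of u w] that s by auto
  obtain d1 \<sigma>1 where d1: "d1 > 0" and \<sigma>1: "family_smooth ?X d1 \<sigma>1"
    "\<And>x t. x \<in> ?X \<Longrightarrow> t \<in> {-d1<..<d1} \<Longrightarrow> 0 < \<sigma>1 x t" "\<And>x t. x \<in> ?X \<Longrightarrow> t \<in> {-d1<..<d1} \<Longrightarrow> t * \<sigma>1 x t \<in> {-s<..<s}"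
    "\<And>u v t r. u \<in> K \<Longrightarrow> v \<in> annulus \<Longrightarrow> t \<in> {0<..<d1} \<Longrightarrow> r \<in> {0<..<s} \<Longrightarrow>
      norm (f (u + r *\<^sub>R v) - f u) * (c0 * c0) \<le> t \<longleftrightarrow> r \<le> t * \<sigma>1 (u, v) t"
    "\<And>u v t. u \<in> K \<Longrightarrow> v \<in> annulus \<Longrightarrow> t \<in> {-d1<..<d1} \<Longrightarrow> t \<noteq> 0 \<Longrightarrow> \<sigma>1 (u, - v) (- t) = \<sigma>1 (u, v) t"
    using s1(3)[OF s(1,2)] by blast
  obtain d2 \<sigma>2 where d2: "d2 > 0" and \<sigma>2: "family_smooth ?X d2 \<sigma>2"
    "\<And>x t. x \<in> ?X \<Longrightarrow> t \<in> {-d2<..<d2} \<Longrightarrow> 0 < \<sigma>2 x t" "\<And>x t. x \<in> ?X \<Longrightarrow> t \<in> {-d2<..<d2} \<Longrightarrow> t * \<sigma>2 x t \<in> {-s<..<s}"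
    "\<And>u v t r. u \<in> K \<Longrightarrow> v \<in> annulus \<Longrightarrow> t \<in> {0<..<d2} \<Longrightarrow> r \<in> {0<..<s} \<Longrightarrow>
      norm (f (u + r *\<^sub>R v) - f u) * (\<rho> (f u) * \<rho> (f (u + r *\<^sub>R v))) \<le> t \<longleftrightarrow> r \<le> t * \<sigma>2 (u, v) t"
    "\<And>u v t. u \<in> K \<Longrightarrow> v \<in> annulus \<Longrightarrow> t \<in> {-d2<..<d2} \<Longrightarrow> t \<noteq> 0 \<Longrightarrow> \<sigma>2 (u, - v) (- t) = \<sigma>2 (u, v) t"
    using s2(3)[OF s(1,3)] by blast
  define d where "d = min d1 d2"
  have d: "d > 0" "d \<le> d1" "d \<le> d2" using d1 d2 by (simp_all add: d_def)
  have td: "t \<in> {-d1<..<d1}" "t \<in> {-d2<..<d2}" if "t \<in> {-d<..<d}" for t using that d by auto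
  have tp: "t \<in> {0<..<d1}" "t \<in> {0<..<d2}" "t \<in> {-d<..<d}" if "t \<in> {0<..<d}" for t using that d by auto
  have inW: "u + r *\<^sub>R v \<in> W" if "u \<in> K" "v \<in> annulus" "r \<in> {-s<..<s}" for u v r
  proof -
    have "norm (r *\<^sub>R v) \<le> s * 2"
      unfolding norm_scaleR using that by (intro mult_mono) (auto simp: annulus_def)
    then show ?thesis using room that by (auto simp: mult.commute)
  qed
  \<comment> \<open>At the radius \<open>t \<sigma>2\<close> the chord weighted by
    \<open>\<rho>\<close> is at most \<open>t\<close>, hence so is the smaller one weighted by
    \<open>c0\<close>.\<close>
  have le12: "\<sigma>2 (u, v) t \<le> \<sigma>1 (u, v) t" if u: "u \<in> K" and v: "v \<in> annulus" and t: "t \<in> {0<..<d}" for u v t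
  proof -
    define r where "r = t * \<sigma>2 (u, v) t"
    have r: "r \<in> {0<..<s}" using \<sigma>2(2,3)[of "(u, v)" t] u v t td[OF tp(3)[OF t]] by (auto simp: r_def)
    have rs: "r \<in> {-s<..<s}" using r s(1) by auto
    have uW: "u \<in> W" using u K(2) by blast
    have "norm (f (u + r *\<^sub>R v) - f u) * (c0 * c0) \<le> norm (f (u + r *\<^sub>R v) - f u) * (\<rho> (f u) * \<rho> (f (u + r *\<^sub>R v)))"
      using \<rho>W[OF uW] \<rho>W[OF inW[OF u v rs]] c0(1) by (intro mult_left_mono mult_mono) auto
    also have "\<dots> \<le> t" using \<sigma>2(4)[OF u v tp(2)[OF t] r] by (simp add: r_def)
    finally have "r \<le> t * \<sigma>1 (u, v) t" using \<sigma>1(4)[OF u v tp(1)[OF t] r] by simp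
    then show ?thesis using t by (simp add: r_def)
  qed
  define \<tau> where "\<tau> z t = \<sigma>1 (fst z) t - \<sigma>2 (fst z) t" for z :: "((real ^ 'm) \<times> (real ^ 'm)) \<times> real" and t
  \<comment> \<open>The radius is \<open>r = t p\<close>, and \<open>p\<close> interpolates between
    \<open>\<sigma>2\<close> at \<open>a = 0\<close> and \<open>\<sigma>1\<close> at
    \<open>a = 1\<close>; convexity keeps \<open>p\<close> positive and \<open>t p\<close> in
    range.\<close>
  define p where "p z t = \<sigma>2 (fst z) t + \<tau> z t * snd z" for z :: "((real ^ 'm) \<times> (real ^ 'm)) \<times> real" and t
  define H where "H z t = \<tau> z t * p z t ^ (CARD('m) - 1) * (volume_density f (fst (fst z)) *
      volume_density f (fst (fst z) + (t * p z t) *\<^sub>R snd (fst z))) *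
      (inverse (p z t) * inverse (R (fst z) (t * p z t))) ^ (2 * CARD('m)) * (1 / ln 2)" for z t
  have cfst: "continuous_on ?X' fst" and csnd: "continuous_on ?X' snd"
    by (intro continuous_intros)+
  have \<sigma>1': "family_smooth ?X' d (\<lambda>z. \<sigma>1 (fst z))"
    by (rule family_smooth_reparam[OF \<sigma>1(1) cfst _ d(2)]) auto
  have \<sigma>2': "family_smooth ?X' d (\<lambda>z. \<sigma>2 (fst z))"
    by (rule family_smooth_reparam[OF \<sigma>2(1) cfst _ d(3)]) auto
  have \<tau>: "family_smooth ?X' d \<tau>" unfolding \<tau>_def
    by (intro family_smoothI family_C_diff family_smoothD[OF \<sigma>1'] family_smoothD[OF \<sigma>2'])
  have p: "family_smooth ?X' d p" unfolding p_def
    by (intro family_smoothI family_C_add family_C_mult family_smoothD[OF \<sigma>2'] family_smoothD[OF \<tau>] family_C_const csnd)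
  have conv: "0 < p z t" "t * p z t \<in> {-s<..<s}" if z: "z \<in> ?X'" and t: "t \<in> {-d<..<d}" for z t
  proof -
    define a where "a = snd z"
    have a: "0 \<le> a" "a \<le> 1" using z by (auto simp: a_def)
    have eq: "p z t = (1 - a) * \<sigma>2 (fst z) t + a * \<sigma>1 (fst z) t"
      by (simp add: p_def \<tau>_def a_def algebra_simps)
    have x: "fst z \<in> ?X" using z by auto
    have pos: "0 < \<sigma>1 (fst z) t" "0 < \<sigma>2 (fst z) t" using \<sigma>1(2)[OF x td(1)[OF t]] \<sigma>2(2)[OF x td(2)[OF t]] by auto
    show "0 < p z t" unfolding eq using pos a
      by (cases "a = 0") (auto intro!: add_nonneg_pos mult_nonneg_nonneg mult_pos_pos)
    have "t * p z t = (1 - a) * (t * \<sigma>2 (fst z) t) + a * (t * \<sigma>1 (fst z) t)" by (simp add: eq algebra_simps)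
    also have "\<dots> \<in> {-s<..<s}"
      using convexD_alt[of "{-s<..<s}" "t * \<sigma>2 (fst z) t" "t * \<sigma>1 (fst z) t" a]
        \<sigma>1(3)[OF x td(1)[OF t]] \<sigma>2(3)[OF x td(2)[OF t]] a by simp
    finally show "t * p z t \<in> {-s<..<s}" .
  qed
  have Rsm: "family_C k ?X' d (\<lambda>z t. R (fst z) (t * p z t))" for k
  proof (rule family_C_compose[where F = "\<lambda>z. R (fst z)" and H = "\<lambda>z t. t * p z t" and d = s0])
    show "family_C k ?X' s0 (\<lambda>z. R (fst z))"
      by (rule family_smoothD[OF family_smooth_reparam[OF R(1) cfst]]) auto
    show "family_C k ?X' d (\<lambda>z t. t * p z t)"
      by (intro family_C_mult family_C_id family_smoothD[OF p])
    show "t * p z t \<in> {-s0<..<s0}" if "z \<in> ?X'" "t \<in> {-d<..<d}" for z t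
      using conv(2)[OF that] s by auto
  qed
  have Rpos: "0 < R (fst z) (t * p z t)" if "z \<in> ?X'" "t \<in> {-d<..<d}" for z t
    using conv(2)[OF that] s that by (intro R(2)) auto
  have i1: "family_C k ?X' d (\<lambda>z t. inverse (p z t))" for k
    by (rule family_C_inverse[OF family_smoothD[OF p]]) (use conv(1) in force)
  have i2: "family_C k ?X' d (\<lambda>z t. inverse (R (fst z) (t * p z t)))" for k
    by (rule family_C_inverse[OF Rsm]) (use Rpos in force)
  have Hsm: "family_smooth ?X' d H" unfolding H_def
    by (intro family_smoothI family_C_mult[OF family_C_mult[OF family_C_mult[OF family_C_mult[OF
          family_smoothD[OF \<tau>] family_C_power[OF family_smoothD[OF p]]]
          family_smoothD[OF family_smooth_volume_density_shell[OF f K(2) room p conv(2)]]]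
          family_C_power[OF family_C_mult[OF i1 i2]]]
          family_C_const[OF continuous_on_const]]) auto
  have vdp: "0 < volume_density f u" if "u \<in> W" for u by (rule volume_density_pos[OF f that])
  obtain d' h where "d' > 0" "d' \<le> d" "family_smooth {0::real} d' (\<lambda>_. h)" "\<And>t. t \<in> {-d'<..<d'} \<Longrightarrow> h (- t) = h t"
    "\<And>t. t \<in> {0<..<d'} \<Longrightarrow> 0 \<le> h t"
    "\<And>t. t \<in> {0<..<d'} \<Longrightarrow>
      (\<integral>\<^sup>+x\<in>f ` B. (\<integral>\<^sup>+y\<in>M. (if c0 * c0 * norm (x - y) \<le> t \<and> t < \<rho> x * \<rho> y * norm (x - y)
         then ennreal (inverse (norm (x - y) ^ (2 * CARD('m)))) else 0)
         \<partial>riemannian_volume TYPE('m) M) \<partial>riemannian_volume TYPE('m) M) =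
      ennreal (inverse (t ^ CARD('m)) * h t)"
  proof (rule piece_shell[OF cl f K B s(1) room d(1) Hsm, where C = "\<lambda>t. inverse (t ^ CARD('m))" and
        k = "\<lambda>t x y. if c0 * c0 * norm (x - y) \<le> t \<and> t < \<rho> x * \<rho> y * norm (x - y)
         then ennreal (inverse (norm (x - y) ^ (2 * CARD('m)))) else 0" and c = "c0 * c0"])
    fix z :: "((real ^ 'm) \<times> (real ^ 'm)) \<times> real" and t assume z: "z \<in> ?X'" and t: "t \<in> {0<..<d}"
    note t' = tp(3)[OF t]
    have "0 \<le> \<tau> z t" using le12[of "fst (fst z)" "snd (fst z)" t] z t by (auto simp: \<tau>_def)
    moreover have "0 < volume_density f (fst (fst z))" using z K(2) by (intro vdp) auto
    moreover have "0 < volume_density f (fst (fst z) + (t * p z t) *\<^sub>R snd (fst z))"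
      using z conv(2)[OF z t'] by (intro vdp inW) auto
    ultimately show "0 \<le> H z t" using conv(1)[OF z t'] Rpos[OF z t'] by (auto simp: H_def)
  next
    fix u v :: "real ^ 'm" and a t :: real assume uva: "u \<in> K" "v \<in> annulus" "a \<in> {0..1::real}" and t: "t \<in> {0<..<d}"
    note t' = tp(3)[OF t]
    have e1: "\<sigma>1 (u, - v) (- t) = \<sigma>1 (u, v) t" by (rule \<sigma>1(5)[OF uva(1,2) td(1)[OF t']]) (use t in auto)
    have e2: "\<sigma>2 (u, - v) (- t) = \<sigma>2 (u, v) t" by (rule \<sigma>2(5)[OF uva(1,2) td(2)[OF t']]) (use t in auto)
    have e3: "\<tau> ((u, - v), a) (- t) = \<tau> ((u, v), a) t" by (simp add: \<tau>_def e1 e2)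
    have e4: "p ((u, - v), a) (- t) = p ((u, v), a) t" by (simp add: p_def e2 e3)
    have z: "((u, v), a) \<in> ?X'" using uva by auto
    have "R (u, - v) (- (t * p ((u, v), a) t)) = R (u, v) (t * p ((u, v), a) t)"
      by (rule R(4)[OF uva(1,2)]) (use conv[OF z t'] s t in auto)
    then show "H ((u, - v), a) (- t) = H ((u, v), a) t" by (simp add: H_def e3 e4)
  next
    fix t :: real assume t: "t \<in> {0<..<d}"
    then show "0 \<le> inverse (t ^ CARD('m))" by simp
    have [measurable]: "(\<lambda>p. \<rho> (fst p)) \<in> borel_measurable (borel :: ('a \<times> 'a) measure)"
      "(\<lambda>p. \<rho> (snd p)) \<in> borel_measurable (borel :: ('a \<times> 'a) measure)"
      by (rule measurable_compose[OF measurable_fst_borel \<rho>(1)] measurable_compose[OF measurable_snd_borel \<rho>(1)])+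
    show "(\<lambda>p. if c0 * c0 * norm (fst p - snd p) \<le> t \<and> t < \<rho> (fst p) * \<rho> (snd p) * norm (fst p - snd p)
         then ennreal (inverse (norm (fst p - snd p) ^ (2 * CARD('m)))) else 0) \<in> borel_measurable (borel :: ('a \<times> 'a) measure)"
      by measurable
    show "c0 * c0 * norm (x - y) \<le> t" if "(if c0 * c0 * norm (x - y) \<le> t \<and> t < \<rho> x * \<rho> y * norm (x - y)
         then ennreal (inverse (norm (x - y) ^ (2 * CARD('m)))) else 0) \<noteq> 0" for x y :: 'a
      using that by (auto split: if_splits)
  next
    fix u v :: "real ^ 'm" and t :: real assume u: "u \<in> K" and v: "v \<in> annulus" and t: "t \<in> {0<..<d}"
    note t' = tp(3)[OF t]
    define S1 S2 where "S1 = t * \<sigma>1 (u, v) t" and "S2 = t * \<sigma>2 (u, v) t"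
    define \<gamma> where "\<gamma> r = volume_density f u * volume_density f (u + r *\<^sub>R v) * r ^ (CARD('m) - 1) / ln 2 *
        inverse ((r * R (u, v) r) ^ (2 * CARD('m)))" for r
    have S: "0 < S2" "S2 \<le> S1" "S1 < s"
      using \<sigma>1(2,3)[of "(u, v)" t] \<sigma>2(2,3)[of "(u, v)" t] u v t td[OF t'] le12[OF u v t] by (auto simp: S1_def S2_def)
    have contR: "continuous_on {0<..<s} (R (u, v))"
    proof -
      have "continuous_on {0<..<s} (\<lambda>r. ((u, v), r))" by (intro continuous_intros)
      moreover have "(\<lambda>r. ((u, v), r)) ` {0<..<s} \<subseteq> ?X \<times> {-s0<..<s0}" using u v s by auto
      ultimately show ?thesis using continuous_on_compose2[OF family_smooth_cont[OF R(1)]] by fastforce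
    qed
    have Rp: "0 < R (u, v) r" if "r \<in> {0<..<s}" for r using that s u v by (intro R(2)) auto
    have cont: "continuous_on {0<..<s} \<gamma>" unfolding \<gamma>_def
      by (intro continuous_intros continuous_on_volume_density_line[OF f room[OF u] v] contR) (use Rp in \<open>force\<close>)+
    have "(\<integral>\<^sup>+r\<in>{0<..<s}. ennreal (volume_density f u * volume_density f (u + r *\<^sub>R v) * r ^ (CARD('m) - 1) / ln 2) *
         (if c0 * c0 * norm (f u - f (u + r *\<^sub>R v)) \<le> t \<and> t < \<rho> (f u) * \<rho> (f (u + r *\<^sub>R v)) * norm (f u - f (u + r *\<^sub>R v))
         then ennreal (inverse (norm (f u - f (u + r *\<^sub>R v)) ^ (2 * CARD('m)))) else 0) \<partial>lborel) =
        (\<integral>\<^sup>+r\<in>{0<..<s}. ennreal (\<gamma> r) * indicator {S2<..S1} r \<partial>lborel)"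
    proof (rule nn_integral_cong)
      fix r
      show "ennreal (volume_density f u * volume_density f (u + r *\<^sub>R v) * r ^ (CARD('m) - 1) / ln 2) *
         (if c0 * c0 * norm (f u - f (u + r *\<^sub>R v)) \<le> t \<and> t < \<rho> (f u) * \<rho> (f (u + r *\<^sub>R v)) * norm (f u - f (u + r *\<^sub>R v))
         then ennreal (inverse (norm (f u - f (u + r *\<^sub>R v)) ^ (2 * CARD('m)))) else 0) * indicator {0<..<s} r =
         ennreal (\<gamma> r) * indicator {S2<..S1} r * indicator {0<..<s} r"
      proof (cases "r \<in> {0<..<s}")
        case True
        have nR: "norm (f u - f (u + r *\<^sub>R v)) = r * R (u, v) r"
          using R(3)[OF u v, of r] True s by (simp add: norm_minus_commute)
        have i1: "c0 * c0 * norm (f u - f (u + r *\<^sub>R v)) \<le> t \<longleftrightarrow> r \<le> S1"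
          using \<sigma>1(4)[OF u v tp(1)[OF t] True] by (simp add: S1_def norm_minus_commute mult_ac)
        have i2: "t < \<rho> (f u) * \<rho> (f (u + r *\<^sub>R v)) * norm (f u - f (u + r *\<^sub>R v)) \<longleftrightarrow> S2 < r"
          using \<sigma>2(4)[OF u v tp(2)[OF t] True] by (simp add: S2_def norm_minus_commute mult_ac flip: not_le)
        have "u \<in> W" "u + r *\<^sub>R v \<in> W" using u K(2) inW[OF u v, of r] True s by auto
        then have nn: "0 \<le> volume_density f u * volume_density f (u + r *\<^sub>R v) * r ^ (CARD('m) - 1) / ln 2"
          using vdp True by (simp add: less_imp_le)
        show ?thesis
          unfolding i1 i2 unfolding nR \<gamma>_def ennreal_mult'[OF nn] using True by (auto simp: indicator_def)
      qed simp
    qed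
    also have "\<dots> = (\<integral>\<^sup>+a\<in>{0..1}. ennreal ((S1 - S2) * \<gamma> (S2 + (S1 - S2) * a)) \<partial>lborel)"
      by (rule nn_integral_shell[OF _ _ _ cont]) (use S in auto)
    also have "\<dots> = (\<integral>\<^sup>+a\<in>{0..1}. ennreal (inverse (t ^ CARD('m)) * H ((u, v), a) t) \<partial>lborel)"
    proof (rule nn_integral_cong)
      fix a :: real
      have "(S1 - S2) * \<gamma> (S2 + (S1 - S2) * a) = inverse (t ^ CARD('m)) * H ((u, v), a) t"
      proof -
        define P where "P = p ((u, v), a) t"
        have 1: "S2 + (S1 - S2) * a = t * P" by (simp add: S1_def S2_def P_def p_def \<tau>_def algebra_simps)
        have 2: "S1 - S2 = t * \<tau> ((u, v), a) t" by (simp add: S1_def S2_def \<tau>_def algebra_simps)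
        \<comment> \<open>The powers of \<open>t\<close>: one from the length of the shell and
          \<open>m - 1\<close> from the radius, against \<open>2m\<close> in the
          denominator.\<close>
        define T where "T = t ^ CARD('m)"
        have T: "t * t ^ (CARD('m) - 1) = T" "t ^ (2 * CARD('m)) = T * T" "T \<noteq> 0"
          using t by (simp_all add: T_def mult_2 power_add flip: power_Suc)
        define V Q where "V = volume_density f u * volume_density f (u + (t * P) *\<^sub>R v)"
          and "Q = R (u, v) (t * P)"
        have "(S1 - S2) * \<gamma> (S2 + (S1 - S2) * a) =
            (t * t ^ (CARD('m) - 1)) * inverse (t ^ (2 * CARD('m))) *
            (\<tau> ((u, v), a) t * P ^ (CARD('m) - 1) * V * (inverse P * inverse Q) ^ (2 * CARD('m)) * (1 / ln 2))"
          unfolding 2 unfolding 1[unfolded 2] \<gamma>_def V_def[symmetric] Q_def[symmetric]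
          by (simp add: power_mult_distrib power_inverse mult_ac divide_inverse)
        also have "(t * t ^ (CARD('m) - 1)) * inverse (t ^ (2 * CARD('m))) = inverse T"
          unfolding T(1,2) using T(3) by (simp add: field_simps)
        also have "inverse T * (\<tau> ((u, v), a) t * P ^ (CARD('m) - 1) * V * (inverse P * inverse Q) ^ (2 * CARD('m)) * (1 / ln 2)) =
            inverse (t ^ CARD('m)) * H ((u, v), a) t"
          by (simp add: T_def H_def P_def V_def Q_def)
        finally show ?thesis .
      qed
      then show "ennreal ((S1 - S2) * \<gamma> (S2 + (S1 - S2) * a)) * indicator {0..1} a =
          ennreal (inverse (t ^ CARD('m)) * H ((u, v), a) t) * indicator {0..1} a" by simp
    qed
    finally show "(\<integral>\<^sup>+r\<in>{0<..<s}. ennreal (volume_density f u * volume_density f (u + r *\<^sub>R v) * r ^ (CARD('m) - 1) / ln 2) *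
         (if c0 * c0 * norm (f u - f (u + r *\<^sub>R v)) \<le> t \<and> t < \<rho> (f u) * \<rho> (f (u + r *\<^sub>R v)) * norm (f u - f (u + r *\<^sub>R v))
         then ennreal (inverse (norm (f u - f (u + r *\<^sub>R v)) ^ (2 * CARD('m)))) else 0) \<partial>lborel) =
        (\<integral>\<^sup>+a\<in>{0..1}. ennreal (inverse (t ^ CARD('m)) * H ((u, v), a) t) \<partial>lborel)" .
  qed (use c0(1) in auto)
  then show ?thesis using that by blast
qed

text \<open>Nonnegativity of the pieces is carried along because sums of values of
  \<open>ennreal\<close> correspond to real sums only for nonnegative summands.\<close>

lemma sum_smooth_pieces:
  fixes I :: "nat \<Rightarrow> real \<Rightarrow> ennreal"
  assumes "\<And>i. i < N \<Longrightarrow> \<exists>d>0. \<exists>h. family_smooth {0::real} d (\<lambda>_. h) \<and> (\<forall>t\<in>{-d<..<d}. h (- t) = h t) \<and>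
      (\<forall>t\<in>{0<..<d}. 0 \<le> h t \<and> I i t = ennreal (C t * h t))"
    and C: "\<And>t. 0 < t \<Longrightarrow> 0 \<le> C t"
  shows "\<exists>d>0. \<exists>h. family_smooth {0::real} d (\<lambda>_. h) \<and> (\<forall>t\<in>{-d<..<d}. h (- t) = h t) \<and>
      (\<forall>t\<in>{0<..<d}. 0 \<le> h t \<and> (\<Sum>i<N. I i t) = ennreal (C t * h t))"
  using assms(1)
proof (induction N)
  case 0
  have "family_smooth {0::real} 1 (\<lambda>_ _. 0 :: real)"
    by (intro family_smoothI family_C_const continuous_on_const)
  then show ?case by (intro exI[of _ 1] conjI exI[of _ "\<lambda>_. 0"]) auto
next
  case (Suc N)
  then obtain d1 h1 where 1: "d1 > 0" "family_smooth {0::real} d1 (\<lambda>_. h1)" "\<And>t. t \<in> {-d1<..<d1} \<Longrightarrow> h1 (- t) = h1 t"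
    "\<And>t. t \<in> {0<..<d1} \<Longrightarrow> 0 \<le> h1 t \<and> (\<Sum>i<N. I i t) = ennreal (C t * h1 t)"
    by (metis less_SucI)
  obtain d2 h2 where 2: "d2 > 0" "family_smooth {0::real} d2 (\<lambda>_. h2)" "\<And>t. t \<in> {-d2<..<d2} \<Longrightarrow> h2 (- t) = h2 t"
    "\<And>t. t \<in> {0<..<d2} \<Longrightarrow> 0 \<le> h2 t \<and> I N t = ennreal (C t * h2 t)"
    using Suc.prems[of N] by auto
  define d where "d = min d1 d2"
  have d: "d > 0" "d \<le> d1" "d \<le> d2" using 1(1) 2(1) by (auto simp: d_def)
  have "family_smooth {0::real} d (\<lambda>_ t. h1 t + h2 t)"
    by (intro family_smoothI family_C_add family_smoothD[OF family_smooth_restrict[OF 1(2) d(2)]]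
        family_smoothD[OF family_smooth_restrict[OF 2(2) d(3)]])
  moreover have "h1 (- t) + h2 (- t) = h1 t + h2 t" if "t \<in> {-d<..<d}" for t
    using 1(3)[of t] 2(3)[of t] that d by auto
  moreover have "0 \<le> h1 t + h2 t \<and> (\<Sum>i<Suc N. I i t) = ennreal (C t * (h1 t + h2 t))" if t: "t \<in> {0<..<d}" for t
  proof -
    have t12: "t \<in> {0<..<d1}" "t \<in> {0<..<d2}" using t d by auto
    have "0 \<le> C t" using C t by simp
    then show ?thesis using 1(4)[OF t12(1)] 2(4)[OF t12(2)] by (simp add: distrib_left ennreal_plus)
  qed
  ultimately show ?case using d(1) by (intro exI[of _ d] conjI exI[of _ "\<lambda>t. h1 t + h2 t"]) auto
qed

section \<open>Finite parts\<close>

text \<open>Hadamard's finite part for functions without logarithmic term: only negative integer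
  powers may be removed. Their number and coefficients are left open, since
  \<open>has_finite_part_unique\<close> fixes the value.\<close>

definition has_finite_part :: "(real \<Rightarrow> real) \<Rightarrow> real \<Rightarrow> bool" where
  "has_finite_part F e \<longleftrightarrow>
     (\<exists>n c. ((\<lambda>t. F t + (\<Sum>i=1..n. c i * inverse t ^ i)) \<longlongrightarrow> e) (at_right 0))"

text \<open>Multiplication by the highest power of \<open>t\<close> isolates the coefficient of the
  most singular term, which must be \<open>0\<close>; induction removes the terms one by
  one.\<close>

lemma inverse_powers_limit_eq_0:
  fixes c :: "nat \<Rightarrow> real"
  assumes "((\<lambda>t. \<Sum>i=1..n. c i * inverse t ^ i) \<longlongrightarrow> L) (at_right 0)"
  shows "L = 0"
  using assms
proof (induction n)
  case 0
  then show ?case by (simp add: tendsto_const_iff)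
next
  case (Suc n)
  have t0: "((\<lambda>t::real. t) \<longlongrightarrow> 0) (at_right 0)" by (rule tendsto_ident_at)
  have A: "((\<lambda>t. t ^ Suc n * (\<Sum>i=1..Suc n. c i * inverse t ^ i)) \<longlongrightarrow> 0 ^ Suc n * L) (at_right 0)"
    by (intro tendsto_mult tendsto_power t0 Suc.prems)
  have A': "((\<lambda>t. \<Sum>i=1..Suc n. c i * t ^ (Suc n - i)) \<longlongrightarrow> (\<Sum>i=1..Suc n. c i * 0 ^ (Suc n - i))) (at_right 0)"
    by (intro tendsto_sum tendsto_mult tendsto_power t0 tendsto_const)
  have C: "\<forall>\<^sub>F t in at_right 0. (\<Sum>i=1..Suc n. c i * t ^ (Suc n - i)) = t ^ Suc n * (\<Sum>i=1..Suc n. c i * inverse t ^ i)"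
    unfolding eventually_at_right_field
  proof (intro exI[of _ 1] conjI allI impI)
    fix t :: real assume t: "0 < t"
    have *: "c i * t ^ (Suc n - i) = t ^ Suc n * (c i * inverse t ^ i)" if "i \<in> {1..Suc n}" for i
    proof -
      have "t ^ Suc n = t ^ (Suc n - i) * t ^ i" using that by (simp flip: power_add)
      then show ?thesis using t by (simp add: power_inverse)
    qed
    show "(\<Sum>i=1..Suc n. c i * t ^ (Suc n - i)) = t ^ Suc n * (\<Sum>i=1..Suc n. c i * inverse t ^ i)"
      unfolding sum_distrib_left by (rule sum.cong[OF refl *])
  qed simp
  have "(\<Sum>i=1..Suc n. c i * 0 ^ (Suc n - i)) = 0 ^ Suc n * L"
    by (rule tendsto_unique[OF trivial_limit_at_right_real A' iffD2[OF tendsto_cong[OF C] A]])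
  moreover have "(\<Sum>i=1..n. c i * 0 ^ (Suc n - i)) = 0"
    by (rule sum.neutral) auto
  ultimately have "c (Suc n) = 0" by simp
  then show ?case using Suc by simp
qed

lemma has_finite_part_add:
  assumes "has_finite_part F e" "has_finite_part G e'"
  shows "has_finite_part (\<lambda>t. F t + G t) (e + e')"
proof -
  obtain n c where 1: "((\<lambda>t. F t + (\<Sum>i=1..n. c i * inverse t ^ i)) \<longlongrightarrow> e) (at_right 0)"
    using assms(1) by (auto simp: has_finite_part_def)
  obtain n' c' where 2: "((\<lambda>t. G t + (\<Sum>i=1..n'. c' i * inverse t ^ i)) \<longlongrightarrow> e') (at_right 0)"
    using assms(2) by (auto simp: has_finite_part_def)
  \<comment> \<open>Both coefficient lists are padded by zeros to the common length
    \<open>max n n'\<close>.\<close>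
  define b where "b i = (if i \<le> n then c i else 0) + (if i \<le> n' then c' i else 0)" for i
  have pad: "(\<Sum>i=1..max n n'. (if i \<le> k then a i else 0) * x i) = (\<Sum>i=1..k. a i * x i)"
    if "k \<le> max n n'" for k and a x :: "nat \<Rightarrow> real"
  proof -
    have "(\<Sum>i=1..k. a i * x i) = (\<Sum>i=1..k. (if i \<le> k then a i else 0) * x i)" by (rule sum.cong) auto
    also have "\<dots> = (\<Sum>i=1..max n n'. (if i \<le> k then a i else 0) * x i)"
      by (rule sum.mono_neutral_left) (use that in auto)
    finally show ?thesis ..
  qed
  have "(\<Sum>i=1..max n n'. b i * inverse t ^ i) = (\<Sum>i=1..n. c i * inverse t ^ i) + (\<Sum>i=1..n'. c' i * inverse t ^ i)" for t
    unfolding b_def distrib_right sum.distrib by (subst (1 2) pad) auto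
  then have "((\<lambda>t. (F t + G t) + (\<Sum>i=1..max n n'. b i * inverse t ^ i)) \<longlongrightarrow> e + e') (at_right 0)"
    using tendsto_add[OF 1 2] by (simp add: algebra_simps)
  then show ?thesis unfolding has_finite_part_def by (intro exI)
qed

lemma has_finite_part_unique:
  assumes "has_finite_part F e" "has_finite_part F e'"
  shows "e = e'"
proof -
  have "has_finite_part (\<lambda>t. - F t) (- e')"
  proof -
    obtain n c where "((\<lambda>t. F t + (\<Sum>i=1..n. c i * inverse t ^ i)) \<longlongrightarrow> e') (at_right 0)"
      using assms(2) by (auto simp: has_finite_part_def)
    from tendsto_minus[OF this]
    have "((\<lambda>t. - F t + (\<Sum>i=1..n. (- c i) * inverse t ^ i)) \<longlongrightarrow> - e') (at_right 0)"
      by (simp add: sum_negf)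
    then show ?thesis unfolding has_finite_part_def by (intro exI[of _ n] exI[of _ "\<lambda>i. - c i"])
  qed
  from has_finite_part_add[OF assms(1) this]
  obtain n c where "((\<lambda>t. \<Sum>i=1..n. c i * inverse t ^ i) \<longlongrightarrow> e - e') (at_right 0)"
    by (auto simp: has_finite_part_def)
  then have "e - e' = 0" by (rule inverse_powers_limit_eq_0)
  then show ?thesis by simp
qed

lemma has_finite_part_tendsto: "(F \<longlongrightarrow> e) (at_right 0) \<Longrightarrow> has_finite_part F e"
  unfolding has_finite_part_def by (rule exI[of _ 0], rule exI[of _ "\<lambda>_. 0"]) simp

lemma has_finite_part_inverse_powers: "has_finite_part (\<lambda>t. \<Sum>i=1..n. c i * inverse t ^ i) 0"
  unfolding has_finite_part_def
  by (rule exI[of _ n], rule exI[of _ "\<lambda>i. - c i"]) (simp add: sum_negf)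

lemma has_finite_part_cong:
  assumes "has_finite_part F e" "\<forall>\<^sub>F t in at_right 0. F t = G t"
  shows "has_finite_part G e"
proof -
  obtain n c where 1: "((\<lambda>t. F t + (\<Sum>i=1..n. c i * inverse t ^ i)) \<longlongrightarrow> e) (at_right 0)"
    using assms(1) by (auto simp: has_finite_part_def)
  have "\<forall>\<^sub>F t in at_right 0. F t + (\<Sum>i=1..n. c i * inverse t ^ i) = G t + (\<Sum>i=1..n. c i * inverse t ^ i)"
    using assms(2) by eventually_elim simp
  then have "((\<lambda>t. G t + (\<Sum>i=1..n. c i * inverse t ^ i)) \<longlongrightarrow> e) (at_right 0)"
    by (rule iffD1[OF tendsto_cong 1])
  then show ?thesis unfolding has_finite_part_def by (intro exI)
qed

text \<open>Rescaling only changes the coefficients of the removed powers. A logarithmic term would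
  shift the value by a multiple of \<open>ln c\<close>.\<close>

lemma has_finite_part_scale:
  assumes "has_finite_part F e" "c > 0"
  shows "has_finite_part (\<lambda>t. F (c * t)) e"
proof -
  obtain n b where 1: "((\<lambda>t. F t + (\<Sum>i=1..n. b i * inverse t ^ i)) \<longlongrightarrow> e) (at_right 0)"
    using assms(1) by (auto simp: has_finite_part_def)
  have "filterlim (\<lambda>t. c * t) (at_right 0) (at_right 0)"
    unfolding filterlim_at
  proof
    show "((\<lambda>t. c * t) \<longlongrightarrow> 0) (at_right 0)" by (auto intro!: tendsto_eq_intros)
    show "\<forall>\<^sub>F t in at_right 0. c * t \<in> {0<..} \<and> c * t \<noteq> 0"
      using assms(2) by (auto simp: eventually_at_right_field intro!: exI[of _ 1])
  qed
  from filterlim_compose[OF 1 this]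
  have "((\<lambda>t. F (c * t) + (\<Sum>i=1..n. (b i * inverse c ^ i) * inverse t ^ i)) \<longlongrightarrow> e) (at_right 0)"
    by (simp add: power_mult_distrib mult.assoc)
  then show ?thesis unfolding has_finite_part_def by (intro exI[of _ n] exI[of _ "\<lambda>i. b i * inverse c ^ i"])
qed

section \<open>One-variable calculus: tail integrals, parity, Taylor remainders\<close>

text \<open>In the application \<open>F\<close> is a tail integral of \<open>g\<close> against the
  measure with distribution function \<open>\<psi>\<close>, and the two bounds compare their
  increments. They force the difference quotients of \<open>F\<close> and of
  \<open>- g(t) \<psi>\<close> to differ by at most \<open>|g s - g t|\<close> times that of
  \<open>\<psi>\<close>.\<close>

lemma derivative_squeeze:
  fixes F \<psi> g :: "real \<Rightarrow> real"
  assumes t: "t \<in> {a<..<b}" and g: "isCont g t" and \<psi>: "(\<psi> has_real_derivative \<psi>') (at t)"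
    and le: "\<And>x y. a < x \<Longrightarrow> x < y \<Longrightarrow> y < b \<Longrightarrow> g y * (\<psi> y - \<psi> x) \<le> F x - F y"
      "\<And>x y. a < x \<Longrightarrow> x < y \<Longrightarrow> y < b \<Longrightarrow> F x - F y \<le> g x * (\<psi> y - \<psi> x)"
  shows "(F has_real_derivative - (g t * \<psi>')) (at t)"
proof -
  define q where "q s = (\<psi> s - \<psi> t) / (s - t)" for s
  have q: "(q \<longlongrightarrow> \<psi>') (at t)" using \<psi> by (simp add: q_def[abs_def] has_field_derivative_iff)
  have g': "((\<lambda>s. g s - g t) \<longlongrightarrow> 0) (at t)" using g by (simp add: isCont_def LIM_zero_iff)
  have "((\<lambda>s. (F s - F t) / (s - t) + g t * q s) \<longlongrightarrow> 0) (at t)"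
  proof (rule Lim_null_comparison)
    show "((\<lambda>s. \<bar>g s - g t\<bar> * \<bar>q s\<bar>) \<longlongrightarrow> 0) (at t)"
      using tendsto_mult[OF tendsto_rabs[OF g'] tendsto_rabs[OF q]] by simp
    have "\<forall>\<^sub>F s in at t. s \<in> {a<..<b}"
      using t by (intro eventually_at_in_open') auto
    moreover have "\<forall>\<^sub>F s in at t. s \<noteq> t" by (simp add: eventually_at_filter)
    ultimately show "\<forall>\<^sub>F s in at t. norm ((F s - F t) / (s - t) + g t * q s) \<le> \<bar>g s - g t\<bar> * \<bar>q s\<bar>"
    proof eventually_elim
      case (elim s)
      have q_eq: "\<psi> s - \<psi> t = q s * (s - t)" using elim by (simp add: q_def)
      have "\<bar>F s - F t + g t * (\<psi> s - \<psi> t)\<bar> \<le> \<bar>(g s - g t) * (\<psi> s - \<psi> t)\<bar>"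
      proof (cases "s < t")
        case True
        then show ?thesis using le(1)[of s t] le(2)[of s t] elim t by (simp add: algebra_simps)
      next
        case False
        then have "t < s" using elim by simp
        then show ?thesis using le(1)[of t s] le(2)[of t s] elim t by (simp add: algebra_simps)
      qed
      moreover have "(F s - F t) / (s - t) + g t * q s = (F s - F t + g t * (\<psi> s - \<psi> t)) / (s - t)"
        using elim by (simp add: q_eq field_simps)
      moreover have "\<bar>(g s - g t) * (\<psi> s - \<psi> t)\<bar> = \<bar>g s - g t\<bar> * \<bar>q s\<bar> * \<bar>s - t\<bar>"
        by (simp add: q_eq abs_mult)
      ultimately show ?case using elim by (simp add: abs_divide divide_le_eq)
    qed
  qed
  from tendsto_diff[OF this tendsto_mult[OF tendsto_const[of "g t"] q]]
  show ?thesis by (simp add: has_field_derivative_iff)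
qed

text \<open>A bounded derivative makes \<open>E\<close> Lipschitz, hence uniformly continuous, hence
  continuously extendable to the end point.\<close>

lemma bounded_derivative_limit_at_right:
  fixes E :: "real \<Rightarrow> real"
  assumes "d > 0" and D: "\<And>t. t \<in> {0<..<d} \<Longrightarrow> (E has_real_derivative E' t) (at t)"
    and B: "\<And>t. t \<in> {0<..<d} \<Longrightarrow> \<bar>E' t\<bar> \<le> B"
  obtains e where "(E \<longlongrightarrow> e) (at_right 0)"
proof -
  have lip: "dist (E x) (E y) \<le> \<bar>B\<bar> * dist x y" if "x \<in> {0<..<d}" "y \<in> {0<..<d}" for x y
  proof -
    have "norm (E x - E y) \<le> \<bar>B\<bar> * norm (x - y)"
    proof (rule field_differentiable_bound[of "{0<..<d}" E E'])
      show "(E has_real_derivative E' z) (at z within {0<..<d})" if "z \<in> {0<..<d}" for z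
        by (rule has_field_derivative_at_within[OF D[OF that]])
      show "norm (E' z) \<le> \<bar>B\<bar>" if "z \<in> {0<..<d}" for z using B[OF that] by simp
    qed (use that in auto)
    then show ?thesis by (simp add: dist_norm)
  qed
  have "uniformly_continuous_on {0<..<d} E"
    unfolding uniformly_continuous_on_def
  proof (intro allI impI)
    fix \<epsilon> :: real assume "\<epsilon> > 0"
    show "\<exists>\<delta>>0. \<forall>x\<in>{0<..<d}. \<forall>x'\<in>{0<..<d}. dist x' x < \<delta> \<longrightarrow> dist (E x') (E x) < \<epsilon>"
    proof (intro exI[of _ "\<epsilon> / (\<bar>B\<bar> + 1)"] conjI ballI impI)
      show "\<epsilon> / (\<bar>B\<bar> + 1) > 0" using \<open>\<epsilon> > 0\<close> by simp
      fix x x' assume x: "x \<in> {0<..<d}" "x' \<in> {0<..<d}" and dx: "dist x' x < \<epsilon> / (\<bar>B\<bar> + 1)"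
      have "dist (E x') (E x) \<le> \<bar>B\<bar> * dist x' x" by (rule lip[OF x(2,1)])
      also have "\<dots> \<le> (\<bar>B\<bar> + 1) * dist x' x" by (intro mult_right_mono) auto
      also have "\<dots> < \<epsilon>" using dx by (simp add: field_simps)
      finally show "dist (E x') (E x) < \<epsilon>" .
    qed
  qed
  then obtain e where "(E \<longlongrightarrow> e) (at 0 within {0<..<d})"
    using uniformly_continuous_on_extension_at_closure[of "{0<..<d}" E 0] \<open>d > 0\<close> by auto
  moreover have "at 0 within {0<..<d} = at_right (0 :: real)"
    by (rule at_within_nhd[of 0 "{-d<..<d}"]) (use \<open>d > 0\<close> in auto)
  ultimately show ?thesis using that by simp
qed

text \<open>Iterating \<open>vector_derivative\<close> yields one coherent sequence of derivatives,
  the form in which parity and Taylor expansion are used.\<close>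

lemma family_smooth_derivative_sequence:
  assumes "family_smooth {0::real} d (\<lambda>_. g)"
  obtains D :: "nat \<Rightarrow> real \<Rightarrow> real" where "D 0 = g"
    "\<And>n t. t \<in> {-d<..<d} \<Longrightarrow> (D n has_real_derivative D (Suc n) t) (at t)"
proof -
  define D where "D n = ((\<lambda>f t. vector_derivative f (at t)) ^^ n) g" for n
  have sm: "family_smooth {0::real} d (\<lambda>_. D n)" and
    der: "\<And>t. t \<in> {-d<..<d} \<Longrightarrow> (D n has_vector_derivative D (Suc n) t) (at t)" for n
  proof -
    have step: "(\<forall>t\<in>{-d<..<d}. (f has_vector_derivative vector_derivative f (at t)) (at t)) \<and>
        family_smooth {0::real} d (\<lambda>_ t. vector_derivative f (at t))" if f: "family_smooth {0::real} d (\<lambda>_. f)" for f :: "real \<Rightarrow> real"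
    proof -
      obtain F' where F': "\<And>x t. x \<in> {0::real} \<Longrightarrow> t \<in> {-d<..<d} \<Longrightarrow> (f has_vector_derivative F' x t) (at t)"
        "family_smooth {0::real} d F'"
        using family_smooth_deriv[OF f] by blast
      have eq: "F' 0 t = vector_derivative f (at t)" if "t \<in> {-d<..<d}" for t
        using vector_derivative_at[OF F'(1)[OF _ that, of 0]] by simp
      have "family_smooth {0::real} d (\<lambda>_ t. vector_derivative f (at t))"
        by (rule family_smooth_cong[OF F'(2)]) (use eq in auto)
      then show ?thesis using F'(1)[of 0] eq by auto
    qed
    have SucD: "D (Suc n) = (\<lambda>t. vector_derivative (D n) (at t))" for n by (simp add: D_def)
    have all: "family_smooth {0::real} d (\<lambda>_. D n)" for n
    proof (induction n)
      case 0 then show ?case using assms by (simp add: D_def)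
    next
      case (Suc n) then show ?case using step[OF Suc] unfolding SucD by blast
    qed
    show "family_smooth {0::real} d (\<lambda>_. D n)" by (rule all)
    show "(D n has_vector_derivative D (Suc n) t) (at t)" if "t \<in> {-d<..<d}" for t
      using step[OF all[of n]] that unfolding SucD by blast
  qed
  show ?thesis
    by (rule that[of D]) (use der in \<open>auto simp: D_def has_real_derivative_iff_has_vector_derivative\<close>)
qed

text \<open>Each differentiation changes the parity; \<open>s\<close> is the sign at order
  \<open>0\<close>.\<close>

lemma derivative_sequence_parity:
  fixes D :: "nat \<Rightarrow> real \<Rightarrow> real"
  assumes D: "\<And>n t. t \<in> {-d<..<d} \<Longrightarrow> (D n has_real_derivative D (Suc n) t) (at t)"
    and s: "\<And>t. t \<in> {-d<..<d} \<Longrightarrow> D 0 (- t) = s * D 0 t" and t: "t \<in> {-d<..<d}"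
  shows "D n (- t) = s * (-1) ^ n * D n t"
  using t
proof (induction n arbitrary: t)
  case 0
  then show ?case using s by simp
next
  case (Suc n)
  have "((\<lambda>x. - x) has_real_derivative - 1) (at t)" by (auto intro!: derivative_eq_intros)
  moreover have "(D n has_real_derivative D (Suc n) (- t)) (at (- t))" using D[of "- t" n] Suc.prems by auto
  ultimately have 1: "((\<lambda>x. D n (- x)) has_real_derivative D (Suc n) (- t) * - 1) (at t)"
    by (intro DERIV_chain2)
  have "((\<lambda>x. s * (-1) ^ n * D n x) has_real_derivative s * (-1) ^ n * D (Suc n) t) (at t)"
    by (rule DERIV_cmult[OF D[OF Suc.prems]])
  then have "((\<lambda>x. D n (- x)) has_real_derivative s * (-1) ^ n * D (Suc n) t) (at t)"
    by (rule has_field_derivative_transform_within_open[of _ _ _ "{-d<..<d}"]) (use Suc in auto)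
  from DERIV_unique[OF 1 this] show ?case by simp
qed

text \<open>On half of the interval the derivative of order \<open>k + n\<close> is bounded by
  compactness. The index \<open>k\<close> allows the expansion of a derivative of the original
  function.\<close>

lemma taylor_remainder_bound:
  fixes D :: "nat \<Rightarrow> real \<Rightarrow> real"
  assumes d: "d > 0" and D: "\<And>n t. t \<in> {-d<..<d} \<Longrightarrow> (D n has_real_derivative D (Suc n) t) (at t)" and n: "n > 0"
  obtains B where "\<And>t. t \<in> {0<..<d/2} \<Longrightarrow> \<bar>D k t - (\<Sum>j<n. D (k + j) 0 / fact j * t ^ j)\<bar> \<le> B * t ^ n"
proof -
  have "continuous_on {0..d/2} (D (k + n))"
    by (intro continuous_at_imp_continuous_on ballI DERIV_isCont[OF D]) (use d in auto)
  then obtain B where B: "\<And>t. t \<in> {0..d/2} \<Longrightarrow> norm (D (k + n) t) \<le> B"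
    using compact_continuous_norm_bound[of "{0..d/2}" "D (k + n)"] by auto
  show ?thesis
  proof (rule that[of "B / fact n"])
    fix t assume t: "t \<in> {0<..<d/2}"
    have "\<exists>s>0. s < t \<and> D k t = (\<Sum>j<n. D (k + j) 0 / fact j * t ^ j) + D (k + n) s / fact n * t ^ n"
    proof (rule Maclaurin[where diff = "\<lambda>j. D (k + j)"])
      show "\<forall>m s. m < n \<and> 0 \<le> s \<and> s \<le> t \<longrightarrow> DERIV (D (k + m)) s :> D (k + Suc m) s"
        using D t d by auto
    qed (use t n in auto)
    then obtain s where s: "0 < s" "s < t" "D k t = (\<Sum>j<n. D (k + j) 0 / fact j * t ^ j) + D (k + n) s / fact n * t ^ n"
      by blast
    then have "\<bar>D k t - (\<Sum>j<n. D (k + j) 0 / fact j * t ^ j)\<bar> = \<bar>D (k + n) s\<bar> / fact n * t ^ n"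
      using t by (simp add: abs_mult)
    also have "\<dots> \<le> B / fact n * t ^ n"
      using B[of s] s t by (intro mult_right_mono divide_right_mono) auto
    finally show "\<bar>D k t - (\<Sum>j<n. D (k + j) 0 / fact j * t ^ j)\<bar> \<le> B / fact n * t ^ n" .
  qed
qed

text \<open>The Taylor coefficients of \<open>h\<close> below order \<open>m\<close> produce
  negative powers, the one of order \<open>m\<close> is the constant term and vanishes by parity,
  and the remainder is \<open>O(t)\<close>.\<close>

lemma has_finite_part_even:
  assumes d: "d > 0" and h: "family_smooth {0::real} d (\<lambda>_. h)" "\<And>t. t \<in> {-d<..<d} \<Longrightarrow> h (- t) = h t"
    and m: "odd m"
  shows "has_finite_part (\<lambda>t. inverse (t ^ m) * h t) 0"
proof -
  obtain D where D: "D 0 = h" "\<And>n t. t \<in> {-d<..<d} \<Longrightarrow> (D n has_real_derivative D (Suc n) t) (at t)"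
    using family_smooth_derivative_sequence[OF h(1)] by blast
  have "D m (- 0) = 1 * (-1) ^ m * D m 0"
    by (rule derivative_sequence_parity[where D = D and d = d, OF D(2)]) (use h(2) D(1) d in auto)
  then have Dm: "D m 0 = 0" using m by simp
  obtain B where "\<And>t. t \<in> {0<..<d/2} \<Longrightarrow> \<bar>D 0 t - (\<Sum>j<Suc m. D (0 + j) 0 / fact j * t ^ j)\<bar> \<le> B * t ^ Suc m"
    using taylor_remainder_bound[where D = D and n = "Suc m" and k = 0, OF d D(2)] by (metis zero_less_Suc)
  then have B: "\<bar>h t - (\<Sum>j<m. D j 0 / fact j * t ^ j)\<bar> \<le> B * t ^ Suc m" if "t \<in> {0<..<d/2}" for t
    using that Dm D(1) by simp
  \<comment> \<open>The Taylor term of order \<open>j\<close> becomes the negative power of order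
    \<open>m - j\<close>.\<close>
  define c where "c i = D (m - i) 0 / fact (m - i)" for i
  have sum_eq: "inverse (t ^ m) * (\<Sum>j<m. D j 0 / fact j * t ^ j) = (\<Sum>i=1..m. c i * inverse t ^ i)" if "t > 0" for t
    unfolding sum_distrib_left
  proof (rule sum.reindex_bij_witness[of _ "\<lambda>i. m - i" "\<lambda>j. m - j"])
    fix j assume "j \<in> {..<m}"
    then have "t ^ m = t ^ j * t ^ (m - j)" "m - (m - j) = j" by (simp_all flip: power_add)
    then show "c (m - j) * inverse t ^ (m - j) = inverse (t ^ m) * (D j 0 / fact j * t ^ j)"
      using that by (simp add: c_def power_inverse field_simps)
  qed auto
  have "((\<lambda>t. inverse (t ^ m) * (h t - (\<Sum>j<m. D j 0 / fact j * t ^ j))) \<longlongrightarrow> 0) (at_right 0)"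
  proof (rule Lim_null_comparison)
    show "((\<lambda>t. B * t) \<longlongrightarrow> 0) (at_right 0)" by (auto intro!: tendsto_eq_intros)
    show "\<forall>\<^sub>F t in at_right 0. norm (inverse (t ^ m) * (h t - (\<Sum>j<m. D j 0 / fact j * t ^ j))) \<le> B * t"
      unfolding eventually_at_right_field
    proof (intro exI[of _ "d / 2"] conjI allI impI)
      fix t assume t: "0 < t" "t < d / 2"
      have "inverse (t ^ m) * \<bar>h t - (\<Sum>j<m. D j 0 / fact j * t ^ j)\<bar> \<le> inverse (t ^ m) * (B * t ^ Suc m)"
        using B[of t] t by (intro mult_left_mono) auto
      also have "\<dots> = B * t" using t by simp
      finally show "norm (inverse (t ^ m) * (h t - (\<Sum>j<m. D j 0 / fact j * t ^ j))) \<le> B * t"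
        using t by (simp add: abs_mult)
    qed (use d in simp)
  qed
  from has_finite_part_add[OF has_finite_part_tendsto[OF this] has_finite_part_inverse_powers[of c m]]
  have "has_finite_part (\<lambda>t. inverse (t ^ m) * (h t - (\<Sum>j<m. D j 0 / fact j * t ^ j)) + (\<Sum>i=1..m. c i * inverse t ^ i)) 0"
    by simp
  then show ?thesis
  proof (rule has_finite_part_cong)
    show "\<forall>\<^sub>F t in at_right 0. inverse (t ^ m) * (h t - (\<Sum>j<m. D j 0 / fact j * t ^ j)) + (\<Sum>i=1..m. c i * inverse t ^ i) = inverse (t ^ m) * h t"
      unfolding eventually_at_right_field
    proof (intro exI[of _ 1] conjI allI impI)
      fix t :: real assume t: "0 < t"
      show "inverse (t ^ m) * (h t - (\<Sum>j<m. D j 0 / fact j * t ^ j)) + (\<Sum>i=1..m. c i * inverse t ^ i) = inverse (t ^ m) * h t"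
        unfolding sum_eq[OF t, symmetric] by (simp add: right_diff_distrib)
    qed simp
  qed
qed

section \<open>Integration over pairs of points\<close>

lemma riemannian_volume_sets:
  fixes M :: "'a::euclidean_space set"
  assumes "closed_submanifold TYPE('m::finite) M"
  shows "sets (riemannian_volume TYPE('m) M) = sets borel"
  using is_riemannian_volume_riemannian_volume[OF assms] by (simp add: is_riemannian_volume_def)

lemma riemannian_volume_pair_sets:
  fixes M :: "'a::euclidean_space set"
  assumes "closed_submanifold TYPE('m::finite) M"
  shows "sets (riemannian_volume TYPE('m) M \<Otimes>\<^sub>M riemannian_volume TYPE('m) M) = sets borel"
  using sets_pair_measure_cong[OF riemannian_volume_sets[OF assms] riemannian_volume_sets[OF assms]]
  unfolding borel_prod .

lemma nn_integral_atlas: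
  fixes f :: "nat \<Rightarrow> real ^ 'm::finite \<Rightarrow> 'a::euclidean_space"
  assumes cl: "closed_submanifold TYPE('m) M" and a: "atlas_partition M N W f K B"
    and G: "G \<in> borel_measurable borel"
  shows "(\<integral>\<^sup>+x\<in>M. G x \<partial>riemannian_volume TYPE('m) M) =
    (\<Sum>i<N. \<integral>\<^sup>+x\<in>f i ` B i. G x \<partial>riemannian_volume TYPE('m) M)"
proof -
  let ?\<mu> = "riemannian_volume TYPE('m) M"
  have M: "compact M" using cl by (simp add: closed_submanifold_def)
  have Gm: "G \<in> borel_measurable ?\<mu>"
    using G by (simp cong: measurable_cong_sets[OF riemannian_volume_sets[OF cl] refl])
  have fB: "f i ` B i \<in> sets ?\<mu>" if "i < N" for i
    unfolding riemannian_volume_sets[OF cl]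
    by (rule borel_image_local_parametrization[OF M atlas_partitionD(1,6,5)[OF a that]])
  have "(\<integral>\<^sup>+x\<in>M. G x \<partial>?\<mu>) = (\<integral>\<^sup>+x. (\<Sum>i<N. G x * indicator (f i ` B i) x) \<partial>?\<mu>)"
  proof (rule nn_integral_cong)
    fix x
    show "G x * indicator M x = (\<Sum>i<N. G x * indicator (f i ` B i) x)"
    proof (cases "x \<in> M")
      case True
      then obtain i where i: "i < N" "x \<in> f i ` B i" using a unfolding atlas_partition_def by blast
      have "x \<in> f j ` B j \<longleftrightarrow> j = i" if "j < N" for j
        using a i that unfolding atlas_partition_def disjoint_family_on_def by blast
      then have "(\<Sum>j<N. G x * indicator (f j ` B j) x) = (\<Sum>j<N. if j = i then G x else 0)"
        by (intro sum.cong refl) (auto simp: indicator_def)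
      also have "\<dots> = G x" using i(1) by simp
      finally show ?thesis using True by simp
    next
      case False
      have "x \<notin> f j ` B j" if "j < N" for j using False that a unfolding atlas_partition_def by blast
      then show ?thesis using False by simp
    qed
  qed
  also have "\<dots> = (\<Sum>i<N. \<integral>\<^sup>+x\<in>f i ` B i. G x \<partial>?\<mu>)"
    using fB Gm by (intro nn_integral_sum borel_measurable_times borel_measurable_indicator) auto
  finally show ?thesis .
qed

lemma nn_integral_pair_iterated:
  fixes M :: "'a::euclidean_space set"
  assumes cl: "closed_submanifold TYPE('m::finite) M"
    and k: "(\<lambda>p. k (fst p) (snd p)) \<in> borel_measurable borel"
  shows "(\<integral>\<^sup>+p\<in>M \<times> M. k (fst p) (snd p) \<partial>(riemannian_volume TYPE('m) M \<Otimes>\<^sub>M riemannian_volume TYPE('m) M)) =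
      (\<integral>\<^sup>+x\<in>M. (\<integral>\<^sup>+y\<in>M. k x y \<partial>riemannian_volume TYPE('m) M) \<partial>riemannian_volume TYPE('m) M)"
    and "(\<lambda>x. \<integral>\<^sup>+y\<in>M. k x y \<partial>riemannian_volume TYPE('m) M) \<in> borel_measurable borel"
proof -
  let ?\<mu> = "riemannian_volume TYPE('m) M"
  interpret finite_measure ?\<mu> by (rule riemannian_volume_finite[OF cl])
  have M: "compact M" using cl by (simp add: closed_submanifold_def)
  have MB: "M \<in> sets borel" by (rule borel_compact[OF M])
  have MMB: "M \<times> M \<in> sets borel" by (rule borel_Times[OF MB MB])
  have "(\<lambda>p. k (fst p) (snd p) * indicator (M \<times> M) p) \<in> borel_measurable borel"
    using k MMB by measurable
  then have m: "(\<lambda>p. k (fst p) (snd p) * indicator (M \<times> M) p) \<in> borel_measurable (?\<mu> \<Otimes>\<^sub>M ?\<mu>)"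
    by (simp cong: measurable_cong_sets[OF riemannian_volume_pair_sets[OF cl] refl])
  have "(\<lambda>p. k (fst p) (snd p) * indicator M (snd p)) \<in> borel_measurable borel" using k MB by measurable
  then have k2: "(\<lambda>p. k (fst p) (snd p) * indicator M (snd p)) \<in> borel_measurable (?\<mu> \<Otimes>\<^sub>M ?\<mu>)"
    by (simp cong: measurable_cong_sets[OF riemannian_volume_pair_sets[OF cl] refl])
  show "(\<lambda>x. \<integral>\<^sup>+y\<in>M. k x y \<partial>?\<mu>) \<in> borel_measurable borel"
    using borel_measurable_nn_integral_fst[OF k2]
    by (simp cong: measurable_cong_sets[OF riemannian_volume_sets[OF cl] refl])
  have "(\<integral>\<^sup>+p\<in>M \<times> M. k (fst p) (snd p) \<partial>(?\<mu> \<Otimes>\<^sub>M ?\<mu>)) =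
      (\<integral>\<^sup>+x. (\<integral>\<^sup>+y. k x y * indicator (M \<times> M) (x, y) \<partial>?\<mu>) \<partial>?\<mu>)"
    using nn_integral_fst[OF m] by simp
  also have "\<dots> = (\<integral>\<^sup>+x\<in>M. (\<integral>\<^sup>+y\<in>M. k x y \<partial>?\<mu>) \<partial>?\<mu>)"
  proof (rule nn_integral_cong)
    fix x
    show "(\<integral>\<^sup>+y. k x y * indicator (M \<times> M) (x, y) \<partial>?\<mu>) = (\<integral>\<^sup>+y\<in>M. k x y \<partial>?\<mu>) * indicator M x"
      by (cases "x \<in> M") (simp_all add: indicator_times)
  qed
  finally show "(\<integral>\<^sup>+p\<in>M \<times> M. k (fst p) (snd p) \<partial>(?\<mu> \<Otimes>\<^sub>M ?\<mu>)) =
      (\<integral>\<^sup>+x\<in>M. (\<integral>\<^sup>+y\<in>M. k x y \<partial>?\<mu>) \<partial>?\<mu>)" .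
qed

lemma nn_integral_pair_atlas:
  fixes f :: "nat \<Rightarrow> real ^ 'm::finite \<Rightarrow> 'a::euclidean_space"
  assumes cl: "closed_submanifold TYPE('m) M" and a: "atlas_partition M N W f K B"
    and k: "(\<lambda>p. k (fst p) (snd p)) \<in> borel_measurable borel"
  shows "(\<integral>\<^sup>+p\<in>M \<times> M. k (fst p) (snd p) \<partial>(riemannian_volume TYPE('m) M \<Otimes>\<^sub>M riemannian_volume TYPE('m) M)) =
    (\<Sum>i<N. \<integral>\<^sup>+x\<in>f i ` B i. (\<integral>\<^sup>+y\<in>M. k x y \<partial>riemannian_volume TYPE('m) M) \<partial>riemannian_volume TYPE('m) M)"
  using nn_integral_pair_iterated[OF cl k] nn_integral_atlas[OF cl a] by simp

lemma psi_nn_integral: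
  fixes M :: "'a::euclidean_space set"
  assumes cl: "closed_submanifold TYPE('m::finite) M"
  shows "ennreal (psi TYPE('m) M t) = (\<integral>\<^sup>+p\<in>M \<times> M. indicator {..t} (norm (fst p - snd p))
    \<partial>(riemannian_volume TYPE('m) M \<Otimes>\<^sub>M riemannian_volume TYPE('m) M))"
proof -
  let ?\<mu> = "riemannian_volume TYPE('m) M"
  interpret finite_measure ?\<mu> by (rule riemannian_volume_finite[OF cl])
  interpret P: finite_measure "?\<mu> \<Otimes>\<^sub>M ?\<mu>"
    by (rule finite_measure_pair_measure) (rule riemannian_volume_finite[OF cl])+
  have M: "compact M" using cl by (simp add: closed_submanifold_def)
  have "closed (near_diagonal t :: ('a \<times> 'a) set)"
    unfolding near_diagonal_def by (auto simp: case_prod_unfold intro!: closed_Collect_le continuous_intros)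
  then have S: "(M \<times> M) \<inter> near_diagonal t \<in> sets (?\<mu> \<Otimes>\<^sub>M ?\<mu>)"
    unfolding riemannian_volume_pair_sets[OF cl] using compact_imp_closed[OF M]
    by (intro sets.Int borel_closed closed_Times)
  have "ennreal (psi TYPE('m) M t) = emeasure (?\<mu> \<Otimes>\<^sub>M ?\<mu>) ((M \<times> M) \<inter> near_diagonal t)"
    by (simp add: psi_def P.emeasure_eq_measure)
  also have "\<dots> = (\<integral>\<^sup>+p. indicator ((M \<times> M) \<inter> near_diagonal t) p \<partial>(?\<mu> \<Otimes>\<^sub>M ?\<mu>))" using S by simp
  also have "\<dots> = (\<integral>\<^sup>+p\<in>M \<times> M. indicator {..t} (norm (fst p - snd p)) \<partial>(?\<mu> \<Otimes>\<^sub>M ?\<mu>))"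
    by (rule nn_integral_cong) (auto simp: indicator_def near_diagonal_def)
  finally show ?thesis .
qed

text \<open>The formula is claimed for \<open>t > 0\<close> only: for negative \<open>t\<close> the
  function \<open>psi\<close> is \<open>0\<close>, whereas \<open>t^m h(t)\<close> continues it
  smoothly from the right.\<close>

lemma psi_expansion:
  fixes M :: "'a::euclidean_space set"
  assumes cl: "closed_submanifold TYPE('m::finite) M"
  obtains d h where "d > 0" "family_smooth {0::real} d (\<lambda>_. h)" "\<And>t. t \<in> {-d<..<d} \<Longrightarrow> h (- t) = h t"
    "\<And>t. t \<in> {0<..<d} \<Longrightarrow> psi TYPE('m) M t = t ^ CARD('m) * h t"
proof -
  let ?\<mu> = "riemannian_volume TYPE('m) M"
  obtain N W K B and f :: "nat \<Rightarrow> real ^ 'm \<Rightarrow> 'a" where a: "atlas_partition M N W f K B"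
    using exists_atlas_partition[OF cl] by blast
  note D = atlas_partitionD[OF a]
  have "\<exists>d>0. \<exists>h. family_smooth {0::real} d (\<lambda>_. h) \<and> (\<forall>t\<in>{-d<..<d}. h (- t) = h t) \<and>
      (\<forall>t\<in>{0<..<d}. 0 \<le> h t \<and> (\<Sum>i<N. \<integral>\<^sup>+x\<in>f i ` B i. (\<integral>\<^sup>+y\<in>M. indicator {..t} (norm (x - y)) \<partial>?\<mu>) \<partial>?\<mu>) = ennreal (t ^ CARD('m) * h t))"
  proof (rule sum_smooth_pieces)
    fix i assume i: "i < N"
    show "\<exists>d>0. \<exists>h. family_smooth {0::real} d (\<lambda>_. h) \<and> (\<forall>t\<in>{-d<..<d}. h (- t) = h t) \<and>
      (\<forall>t\<in>{0<..<d}. 0 \<le> h t \<and> (\<integral>\<^sup>+x\<in>f i ` B i. (\<integral>\<^sup>+y\<in>M. indicator {..t} (norm (x - y)) \<partial>?\<mu>) \<partial>?\<mu>) = ennreal (t ^ CARD('m) * h t))"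
    proof (rule piece_ball_volume[OF cl D(1)[OF i] D(2)[OF i] D(3)[OF i] D(6)[OF i] D(4)[OF i]], goal_cases)
      case (1 d h)
      show ?case by (rule exI[of _ d], intro conjI, rule 1(1), rule exI[of _ h]) (use 1 in simp)
    qed
  qed simp
  then obtain d h where h: "d > 0" "family_smooth {0::real} d (\<lambda>_. h)" "\<forall>t\<in>{-d<..<d}. h (- t) = h t"
    "\<forall>t\<in>{0<..<d}. 0 \<le> h t \<and> (\<Sum>i<N. \<integral>\<^sup>+x\<in>f i ` B i. (\<integral>\<^sup>+y\<in>M. indicator {..t} (norm (x - y)) \<partial>?\<mu>) \<partial>?\<mu>) = ennreal (t ^ CARD('m) * h t)"
    by blast
  show ?thesis
  proof (rule that[OF h(1,2)])
    show "h (- t) = h t" if "t \<in> {-d<..<d}" for t using h(3) that by blast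
    fix t assume t: "t \<in> {0<..<d}"
    have "(\<lambda>p. indicator {..t} (norm (fst p - snd p)) :: ennreal) \<in> borel_measurable (borel :: ('a \<times> 'a) measure)"
      by measurable
    from nn_integral_pair_atlas[OF cl a, of "\<lambda>x y. indicator {..t} (norm (x - y))", OF this]
    have "ennreal (psi TYPE('m) M t) = ennreal (t ^ CARD('m) * h t)"
      using h(4) t by (simp add: psi_nn_integral[OF cl])
    then show "psi TYPE('m) M t = t ^ CARD('m) * h t"
      using h(4) t by (simp add: psi_def)
  qed
qed

text \<open>The values lie in \<open>ennreal\<close>, so that Tonelli and the conformal change of
  variables apply before finiteness is known. The strict inequality matches the complement of
  \<open>near_diagonal t\<close>.\<close>

definition outer_energy :: "'m::finite itself \<Rightarrow> 'a::euclidean_space set \<Rightarrow> real \<Rightarrow> ennreal" where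
  "outer_energy m M t = (\<integral>\<^sup>+p\<in>M \<times> M.
     (if t < norm (fst p - snd p) then ennreal (inverse (norm (fst p - snd p) ^ (2 * CARD('m)))) else 0)
     \<partial>(riemannian_volume m M \<Otimes>\<^sub>M riemannian_volume m M))"

lemma energy_shell_expansion:
  fixes M :: "'a::euclidean_space set" and \<rho> :: "'a \<Rightarrow> real"
  assumes cl: "closed_submanifold TYPE('m::finite) M"
    and \<rho>: "\<rho> \<in> borel_measurable borel"
      "\<And>W (f :: real ^ 'm \<Rightarrow> 'a). local_parametrization M W f \<Longrightarrow> smooth_on W (\<lambda>u. \<rho> (f u))"
    and c0: "0 < c0" "\<And>x. x \<in> M \<Longrightarrow> c0 \<le> \<rho> x"
  obtains d h where "d > 0" "family_smooth {0::real} d (\<lambda>_. h)" "\<And>t. t \<in> {-d<..<d} \<Longrightarrow> h (- t) = h t"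
    "\<And>t. t \<in> {0<..<d} \<Longrightarrow> 0 \<le> h t"
    "\<And>t. t \<in> {0<..<d} \<Longrightarrow>
      (\<integral>\<^sup>+p\<in>M \<times> M. (if c0 * c0 * norm (fst p - snd p) \<le> t \<and> t < \<rho> (fst p) * \<rho> (snd p) * norm (fst p - snd p)
         then ennreal (inverse (norm (fst p - snd p) ^ (2 * CARD('m)))) else 0)
         \<partial>(riemannian_volume TYPE('m) M \<Otimes>\<^sub>M riemannian_volume TYPE('m) M)) =
      ennreal (inverse (t ^ CARD('m)) * h t)"
proof -
  let ?\<mu> = "riemannian_volume TYPE('m) M"
  define k where "k t x y = (if c0 * c0 * norm (x - y) \<le> t \<and> t < \<rho> x * \<rho> y * norm (x - y)
         then ennreal (inverse (norm (x - y) ^ (2 * CARD('m)))) else 0)" for t x y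
  obtain N W K B and f :: "nat \<Rightarrow> real ^ 'm \<Rightarrow> 'a" where a: "atlas_partition M N W f K B"
    using exists_atlas_partition[OF cl] by blast
  note D = atlas_partitionD[OF a]
  have "\<exists>d>0. \<exists>h. family_smooth {0::real} d (\<lambda>_. h) \<and> (\<forall>t\<in>{-d<..<d}. h (- t) = h t) \<and>
      (\<forall>t\<in>{0<..<d}. 0 \<le> h t \<and> (\<Sum>i<N. \<integral>\<^sup>+x\<in>f i ` B i. (\<integral>\<^sup>+y\<in>M. k t x y \<partial>?\<mu>) \<partial>?\<mu>) = ennreal (inverse (t ^ CARD('m)) * h t))"
  proof (rule sum_smooth_pieces)
    fix i assume i: "i < N"
    show "\<exists>d>0. \<exists>h. family_smooth {0::real} d (\<lambda>_. h) \<and> (\<forall>t\<in>{-d<..<d}. h (- t) = h t) \<and>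
      (\<forall>t\<in>{0<..<d}. 0 \<le> h t \<and> (\<integral>\<^sup>+x\<in>f i ` B i. (\<integral>\<^sup>+y\<in>M. k t x y \<partial>?\<mu>) \<partial>?\<mu>) = ennreal (inverse (t ^ CARD('m)) * h t))"
      unfolding k_def
    proof (rule piece_energy_shell[OF cl D(1)[OF i] D(2)[OF i] D(3)[OF i] D(6)[OF i] D(4)[OF i] \<rho>(1) \<rho>(2)[OF D(1)[OF i]] c0(1)], goal_cases)
      case (1 x)
      then show ?case by (rule c0(2))
    next
      case (2 d h)
      show ?case by (rule exI[of _ d], intro conjI, rule 2(1), rule exI[of _ h]) (use 2 in simp)
    qed
  qed simp
  then obtain d h where h: "d > 0" "family_smooth {0::real} d (\<lambda>_. h)" "\<forall>t\<in>{-d<..<d}. h (- t) = h t"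
    "\<forall>t\<in>{0<..<d}. 0 \<le> h t \<and> (\<Sum>i<N. \<integral>\<^sup>+x\<in>f i ` B i. (\<integral>\<^sup>+y\<in>M. k t x y \<partial>?\<mu>) \<partial>?\<mu>) = ennreal (inverse (t ^ CARD('m)) * h t)"
    by blast
  have [measurable]: "(\<lambda>p. \<rho> (fst p)) \<in> borel_measurable (borel :: ('a \<times> 'a) measure)"
      "(\<lambda>p. \<rho> (snd p)) \<in> borel_measurable (borel :: ('a \<times> 'a) measure)"
    by (rule measurable_compose[OF measurable_fst_borel \<rho>(1)] measurable_compose[OF measurable_snd_borel \<rho>(1)])+
  have km: "(\<lambda>p. k t (fst p) (snd p)) \<in> borel_measurable (borel :: ('a \<times> 'a) measure)" for t
    unfolding k_def by measurable
  have "(\<integral>\<^sup>+p\<in>M \<times> M. k t (fst p) (snd p) \<partial>(?\<mu> \<Otimes>\<^sub>M ?\<mu>)) = ennreal (inverse (t ^ CARD('m)) * h t)" if t: "t \<in> {0<..<d}" for t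
    using nn_integral_pair_atlas[OF cl a km] h(4) t by simp
  note * = this[unfolded k_def]
  show ?thesis
  proof (rule that[OF h(1,2)])
    show "h (- t) = h t" if "t \<in> {-d<..<d}" for t using h(3) that by blast
    show "0 \<le> h t" if "t \<in> {0<..<d}" for t using h(4) that by blast
  qed (rule *)
qed

text \<open>At distances above \<open>t\<close> the kernel is bounded by \<open>t^(-2m)\<close>, and
  the product measure is finite.\<close>

lemma outer_energy_finite:
  fixes M :: "'a::euclidean_space set"
  assumes cl: "closed_submanifold TYPE('m::finite) M" and t: "t > 0"
  shows "outer_energy TYPE('m) M t < \<infinity>"
proof -
  let ?\<mu> = "riemannian_volume TYPE('m) M"
  interpret P: finite_measure "?\<mu> \<Otimes>\<^sub>M ?\<mu>"
    by (rule finite_measure_pair_measure) (rule riemannian_volume_finite[OF cl])+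
  have "outer_energy TYPE('m) M t \<le> (\<integral>\<^sup>+p. ennreal (inverse (t ^ (2 * CARD('m)))) \<partial>(?\<mu> \<Otimes>\<^sub>M ?\<mu>))"
    unfolding outer_energy_def
  proof (rule nn_integral_mono)
    fix p :: "'a \<times> 'a"
    show "(if t < norm (fst p - snd p) then ennreal (inverse (norm (fst p - snd p) ^ (2 * CARD('m)))) else 0) * indicator (M \<times> M) p
      \<le> ennreal (inverse (t ^ (2 * CARD('m))))"
      using t by (auto simp: indicator_def intro!: ennreal_leI le_imp_inverse_le power_mono)
  qed
  also have "\<dots> = ennreal (inverse (t ^ (2 * CARD('m)))) * emeasure (?\<mu> \<Otimes>\<^sub>M ?\<mu>) (space (?\<mu> \<Otimes>\<^sub>M ?\<mu>))" by simp
  also have "\<dots> < \<infinity>"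
    using P.emeasure_finite[of "space (?\<mu> \<Otimes>\<^sub>M ?\<mu>)", unfolded infinity_ennreal_def less_top]
    by (simp add: ennreal_mult_less_top)
  finally show ?thesis .
qed

lemma measurable_pair_riemannian_volume:
  fixes M :: "'a::euclidean_space set" and F :: "'a \<times> 'a \<Rightarrow> ennreal"
  assumes cl: "closed_submanifold TYPE('m::finite) M" and F: "F \<in> borel_measurable borel"
  shows "(\<lambda>p. F p * indicator (M \<times> M) p) \<in>
    borel_measurable (riemannian_volume TYPE('m) M \<Otimes>\<^sub>M riemannian_volume TYPE('m) M)"
proof -
  have "compact M" using cl by (simp add: closed_submanifold_def)
  then have MMB: "M \<times> M \<in> sets borel" by (intro borel_Times borel_compact)
  then have "(\<lambda>p. F p * indicator (M \<times> M) p) \<in> borel_measurable borel"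
    using F by measurable
  then show ?thesis by (simp cong: measurable_cong_sets[OF riemannian_volume_pair_sets[OF cl] refl])
qed

text \<open>Passing from distance \<open>x\<close> to \<open>y\<close> removes the pairs with
  distance in \<open>{x<..y}\<close>, on which the kernel lies between \<open>y^(-2m)\<close> and
  \<open>x^(-2m)\<close>. These are the bounds that \<open>derivative_squeeze\<close> takes as
  hypotheses.\<close>

lemma outer_energy_squeeze:
  fixes M :: "'a::euclidean_space set"
  assumes cl: "closed_submanifold TYPE('m::finite) M" and xy: "0 < x" "x < y"
  shows "inverse (y ^ (2 * CARD('m))) * (psi TYPE('m) M y - psi TYPE('m) M x) \<le>
      enn2real (outer_energy TYPE('m) M x) - enn2real (outer_energy TYPE('m) M y)"
    and "enn2real (outer_energy TYPE('m) M x) - enn2real (outer_energy TYPE('m) M y) \<le>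
      inverse (x ^ (2 * CARD('m))) * (psi TYPE('m) M y - psi TYPE('m) M x)"
proof -
  let ?\<mu> = "riemannian_volume TYPE('m) M" and ?k = "2 * CARD('m)"
  let ?P = "?\<mu> \<Otimes>\<^sub>M ?\<mu>"
  define e where "e p = ennreal (inverse (norm (fst p - snd p) ^ ?k))" for p :: "'a \<times> 'a"
  define n where "n p = norm (fst p - snd p)" for p :: "'a \<times> 'a"
  have [measurable]: "n \<in> borel_measurable borel" "e \<in> borel_measurable borel"
    unfolding n_def[abs_def] e_def[abs_def] by measurable
  \<comment> \<open>\<open>A\<close> is the measure and \<open>C\<close> the energy of the pairs
    with distance in \<open>{x<..y}\<close>; both turn out finite, so differences can be formed in
    the reals.\<close>
  define A where "A = (\<integral>\<^sup>+p\<in>M \<times> M. indicator {x<..y} (n p) \<partial>?P)"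
  define C where "C = (\<integral>\<^sup>+p\<in>M \<times> M. e p * indicator {x<..y} (n p) \<partial>?P)"
  have "ennreal (psi TYPE('m) M y) = (\<integral>\<^sup>+p. indicator {..x} (n p) * indicator (M \<times> M) p + indicator {x<..y} (n p) * indicator (M \<times> M) p \<partial>?P)"
    unfolding psi_nn_integral[OF cl] n_def
    by (rule nn_integral_cong) (use xy in \<open>auto simp: indicator_def\<close>)
  also have "\<dots> = ennreal (psi TYPE('m) M x) + A"
    unfolding psi_nn_integral[OF cl] A_def n_def[symmetric]
    by (intro nn_integral_add measurable_pair_riemannian_volume[OF cl]) measurable
  finally have psi: "ennreal (psi TYPE('m) M y) = ennreal (psi TYPE('m) M x) + A" .
  have "outer_energy TYPE('m) M x = (\<integral>\<^sup>+p. (if y < n p then e p else 0) * indicator (M \<times> M) p + (e p * indicator {x<..y} (n p)) * indicator (M \<times> M) p \<partial>?P)"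
    unfolding outer_energy_def n_def[symmetric] e_def[unfolded n_def[symmetric], symmetric]
    by (rule nn_integral_cong) (use xy in \<open>auto simp: indicator_def e_def n_def\<close>)
  also have "\<dots> = outer_energy TYPE('m) M y + C"
    unfolding outer_energy_def C_def n_def[symmetric] e_def[unfolded n_def[symmetric], symmetric]
    by (subst nn_integral_add) (auto intro!: measurable_pair_riemannian_volume[OF cl] simp: e_def n_def)
  finally have out: "outer_energy TYPE('m) M x = outer_energy TYPE('m) M y + C" .
  have C1: "ennreal (inverse (y ^ ?k)) * A \<le> C"
  proof -
    have "ennreal (inverse (y ^ ?k)) * A = (\<integral>\<^sup>+p. ennreal (inverse (y ^ ?k)) * (indicator {x<..y} (n p) * indicator (M \<times> M) p) \<partial>?P)"
      unfolding A_def by (rule nn_integral_cmult[symmetric]) (rule measurable_pair_riemannian_volume[OF cl], measurable)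
    also have "\<dots> \<le> C" unfolding C_def
    proof (rule nn_integral_mono)
      fix p
      have "inverse (y ^ ?k) \<le> inverse (n p ^ ?k)" if "x < n p" "n p \<le> y"
        using that xy by (intro le_imp_inverse_le power_mono) auto
      then show "ennreal (inverse (y ^ ?k)) * (indicator {x<..y} (n p) * indicator (M \<times> M) p) \<le> e p * indicator {x<..y} (n p) * indicator (M \<times> M) p"
        by (auto simp: indicator_def e_def n_def intro!: ennreal_leI)
    qed
    finally show ?thesis .
  qed
  have C2: "C \<le> ennreal (inverse (x ^ ?k)) * A"
  proof -
    have "C \<le> (\<integral>\<^sup>+p. ennreal (inverse (x ^ ?k)) * (indicator {x<..y} (n p) * indicator (M \<times> M) p) \<partial>?P)"
      unfolding C_def
    proof (rule nn_integral_mono)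
      fix p
      have "inverse (n p ^ ?k) \<le> inverse (x ^ ?k)" if "x < n p"
        using that xy by (intro le_imp_inverse_le power_mono) auto
      then show "e p * indicator {x<..y} (n p) * indicator (M \<times> M) p \<le> ennreal (inverse (x ^ ?k)) * (indicator {x<..y} (n p) * indicator (M \<times> M) p)"
        by (auto simp: indicator_def e_def n_def intro!: ennreal_leI)
    qed
    also have "\<dots> = ennreal (inverse (x ^ ?k)) * A"
      unfolding A_def by (rule nn_integral_cmult) (rule measurable_pair_riemannian_volume[OF cl], measurable)
    finally show ?thesis .
  qed
  have p0: "0 \<le> psi TYPE('m) M x" "0 \<le> psi TYPE('m) M y" by (simp_all add: psi_def)
  have "A < \<infinity>" using psi by (metis ennreal_less_top infinity_ennreal_def le_iff_add add.commute order_le_less_trans)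
  then obtain a where a: "0 \<le> a" "A = ennreal a" by (metis less_top_ennreal infinity_ennreal_def)
  have "C < \<infinity>" using C2 a by (metis ennreal_less_top ennreal_mult' infinity_ennreal_def order_le_less_trans ennreal_mult_less_top)
  then obtain c where c: "0 \<le> c" "C = ennreal c" by (metis less_top_ennreal infinity_ennreal_def)
  have "ennreal (psi TYPE('m) M y) = ennreal (psi TYPE('m) M x + a)" using psi a p0 by (simp add: ennreal_plus)
  then have "psi TYPE('m) M y = psi TYPE('m) M x + a" by (subst (asm) ennreal_inj) (use p0 a in auto)
  then have pa: "psi TYPE('m) M y - psi TYPE('m) M x = a" by simp
  have "enn2real (outer_energy TYPE('m) M x) = enn2real (outer_energy TYPE('m) M y) + c"
    unfolding out c(2) using outer_energy_finite[OF cl, of y] xy c(1) by (subst enn2real_plus) auto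
  then have oc: "enn2real (outer_energy TYPE('m) M x) - enn2real (outer_energy TYPE('m) M y) = c" by simp
  have "ennreal (inverse (y ^ ?k) * a) \<le> ennreal c" using C1 a c xy by (simp add: ennreal_mult)
  then show "inverse (y ^ ?k) * (psi TYPE('m) M y - psi TYPE('m) M x) \<le>
      enn2real (outer_energy TYPE('m) M x) - enn2real (outer_energy TYPE('m) M y)"
    unfolding pa oc using c(1) by simp
  have "ennreal c \<le> ennreal (inverse (x ^ ?k) * a)" using C2 a c xy by (simp add: ennreal_mult)
  then show "enn2real (outer_energy TYPE('m) M x) - enn2real (outer_energy TYPE('m) M y) \<le>
      inverse (x ^ ?k) * (psi TYPE('m) M y - psi TYPE('m) M x)"
    unfolding pa oc using a(1) xy by simp
qed

section \<open>Evaluation of the regularized energy\<close>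

text \<open>For a positive base and a negative integer exponent the complex power is an ordinary
  inverse power, so the integral is real.\<close>

lemma truncated_energy_eq:
  fixes M :: "'a::euclidean_space set"
  assumes cl: "closed_submanifold TYPE('m::finite) M" and t: "t > 0"
  shows "truncated_energy TYPE('m) k M (- 2 * of_nat CARD('m)) t =
    complex_of_real (enn2real (outer_energy TYPE('m) M t)) +
    (\<Sum>j=1..k. complex_of_real ((deriv_nonneg ^^ j) (psi TYPE('m) M) 0 / fact (j - 1)) *
        (if - 2 * of_nat CARD('m) = (- of_nat j :: complex) then complex_of_real (ln t)
         else complex_of_real t powr (- 2 * of_nat CARD('m) + of_nat j) / (- 2 * of_nat CARD('m) + of_nat j)))"
proof -
  let ?\<mu> = "riemannian_volume TYPE('m) M" and ?k = "2 * CARD('m)"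
  let ?P = "?\<mu> \<Otimes>\<^sub>M ?\<mu>"
  define G where "G p = (if t < norm (fst p - snd p) then inverse (norm (fst p - snd p) ^ ?k) else 0) * indicator (M \<times> M) p"
    for p :: "'a \<times> 'a"
  have "(LINT p : (M \<times> M) - near_diagonal t | ?P. complex_of_real (norm (fst p - snd p)) powr (- 2 * of_nat CARD('m))) =
      (LINT p | ?P. complex_of_real (G p))"
    unfolding set_lebesgue_integral_def
  proof (rule Bochner_Integration.integral_cong[OF refl])
    fix p :: "'a \<times> 'a"
    have pw: "complex_of_real r powr (- 2 * of_nat CARD('m)) = complex_of_real (inverse (r ^ ?k))" if "r > 0" for r
    proof -
      have "complex_of_real r powr (- 2 * of_nat CARD('m)) = complex_of_real r powr complex_of_real (- real ?k)" by simp
      also have "\<dots> = complex_of_real (r powr (- real ?k))"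
        by (rule powr_of_real) (use that in simp)
      also have "r powr (- real ?k) = inverse (r ^ ?k)"
        using that by (simp only: powr_minus powr_realpow)
      finally show ?thesis .
    qed
    show "indicator ((M \<times> M) - near_diagonal t) p *\<^sub>R (complex_of_real (norm (fst p - snd p)) powr (- 2 * of_nat CARD('m))) = complex_of_real (G p)"
    proof (cases "p \<in> (M \<times> M) - near_diagonal t")
      case True
      then have "t < norm (fst p - snd p)" by (auto simp: near_diagonal_def)
      then have "complex_of_real (norm (fst p - snd p)) powr (- 2 * of_nat CARD('m)) = complex_of_real (inverse (norm (fst p - snd p) ^ ?k))"
        using t by (intro pw) linarith
      then show ?thesis using True \<open>t < norm (fst p - snd p)\<close> by (simp add: G_def)
    next
      case False
      then show ?thesis by (auto simp: G_def near_diagonal_def indicator_def)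
    qed
  qed
  also have "\<dots> = complex_of_real (LINT p | ?P. G p)" by simp
  also have "(LINT p | ?P. G p) = enn2real (\<integral>\<^sup>+p. ennreal (G p) \<partial>?P)"
  proof (rule integral_eq_nn_integral)
    have "compact M" using cl by (simp add: closed_submanifold_def)
    then have "M \<times> M \<in> sets borel" by (intro borel_Times borel_compact)
    then have "G \<in> borel_measurable borel" unfolding G_def[abs_def] by measurable
    then show "G \<in> borel_measurable ?P"
      by (simp cong: measurable_cong_sets[OF riemannian_volume_pair_sets[OF cl] refl])
  qed (simp add: G_def)
  also have "(\<integral>\<^sup>+p. ennreal (G p) \<partial>?P) = outer_energy TYPE('m) M t"
    unfolding outer_energy_def by (rule nn_integral_cong) (auto simp: G_def indicator_def)
  finally show ?thesis unfolding truncated_energy_def by simp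
qed

text \<open>The expansion of \<open>psi\<close> says nothing at \<open>t = 0\<close>, but the
  iterated derivatives at \<open>0\<close> involve that value. Monotonicity and the limit from the
  right supply it.\<close>

lemma psi_at_0:
  fixes M :: "'a::euclidean_space set"
  assumes cl: "closed_submanifold TYPE('m::finite) M" and d: "d > 0"
    and eq: "\<And>t. t \<in> {0<..<d} \<Longrightarrow> psi TYPE('m) M t = g t" and g: "isCont g 0" "g 0 = 0"
  shows "psi TYPE('m) M 0 = 0"
proof -
  have le: "psi TYPE('m) M 0 \<le> psi TYPE('m) M t" if "t > 0" for t
  proof -
    have "ennreal (psi TYPE('m) M 0) \<le> ennreal (psi TYPE('m) M t)"
      unfolding psi_nn_integral[OF cl]
      by (rule nn_integral_mono) (use that in \<open>auto simp: indicator_def\<close>)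
    then show ?thesis by (simp add: psi_def)
  qed
  have "(g \<longlongrightarrow> 0) (at_right 0)"
    using g by (auto simp: isCont_def intro: filterlim_mono[OF _ order_refl at_le])
  moreover have "\<forall>\<^sub>F t in at_right 0. psi TYPE('m) M 0 \<le> g t"
    unfolding eventually_at_right_field
    by (intro exI[of _ d]) (use d eq le in fastforce)
  ultimately have "psi TYPE('m) M 0 \<le> 0"
    by (intro tendsto_lowerbound[of g]) auto
  then show ?thesis by (simp add: psi_def measure_le_0_iff)
qed

text \<open>Lets the one-sided derivatives of \<open>psi\<close> at \<open>0\<close> be read off
  from a smooth function on both sides that agrees with \<open>psi\<close> on the right.\<close>

lemma deriv_nonneg_eq:
  assumes "d > 0" and t: "t \<in> {0..<d}" and eq: "\<And>s. s \<in> {0..<d} \<Longrightarrow> F s = G s"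
    and G: "(G has_real_derivative G') (at t)"
  shows "deriv_nonneg F t = G'"
  unfolding deriv_nonneg_def
proof (rule vector_derivative_within)
  show "at t within {0..} \<noteq> bot"
  proof (cases "t = 0")
    case True
    then show ?thesis by (simp add: at_within_Ici_at_right)
  next
    case False
    have "at t within {0..} = at t within UNIV"
      by (rule at_within_nhd[of t "{0<..}"]) (use t False in auto)
    then show ?thesis by simp
  qed
  have "(G has_vector_derivative G') (at t within {0..})"
    using G by (simp add: has_real_derivative_iff_has_vector_derivative has_vector_derivative_at_within)
  then show "(F has_vector_derivative G') (at t within {0..})"
  proof (rule has_vector_derivative_transform_within[where d = "d - t"])
    show "G s = F s" if "s \<in> {0..}" "dist s t < d - t" for s
      using eq[of s] that t by (auto simp: dist_real_def)
  qed (use t in auto)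
qed

text \<open>The outer energy has derivative \<open>- t^(-2m) psi'(t)\<close>. The correction terms
  of order below \<open>2m\<close> have the derivatives that cancel the Taylor polynomial of
  \<open>psi'\<close>, so the sum has bounded derivative and converges. The logarithm has
  coefficient \<open>0\<close>, and the terms of order above \<open>2m\<close> tend to
  \<open>0\<close>.\<close>

lemma regularized_energy_finite_part:
  fixes M :: "'a::euclidean_space set"
  assumes cl: "closed_submanifold TYPE('m::finite) M" and m: "odd CARD('m)"
  obtains e where "has_finite_part (\<lambda>t. enn2real (outer_energy TYPE('m) M t)) e"
    "regularized_energy TYPE('m) M (- 2 * of_nat CARD('m)) = complex_of_real e"
proof -
  define k0 where "k0 = 2 * CARD('m)"
  have k0: "k0 \<ge> 2" using zero_less_card_finite[where 'a='m] unfolding k0_def by linarith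
  define F where "F t = enn2real (outer_energy TYPE('m) M t)" for t
  obtain d h where d: "d > 0" and h: "family_smooth {0::real} d (\<lambda>_. h)" "\<And>t. t \<in> {-d<..<d} \<Longrightarrow> h (- t) = h t"
    "\<And>t. t \<in> {0<..<d} \<Longrightarrow> psi TYPE('m) M t = t ^ CARD('m) * h t"
    using psi_expansion[OF cl] by metis
  \<comment> \<open>The smooth continuation of \<open>psi\<close> to negative \<open>t\<close>; it
    is odd, being an odd power times an even function.\<close>
  define g where "g t = t ^ CARD('m) * h t" for t
  have gsm: "family_smooth {0::real} d (\<lambda>_. g)" unfolding g_def
    by (intro family_smoothI family_C_mult family_C_power family_C_id family_smoothD[OF h(1)])
  obtain D where D: "D 0 = g" "\<And>n t. t \<in> {-d<..<d} \<Longrightarrow> (D n has_real_derivative D (Suc n) t) (at t)"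
    using family_smooth_derivative_sequence[OF gsm] by metis
  have "isCont g 0" using DERIV_isCont[OF D(2)[of 0 0]] d D(1) by simp
  have "g 0 = 0" by (simp add: g_def)
  have psi_g: "psi TYPE('m) M t = g t" if "t \<in> {0<..<d}" for t using h(3)[OF that] by (simp add: g_def)
  have psi0: "psi TYPE('m) M 0 = 0"
    by (rule psi_at_0[OF cl d psi_g \<open>isCont g 0\<close> \<open>g 0 = 0\<close>])
  have psi_eq: "psi TYPE('m) M t = D 0 t" if "t \<in> {0..<d}" for t
    using that psi0 h(3)[of t] \<open>g 0 = 0\<close> by (cases "t = 0") (auto simp: D(1) g_def)
  have iter: "(deriv_nonneg ^^ j) (psi TYPE('m) M) t = D j t" if "t \<in> {0..<d}" for j t
    using that
  proof (induction j arbitrary: t)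
    case 0
    then show ?case using psi_eq by simp
  next
    case (Suc j)
    have "deriv_nonneg ((deriv_nonneg ^^ j) (psi TYPE('m) M)) t = D (Suc j) t"
      by (rule deriv_nonneg_eq[OF d Suc.prems Suc.IH D(2)]) (use Suc.prems d in auto)
    then show ?case by simp
  qed
  \<comment> \<open>Derivatives of even order of an odd function vanish at \<open>0\<close>, and the
    even order \<open>2m\<close> is the one that goes with the logarithm.\<close>
  have Dk0: "D k0 0 = 0"
  proof -
    have "D k0 (- 0) = - 1 * (- 1) ^ k0 * D k0 0"
    proof (rule derivative_sequence_parity[where D = D and d = d, OF D(2)])
      show "D 0 (- t) = - 1 * D 0 t" if "t \<in> {-d<..<d}" for t
        using h(2)[OF that] m by (simp add: D(1) g_def)
    qed (use d in auto)
    then show ?thesis by (simp add: k0_def)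
  qed
  define a where "a j = D j 0 / fact (j - 1)" for j
  have dF: "(F has_real_derivative - (inverse (t ^ k0) * D 1 t)) (at t)" if t: "t \<in> {0<..<d}" for t
  proof (rule derivative_squeeze[where \<psi> = "psi TYPE('m) M" and g = "\<lambda>t. inverse (t ^ k0)", OF t])
    show "isCont (\<lambda>t. inverse (t ^ k0)) t" using t by (intro continuous_intros) auto
    have "(D 0 has_real_derivative D 1 t) (at t)" using D(2)[of t 0] t by auto
    then show "(psi TYPE('m) M has_real_derivative D 1 t) (at t)"
      by (rule has_field_derivative_transform_within_open[of _ _ _ "{0<..<d}"]) (use t psi_eq in auto)
  qed (use outer_energy_squeeze[OF cl] in \<open>simp_all add: F_def k0_def\<close>)
  \<comment> \<open>The correction terms with \<open>j < k0\<close>, whose exponents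
    \<open>j - k0\<close> are negative integers.\<close>
  define Es where "Es t = (\<Sum>j=1..k0-1. a j * inverse t ^ (k0 - j) / (real j - real k0))" for t
  have dEs: "(Es has_real_derivative (\<Sum>j=1..k0-1. a j * (inverse (t ^ k0) * t ^ (j - 1)))) (at t)" if t: "t > 0" for t
    unfolding Es_def
  proof (rule DERIV_sum)
    fix j assume j: "j \<in> {1..k0-1}"
    define n where "n = k0 - j"
    have n: "n > 0" "real j - real k0 = - real n" "k0 = n + j" using j by (auto simp: n_def)
    have "((\<lambda>t. inverse t ^ n) has_real_derivative real n * (inverse t ^ (n - 1) * - (inverse t * inverse t))) (at t)"
      using t by (auto intro!: derivative_eq_intros)
    from DERIV_cdivide[OF DERIV_cmult[OF this, of "a j"], of "- real n"]
    have "((\<lambda>t. a j * inverse t ^ n / - real n) has_real_derivative a j * (inverse t ^ (n - 1) * (inverse t * inverse t))) (at t)"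
      using n(1) by (simp add: field_simps)
    moreover have "inverse t ^ (n - 1) * (inverse t * inverse t) = inverse (t ^ k0) * t ^ (j - 1)"
    proof -
      obtain n' j' where nj: "n = Suc n'" "j = Suc j'" using n(1) j by (metis Suc_pred' atLeastAtMost_iff less_eq_Suc_le One_nat_def)
      show ?thesis using t by (simp add: nj n(3) power_add field_simps)
    qed
    ultimately show "((\<lambda>t. a j * inverse t ^ (k0 - j) / (real j - real k0)) has_real_derivative a j * (inverse (t ^ k0) * t ^ (j - 1))) (at t)"
      unfolding n(2) n_def[symmetric] by simp
  qed
  have "\<exists>B. \<forall>t\<in>{0<..<d/2}. \<bar>D 1 t - (\<Sum>j<k0. D (1 + j) 0 / fact j * t ^ j)\<bar> \<le> B * t ^ k0"
  proof (rule taylor_remainder_bound[where D = D and n = k0 and k = 1, OF d D(2)], goal_cases)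
    case 2
    then show ?case using k0 by simp
  next
    case (3 B)
    then show ?case by (intro exI[of _ B] ballI)
  qed
  then obtain B where B: "\<And>t. t \<in> {0<..<d/2} \<Longrightarrow> \<bar>D 1 t - (\<Sum>j<k0. D (1 + j) 0 / fact j * t ^ j)\<bar> \<le> B * t ^ k0"
    by blast
  \<comment> \<open>The last summand on the left contains \<open>D k0 0\<close> and vanishes, so one
    term fewer remains. It is the one that would give \<open>1 / t\<close> and hence the
    logarithm.\<close>
  have sum_eq: "(\<Sum>j<k0. D (1 + j) 0 / fact j * t ^ j) = (\<Sum>j=1..k0-1. a j * t ^ (j - 1))" for t
  proof -
    obtain k' where k': "k0 = Suc k'" using k0 by (cases k0) auto
    have "(\<Sum>j<k0. D (1 + j) 0 / fact j * t ^ j) = (\<Sum>j<k'. D (Suc j) 0 / fact j * t ^ j)"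
      using Dk0 by (simp add: k')
    also have "\<dots> = (\<Sum>j=1..k0-1. a j * t ^ (j - 1))"
      by (simp add: k' a_def sum.atLeast1_atMost_eq)
    finally show ?thesis .
  qed
  obtain e where e: "((\<lambda>t. F t + Es t) \<longlongrightarrow> e) (at_right 0)"
  proof (rule bounded_derivative_limit_at_right[where E = "\<lambda>t. F t + Es t" and d = "d / 2" and B = B and
        E' = "\<lambda>t. - (inverse (t ^ k0) * D 1 t) + (\<Sum>j=1..k0-1. a j * (inverse (t ^ k0) * t ^ (j - 1)))"])
    show "d / 2 > 0" using d by simp
    fix t assume t: "t \<in> {0<..<d/2}"
    show "((\<lambda>t. F t + Es t) has_real_derivative - (inverse (t ^ k0) * D 1 t) + (\<Sum>j=1..k0-1. a j * (inverse (t ^ k0) * t ^ (j - 1)))) (at t)"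
      by (rule DERIV_add[OF dF dEs]) (use t in auto)
    have "- (inverse (t ^ k0) * D 1 t) + (\<Sum>j=1..k0-1. a j * (inverse (t ^ k0) * t ^ (j - 1))) =
        - (inverse (t ^ k0) * (D 1 t - (\<Sum>j<k0. D (1 + j) 0 / fact j * t ^ j)))"
      unfolding sum_eq by (simp add: right_diff_distrib sum_distrib_left mult_ac)
    moreover have "\<bar>inverse (t ^ k0) * (D 1 t - (\<Sum>j<k0. D (1 + j) 0 / fact j * t ^ j))\<bar> \<le> inverse (t ^ k0) * (B * t ^ k0)"
      unfolding abs_mult using t by (intro mult_mono B) auto
    moreover have "inverse (t ^ k0) * (B * t ^ k0) = B" using t by simp
    ultimately show "\<bar>- (inverse (t ^ k0) * D 1 t) + (\<Sum>j=1..k0-1. a j * (inverse (t ^ k0) * t ^ (j - 1)))\<bar> \<le> B" by simp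
  qed
  have fp: "has_finite_part F e" unfolding has_finite_part_def
  proof (intro exI)
    have "Es t = (\<Sum>i=1..k0-1. (a (k0 - i) / - real i) * inverse t ^ i)" for t
      unfolding Es_def
    proof (rule sum.reindex_bij_witness[of _ "\<lambda>i. k0 - i" "\<lambda>j. k0 - j"])
      fix j assume "j \<in> {1..k0-1}"
      then have "k0 - (k0 - j) = j" "- real (k0 - j) = real j - real k0" by auto
      then show "a (k0 - (k0 - j)) / - real (k0 - j) * inverse t ^ (k0 - j) = a j * inverse t ^ (k0 - j) / (real j - real k0)"
        by simp
    qed auto
    then show "((\<lambda>t. F t + (\<Sum>i=1..k0-1. (a (k0 - i) / - real i) * inverse t ^ i)) \<longlongrightarrow> e) (at_right 0)"
      using e by simp
  qed
  have z: "- 2 * of_nat CARD('m) = - (of_nat k0 :: complex)" by (simp add: k0_def)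
  \<comment> \<open>Three kinds of correction terms: negative powers, the logarithm with coefficient
    \<open>0\<close>, and powers that tend to \<open>0\<close>.\<close>
  define w where "w j t = (if j < k0 then a j * inverse t ^ (k0 - j) / (real j - real k0)
      else if j = k0 then 0 else a j * t ^ (j - k0) / (real j - real k0))" for j t
  have term_eq: "complex_of_real ((deriv_nonneg ^^ j) (psi TYPE('m) M) 0 / fact (j - 1)) *
        (if - of_nat k0 = (- of_nat j :: complex) then complex_of_real (ln t)
         else complex_of_real t powr (- of_nat k0 + of_nat j) / (- of_nat k0 + of_nat j)) = complex_of_real (w j t)"
    if t: "t > 0" for j t
  proof -
    have aj: "(deriv_nonneg ^^ j) (psi TYPE('m) M) 0 / fact (j - 1) = a j"
      using iter[of 0 j] d by (simp add: a_def)
    show ?thesis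
    proof (cases "j = k0")
      case True
      then show ?thesis unfolding aj using Dk0 by (simp add: w_def a_def)
    next
      case False
      have r: "- of_nat k0 + of_nat j = complex_of_real (real j - real k0)" by simp
      have "complex_of_real t powr (- of_nat k0 + of_nat j) = complex_of_real (t powr (real j - real k0))"
        unfolding r by (rule powr_of_real) (use t in simp)
      moreover have "t powr (real j - real k0) = (if j < k0 then inverse t ^ (k0 - j) else t ^ (j - k0))"
      proof (cases "j < k0")
        case True
        then have "real j - real k0 = - real (k0 - j)" by simp
        then show ?thesis using True t by (simp only: powr_minus powr_realpow power_inverse if_True)
      next
        case False
        then have "real j - real k0 = real (j - k0)" by simp
        then show ?thesis using False t by (simp only: powr_realpow if_False)
      qed
      ultimately show ?thesis unfolding aj r using False by (simp add: w_def)
    qed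
  qed
  have lim: "(truncated_energy TYPE('m) k M (- 2 * of_nat CARD('m)) \<longlongrightarrow> complex_of_real e) (at_right 0)"
    if k: "k \<ge> k0" for k
  proof -
    have t0: "((\<lambda>t::real. t) \<longlongrightarrow> 0) (at_right 0)" by (rule tendsto_ident_at)
    have "((\<lambda>t. \<Sum>j=k0..k. w j t) \<longlongrightarrow> 0) (at_right 0)"
    proof (rule tendsto_null_sum)
      fix j assume j: "j \<in> {k0..k}"
      show "(w j \<longlongrightarrow> 0) (at_right 0)"
      proof (cases "j = k0")
        case True
        then show ?thesis by (simp add: w_def[abs_def])
      next
        case False
        then have jk: "j > k0" using j by simp
        have "((\<lambda>t. a j * t ^ (j - k0) / (real j - real k0)) \<longlongrightarrow> a j * 0 ^ (j - k0) / (real j - real k0)) (at_right 0)"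
          using jk by (intro tendsto_divide tendsto_mult tendsto_const tendsto_power t0) auto
        moreover have "(0::real) ^ (j - k0) = 0" using jk by simp
        ultimately have "((\<lambda>t. a j * t ^ (j - k0) / (real j - real k0)) \<longlongrightarrow> 0) (at_right 0)"
          by (simp only: mult_zero_right div_0)
        then show ?thesis using jk by (simp add: w_def[abs_def])
      qed
    qed
    from tendsto_add[OF e this]
    have "((\<lambda>t. F t + Es t + (\<Sum>j=k0..k. w j t)) \<longlongrightarrow> e) (at_right 0)" by simp
    then have l: "((\<lambda>t. complex_of_real (F t + Es t + (\<Sum>j=k0..k. w j t))) \<longlongrightarrow> complex_of_real e) (at_right 0)"
      by (rule tendsto_of_real)
    have ev: "\<forall>\<^sub>F t in at_right 0. complex_of_real (F t + Es t + (\<Sum>j=k0..k. w j t)) =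
        truncated_energy TYPE('m) k M (- 2 * of_nat CARD('m)) t"
      unfolding eventually_at_right_field
    proof (intro exI[of _ 1] conjI allI impI)
      fix t :: real assume t: "0 < t"
      have "{1..k} = {1..k0-1} \<union> {k0..k}" using k0 k by auto
      then have "(\<Sum>j=1..k. w j t) = (\<Sum>j=1..k0-1. w j t) + (\<Sum>j=k0..k. w j t)"
        using k0 by (simp only:, intro sum.union_disjoint) auto
      moreover have "(\<Sum>j=1..k0-1. w j t) = Es t" unfolding Es_def by (rule sum.cong) (auto simp: w_def)
      ultimately have s: "(\<Sum>j=1..k. w j t) = Es t + (\<Sum>j=k0..k. w j t)" by simp
      have "complex_of_real (F t + Es t + (\<Sum>j=k0..k. w j t)) = complex_of_real (F t + (\<Sum>j=1..k. w j t))"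
        by (simp only: s add.assoc)
      also have "\<dots> = complex_of_real (F t) + (\<Sum>j=1..k. complex_of_real (w j t))"
        by (simp only: of_real_add of_real_sum)
      also have "\<dots> = truncated_energy TYPE('m) k M (- 2 * of_nat CARD('m)) t"
        using truncated_energy_eq[OF cl t, of k, unfolded z, unfolded term_eq[OF t]] unfolding z F_def by (rule sym)
      finally show "complex_of_real (F t + Es t + (\<Sum>j=k0..k. w j t)) = truncated_energy TYPE('m) k M (- 2 * of_nat CARD('m)) t" .
    qed simp
    show ?thesis by (rule iffD1[OF tendsto_cong[OF ev] l])
  qed
  have "regularized_energy TYPE('m) M (- 2 * of_nat CARD('m)) = complex_of_real e"
    unfolding regularized_energy_def
  proof (rule the_equality)
    show "\<forall>k. - real k - 1 < Re (- 2 * of_nat CARD('m)) \<longrightarrow>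
        (truncated_energy TYPE('m) k M (- 2 * of_nat CARD('m)) \<longlongrightarrow> complex_of_real e) (at_right 0)"
    proof (intro allI impI)
      fix k assume "- real k - 1 < Re (- 2 * of_nat CARD('m))"
      then have "real k0 < real (k + 1)" by (simp add: k0_def)
      then have "k \<ge> k0" by (simp only: of_nat_less_iff)
      then show "(truncated_energy TYPE('m) k M (- 2 * of_nat CARD('m)) \<longlongrightarrow> complex_of_real e) (at_right 0)" by (rule lim)
    qed
    \<comment> \<open>\<open>k0\<close> is the smallest admissible number of correction terms; it
      alone determines the limit.\<close>
    fix e' assume "\<forall>k. - real k - 1 < Re (- 2 * of_nat CARD('m)) \<longrightarrow>
        (truncated_energy TYPE('m) k M (- 2 * of_nat CARD('m)) \<longlongrightarrow> e') (at_right 0)"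
    moreover have "- real k0 - 1 < Re (- 2 * of_nat CARD('m))" by (simp add: k0_def)
    ultimately have "(truncated_energy TYPE('m) k0 M (- 2 * of_nat CARD('m)) \<longlongrightarrow> e') (at_right 0)" by blast
    then show "e' = complex_of_real e"
      using lim[OF order_refl] tendsto_unique[OF trivial_limit_at_right_real] by blast
  qed
  then show ?thesis using that fp unfolding F_def by blast
qed

section \<open>Moebius transformations and conformal images\<close>

text \<open>The polarization of the quadratic form \<open>|x|^2 - p q\<close> on triples
  \<open>(x, p, q)\<close>: a Lorentz form in which \<open>p\<close> and \<open>q\<close> are null
  coordinates.\<close>

definition lorentz :: "'a::real_inner \<times> real \<times> real \<Rightarrow> 'a \<times> real \<times> real \<Rightarrow> real" where
  "lorentz \<xi> \<eta> = fst \<xi> \<bullet> fst \<eta> - (fst (snd \<xi>) * snd (snd \<eta>) + fst (snd \<eta>) * snd (snd \<xi>)) / 2"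

text \<open>Points of the compactified space as null vectors. The last coordinate is
  \<open>1\<close> for finite points and \<open>0\<close> at infinity, so scaling a vector until
  that coordinate is \<open>1\<close> recovers a finite point.\<close>

definition light_ray :: "'a::real_inner option \<Rightarrow> 'a \<times> real \<times> real" where
  "light_ray P = (case P of None \<Rightarrow> (0, 1, 0) | Some x \<Rightarrow> (x, x \<bullet> x, 1))"

text \<open>The factor \<open>\<kappa>\<close> admits maps that scale the form, so that inversions
  have a polynomial lift. Positivity of \<open>\<mu>\<close> matters because a root of its inverse
  becomes the factor \<open>\<rho>\<close>.\<close>

definition lorentz_lift :: "('a::euclidean_space option \<Rightarrow> 'a option) \<Rightarrow> ('a \<times> real \<times> real \<Rightarrow> 'a \<times> real \<times> real) \<Rightarrow> real \<Rightarrow> bool" where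
  "lorentz_lift T L \<kappa> \<longleftrightarrow> linear L \<and> \<kappa> > 0 \<and> (\<forall>\<xi> \<eta>. lorentz (L \<xi>) (L \<eta>) = \<kappa> * lorentz \<xi> \<eta>) \<and>
     (\<forall>P. \<exists>\<mu>>0. L (light_ray P) = \<mu> *\<^sub>R light_ray (T P))"

text \<open>Since squared distances are Lorentz products of lifts up to a constant, a map that
  respects the form controls distances.\<close>

lemma lorentz_light_ray: "lorentz (light_ray (Some x)) (light_ray (Some y)) = - (norm (x - y))\<^sup>2 / 2"
  by (simp add: lorentz_def light_ray_def power2_norm_eq_inner inner_diff inner_commute field_simps)

lemma lorentz_scaleR: "lorentz (a *\<^sub>R \<xi>) (b *\<^sub>R \<eta>) = a * b * lorentz \<xi> \<eta>"
  by (simp add: lorentz_def field_simps)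

lemma lorentz_lift_id: "lorentz_lift id id 1"
  unfolding lorentz_lift_def by (auto intro!: exI[of _ 1] simp: linear_id[unfolded id_def] id_def)

lemma lorentz_lift_compose:
  assumes S: "lorentz_lift S L \<kappa>" and T: "lorentz_lift T L' \<kappa>'"
  shows "lorentz_lift (S \<circ> T) (L \<circ> L') (\<kappa> * \<kappa>')"
  unfolding lorentz_lift_def
proof (intro conjI allI)
  show "linear (L \<circ> L')" using S T unfolding lorentz_lift_def by (intro linear_compose) auto
  show "0 < \<kappa> * \<kappa>'" using S T unfolding lorentz_lift_def by auto
  show "lorentz ((L \<circ> L') \<xi>) ((L \<circ> L') \<eta>) = \<kappa> * \<kappa>' * lorentz \<xi> \<eta>" for \<xi> \<eta>
    using S T unfolding lorentz_lift_def by (simp del: split_paired_All)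
  show "\<exists>\<mu>>0. (L \<circ> L') (light_ray P) = \<mu> *\<^sub>R light_ray ((S \<circ> T) P)" for P
  proof -
    obtain \<mu>' where \<mu>': "\<mu>' > 0" "L' (light_ray P) = \<mu>' *\<^sub>R light_ray (T P)"
      using T unfolding lorentz_lift_def by blast
    obtain \<mu> where \<mu>: "\<mu> > 0" "L (light_ray (T P)) = \<mu> *\<^sub>R light_ray (S (T P))"
      using S unfolding lorentz_lift_def by blast
    have "linear L" using S unfolding lorentz_lift_def by blast
    then have "(L \<circ> L') (light_ray P) = (\<mu>' * \<mu>) *\<^sub>R light_ray ((S \<circ> T) P)"
      using \<mu>' \<mu> by (simp add: linear_scale)
    then show ?thesis using \<mu>' \<mu> mult_pos_pos by blast
  qed
qed

text \<open>The lift is the reflection formula made homogeneous: \<open>1\<close> becomes the last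
  coordinate, and \<open>|x|^2\<close> changes by \<open>-4 b s\<close> with
  \<open>s = (a \<bullet> x - b) / (a \<bullet> a)\<close>.\<close>

lemma lorentz_lift_reflection:
  fixes a :: "'a::euclidean_space"
  assumes a: "a \<noteq> 0"
  shows "lorentz_lift (hyperplane_reflection a b)
    (\<lambda>\<xi>. (fst \<xi> - (2 * ((a \<bullet> fst \<xi> - b * snd (snd \<xi>)) / (a \<bullet> a))) *\<^sub>R a,
         fst (snd \<xi>) - 4 * b * ((a \<bullet> fst \<xi> - b * snd (snd \<xi>)) / (a \<bullet> a)), snd (snd \<xi>))) 1"
proof -
  define u where "u \<xi> = (a \<bullet> fst \<xi> - b * snd (snd \<xi>)) / (a \<bullet> a)" for \<xi> :: "'a \<times> real \<times> real"
  have aa: "a \<bullet> a \<noteq> 0" using a by simp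
  have u: "u \<xi> * (a \<bullet> a) = a \<bullet> fst \<xi> - b * snd (snd \<xi>)" for \<xi> unfolding u_def using aa by simp
  have lu: "u (\<xi> + \<eta>) = u \<xi> + u \<eta>" "u (r *\<^sub>R \<xi>) = r * u \<xi>" for \<xi> \<eta> r
    unfolding u_def using aa by (auto simp: inner_add_right field_simps)
  have "lorentz_lift (hyperplane_reflection a b)
    (\<lambda>\<xi>. (fst \<xi> - (2 * u \<xi>) *\<^sub>R a, fst (snd \<xi>) - 4 * b * u \<xi>, snd (snd \<xi>))) 1"
    unfolding lorentz_lift_def
  proof (intro conjI allI)
    show "linear (\<lambda>\<xi>. (fst \<xi> - (2 * u \<xi>) *\<^sub>R a, fst (snd \<xi>) - 4 * b * u \<xi>, snd (snd \<xi>)))"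
      by (rule linearI) (auto simp: lu algebra_simps)
    show "lorentz (fst \<xi> - (2 * u \<xi>) *\<^sub>R a, fst (snd \<xi>) - 4 * b * u \<xi>, snd (snd \<xi>))
        (fst \<eta> - (2 * u \<eta>) *\<^sub>R a, fst (snd \<eta>) - 4 * b * u \<eta>, snd (snd \<eta>)) = 1 * lorentz \<xi> \<eta>" for \<xi> \<eta>
      unfolding lorentz_def fst_conv snd_conv inner_diff inner_scaleR_left inner_scaleR_right inner_commute[of "fst \<xi>" a]
      using u[of \<xi>] u[of \<eta>] by algebra
    show "\<exists>\<mu>>0. (fst (light_ray P) - (2 * u (light_ray P)) *\<^sub>R a, fst (snd (light_ray P)) - 4 * b * u (light_ray P),
        snd (snd (light_ray P))) = \<mu> *\<^sub>R light_ray (hyperplane_reflection a b P)" for P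
    proof (intro exI[of _ 1] conjI)
      show "(fst (light_ray P) - (2 * u (light_ray P)) *\<^sub>R a, fst (snd (light_ray P)) - 4 * b * u (light_ray P),
        snd (snd (light_ray P))) = 1 *\<^sub>R light_ray (hyperplane_reflection a b P)"
      proof (cases P)
        case None
        then show ?thesis by (simp add: light_ray_def hyperplane_reflection_def u_def)
      next
        case (Some x)
        have u1: "u (light_ray (Some x)) = (a \<bullet> x - b) / (a \<bullet> a)" by (simp add: light_ray_def u_def)
        define s where "s = (a \<bullet> x - b) / (a \<bullet> a)"
        have s: "s * (a \<bullet> a) = a \<bullet> x - b" unfolding s_def using aa by simp
        have "x \<bullet> x - 4 * b * s = (x - (2 * s) *\<^sub>R a) \<bullet> (x - (2 * s) *\<^sub>R a)"
          unfolding inner_diff inner_scaleR_left inner_scaleR_right inner_commute[of x a] using s by algebra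
        then have "(x - (2 * s) *\<^sub>R a, x \<bullet> x - 4 * b * s, 1) = light_ray (Some (x - (2 * s) *\<^sub>R a))"
          by (simp add: light_ray_def)
        then show ?thesis unfolding Some u1 by (simp add: light_ray_def hyperplane_reflection_def s_def)
      qed
    qed simp
  qed simp
  then show ?thesis unfolding u_def .
qed

lemma lorentz_lift_inversion:
  fixes c :: "'a::euclidean_space"
  assumes r: "r > 0"
  shows "\<exists>L \<kappa>. lorentz_lift (sphere_inversion c r) L \<kappa>"
proof -
  \<comment> \<open>\<open>m\<close> is the linear form whose value on the lift of \<open>x\<close>
    is \<open>|x - c|^2\<close>. Multiplying the lift of the image point by \<open>|x - c|^2\<close>
    clears the denominators and leaves the linear map \<open>L\<close>.\<close>
  define m where "m \<xi> = fst (snd \<xi>) - 2 * (c \<bullet> fst \<xi>) + (c \<bullet> c) * snd (snd \<xi>)" for \<xi> :: "'a \<times> real \<times> real"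
  define L where "L \<xi> = (m \<xi> *\<^sub>R c + r\<^sup>2 *\<^sub>R (fst \<xi> - snd (snd \<xi>) *\<^sub>R c),
      (c \<bullet> c) * m \<xi> + 2 * r\<^sup>2 * (c \<bullet> (fst \<xi> - snd (snd \<xi>) *\<^sub>R c)) + r ^ 4 * snd (snd \<xi>), m \<xi>)"
    for \<xi> :: "'a \<times> real \<times> real"
  have "lorentz_lift (sphere_inversion c r) L (r ^ 4)"
    unfolding lorentz_lift_def
  proof (intro conjI allI)
    have lm: "m (\<xi> + \<eta>) = m \<xi> + m \<eta>" "m (s *\<^sub>R \<xi>) = s * m \<xi>" for \<xi> \<eta> s
      unfolding m_def by (auto simp: inner_add_right algebra_simps)
    show "linear L"
      by (rule linearI) (auto simp: L_def lm inner_add_right inner_diff_right algebra_simps)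
    show "0 < r ^ 4" using r by simp
    show "lorentz (L \<xi>) (L \<eta>) = r ^ 4 * lorentz \<xi> \<eta>" for \<xi> \<eta>
    proof -
      obtain x p q where \<xi>: "\<xi> = (x, p, q)" by (cases \<xi>) auto
      obtain y p' q' where \<eta>: "\<eta> = (y, p', q')" by (cases \<eta>) auto
      show ?thesis
        unfolding \<xi> \<eta> lorentz_def L_def m_def fst_conv snd_conv inner_add_left inner_add_right inner_diff_left inner_diff_right
          inner_scaleR_left inner_scaleR_right inner_commute[of x c] inner_commute[of y c] by algebra
    qed
    show "\<exists>\<mu>>0. L (light_ray P) = \<mu> *\<^sub>R light_ray (sphere_inversion c r P)" for P
    proof (cases P)
      case None
      then show ?thesis
        by (intro exI[of _ 1]) (auto simp: light_ray_def sphere_inversion_def L_def m_def)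
    next
      case (Some x)
      show ?thesis
      proof (cases "x = c")
        case True
        then show ?thesis using Some r
          by (intro exI[of _ "r ^ 4"]) (auto simp: light_ray_def sphere_inversion_def L_def m_def)
      next
        case False
        define s where "s = (norm (x - c))\<^sup>2"
        define w where "w = x - c"
        have s: "s > 0" "w \<bullet> w = s" using False by (auto simp: s_def w_def power2_norm_eq_inner)
        have ms: "m (light_ray (Some x)) = s"
          by (simp add: m_def light_ray_def s_def power2_norm_eq_inner inner_diff inner_commute)
        have 1: "s *\<^sub>R (c + (r\<^sup>2 / s) *\<^sub>R w) = s *\<^sub>R c + r\<^sup>2 *\<^sub>R w"
          using s by (simp add: scaleR_right_distrib)
        define R where "R = r\<^sup>2 / s"
        have R: "r\<^sup>2 = s * R" "r ^ 4 = (s * R) * (s * R)" using s by (auto simp: R_def eval_nat_numeral)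
        have 2: "s * ((c + R *\<^sub>R w) \<bullet> (c + R *\<^sub>R w)) = (c \<bullet> c) * s + 2 * r\<^sup>2 * (c \<bullet> w) + r ^ 4"
          unfolding R inner_add_left inner_add_right inner_scaleR_left inner_scaleR_right s(2) inner_commute[of w c]
          by algebra
        have "L (light_ray (Some x)) = (s *\<^sub>R c + r\<^sup>2 *\<^sub>R w, (c \<bullet> c) * s + 2 * r\<^sup>2 * (c \<bullet> w) + r ^ 4, s)"
          unfolding L_def ms by (simp add: light_ray_def w_def)
        also have "\<dots> = s *\<^sub>R light_ray (Some (c + R *\<^sub>R w))"
          unfolding 2[symmetric] by (simp add: light_ray_def 1[folded R_def])
        also have "Some (c + R *\<^sub>R w) = sphere_inversion c r (Some x)"
          using False by (simp add: sphere_inversion_def R_def s_def w_def)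
        finally show ?thesis using s Some by blast
      qed
    qed
  qed
  then show ?thesis by blast
qed

lemma moebius_transformation_lift:
  fixes T :: "'a::euclidean_space option \<Rightarrow> 'a option"
  assumes "moebius_transformation T"
  obtains L \<kappa> where "lorentz_lift T L \<kappa>"
proof -
  have "\<exists>L \<kappa>. lorentz_lift T L \<kappa>" using assms
  proof (induction rule: moebius_transformation.induct)
    case identity
    show ?case using lorentz_lift_id by blast
  next
    case (inversion r T c)
    then show ?case using lorentz_lift_inversion[of r c] lorentz_lift_compose by blast
  next
    case (reflection a T b)
    then show ?case using lorentz_lift_reflection[of a b] lorentz_lift_compose by blast
  qed
  then show ?thesis using that by blast
qed

section \<open>Conformal images of submanifolds\<close>

text \<open>Conformality is stated by the chord identity for pairs instead of by derivatives: this
  is how the energy kernel transforms, and the scaling of lengths by \<open>\<rho>^2\<close> follows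
  from it. The maps are total and Borel on the whole space so that integrands stay measurable;
  smoothness is tested only along smooth maps into \<open>M\<close>.\<close>

definition conformal_image ::
    "'m::finite itself \<Rightarrow> 'a::euclidean_space set \<Rightarrow> 'a set \<Rightarrow> ('a \<Rightarrow> 'a) \<Rightarrow> ('a \<Rightarrow> real) \<Rightarrow> bool" where
  "conformal_image (_ :: 'm itself) M M' \<tau> \<rho> \<longleftrightarrow>
     \<tau> \<in> borel_measurable borel \<and> \<rho> \<in> borel_measurable borel \<and>
     continuous_on M \<tau> \<and> continuous_on M \<rho> \<and> \<tau> ` M = M' \<and> (\<forall>x\<in>M. 0 < \<rho> x) \<and>
     (\<forall>x\<in>M. \<forall>y\<in>M. norm (\<tau> x - \<tau> y) = \<rho> x * \<rho> y * norm (x - y)) \<and>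
     (\<forall>W (f :: real ^ 'm \<Rightarrow> 'a). open W \<longrightarrow> smooth_on W f \<longrightarrow> f ` W \<subseteq> M \<longrightarrow>
        smooth_on W (\<lambda>u. \<tau> (f u)) \<and> smooth_on W (\<lambda>u. \<rho> (f u)))"

lemma conformal_imageD:
  assumes "conformal_image TYPE('m::finite) (M :: 'a::euclidean_space set) M' \<tau> \<rho>"
  shows "\<tau> \<in> borel_measurable borel" "\<rho> \<in> borel_measurable borel"
    "continuous_on M \<tau>" "continuous_on M \<rho>" "\<tau> ` M = M'" "\<And>x. x \<in> M \<Longrightarrow> 0 < \<rho> x"
    "\<And>x y. x \<in> M \<Longrightarrow> y \<in> M \<Longrightarrow> norm (\<tau> x - \<tau> y) = \<rho> x * \<rho> y * norm (x - y)"
    "\<And>W (f :: real ^ 'm \<Rightarrow> 'a). local_parametrization M W f \<Longrightarrow> smooth_on W (\<lambda>u. \<tau> (f u))"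
    "\<And>W (f :: real ^ 'm \<Rightarrow> 'a). local_parametrization M W f \<Longrightarrow> smooth_on W (\<lambda>u. \<rho> (f u))"
proof -
  note c = assms[unfolded conformal_image_def]
  show "\<tau> \<in> borel_measurable borel" "\<rho> \<in> borel_measurable borel"
    "continuous_on M \<tau>" "continuous_on M \<rho>" "\<tau> ` M = M'"
    using c by (simp_all only: HOL.simp_thms)
  have "\<forall>x\<in>M. 0 < \<rho> x" using c by (elim conjE)
  then show "0 < \<rho> x" if "x \<in> M" for x using that by (rule bspec)
  have "\<forall>x\<in>M. \<forall>y\<in>M. norm (\<tau> x - \<tau> y) = \<rho> x * \<rho> y * norm (x - y)" using c by (elim conjE)
  then show "norm (\<tau> x - \<tau> y) = \<rho> x * \<rho> y * norm (x - y)" if "x \<in> M" "y \<in> M" for x y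
    using that by (simp only: Ball_def)
  have s: "\<forall>W (f :: real ^ 'm \<Rightarrow> 'a). open W \<longrightarrow> smooth_on W f \<longrightarrow> f ` W \<subseteq> M \<longrightarrow>
      smooth_on W (\<lambda>u. \<tau> (f u)) \<and> smooth_on W (\<lambda>u. \<rho> (f u))" using c by (elim conjE)
  fix W and f :: "real ^ 'm \<Rightarrow> 'a" assume f: "local_parametrization M W f"
  note s' = s[rule_format, OF local_parametrizationD(1)[OF f] local_parametrizationD(2)[OF f] local_parametrizationD(7)[OF f]]
  show "smooth_on W (\<lambda>u. \<tau> (f u))" by (rule s'[THEN conjunct1])
  show "smooth_on W (\<lambda>u. \<rho> (f u))" by (rule s'[THEN conjunct2])
qed

text \<open>\<open>N x\<close> is the last coordinate of the lifted image; dividing by it gives the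
  point \<open>\<tau> x\<close>. Comparing Lorentz products gives
  \<open>N x N y |\<tau> x - \<tau> y|^2 = \<kappa> |x - y|^2\<close>, and splitting the factor
  evenly between \<open>x\<close> and \<open>y\<close> dictates the two roots in
  \<open>\<rho>\<close>.\<close>

lemma moebius_conformal_image:
  fixes M M' :: "'a::euclidean_space set"
  assumes T: "moebius_transformation T" and im: "T ` (Some ` M) = Some ` M'"
  obtains \<tau> \<rho> where "conformal_image TYPE('m::finite) M M' \<tau> \<rho>"
proof -
  obtain L \<kappa> where Lk: "lorentz_lift T L \<kappa>" by (rule moebius_transformation_lift[OF T])
  have L: "linear L" "\<kappa> > 0" "\<And>\<xi> \<eta>. lorentz (L \<xi>) (L \<eta>) = \<kappa> * lorentz \<xi> \<eta>"
    "\<And>P. \<exists>\<mu>>0. L (light_ray P) = \<mu> *\<^sub>R light_ray (T P)"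
    using Lk unfolding lorentz_lift_def by blast+
  define G where "G x = L (x, x \<bullet> x, 1)" for x
  define N where "N x = snd (snd (G x))" for x
  define \<tau> where "\<tau> x = inverse (N x) *\<^sub>R fst (G x)" for x
  define \<rho> where "\<rho> x = sqrt (sqrt \<kappa> * inverse (N x))" for x
  have bL: "bounded_linear L" using L(1) by (rule linear_conv_bounded_linear[THEN iffD1])
  \<comment> \<open>No point of \<open>M\<close> goes to infinity, so the last coordinate of the
    lifted image is \<open>\<mu> > 0\<close>.\<close>
  have GM: "N x > 0 \<and> T (Some x) = Some (\<tau> x) \<and> G x = N x *\<^sub>R light_ray (Some (\<tau> x))" if x: "x \<in> M" for x
  proof -
    have "T (Some x) \<in> Some ` M'" using im x by blast
    then obtain y where y: "T (Some x) = Some y" by blast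
    obtain \<mu> where \<mu>: "\<mu> > 0" "L (light_ray (Some x)) = \<mu> *\<^sub>R light_ray (Some y)" using L(4)[of "Some x"] y by auto
    then have g: "G x = \<mu> *\<^sub>R light_ray (Some y)" by (simp add: G_def light_ray_def)
    then have N: "N x = \<mu>" by (simp add: N_def light_ray_def)
    have "\<tau> x = y" unfolding \<tau>_def N g using \<mu>(1) by (simp add: light_ray_def)
    then show ?thesis using \<mu>(1) N g y by simp
  qed
  have Gc: "continuous_on UNIV G" unfolding G_def
    by (intro linear_continuous_on_compose[OF _ L(1)] continuous_intros)
  have Nc: "continuous_on UNIV N" unfolding N_def by (intro continuous_intros Gc)
  have mb: "N \<in> borel_measurable borel" "(\<lambda>x. fst (G x)) \<in> borel_measurable borel"
    by (intro borel_measurable_continuous_onI Nc continuous_intros Gc)+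
  have Nne: "\<forall>x\<in>M. N x \<noteq> 0" using GM by force
  have "conformal_image TYPE('m) M M' \<tau> \<rho>" unfolding conformal_image_def
  proof (intro conjI ballI allI impI)
    show "\<tau> \<in> borel_measurable borel" unfolding \<tau>_def using mb by measurable
    show "\<rho> \<in> borel_measurable borel" unfolding \<rho>_def using mb by measurable
    show "continuous_on M \<tau>" unfolding \<tau>_def
      by (intro continuous_intros continuous_on_subset[OF Gc] continuous_on_subset[OF Nc] Nne) auto
    show "continuous_on M \<rho>" unfolding \<rho>_def
      by (intro continuous_intros continuous_on_subset[OF Nc] Nne) auto
    have "Some ` (\<tau> ` M) = T ` (Some ` M)" unfolding image_image by (rule image_cong) (use GM in auto)
    then show "\<tau> ` M = M'" unfolding im by (rule inj_image_eq_iff[OF inj_Some, THEN iffD1])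
    have rp: "0 < \<rho> x" if "x \<in> M" for x unfolding \<rho>_def using GM[OF that] L(2) by simp
    then show "x \<in> M \<Longrightarrow> 0 < \<rho> x" for x .
    show "norm (\<tau> x - \<tau> y) = \<rho> x * \<rho> y * norm (x - y)" if xy: "x \<in> M" "y \<in> M" for x y
    proof -
      have "lorentz (G x) (G y) = \<kappa> * lorentz (light_ray (Some x)) (light_ray (Some y))"
        unfolding G_def L(3) by (simp add: light_ray_def)
      moreover have "lorentz (G x) (G y) = N x * N y * lorentz (light_ray (Some (\<tau> x))) (light_ray (Some (\<tau> y)))"
        using GM[OF xy(1)] GM[OF xy(2)] lorentz_scaleR by metis
      ultimately have eq: "N x * N y * (norm (\<tau> x - \<tau> y))\<^sup>2 = \<kappa> * (norm (x - y))\<^sup>2"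
        unfolding lorentz_light_ray by simp
      have p: "N x > 0" "N y > 0" using GM xy by blast+
      have r2: "(\<rho> x)\<^sup>2 = sqrt \<kappa> * inverse (N x)" "(\<rho> y)\<^sup>2 = sqrt \<kappa> * inverse (N y)"
        unfolding \<rho>_def using p L(2) by auto
      have "(\<rho> x * \<rho> y * norm (x - y))\<^sup>2 = (sqrt \<kappa>)\<^sup>2 * (inverse (N x) * inverse (N y)) * (norm (x - y))\<^sup>2"
        unfolding power_mult_distrib r2 by (simp add: power2_eq_square)
      also have "\<dots> = (inverse (N x) * inverse (N y)) * (\<kappa> * (norm (x - y))\<^sup>2)" using L(2) by simp
      also have "\<dots> = (norm (\<tau> x - \<tau> y))\<^sup>2" unfolding eq[symmetric] using p by (simp add: field_simps)
      finally have sq: "(\<rho> x * \<rho> y * norm (x - y))\<^sup>2 = (norm (\<tau> x - \<tau> y))\<^sup>2" .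
      have "0 \<le> \<rho> x * \<rho> y * norm (x - y)"
        by (intro mult_nonneg_nonneg norm_ge_zero less_imp_le[OF rp] xy)
      then show ?thesis by (rule power2_eq_imp_eq[OF sq[symmetric] norm_ge_zero])
    qed
    fix W and f :: "real ^ 'm \<Rightarrow> 'a" assume W: "open W" and f: "smooth_on W f" "f ` W \<subseteq> M"
    have fk: "higher_differentiable_on k W f" for k using f(1) by (simp add: smooth_on_def)
    have ff: "higher_differentiable_on k W (\<lambda>u. f u \<bullet> f u)" for k
      by (rule higher_differentiable_on_bilinear[OF W bounded_bilinear_inner fk fk])
    have bl: "bounded_linear (\<lambda>x::'a. (x, 0::real, 0::real))" "bounded_linear (\<lambda>s::real. (0::'a, s, 0::real))"
      by (intro linear_conv_bounded_linear[THEN iffD1] linearI; simp)+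
    have Gk: "higher_differentiable_on k W (\<lambda>u. G (f u))" for k
    proof -
      have "higher_differentiable_on k W (\<lambda>u. (f u, 0::real, 0::real) + (0, f u \<bullet> f u, 0) + (0, 0, 1))"
        by (intro higher_differentiable_on_add[OF W] higher_differentiable_on_const[OF W]
            higher_differentiable_on_linear[OF W bl(1) fk] higher_differentiable_on_linear[OF W bl(2) ff])
      then have "higher_differentiable_on k W (\<lambda>u. (f u, f u \<bullet> f u, 1::real))" by simp
      from higher_differentiable_on_linear[OF W bL this] show ?thesis unfolding G_def .
    qed
    have Nk: "higher_differentiable_on k W (\<lambda>u. N (f u))" for k unfolding N_def
      by (rule higher_differentiable_on_linear[OF W bounded_linear_compose[OF bounded_linear_snd bounded_linear_snd] Gk])
    have Np: "N (f u) > 0" if "u \<in> W" for u using GM f(2) that by blast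
    have iN: "higher_differentiable_on k W (\<lambda>u. inverse (N (f u)))" for k
      by (rule higher_differentiable_on_inverse[OF W Nk]) (use Np in force)
    show "smooth_on W (\<lambda>u. \<tau> (f u))" unfolding smooth_on_def \<tau>_def
      by (intro allI higher_differentiable_on_bilinear[OF W bounded_bilinear_scaleR iN]
          higher_differentiable_on_linear[OF W bounded_linear_fst Gk])
    show "smooth_on W (\<lambda>u. \<rho> (f u))" unfolding smooth_on_def \<rho>_def
      by (intro allI higher_differentiable_on_sqrt[OF W] higher_differentiable_on_bilinear[OF W bounded_bilinear_mult
          higher_differentiable_on_const[OF W] iN]) (use Np L(2) in simp)
  qed
  then show ?thesis by (rule that)
qed

text \<open>The chord identity divided by the parameter, in the limit of a vanishing chord;
  continuity of \<open>\<rho>\<close> merges its two factors into a square.\<close>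

lemma norm_frechet_derivative_conformal:
  fixes f :: "real ^ 'm::finite \<Rightarrow> 'a::euclidean_space"
  assumes c: "conformal_image TYPE('m) M M' \<tau> \<rho>" and f: "local_parametrization M W f" and u: "u \<in> W"
  shows "norm (frechet_derivative (\<lambda>u. \<tau> (f u)) (at u) v) = (\<rho> (f u))\<^sup>2 * norm (frechet_derivative f (at u) v)"
proof -
  note fD = local_parametrizationD[OF f] and cD = conformal_imageD[OF c]
  have line: "((\<lambda>s. g (u + s *\<^sub>R v)) has_vector_derivative frechet_derivative g (at u) v) (at 0)"
    if g: "(g has_derivative frechet_derivative g (at u)) (at u)" for g :: "real ^ 'm \<Rightarrow> 'a"
  proof -
    have "((\<lambda>s. u + s *\<^sub>R v) has_derivative (\<lambda>s. s *\<^sub>R v)) (at 0)" by (auto intro!: derivative_eq_intros)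
    moreover have "(g has_derivative frechet_derivative g (at u)) (at (u + 0 *\<^sub>R v))" using g by simp
    ultimately have "((\<lambda>s. g (u + s *\<^sub>R v)) has_derivative (\<lambda>s. frechet_derivative g (at u) (s *\<^sub>R v))) (at 0)"
      by (rule has_derivative_compose)
    moreover have "linear (frechet_derivative g (at u))" using g by (rule has_derivative_linear)
    ultimately show ?thesis by (simp add: has_vector_derivative_def linear_scale)
  qed
  define g where "g = (\<lambda>u. \<tau> (f u))"
  have g: "(g has_derivative frechet_derivative g (at u)) (at u)"
    unfolding g_def by (rule smooth_on_has_derivative[OF cD(8)[OF f] u])
  have lf: "((\<lambda>s. (1 / s) *\<^sub>R (f (u + s *\<^sub>R v) - f u)) \<longlongrightarrow> frechet_derivative f (at u) v) (at 0)"
    using line[OF fD(8)[OF u]] unfolding has_vector_derivative_iff_quotient by simp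
  have lg: "((\<lambda>s. (1 / s) *\<^sub>R (g (u + s *\<^sub>R v) - g u)) \<longlongrightarrow> frechet_derivative g (at u) v) (at 0)"
    using line[OF g] unfolding has_vector_derivative_iff_quotient by simp
  have lin: "((\<lambda>s. u + s *\<^sub>R v) \<longlongrightarrow> u) (at (0::real))" by (auto intro!: tendsto_eq_intros)
  have "isCont (\<lambda>u. \<rho> (f u)) u"
    using smooth_on_continuous[OF cD(9)[OF f]] fD(1) u by (simp add: continuous_on_eq_continuous_at)
  then have lr: "((\<lambda>s. \<rho> (f (u + s *\<^sub>R v))) \<longlongrightarrow> \<rho> (f u)) (at (0::real))"
    by (rule isCont_tendsto_compose) (rule lin)
  have ev: "\<forall>\<^sub>F s in at (0::real). u + s *\<^sub>R v \<in> W"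
    by (rule topological_tendstoD[OF lin fD(1) u])
  have "((\<lambda>s. \<rho> (f (u + s *\<^sub>R v)) * \<rho> (f u) * norm ((1 / s) *\<^sub>R (f (u + s *\<^sub>R v) - f u))) \<longlongrightarrow>
      \<rho> (f u) * \<rho> (f u) * norm (frechet_derivative f (at u) v)) (at 0)"
    by (intro tendsto_mult lr tendsto_const tendsto_norm lf)
  moreover have "\<forall>\<^sub>F s in at (0::real). \<rho> (f (u + s *\<^sub>R v)) * \<rho> (f u) * norm ((1 / s) *\<^sub>R (f (u + s *\<^sub>R v) - f u)) =
      norm ((1 / s) *\<^sub>R (g (u + s *\<^sub>R v) - g u))"
    using ev
  proof (rule eventually_mono)
    fix s :: real assume "u + s *\<^sub>R v \<in> W"
    then have "f (u + s *\<^sub>R v) \<in> M" "f u \<in> M" using fD(7) u by auto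
    from cD(7)[OF this] show "\<rho> (f (u + s *\<^sub>R v)) * \<rho> (f u) * norm ((1 / s) *\<^sub>R (f (u + s *\<^sub>R v) - f u)) =
      norm ((1 / s) *\<^sub>R (g (u + s *\<^sub>R v) - g u))" by (simp add: g_def)
  qed
  ultimately have "((\<lambda>s. norm ((1 / s) *\<^sub>R (g (u + s *\<^sub>R v) - g u))) \<longlongrightarrow>
      \<rho> (f u) * \<rho> (f u) * norm (frechet_derivative f (at u) v)) (at 0)"
    by (rule Lim_transform_eventually)
  from tendsto_unique[OF _ tendsto_norm[OF lg] this] show ?thesis
    by (simp add: g_def power2_eq_square)
qed

lemma inj_on_conformal:
  assumes c: "conformal_image TYPE('m::finite) M M' \<tau> \<rho>"
  shows "inj_on \<tau> M"
proof (rule inj_onI)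
  note cD = conformal_imageD[OF c]
  fix x y assume xy: "x \<in> M" "y \<in> M" "\<tau> x = \<tau> y"
  then have "\<rho> x * \<rho> y * norm (x - y) = 0" using cD(7)[OF xy(1,2)] by simp
  then show "x = y" using cD(6)[OF xy(1)] cD(6)[OF xy(2)] by simp
qed

text \<open>The derivative stays injective because lengths are only rescaled by a positive factor,
  and an injective continuous map on the compact \<open>M\<close> is a homeomorphism onto its
  image.\<close>

lemma local_parametrization_conformal:
  fixes f :: "real ^ 'm::finite \<Rightarrow> 'a::euclidean_space"
  assumes M: "compact M" and c: "conformal_image TYPE('m) M M' \<tau> \<rho>" and f: "local_parametrization M W f"
  shows "local_parametrization M' W (\<lambda>u. \<tau> (f u))"
proof -
  note fD = local_parametrizationD[OF f] and cD = conformal_imageD[OF c]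
  obtain \<sigma> where \<sigma>: "homeomorphism M M' \<tau> \<sigma>"
    using homeomorphism_compact[OF M cD(3) cD(5) inj_on_conformal[OF c]] by blast
  obtain k where k: "homeomorphism W (f ` W) f k" using f unfolding local_parametrization_def by blast
  have im: "(\<lambda>u. \<tau> (f u)) ` W = \<tau> ` (f ` W)" by (simp only: image_image)
  have sub: "homeomorphism (f ` W) (\<tau> ` (f ` W)) \<tau> \<sigma>"
    by (rule homeomorphism_of_subsets[OF \<sigma> fD(7) subset_refl refl])
  have "inj (frechet_derivative (\<lambda>u. \<tau> (f u)) (at u))" if u: "u \<in> W" for u
  proof -
    have lin: "linear (frechet_derivative (\<lambda>u. \<tau> (f u)) (at u))"
      by (rule has_derivative_linear[OF smooth_on_has_derivative[OF cD(8)[OF f] u]])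
    have "f u \<in> M" using fD(7) u by blast
    show ?thesis unfolding linear_injective_0[OF lin]
    proof (intro allI impI)
      fix v assume "frechet_derivative (\<lambda>u. \<tau> (f u)) (at u) v = 0"
      then have "(\<rho> (f u))\<^sup>2 * norm (frechet_derivative f (at u) v) = 0"
        using norm_frechet_derivative_conformal[OF c f u, of v] by simp
      then have "frechet_derivative f (at u) v = 0" using cD(6)[OF \<open>f u \<in> M\<close>] by simp
      then show "v = 0" using fD(3)[OF u] linear_injective_0[OF fD(9)[OF u]] by blast
    qed
  qed
  moreover have "openin (top_of_set M') ((\<lambda>u. \<tau> (f u)) ` W)"
    unfolding im by (rule homeomorphism_imp_open_map[OF \<sigma> fD(4)])
  moreover have "homeomorphism W ((\<lambda>u. \<tau> (f u)) ` W) (\<lambda>u. \<tau> (f u)) (k \<circ> \<sigma>)"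
    using homeomorphism_compose[OF k sub] unfolding im o_def .
  ultimately show ?thesis unfolding local_parametrization_def using fD(1) cD(8)[OF f] by blast
qed

text \<open>Lengths scale by \<open>\<rho>^2\<close>, so the Gram matrix scales by
  \<open>\<rho>^4\<close>, its determinant by \<open>\<rho>^(4m)\<close> and the density by the root
  of that.\<close>

lemma volume_density_conformal:
  fixes f :: "real ^ 'm::finite \<Rightarrow> 'a::euclidean_space"
  assumes c: "conformal_image TYPE('m) M M' \<tau> \<rho>" and f: "local_parametrization M W f" and u: "u \<in> W"
  shows "volume_density (\<lambda>u. \<tau> (f u)) u = \<rho> (f u) ^ (2 * CARD('m)) * volume_density f u"
proof -
  note fD = local_parametrizationD[OF f] and cD = conformal_imageD[OF c]
  have "f u \<in> M" using fD(7) u by blast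
  have lin: "linear (frechet_derivative (\<lambda>u. \<tau> (f u)) (at u))"
    by (rule has_derivative_linear[OF smooth_on_has_derivative[OF cD(8)[OF f] u]])
  have "gram (frechet_derivative (\<lambda>u. \<tau> (f u)) (at u)) = ((\<rho> (f u))\<^sup>2)\<^sup>2 *\<^sub>R gram (frechet_derivative f (at u))"
    by (rule gram_scale[OF fD(9)[OF u] lin norm_frechet_derivative_conformal[OF c f u]])
  then have "volume_density (\<lambda>u. \<tau> (f u)) u = sqrt ((((\<rho> (f u))\<^sup>2)\<^sup>2) ^ CARD('m)) * volume_density f u"
    unfolding volume_density_gram by (simp only: det_scaleR real_sqrt_mult)
  also have "(((\<rho> (f u))\<^sup>2)\<^sup>2) ^ CARD('m) = (\<rho> (f u) ^ (2 * CARD('m)))\<^sup>2"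
    by (simp add: power_mult[symmetric] mult_ac)
  also have "sqrt ((\<rho> (f u) ^ (2 * CARD('m)))\<^sup>2) = \<rho> (f u) ^ (2 * CARD('m))"
    using cD(6)[OF \<open>f u \<in> M\<close>] by simp
  finally show ?thesis .
qed

lemma closed_submanifold_conformal:
  assumes cl: "closed_submanifold TYPE('m::finite) M" and c: "conformal_image TYPE('m) M M' \<tau> \<rho>"
  shows "closed_submanifold TYPE('m) M'"
  unfolding closed_submanifold_def
proof (intro conjI ballI)
  note cD = conformal_imageD[OF c]
  have M: "compact M" using cl by (simp add: closed_submanifold_def)
  show "compact M'" using compact_continuous_image[OF cD(3) M] unfolding cD(5) .
  fix p assume "p \<in> M'"
  then obtain x where x: "x \<in> M" "p = \<tau> x" using cD(5) by blast
  then obtain W and f :: "real ^ 'm \<Rightarrow> 'a" where f: "local_parametrization M W f" "x \<in> f ` W"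
    using cl unfolding closed_submanifold_def by blast
  have "p \<in> (\<lambda>u. \<tau> (f u)) ` W" using f(2) x(2) by blast
  then show "\<exists>W (f :: real ^ 'm \<Rightarrow> 'a). local_parametrization M' W f \<and> p \<in> f ` W"
    using local_parametrization_conformal[OF M c f(1)] by (intro exI conjI)
qed

text \<open>\<open>\<tau>\<close> carries an atlas partition of \<open>M\<close> to one of
  \<open>M'\<close> with the same parameter sets, so the integrals are compared piece by piece on
  common domains.\<close>

lemma nn_integral_conformal:
  assumes cl: "closed_submanifold TYPE('m::finite) M" and c: "conformal_image TYPE('m) M M' \<tau> \<rho>"
    and h: "h \<in> borel_measurable borel"
  shows "(\<integral>\<^sup>+y\<in>M'. h y \<partial>riemannian_volume TYPE('m) M') =
    (\<integral>\<^sup>+x\<in>M. h (\<tau> x) * ennreal (\<rho> x ^ (2 * CARD('m))) \<partial>riemannian_volume TYPE('m) M)"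
proof -
  note cD = conformal_imageD[OF c]
  have M: "compact M" using cl by (simp add: closed_submanifold_def)
  have cl': "closed_submanifold TYPE('m) M'" by (rule closed_submanifold_conformal[OF cl c])
  then have M': "compact M'" by (simp add: closed_submanifold_def)
  obtain N W f K B where a: "atlas_partition M N W (f :: nat \<Rightarrow> real ^ 'm \<Rightarrow> 'a) K B"
    by (rule exists_atlas_partition[OF cl])
  note aD = atlas_partitionD[OF a]
  define g where "g i u = \<tau> (f i u)" for i u
  have gi: "local_parametrization M' (W i) (g i)" if "i < N" for i
    unfolding g_def by (rule local_parametrization_conformal[OF M c aD(1)[OF that]])
  note inj = inj_on_conformal[OF c]
  have gim: "g i ` B i = \<tau> ` (f i ` B i)" for i unfolding g_def by (simp only: image_image)
  have fM: "f i ` B i \<subseteq> M" if "i < N" for i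
    using local_parametrizationD(7)[OF aD(1)[OF that]] aD(5)[OF that] by blast
  have a': "atlas_partition M' N W g K B"
    unfolding atlas_partition_def
  proof (intro conjI allI impI)
    fix i assume i: "i < N"
    show "local_parametrization M' (W i) (g i)" by (rule gi[OF i])
    show "compact (K i)" "K i \<subseteq> W i" "B i \<subseteq> K i" "B i \<in> sets borel" using aD[OF i] by auto
  next
    have dis: "f i ` B i \<inter> f j ` B j = {}" if "i < N" "j < N" "i \<noteq> j" for i j
      using a that unfolding atlas_partition_def disjoint_family_on_def by simp
    show "disjoint_family_on (\<lambda>i. g i ` B i) {..<N}"
      unfolding disjoint_family_on_def gim
    proof (intro ballI impI)
      fix i j assume ij: "i \<in> {..<N}" "j \<in> {..<N}" "i \<noteq> j"
      show "\<tau> ` f i ` B i \<inter> \<tau> ` f j ` B j = {}"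
        using inj_on_image_Int[OF inj fM fM, of i j] dis[of i j] ij by simp
    qed
    have "M = (\<Union>i<N. f i ` B i)" using a unfolding atlas_partition_def by blast
    then have "\<tau> ` M = (\<Union>i<N. \<tau> ` f i ` B i)" by (simp only: image_UN)
    then show "M' = (\<Union>i<N. g i ` B i)" unfolding gim cD(5) .
  qed
  have hm: "(\<lambda>x. h (\<tau> x) * ennreal (\<rho> x ^ (2 * CARD('m)))) \<in> borel_measurable borel"
  proof -
    have [measurable]: "\<tau> \<in> borel_measurable borel" "\<rho> \<in> borel_measurable borel" "h \<in> borel_measurable borel"
      using cD(1,2) h by auto
    show ?thesis by measurable
  qed
  have "(\<integral>\<^sup>+y\<in>g i ` B i. h y \<partial>riemannian_volume TYPE('m) M') =
      (\<integral>\<^sup>+x\<in>f i ` B i. h (\<tau> x) * ennreal (\<rho> x ^ (2 * CARD('m))) \<partial>riemannian_volume TYPE('m) M)"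
    if i: "i < N" for i
  proof -
    have "(\<integral>\<^sup>+y\<in>g i ` B i. h y \<partial>riemannian_volume TYPE('m) M') =
        (\<integral>\<^sup>+u\<in>B i. h (g i u) * ennreal (volume_density (g i) u) \<partial>lborel)"
      by (rule nn_integral_local_parametrization[OF M' is_riemannian_volume_riemannian_volume[OF cl'] gi[OF i] aD(6)[OF i] aD(5)[OF i] h])
    also have "\<dots> = (\<integral>\<^sup>+u\<in>B i. (h (\<tau> (f i u)) * ennreal (\<rho> (f i u) ^ (2 * CARD('m)))) * ennreal (volume_density (f i) u) \<partial>lborel)"
    proof (rule nn_integral_cong)
      fix u :: "real ^ 'm"
      show "h (g i u) * ennreal (volume_density (g i) u) * indicator (B i) u =
        h (\<tau> (f i u)) * ennreal (\<rho> (f i u) ^ (2 * CARD('m))) * ennreal (volume_density (f i) u) * indicator (B i) u"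
      proof (cases "u \<in> B i")
        case True
        then have u: "u \<in> W i" and fu: "f i u \<in> M" using aD(5)[OF i] fM[OF i] by auto
        have "ennreal (volume_density (g i) u) = ennreal (\<rho> (f i u) ^ (2 * CARD('m))) * ennreal (volume_density (f i) u)"
          unfolding g_def volume_density_conformal[OF c aD(1)[OF i] u]
          by (rule ennreal_mult') (simp add: less_imp_le[OF cD(6)[OF fu]])
        then show ?thesis unfolding g_def by (simp add: mult.assoc)
      qed simp
    qed
    also have "\<dots> = (\<integral>\<^sup>+x\<in>f i ` B i. h (\<tau> x) * ennreal (\<rho> x ^ (2 * CARD('m))) \<partial>riemannian_volume TYPE('m) M)"
      by (rule nn_integral_local_parametrization[OF M is_riemannian_volume_riemannian_volume[OF cl] aD(1)[OF i] aD(6)[OF i] aD(5)[OF i] hm, symmetric])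
    finally show ?thesis .
  qed
  then show ?thesis unfolding nn_integral_atlas[OF cl' a' h] nn_integral_atlas[OF cl a hm]
    by (intro sum.cong refl) simp
qed

lemma nn_integral_pair_conformal:
  fixes M :: "'a::euclidean_space set"
  assumes cl: "closed_submanifold TYPE('m::finite) M" and c: "conformal_image TYPE('m) M M' \<tau> \<rho>"
    and k: "(\<lambda>p. k (fst p) (snd p)) \<in> borel_measurable borel"
  shows "(\<integral>\<^sup>+p\<in>M' \<times> M'. k (fst p) (snd p) \<partial>(riemannian_volume TYPE('m) M' \<Otimes>\<^sub>M riemannian_volume TYPE('m) M')) =
    (\<integral>\<^sup>+p\<in>M \<times> M. k (\<tau> (fst p)) (\<tau> (snd p)) * ennreal (\<rho> (snd p) ^ (2 * CARD('m))) * ennreal (\<rho> (fst p) ^ (2 * CARD('m)))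
      \<partial>(riemannian_volume TYPE('m) M \<Otimes>\<^sub>M riemannian_volume TYPE('m) M))"
proof -
  let ?\<mu> = "riemannian_volume TYPE('m) M" and ?\<mu>' = "riemannian_volume TYPE('m) M'"
  note cD = conformal_imageD[OF c]
  have cl': "closed_submanifold TYPE('m) M'" by (rule closed_submanifold_conformal[OF cl c])
  have [measurable]: "\<tau> \<in> borel_measurable borel" "\<rho> \<in> borel_measurable borel" using cD(1,2) .
  have [measurable]: "fst \<in> borel_measurable (borel :: ('a \<times> 'a) measure)" "snd \<in> borel_measurable (borel :: ('a \<times> 'a) measure)"
    by (intro borel_measurable_continuous_onI continuous_intros)+
  have k\<tau>: "(\<lambda>p. k (\<tau> (fst p)) (\<tau> (snd p))) \<in> borel_measurable borel"
  proof -
    have "(\<lambda>p::'a \<times> 'a. (\<tau> (fst p), \<tau> (snd p))) \<in> borel_measurable borel"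
      by (rule borel_measurable_Pair) measurable
    from measurable_compose[OF this k] show ?thesis by simp
  qed
  define k' where "k' x y = k (\<tau> x) (\<tau> y) * ennreal (\<rho> y ^ (2 * CARD('m))) * ennreal (\<rho> x ^ (2 * CARD('m)))" for x y
  have k': "(\<lambda>p. k' (fst p) (snd p)) \<in> borel_measurable borel"
    unfolding k'_def using k\<tau> by measurable
  have ky: "k x \<in> borel_measurable borel" for x
  proof -
    have "(\<lambda>y::'a. (x, y)) \<in> borel_measurable borel" by (intro borel_measurable_continuous_onI continuous_intros)
    from measurable_compose[OF this k] show ?thesis by simp
  qed
  have "(\<integral>\<^sup>+p\<in>M' \<times> M'. k (fst p) (snd p) \<partial>(?\<mu>' \<Otimes>\<^sub>M ?\<mu>')) = (\<integral>\<^sup>+x\<in>M'. (\<integral>\<^sup>+y\<in>M'. k x y \<partial>?\<mu>') \<partial>?\<mu>')"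
    by (rule nn_integral_pair_iterated(1)[OF cl' k])
  also have "\<dots> = (\<integral>\<^sup>+x\<in>M. (\<integral>\<^sup>+y\<in>M'. k (\<tau> x) y \<partial>?\<mu>') * ennreal (\<rho> x ^ (2 * CARD('m))) \<partial>?\<mu>)"
    by (rule nn_integral_conformal[OF cl c nn_integral_pair_iterated(2)[OF cl' k]])
  also have "\<dots> = (\<integral>\<^sup>+x\<in>M. (\<integral>\<^sup>+y\<in>M. k' x y \<partial>?\<mu>) \<partial>?\<mu>)"
  proof (rule nn_integral_cong)
    fix x
    have m: "(\<lambda>y. k (\<tau> x) (\<tau> y) * ennreal (\<rho> y ^ (2 * CARD('m))) * indicator M y) \<in> borel_measurable ?\<mu>"
    proof -
      have "compact M" using cl by (simp add: closed_submanifold_def)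
      then have [measurable]: "M \<in> sets borel" by (intro borel_closed compact_imp_closed)
      have [measurable]: "(\<lambda>y. k (\<tau> x) (\<tau> y)) \<in> borel_measurable borel"
        using measurable_compose[OF cD(1) ky[of "\<tau> x"]] by simp
      show ?thesis unfolding measurable_cong_sets[OF riemannian_volume_sets[OF cl] refl] by measurable
    qed
    have "(\<integral>\<^sup>+y\<in>M'. k (\<tau> x) y \<partial>?\<mu>') * ennreal (\<rho> x ^ (2 * CARD('m))) =
        (\<integral>\<^sup>+y\<in>M. k (\<tau> x) (\<tau> y) * ennreal (\<rho> y ^ (2 * CARD('m))) \<partial>?\<mu>) * ennreal (\<rho> x ^ (2 * CARD('m)))"
      unfolding nn_integral_conformal[OF cl c ky] ..
    also have "\<dots> = (\<integral>\<^sup>+y\<in>M. k' x y \<partial>?\<mu>)"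
      unfolding nn_integral_multc[OF m, symmetric] k'_def by (intro nn_integral_cong) (simp add: mult_ac)
    finally show "(\<integral>\<^sup>+y\<in>M'. k (\<tau> x) y \<partial>?\<mu>') * ennreal (\<rho> x ^ (2 * CARD('m))) * indicator M x =
        (\<integral>\<^sup>+y\<in>M. k' x y \<partial>?\<mu>) * indicator M x" by simp
  qed
  also have "\<dots> = (\<integral>\<^sup>+p\<in>M \<times> M. k' (fst p) (snd p) \<partial>(?\<mu> \<Otimes>\<^sub>M ?\<mu>))"
    by (rule nn_integral_pair_iterated(1)[OF cl k', symmetric])
  finally show ?thesis unfolding k'_def .
qed

text \<open>The two density factors \<open>\<rho>^(2m)\<close> cancel exactly against the kernel of
  exponent \<open>-2m\<close>: what remains is the same kernel on the pairs with
  \<open>\<rho> x \<rho> y |x - y| > t\<close>. As \<open>c0\<close> bounds \<open>\<rho>\<close>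
  below, this region contains the pairs with \<open>c0^2 |x - y| > t\<close>, and the rest is the
  shell.\<close>

lemma outer_energy_conformal:
  fixes M :: "'a::euclidean_space set"
  assumes cl: "closed_submanifold TYPE('m::finite) M" and c: "conformal_image TYPE('m) M M' \<tau> \<rho>"
    and c0: "c0 > 0" "\<And>x. x \<in> M \<Longrightarrow> c0 \<le> \<rho> x"
  shows "outer_energy TYPE('m) M' t = outer_energy TYPE('m) M (inverse (c0 * c0) * t) +
    (\<integral>\<^sup>+p\<in>M \<times> M. (if c0 * c0 * norm (fst p - snd p) \<le> t \<and> t < \<rho> (fst p) * \<rho> (snd p) * norm (fst p - snd p)
         then ennreal (inverse (norm (fst p - snd p) ^ (2 * CARD('m)))) else 0)
         \<partial>(riemannian_volume TYPE('m) M \<Otimes>\<^sub>M riemannian_volume TYPE('m) M))"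
proof -
  let ?P = "riemannian_volume TYPE('m) M \<Otimes>\<^sub>M riemannian_volume TYPE('m) M" and ?k = "2 * CARD('m)"
  note cD = conformal_imageD[OF c]
  have [measurable]: "\<rho> \<in> borel_measurable borel" using cD(2) .
  have [measurable]: "fst \<in> borel_measurable (borel :: ('a \<times> 'a) measure)" "snd \<in> borel_measurable (borel :: ('a \<times> 'a) measure)"
    by (intro borel_measurable_continuous_onI continuous_intros)+
  define k where "k x y = (if t < norm (x - y) then ennreal (inverse (norm (x - y) ^ ?k)) else 0)" for x y :: 'a
  have km: "(\<lambda>p. k (fst p) (snd p)) \<in> borel_measurable borel" unfolding k_def by measurable
  define A where "A p = (if inverse (c0 * c0) * t < norm (fst p - snd p) then ennreal (inverse (norm (fst p - snd p) ^ ?k)) else 0)"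
    for p :: "'a \<times> 'a"
  define S where "S p = (if c0 * c0 * norm (fst p - snd p) \<le> t \<and> t < \<rho> (fst p) * \<rho> (snd p) * norm (fst p - snd p)
         then ennreal (inverse (norm (fst p - snd p) ^ ?k)) else 0)" for p
  have AS: "A \<in> borel_measurable borel" "S \<in> borel_measurable borel"
    unfolding A_def S_def by measurable
  have split: "k (\<tau> x) (\<tau> y) * ennreal (\<rho> y ^ ?k) * ennreal (\<rho> x ^ ?k) = A (x, y) + S (x, y)"
    if xy: "x \<in> M" "y \<in> M" for x y
  proof -
    define d where "d = norm (x - y)"
    have d: "d \<ge> 0" by (simp add: d_def)
    have r: "\<rho> x > 0" "\<rho> y > 0" using cD(6) xy by auto
    have n: "norm (\<tau> x - \<tau> y) = \<rho> x * \<rho> y * d" unfolding d_def by (rule cD(7)[OF xy])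
    have cc: "c0 * c0 * d \<le> \<rho> x * \<rho> y * d"
      by (intro mult_right_mono mult_mono c0(2) xy d) (use c0(1) r in auto)
    have iff: "inverse (c0 * c0) * t < d \<longleftrightarrow> t < c0 * c0 * d" using c0(1) by (simp add: field_simps)
    have "inverse ((\<rho> x * \<rho> y * d) ^ ?k) * \<rho> y ^ ?k * \<rho> x ^ ?k = inverse (d ^ ?k)"
      using r by (simp add: power_mult_distrib field_simps)
    then have e: "ennreal (inverse ((\<rho> x * \<rho> y * d) ^ ?k)) * ennreal (\<rho> y ^ ?k) * ennreal (\<rho> x ^ ?k) = ennreal (inverse (d ^ ?k))"
      using r d by (simp add: ennreal_mult'[symmetric])
    have "k (\<tau> x) (\<tau> y) * ennreal (\<rho> y ^ ?k) * ennreal (\<rho> x ^ ?k) =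
        (if t < \<rho> x * \<rho> y * d then ennreal (inverse (d ^ ?k)) else 0)"
      unfolding k_def n using e by (simp only: if_True if_False mult_zero_left split: if_split) simp
    also have "\<dots> = (if t < c0 * c0 * d then ennreal (inverse (d ^ ?k)) else 0) +
        (if c0 * c0 * d \<le> t \<and> t < \<rho> x * \<rho> y * d then ennreal (inverse (d ^ ?k)) else 0)"
      using cc by auto
    also have "\<dots> = A (x, y) + S (x, y)" unfolding A_def S_def fst_conv snd_conv d_def[symmetric] iff ..
    finally show ?thesis .
  qed
  have "outer_energy TYPE('m) M' t =
      (\<integral>\<^sup>+p\<in>M \<times> M. k (\<tau> (fst p)) (\<tau> (snd p)) * ennreal (\<rho> (snd p) ^ ?k) * ennreal (\<rho> (fst p) ^ ?k) \<partial>?P)"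
    unfolding outer_energy_def using nn_integral_pair_conformal[OF cl c km] unfolding k_def .
  also have "\<dots> = (\<integral>\<^sup>+p. A p * indicator (M \<times> M) p + S p * indicator (M \<times> M) p \<partial>?P)"
  proof (rule nn_integral_cong)
    fix p :: "'a \<times> 'a"
    show "k (\<tau> (fst p)) (\<tau> (snd p)) * ennreal (\<rho> (snd p) ^ ?k) * ennreal (\<rho> (fst p) ^ ?k) * indicator (M \<times> M) p =
        A p * indicator (M \<times> M) p + S p * indicator (M \<times> M) p"
    proof (cases "p \<in> M \<times> M")
      case True
      then have "k (\<tau> (fst p)) (\<tau> (snd p)) * ennreal (\<rho> (snd p) ^ ?k) * ennreal (\<rho> (fst p) ^ ?k) = A p + S p"
        using split[of "fst p" "snd p"] by (simp add: mem_Times_iff)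
      then show ?thesis using True by (simp only: indicator_simps mult_1_right)
    qed simp
  qed
  also have "\<dots> = (\<integral>\<^sup>+p\<in>M \<times> M. A p \<partial>?P) + (\<integral>\<^sup>+p\<in>M \<times> M. S p \<partial>?P)"
    by (intro nn_integral_add measurable_pair_riemannian_volume[OF cl] AS)
  finally show ?thesis unfolding outer_energy_def A_def S_def .
qed

theorem proposition3p11:
  fixes M M' :: "(real ^ 'n) set"
    and T :: "(real ^ 'n) option \<Rightarrow> (real ^ 'n) option"
  assumes "closed_submanifold TYPE('m::finite) M"
    and "odd CARD('m)"
    and "moebius_transformation T"
    and "T ` (Some ` M) = Some ` M'"
    and "compact M'"
  shows "regularized_energy TYPE('m) M (- 2 * of_nat CARD('m)) =
         regularized_energy TYPE('m) M' (- 2 * of_nat CARD('m))"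
proof -
  note cl = assms(1) and m = assms(2)
  obtain \<tau> \<rho> where c: "conformal_image TYPE('m) M M' \<tau> \<rho>"
    by (rule moebius_conformal_image[OF assms(3,4)])
  note cD = conformal_imageD[OF c]
  have cl': "closed_submanifold TYPE('m) M'" by (rule closed_submanifold_conformal[OF cl c])
  have M: "compact M" using cl by (simp add: closed_submanifold_def)
  obtain c0 where c0: "c0 > 0" "\<And>x. x \<in> M \<Longrightarrow> c0 \<le> \<rho> x"
  proof (rule compact_continuous_lower_bound[OF M cD(4) cD(6)], goal_cases)
    case (1 x)
    show ?case by (rule 1(2))
  next
    case (2 c)
    show ?case by (rule 2(1)[OF 2(2) 2(3)])
  qed
  define F where "F t = enn2real (outer_energy TYPE('m) M t)" for t
  define F' where "F' t = enn2real (outer_energy TYPE('m) M' t)" for t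
  obtain e where e: "has_finite_part F e" "regularized_energy TYPE('m) M (- 2 * of_nat CARD('m)) = complex_of_real e"
    unfolding F_def by (rule regularized_energy_finite_part[OF cl m])
  obtain e' where e': "has_finite_part F' e'" "regularized_energy TYPE('m) M' (- 2 * of_nat CARD('m)) = complex_of_real e'"
    unfolding F'_def by (rule regularized_energy_finite_part[OF cl' m])
  obtain d h where d: "d > 0" and h: "family_smooth {0::real} d (\<lambda>_. h)" "\<And>t. t \<in> {-d<..<d} \<Longrightarrow> h (- t) = h t"
    "\<And>t. t \<in> {0<..<d} \<Longrightarrow> 0 \<le> h t"
    "\<And>t. t \<in> {0<..<d} \<Longrightarrow>
      (\<integral>\<^sup>+p\<in>M \<times> M. (if c0 * c0 * norm (fst p - snd p) \<le> t \<and> t < \<rho> (fst p) * \<rho> (snd p) * norm (fst p - snd p)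
         then ennreal (inverse (norm (fst p - snd p) ^ (2 * CARD('m)))) else 0)
         \<partial>(riemannian_volume TYPE('m) M \<Otimes>\<^sub>M riemannian_volume TYPE('m) M)) =
      ennreal (inverse (t ^ CARD('m)) * h t)"
  proof (rule energy_shell_expansion[OF cl cD(2) cD(9) c0], goal_cases)
    case (1 W f)
    show ?case by (rule 1(2))
  next
    case (2 x)
    show ?case by (rule 2(2))
  next
    case (3 d h)
    show ?case by (rule 3(1)[OF 3(2-6)])
  qed
  \<comment> \<open>Rescaling keeps \<open>e\<close>, and the shell contributes \<open>0\<close>
    because \<open>CARD('m)\<close> is odd.\<close>
  have "has_finite_part (\<lambda>t. F (inverse (c0 * c0) * t) + inverse (t ^ CARD('m)) * h t) (e + 0)"
    by (intro has_finite_part_add has_finite_part_scale[OF e(1)] has_finite_part_even[OF d h(1) h(2) m])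
      (use c0(1) in auto)
  moreover have "\<forall>\<^sub>F t in at_right 0. F (inverse (c0 * c0) * t) + inverse (t ^ CARD('m)) * h t = F' t"
    unfolding eventually_at_right_field
  proof (intro exI[of _ d] conjI allI impI d)
    fix t :: real assume "0 < t" "t < d"
    then have t: "t \<in> {0<..<d}" by simp
    have "0 \<le> inverse (t ^ CARD('m)) * h t" using h(3)[OF t] t by simp
    moreover have "outer_energy TYPE('m) M (inverse (c0 * c0) * t) < \<infinity>"
      by (rule outer_energy_finite[OF cl]) (use c0(1) t in simp)
    moreover have "outer_energy TYPE('m) M' t =
        outer_energy TYPE('m) M (inverse (c0 * c0) * t) + ennreal (inverse (t ^ CARD('m)) * h t)"
      using outer_energy_conformal[OF cl c c0(1) c0(2), of t] unfolding h(4)[OF t] by simp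
    ultimately show "F (inverse (c0 * c0) * t) + inverse (t ^ CARD('m)) * h t = F' t"
      unfolding F_def F'_def by (simp add: enn2real_plus)
  qed
  ultimately have "has_finite_part F' (e + 0)" by (rule has_finite_part_cong)
  then have "e' = e" using has_finite_part_unique[OF e'(1)] by simp
  then show ?thesis using e(2) e'(2) by simp
qed

end
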